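(* Consider the $GI/GI/1{+}GI$ setting of the context with $F$ satisfying the local condition with index $k\ge1$; let $h=k/(k+1)$ and $\beta=F^{(k)}(0)/k!$. Fix $\mu>0$, $b>0$, $\gamma>0$, $c\in\mathbb R$, and let $\lambda=\rho(\alpha)\mu$ with $\rho(\alpha)=1+c\alpha^\gamma$. Let $c_a^2=I_a(\infty)$, $c_x^2=c_a^2+c_s^2$, and for each $\alpha>0$ let $Z^\alpha_{\mathrm{RQ},b}$ be the unique solution $z\ge0$ of \[ z=\sup_{s\ge0}\left\{\frac{\lambda\bar F(\alpha z)s}{\mu}-s+b\sqrt{\hat I_w(s)\,w_{\tilde c,k}(\alpha^{2h}\tau s)\frac{\lambda\bar F(\alpha z)s}{\mu^2}}\right\}, \] with $\hat I_w,\tau,\tilde c,w_{\tilde c,k}$ as in the context. Then: 1. (Underloaded) If $0<\gamma<h$ and $c<0$, then $\lim_{\alpha\downarrow0}(-c)\mu\alpha^\gamma Z^\alpha_{\mathrm{RQ},b}=\lim_{\alpha\downarrow0}Z^\alpha_{\mathrm{RQ},b}/\mathbb E[Z_{M/M/1}]=\frac{b^2}{2}\frac{c_x^2}{2}$, where $\mathbb E[Z_{M/M/1}]=\rho(\alpha)(\mu(1-\rho(\alpha)))^{-1}$. 2. (Critically loaded) If $\gamma\ge h$, there is a finite constant $\hat Z_{\mathrm{RQ},b}>0$ with $\lim_{\alpha\downarrow0}\alpha^hZ^\alpha_{\mathrm{RQ},b}=\hat Z_{\mathrm{RQ},b}$, and $\hat Z_{\mathrm{RQ},b}$ is the unique positive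 solution of \[ \hat Z=\sup_{u\ge0}\left\{\left(\mathbf 1\{\gamma=h\}c-\beta\hat Z^k\right)u+b\sqrt{\frac{c_x^2}{\mu}w_{\tilde c,k}(\tau u)u}\right\}. \] 3. (Overloaded) If $0<\gamma<h$ and $c>0$, then $\lim_{\alpha\downarrow0}\alpha^{1-\gamma/k}Z^\alpha_{\mathrm{RQ},b}=(c/\beta)^{1/k}=\left(\frac{c\,k!}{F^{(k)}(0)}\right)^{1/k}$; equivalently $\lim_{\alpha\downarrow0}\frac{\rho(\alpha)}{\rho(\alpha)-1}F(\alpha Z^\alpha_{\mathrm{RQ},b})=1$.
   Context: Standing model: arrivals form a stationary renewal process with rate $\lambda$ and index of dispersion for counts $I_a(t)=\mathrm{Var}(A(t))/(\lambda t)$ with finite limit $I_a(\infty)=c_a^2$; service times i.i.d. with mean $1/\mu$, finite variance, squared coefficient of variation $c_s^2$; patience times i.i.d. $D=\alpha^{-1}\tilde D$, $\tilde D\ge0$, $\mathbb E\tilde D=1$, CDF $F$ twice continuously differentiable on $[0,\infty)$ with support $[0,\infty)$, density $f(0)<\infty$; $\bar F=1-F$; primitives independent; $\rho=\rho(\alpha)$. Local condition with index $k$: $F$ is $k$ times continuously differentiable on $[0,\infty)$, $F^{(j)}(0)=0$ for $j<k$, $F^{(k)}(0)\ne0$. Define $\hat I_w(s)=\frac{I_a(s)}{\rho\vee1}+\left(1-\frac1{\rho\vee1}\right)+c_s^2$, $\tau=(c_x^2/(2\mu))^{(k-1)/(k+1)}\beta^{2/(k+1)}$ and $\tilde c=\bar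 c\,(c_x^2/(2\mu))^{-k/(k+1)}\beta^{-1/(k+1)}$ with $\bar c=\mathbf 1\{\gamma=h\}c$. For $c'\in\mathbb R$, $w_{c',k}(t)=\mathrm{Var}(Y^{c',k}(t))/(2t)$ ($t>0$), $w_{c',k}(0)=1$, where $Y^{c',k}(t)=\sqrt2B(t)-\int_0^t(Z^{c',k}(s))^kds$, $B$ is a standard Brownian motion and $Z^{c',k}$ is the reflected diffusion $Z^{c',k}(t)=Z^{c',k}(0)+\sqrt2B(t)+\int_0^t(c'-(Z^{c',k}(s))^k)ds+L^{c',k}(t)$ on $[0,\infty)$ ($L^{c',k}$ nondecreasing from $0$, increasing only when $Z^{c',k}=0$), with $Z^{c',k}(0)$ independent of $B$ and density $\propto\exp\{c'x-\frac{x^{k+1}}{k+1}\}\mathbf 1\{x\ge0\}$. *)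

theory Defs
  imports "HOL-Probability.Probability"
begin

text \<open>X is centred Gaussian with variance v (v = 0 allowed: degenerate at 0),
  characterised by its characteristic function.\<close>
definition gaussian0 :: "'a measure \<Rightarrow> ('a \<Rightarrow> real) \<Rightarrow> real \<Rightarrow> bool" where
  "gaussian0 M X v \<longleftrightarrow> X \<in> borel_measurable M \<and>
     (\<forall>\<theta>::real. char (distr M borel X) \<theta> = complex_of_real (exp (- (\<theta>\<^sup>2 * v) / 2)))"

definition std_brownian_motion :: "'a measure \<Rightarrow> (real \<Rightarrow> 'a \<Rightarrow> real) \<Rightarrow> bool" where
  "std_brownian_motion M B \<longleftrightarrow> prob_space M \<and>
     (\<forall>t\<ge>0. B t \<in> borel_measurable M) \<and>
     (\<forall>\<omega>\<in>space M. B 0 \<omega> = 0 \<and> continuous_on {0..} (\<lambda>t. B t \<omega>)) \<and>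
     (\<forall>(ts::real list) (cs::real list). length cs = length ts \<and> (\<forall>t\<in>set ts. 0 \<le> t) \<longrightarrow>
        gaussian0 M (\<lambda>\<omega>. \<Sum>i<length ts. cs!i * B (ts!i) \<omega>)
          (\<Sum>i<length ts. \<Sum>j<length ts. cs!i * cs!j * min (ts!i) (ts!j)))"

definition stat_density :: "real \<Rightarrow> nat \<Rightarrow> real \<Rightarrow> real" where
  "stat_density c' k x =
     (if 0 \<le> x then exp (c' * x - x ^ (k+1) / real (k+1)) /
        (LBINT y:{0..}. exp (c' * y - y ^ (k+1) / real (k+1))) else 0)"

definition refl_diffusion_setup ::
  "'a measure \<Rightarrow> real \<Rightarrow> nat \<Rightarrow> (real \<Rightarrow> 'a \<Rightarrow> real) \<Rightarrow> (real \<Rightarrow> 'a \<Rightarrow> real)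
     \<Rightarrow> (real \<Rightarrow> 'a \<Rightarrow> real) \<Rightarrow> bool" where
  "refl_diffusion_setup M c' k B Z L \<longleftrightarrow>
     std_brownian_motion M B \<and>
     distributed M lborel (Z 0) (\<lambda>x. ennreal (stat_density c' k x)) \<and>
     prob_space.indep_set M
        {Z 0 -` S \<inter> space M | S. S \<in> sets borel}
        (sigma_sets (space M) {B t -` S \<inter> space M | t S. 0 \<le> t \<and> S \<in> sets borel}) \<and>
     (\<forall>t\<ge>0. Z t \<in> borel_measurable M \<and> L t \<in> borel_measurable M) \<and>
     (\<forall>\<omega>\<in>space M.
        continuous_on {0..} (\<lambda>t. Z t \<omega>) \<and> continuous_on {0..} (\<lambda>t. L t \<omega>) \<and>
        L 0 \<omega> = 0 \<and> mono_on {0..} (\<lambda>t. L t \<omega>) \<and>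
        (\<forall>t\<ge>0. 0 \<le> Z t \<omega>) \<and>
        (\<forall>s t. 0 \<le> s \<and> s \<le> t \<and> (\<forall>u\<in>{s..t}. 0 < Z u \<omega>) \<longrightarrow> L s \<omega> = L t \<omega>) \<and>
        (\<forall>t\<ge>0. Z t \<omega> = Z 0 \<omega> + sqrt 2 * B t \<omega>
                 + integral {0..t} (\<lambda>s. c' - (Z s \<omega>) ^ k) + L t \<omega>))"

text \<open>w_{c',k}(t) = Var(Y(t))/(2t), Y(t) = sqrt 2 B(t) - int_0^t Z(s)^k ds; w(0) = 1.
  The variance depends only on the law, so any realisation (on a standard sample space) is used.\<close>
definition w_fun :: "real \<Rightarrow> nat \<Rightarrow> real \<Rightarrow> real" where
  "w_fun c' k t = (if t = 0 then 1 else
     (SOME v. \<exists>(M :: (nat \<Rightarrow> real) measure) B Z L. refl_diffusion_setup M c' k B Z L \<and>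
        (let Y = (\<lambda>\<omega>. sqrt 2 * B t \<omega> - integral {0..t} (\<lambda>s. (Z s \<omega>) ^ k)) in
         v = (LINT \<omega>|M. (Y \<omega> - (LINT \<omega>'|M. Y \<omega>'))\<^sup>2) / (2 * t))))"

definition equilibrium_measure :: "real measure \<Rightarrow> real measure" where
  "equilibrium_measure G = density lborel
     (\<lambda>x. ennreal (if 0 \<le> x then measure G {x<..} / (LINT u|G. u) else 0))"

text \<open>Coordinates: omega 0 = first arrival time (equilibrium law), omega n = n-th
  subsequent inter-arrival time (law G), all independent.\<close>
definition renewal_measure :: "real measure \<Rightarrow> (nat \<Rightarrow> real) measure" where
  "renewal_measure G = PiM UNIV (\<lambda>n. if n = 0 then equilibrium_measure G else G)"

definition renewal_count :: "real \<Rightarrow> (nat \<Rightarrow> real) \<Rightarrow> nat" where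
  "renewal_count t \<omega> = card {n. (\<Sum>i\<le>n. \<omega> i) \<le> t}"

definition renewal_idc :: "real measure \<Rightarrow> real \<Rightarrow> real" where
  "renewal_idc G t =
     (let M = renewal_measure G; A = (\<lambda>\<omega>. real (renewal_count t \<omega>));
          lam = 1 / (LINT u|G. u) in
      (LINT \<omega>|M. (A \<omega> - (LINT \<omega>'|M. A \<omega>'))\<^sup>2) / (lam * t))"

end

theory Submission
  imports Defs "HOL-Library.Discrete_Functions"
begin

text \<open>
  The function \<open>w\<close> enters only through three properties: it is nonnegative, bounded, and tends to
  \<open>1\<close> at \<open>0\<close>. Since it is chosen by \<open>SOME\<close>, a stationary reflected diffusion has to be exhibited, and
  the bounds have to hold for every realisation. Both come from the implicit Euler scheme for the
  reflected equation. Its limit along dyadic grids, driven by a Brownian motion obtained from a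
  Schauder series, is a solution. Conversely, the monotone drift forces the scheme to follow any
  solution, and makes the discretised \<open>Y(t)\<close> a coordinatewise 1-Lipschitz function of the
  independent starting point and increments, so \<open>Var Y(t) = O(t)\<close> by an Efron--Stein argument; a
  bound on the mean of \<open>cosh\<close> of the scheme controls the drift for small \<open>t\<close>.

  With these properties the fixed point is analysed by scaling \<open>s\<close>. The coefficient
  \<open>\<rho> (1 - F (\<alpha> Z)) - 1\<close> can never be positive, as the supremum would be infinite; this settles the
  overloaded regime. In the underloaded regime a Young inequality gives the upper bound, and the
  optimal \<open>s\<close> the lower one. In the critical regime \<open>\<alpha> powr h * Z \<alpha>\<close> is bounded and each of its
  limit points solves the limiting equation, whose right-hand side is decreasing in the unknown.
\<close>


section \<open>Implicit Euler scheme for a reflected equation with power drift\<close>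

text \<open>The drift x^k is monotone, but for k > 1 not globally Lipschitz. The implicit step
  \<open>z + d * z ^ k = max 0 (x + d * c)\<close> is nonexpansive for every step size, and the
  \<open>max\<close> performs the reflection. This is where the Lipschitz constant 1 comes from:
  what a perturbation adds to the accumulated drift is lost by the state, so the drift total changes
  by at most the perturbation. \<open>cosh\<close> is chosen because it dominates every even power,
  is even and increasing on the half line, and has an explicit Gaussian mean. The exponent
  \<open>h\<close> solves k (1 - h) = h: if Z has order \<alpha>^(-h), then F (\<alpha> Z) has order
  \<alpha>^h, the same as the slope that produces such a Z. The decisive s has order
  \<alpha>^(-2\<gamma>) in the underloaded regime and \<alpha>^(-2h) in the critical one, so the
  argument \<alpha>^(2h) \<tau> s of \<open>w\<close> tends to 0 in the former and stays fixed in
  the latter, where the whole function \<open>w\<close> survives in the limit. The index of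
  dispersion is known only through its limit at infinity; for bounded times the variance of the
  count is estimated from the Laplace transform of the inter-arrival law.\<close>

locale power_drift =
  fixes c :: real and k :: nat
  assumes k_pos: "1 \<le> k"
begin

text \<open>The resolvent of the monotone map z \<mapsto> z^k. For nonnegative arguments
  \<open>SOME\<close> picks the only root; it lies between 0 and y.\<close>

definition resolvent :: "real \<Rightarrow> real \<Rightarrow> real" where
  "resolvent d y = (SOME z. 0 \<le> z \<and> z + d * z ^ k = y)"

lemma resolvent:
  assumes "0 \<le> d" "0 \<le> y"
  shows resolvent_nonneg: "0 \<le> resolvent d y"
    and resolvent_eq: "resolvent d y + d * resolvent d y ^ k = y"
proof -
  have "\<exists>z. 0 \<le> z \<and> z \<le> y \<and> z + d * z ^ k = y"
    using assms k_pos by (intro IVT') (auto intro!: continuous_intros simp: power_0_left)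
  then have "\<exists>z. 0 \<le> z \<and> z + d * z ^ k = y"
    by blast
  from someI_ex[OF this] show "0 \<le> resolvent d y" "resolvent d y + d * resolvent d y ^ k = y"
    unfolding resolvent_def by auto
qed

text \<open>Constant drift and noise are added explicitly, negative values are cut off, and the
  power drift is applied implicitly. The amount added by \<open>max\<close> is the discrete
  reflection term; if it is positive, the new state is 0.\<close>

definition euler_step :: "real \<Rightarrow> real \<Rightarrow> real" where
  "euler_step d x = resolvent d (max 0 (x + d * c))"

lemma euler_step_nonneg: "0 \<le> d \<Longrightarrow> 0 \<le> euler_step d x"
  by (simp add: euler_step_def resolvent_nonneg)

lemma euler_step_sum: "0 \<le> d \<Longrightarrow> euler_step d x + d * euler_step d x ^ k = max 0 (x + d * c)"
  by (simp add: euler_step_def resolvent_eq)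

lemma euler_step_ge: "0 \<le> d \<Longrightarrow> x + d * c \<le> euler_step d x + d * euler_step d x ^ k"
  by (simp add: euler_step_sum)

lemma euler_step_pos_eq:
  assumes "0 \<le> d" "0 < euler_step d x"
  shows "euler_step d x + d * euler_step d x ^ k = x + d * c"
proof -
  have "0 < euler_step d x + d * euler_step d x ^ k"
    using assms by (intro add_pos_nonneg) auto
  then show ?thesis
    using euler_step_sum[OF assms(1), of x] by auto
qed

lemma euler_step_mono:
  assumes "0 \<le> d" "x \<le> x'"
  shows "euler_step d x \<le> euler_step d x'"
proof (rule ccontr)
  let ?z = "euler_step d x" and ?z' = "euler_step d x'"
  assume "\<not> ?z \<le> ?z'"
  then have "?z' < ?z" by simp
  moreover have "d * ?z' ^ k \<le> d * ?z ^ k"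
    using \<open>?z' < ?z\<close> assms by (intro mult_left_mono power_mono) (auto simp: euler_step_nonneg)
  ultimately have "max 0 (x' + d * c) < max 0 (x + d * c)"
    using euler_step_sum[OF assms(1)] by (metis add_less_le_mono)
  then show False using assms(2) by auto
qed

text \<open>An inequality and not an equation, since the cutoff at 0 may shrink the gap between the
  two inputs.\<close>

lemma euler_step_diff:
  assumes "0 \<le> d" "x \<le> x'"
  shows "(euler_step d x' - euler_step d x) + d * (euler_step d x' ^ k - euler_step d x ^ k) \<le> x' - x"
  using euler_step_sum[OF assms(1), of x] euler_step_sum[OF assms(1), of x'] assms(2)
  by (simp add: algebra_simps)

lemma euler_step_power_mono:
  assumes "0 \<le> d" "x \<le> x'"
  shows "0 \<le> d * (euler_step d x' ^ k - euler_step d x ^ k)"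
  using assms euler_step_mono[OF assms] by (auto intro!: mult_nonneg_nonneg power_mono euler_step_nonneg)

lemma euler_step_lipschitz:
  assumes "0 \<le> d"
  shows "\<bar>euler_step d x' - euler_step d x\<bar> \<le> \<bar>x' - x\<bar>"
proof (cases "x \<le> x'")
  case True
  then show ?thesis
    using euler_step_mono[OF assms True] euler_step_diff[OF assms True] euler_step_power_mono[OF assms True]
    by linarith
next
  case False
  then have le: "x' \<le> x" by simp
  show ?thesis
    using euler_step_mono[OF assms le] euler_step_diff[OF assms le] euler_step_power_mono[OF assms le]
    by linarith
qed

lemma continuous_euler_step:
  assumes "0 \<le> d"
  shows "continuous_on UNIV (euler_step d)"
  unfolding continuous_on_iff dist_real_def
  using euler_step_lipschitz[OF assms] by (metis UNIV_I order_le_less_trans)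

lemma borel_measurable_euler_step [measurable]:
  assumes "0 \<le> d" shows "euler_step d \<in> borel_measurable borel"
  using continuous_euler_step[OF assms] by (rule borel_measurable_continuous_onI)

primrec scheme :: "real \<Rightarrow> real \<Rightarrow> (nat \<Rightarrow> real) \<Rightarrow> nat \<Rightarrow> real" where
  "scheme d x \<xi> 0 = x"
| "scheme d x \<xi> (Suc n) = euler_step d (scheme d x \<xi> n + \<xi> n)"

declare scheme.simps(2) [simp del]

lemma scheme_nonneg: "0 \<le> d \<Longrightarrow> 0 \<le> x \<Longrightarrow> 0 \<le> scheme d x \<xi> n"
  by (cases n) (auto simp: scheme.simps(2) euler_step_nonneg)

lemma scheme_cong: "(\<And>i. i < n \<Longrightarrow> \<xi> i = \<xi>' i) \<Longrightarrow> scheme d x \<xi> n = scheme d x \<xi>' n"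
  by (induction n) (auto simp: scheme.simps(2))

text \<open>Riemann sum for the integral of Z^k with right end points, because the implicit step
  charges the drift at the new state.\<close>

definition drift_sum :: "real \<Rightarrow> real \<Rightarrow> (nat \<Rightarrow> real) \<Rightarrow> nat \<Rightarrow> real" where
  "drift_sum d x \<xi> n = (\<Sum>i<n. d * scheme d x \<xi> (Suc i) ^ k)"

text \<open>Once two runs of the scheme are driven by the same increments, the total difference of their
  drifts is paid for by the difference of the states: the scheme dissipates exactly what it
  accumulates in the drift.\<close>

lemma scheme_dissipation:
  assumes d: "0 \<le> d" and "m \<le> n" and eq: "\<And>i. m \<le> i \<Longrightarrow> \<xi>' i = \<xi> i"
    and le: "scheme d x \<xi> m \<le> scheme d x' \<xi>' m"
  shows "scheme d x \<xi> n \<le> scheme d x' \<xi>' n \<and>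
    0 \<le> (\<Sum>i=m..<n. d * (scheme d x' \<xi>' (Suc i) ^ k - scheme d x \<xi> (Suc i) ^ k)) \<and>
    (scheme d x' \<xi>' n - scheme d x \<xi> n) +
      (\<Sum>i=m..<n. d * (scheme d x' \<xi>' (Suc i) ^ k - scheme d x \<xi> (Suc i) ^ k))
      \<le> scheme d x' \<xi>' m - scheme d x \<xi> m"
  using \<open>m \<le> n\<close>
proof (induction n rule: dec_induct)
  case base
  then show ?case using le by simp
next
  case (step n)
  have inc: "scheme d x \<xi> n + \<xi> n \<le> scheme d x' \<xi>' n + \<xi>' n"
    using step eq by simp
  show ?case
    using step euler_step_mono[OF d inc] euler_step_diff[OF d inc] euler_step_power_mono[OF d inc] eq[of n]
    by (simp add: scheme.simps(2))
qed

text \<open>The discretised Y as a function of one vector: entry 0 is the starting point, entry i +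
  1 the increment of step i. The starting point enters through the drift alone.\<close>

definition outflow :: "real \<Rightarrow> nat \<Rightarrow> (nat \<Rightarrow> real) \<Rightarrow> real" where
  "outflow d n v = (\<Sum>i<n. v (Suc i)) - drift_sum d (v 0) (\<lambda>i. v (Suc i)) n"

text \<open>Raising the starting point changes only the drift, by at most the rise. Raising an
  increment adds the rise and subtracts a drift difference between 0 and the rise. Both drift
  differences are bounded by \<open>scheme_dissipation\<close>, applied from the time where the two
  runs separate.\<close>

lemma outflow_upd_mono:
  assumes d: "0 \<le> d" and j: "j \<le> n" and e: "v j \<le> y"
  shows "\<bar>outflow d n (v(j := y)) - outflow d n v\<bar> \<le> y - v j"
proof (cases j)
  case 0
  let ?\<xi> = "\<lambda>i. v (Suc i)"
  have "outflow d n (v(j := y)) - outflow d n v =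
      - (\<Sum>i=0..<n. d * (scheme d y ?\<xi> (Suc i) ^ k - scheme d (v 0) ?\<xi> (Suc i) ^ k))"
    using 0 by (simp add: outflow_def drift_sum_def sum_subtractf right_diff_distrib lessThan_atLeast0)
  then show ?thesis
    using scheme_dissipation[OF d, of 0 n ?\<xi> ?\<xi> "v 0" y] e 0 by simp
next
  case (Suc m)
  let ?\<xi> = "\<lambda>i. v (Suc i)" and ?\<xi>' = "\<lambda>i. (v(j := y)) (Suc i)"
  let ?D = "\<lambda>i. d * (scheme d (v 0) ?\<xi>' (Suc i) ^ k - scheme d (v 0) ?\<xi> (Suc i) ^ k)"
  have same: "scheme d (v 0) ?\<xi>' i = scheme d (v 0) ?\<xi> i" if "i \<le> m" for i
    using that Suc by (intro scheme_cong) auto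
  have inc: "scheme d (v 0) ?\<xi> m + ?\<xi> m \<le> scheme d (v 0) ?\<xi>' m + ?\<xi>' m"
    using same[of m] Suc e by simp
  have le: "scheme d (v 0) ?\<xi> (Suc m) \<le> scheme d (v 0) ?\<xi>' (Suc m)"
    using euler_step_mono[OF d inc] by (simp add: scheme.simps(2))
  \<comment> \<open>Step m is treated apart, since the two runs share their increments only from
    \<open>Suc m\<close> on.\<close>
  have "0 \<le> ?D m" "(scheme d (v 0) ?\<xi>' (Suc m) - scheme d (v 0) ?\<xi> (Suc m)) + ?D m \<le> y - v j"
    using euler_step_power_mono[OF d inc] euler_step_diff[OF d inc] same[of m] Suc
    by (simp_all add: scheme.simps(2))
  moreover have "scheme d (v 0) ?\<xi> n \<le> scheme d (v 0) ?\<xi>' n \<and> 0 \<le> (\<Sum>i=Suc m..<n. ?D i) \<and>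
      (scheme d (v 0) ?\<xi>' n - scheme d (v 0) ?\<xi> n) + (\<Sum>i=Suc m..<n. ?D i)
      \<le> scheme d (v 0) ?\<xi>' (Suc m) - scheme d (v 0) ?\<xi> (Suc m)"
    using j Suc by (intro scheme_dissipation[OF d _ _ le]) auto
  moreover have "(\<Sum>i<n. ?D i) = ?D m + (\<Sum>i=Suc m..<n. ?D i)"
  proof -
    have "(\<Sum>i<n. ?D i) = (\<Sum>i=0..<m. ?D i) + (\<Sum>i=m..<n. ?D i)"
      using j Suc by (simp only: lessThan_atLeast0 sum.atLeastLessThan_concat[of 0 m n])
    also have "(\<Sum>i=0..<m. ?D i) = 0"
      by (intro sum.neutral ballI) (use same in simp)
    also have "(\<Sum>i=m..<n. ?D i) = ?D m + (\<Sum>i=Suc m..<n. ?D i)"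
      using j Suc by (intro sum.atLeast_Suc_lessThan) auto
    finally show ?thesis by simp
  qed
  moreover have "outflow d n (v(j := y)) - outflow d n v = (y - v j) - (\<Sum>i<n. ?D i)"
  proof -
    have "(\<Sum>i<n. ?\<xi>' i) - (\<Sum>i<n. ?\<xi> i) = (\<Sum>i<n. if i = m then y - v j else 0)"
      unfolding sum_subtractf[symmetric] using Suc by (intro sum.cong) auto
    also have "\<dots> = y - v j" using j Suc by simp
    finally show ?thesis
      using Suc by (simp add: outflow_def drift_sum_def sum_subtractf right_diff_distrib)
  qed
  ultimately show ?thesis by linarith
qed

lemma outflow_lipschitz:
  assumes d: "0 \<le> d" and j: "j \<le> n"
  shows "\<bar>outflow d n (v(j := y)) - outflow d n v\<bar> \<le> \<bar>y - v j\<bar>"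
proof (cases "v j \<le> y")
  case True
  then show ?thesis using outflow_upd_mono[of d j n v y] assms by simp
next
  case False
  then show ?thesis using outflow_upd_mono[of d j n "v(j := y)" "v j"] assms by simp
qed

section \<open>Reflected equations and the error of the scheme against a given solution\<close>

text \<open>The pathwise part of \<open>refl_diffusion_setup\<close> for a single driver, with the
  starting point absorbed in \<open>\<psi>\<close>; at t = 0 the equation gives z 0 = \<psi>
  0.\<close>

definition reflected_solution :: "(real \<Rightarrow> real) \<Rightarrow> (real \<Rightarrow> real) \<Rightarrow> (real \<Rightarrow> real) \<Rightarrow> bool" where
  "reflected_solution \<psi> z l \<longleftrightarrow>
     continuous_on {0..} z \<and> l 0 = 0 \<and> mono_on {0..} l \<and> (\<forall>t\<ge>0. 0 \<le> z t) \<and>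
     (\<forall>s t. 0 \<le> s \<and> s \<le> t \<and> (\<forall>u\<in>{s..t}. 0 < z u) \<longrightarrow> l s = l t) \<and>
     (\<forall>t\<ge>0. z t = \<psi> t + integral {0..t} (\<lambda>s. c - z s ^ k) + l t)"

definition increments :: "(real \<Rightarrow> real) \<Rightarrow> real \<Rightarrow> nat \<Rightarrow> real" where
  "increments \<psi> d i = \<psi> (real (Suc i) * d) - \<psi> (real i * d)"

lemma reflected_solution_increment:
  assumes sol: "reflected_solution \<psi> z l" and st: "0 \<le> s" "s \<le> t"
  shows "z t - z s = \<psi> t - \<psi> s + integral {s..t} (\<lambda>u. c - z u ^ k) + (l t - l s)"
    and "(\<lambda>u. c - z u ^ k) integrable_on {s..t}"
proof -
  have cont: "continuous_on {0..t} (\<lambda>u. c - z u ^ k)"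
    using sol unfolding reflected_solution_def
    by (auto intro!: continuous_intros intro: continuous_on_subset)
  then have int: "(\<lambda>u. c - z u ^ k) integrable_on {0..t}"
    by (rule integrable_continuous_interval)
  then show "(\<lambda>u. c - z u ^ k) integrable_on {s..t}"
    by (rule integrable_on_subinterval) (use st in auto)
  have "integral {0..s} (\<lambda>u. c - z u ^ k) + integral {s..t} (\<lambda>u. c - z u ^ k)
      = integral {0..t} (\<lambda>u. c - z u ^ k)"
    using st int by (intro Henstock_Kurzweil_Integration.integral_combine) auto
  then show "z t - z s = \<psi> t - \<psi> s + integral {s..t} (\<lambda>u. c - z u ^ k) + (l t - l s)"
    using sol st unfolding reflected_solution_def by (smt (verit))
qed

text \<open>Monotonicity of the drift makes the error non-increasing as soon as it exceeds the
  oscillation of the solution over one time step.\<close>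

lemma scheme_error:
  assumes sol: "reflected_solution \<psi> z l" and d: "0 < d"
    and osc: "\<And>s s'. 0 \<le> s \<Longrightarrow> s \<le> s' \<Longrightarrow> s' \<le> T \<Longrightarrow> s' - s \<le> d \<Longrightarrow> \<bar>z s' - z s\<bar> \<le> \<epsilon>"
    and "real i * d \<le> T"
  shows "\<bar>scheme d (\<psi> 0) (increments \<psi> d) i - z (real i * d)\<bar> \<le> \<epsilon>"
  using \<open>real i * d \<le> T\<close>
proof (induction i)
  case 0
  have "z 0 = \<psi> 0"
    using sol unfolding reflected_solution_def by (smt (verit) integral_singleton atLeastAtMost_singleton)
  then show ?case using osc[of 0 0] 0 d by auto
next
  case (Suc i)
  define s where "s = real i * d"
  define t where "t = real (Suc i) * d"
  have st: "0 \<le> s" "s \<le> t" "t \<le> T" "t - s = d"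
    using d Suc.prems by (auto simp: s_def t_def algebra_simps)
  define \<zeta> where "\<zeta> = scheme d (\<psi> 0) (increments \<psi> d)"
  define x where "x = \<zeta> i + (\<psi> t - \<psi> s)"
  have z': "\<zeta> (Suc i) = euler_step d x"
    by (simp add: \<zeta>_def x_def scheme.simps(2) increments_def s_def t_def)
  have IH: "\<bar>\<zeta> i - z s\<bar> \<le> \<epsilon>"
    using Suc.IH st by (simp add: \<zeta>_def s_def)
  have nonneg: "0 \<le> z u" if "0 \<le> u" for u
    using sol that unfolding reflected_solution_def by blast
  have near: "\<bar>z t - z u\<bar> \<le> \<epsilon>" if "u \<in> {s..t}" for u
    using osc[of u t] that st by auto
  note inc = reflected_solution_increment[OF sol st(1,2)]
  have mono: "l s \<le> l t"
    using sol st unfolding reflected_solution_def by (auto intro: mono_onD)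
  have int_const: "integral {s..t} (\<lambda>u. c - \<zeta> (Suc i) ^ k) = d * (c - \<zeta> (Suc i) ^ k)"
    using st by simp
  have "\<zeta> (Suc i) - z t \<le> \<epsilon>"
  proof (rule ccontr)
    assume "\<not> ?thesis"
    \<comment> \<open>By the oscillation bound the new state now exceeds the solution on the whole
      step, so its drift is at most that of the solution; being positive it receives no reflection,
      whereas \<open>l\<close> may grow. Hence its lead was larger than \<epsilon> already at
      \<open>s\<close>, against \<open>IH\<close>.\<close>
    then have big: "z t + \<epsilon> < \<zeta> (Suc i)" by simp
    have "\<epsilon> \<ge> 0" using IH by linarith
    then have "0 < \<zeta> (Suc i)" using big nonneg[of t] st by linarith
    then have eq: "\<zeta> (Suc i) + d * \<zeta> (Suc i) ^ k = x + d * c"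
      using euler_step_pos_eq d by (simp add: z')
    have "integral {s..t} (\<lambda>u. c - \<zeta> (Suc i) ^ k) \<le> integral {s..t} (\<lambda>u. c - z u ^ k)"
    proof (rule integral_le)
      fix u assume u: "u \<in> {s..t}"
      then have "z u \<le> \<zeta> (Suc i)" using near[OF u] big by linarith
      then show "c - \<zeta> (Suc i) ^ k \<le> c - z u ^ k"
        using nonneg[of u] u st by (simp add: power_mono)
    qed (use inc in auto)
    then show False
      using eq inc(1) mono int_const IH big by (simp add: x_def algebra_simps)
  qed
  moreover have "- \<epsilon> \<le> \<zeta> (Suc i) - z t"
  proof (rule ccontr)
    assume "\<not> ?thesis"
    \<comment> \<open>Here the solution stays above the new state and hence positive, so
      \<open>l\<close> is constant on the step, while the scheme can only gain from its
      cutoff.\<close>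
    then have big: "\<zeta> (Suc i) + \<epsilon> < z t" by simp
    have z'0: "0 \<le> \<zeta> (Suc i)" using d by (simp add: z' euler_step_nonneg)
    have low: "\<zeta> (Suc i) < z u" if "u \<in> {s..t}" for u
      using near[OF that] big by linarith
    then have "l s = l t"
      using sol st z'0 unfolding reflected_solution_def by (smt (verit))
    moreover have "integral {s..t} (\<lambda>u. c - z u ^ k) \<le> integral {s..t} (\<lambda>u. c - \<zeta> (Suc i) ^ k)"
      by (rule integral_le) (use inc low z'0 in \<open>auto intro!: power_mono simp: less_imp_le\<close>)
    ultimately show False
      using euler_step_ge[of d x] d inc(1) int_const IH big by (simp add: x_def z' algebra_simps)
  qed
  ultimately show ?case by (simp add: \<zeta>_def t_def)
qed

end

text \<open>The factor R^n in place of R^(n-1) is affordable for 1 \<le> R and keeps the induction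
  free of subtraction.\<close>

lemma abs_power_diff_le:
  fixes a b R :: real
  assumes "\<bar>a\<bar> \<le> R" "\<bar>b\<bar> \<le> R" "1 \<le> R"
  shows "\<bar>a ^ n - b ^ n\<bar> \<le> real n * R ^ n * \<bar>a - b\<bar>"
proof (induction n)
  case (Suc n)
  have "a ^ Suc n - b ^ Suc n = a * (a ^ n - b ^ n) + b ^ n * (a - b)"
    by (simp add: algebra_simps)
  then have "\<bar>a ^ Suc n - b ^ Suc n\<bar> \<le> \<bar>a\<bar> * \<bar>a ^ n - b ^ n\<bar> + \<bar>b\<bar> ^ n * \<bar>a - b\<bar>"
    by (metis abs_triangle_ineq abs_mult power_abs)
  also have "\<dots> \<le> R * (real n * R ^ n * \<bar>a - b\<bar>) + R ^ Suc n * \<bar>a - b\<bar>"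
  proof (intro add_mono mult_mono Suc)
    show "\<bar>b\<bar> ^ n \<le> R ^ Suc n"
      using assms by (intro order_trans[OF power_mono[of "\<bar>b\<bar>" R n]] power_increasing) auto
  qed (use assms in auto)
  also have "\<dots> = real (Suc n) * R ^ Suc n * \<bar>a - b\<bar>"
    by (simp add: algebra_simps)
  finally show ?case .
qed auto

text \<open>The node value is compared with all values of f on its cell, so each cell contributes at
  most d \<epsilon> and the errors add up.\<close>

lemma riemann_sum_error:
  fixes f :: "real \<Rightarrow> real"
  assumes f: "continuous_on {0..} f" and d: "0 < d"
    and y: "\<And>i s. i < n \<Longrightarrow> real i * d \<le> s \<Longrightarrow> s \<le> real (Suc i) * d \<Longrightarrow> \<bar>y i - f s\<bar> \<le> \<epsilon>"
  shows "\<bar>(\<Sum>i<n. d * y i) - integral {0..real n * d} f\<bar> \<le> real n * d * \<epsilon>"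
  using y
proof (induction n)
  case (Suc n)
  let ?s = "real n * d" and ?t = "real (Suc n) * d"
  have st: "0 \<le> ?s" "?s \<le> ?t" "?t - ?s = d" using d by (auto simp: algebra_simps)
  have int: "f integrable_on {a..b}" if "0 \<le> a" for a b
    using f that by (intro integrable_continuous_interval) (auto intro: continuous_on_subset)
  have comb: "integral {0..?s} f + integral {?s..?t} f = integral {0..?t} f"
    using st int by (intro Henstock_Kurzweil_Integration.integral_combine) auto
  have diff: "d * y n - integral {?s..?t} f = integral {?s..?t} (\<lambda>s. y n - f s)"
    using st int by (subst Henstock_Kurzweil_Integration.integral_diff) auto
  have "norm (integral {?s..?t} (\<lambda>s. y n - f s)) \<le> \<epsilon> * (?t - ?s)"
  proof (rule integral_bound)
    show "continuous_on {?s..?t} (\<lambda>s. y n - f s)"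
      using st by (intro continuous_intros continuous_on_subset[OF f]) auto
  qed (use st Suc.prems in auto)
  then have "\<bar>d * y n - integral {?s..?t} f\<bar> \<le> d * \<epsilon>"
    using st diff by (simp add: mult.commute)
  moreover have "\<bar>(\<Sum>i<n. d * y i) - integral {0..?s} f\<bar> \<le> ?s * \<epsilon>"
    using Suc by auto
  ultimately show ?case
    using comb by (simp add: algebra_simps abs_le_iff)
qed auto

context power_drift
begin

lemma drift_sum_error:
  assumes z: "continuous_on {0..} z" and d: "0 < d" and x: "0 \<le> x"
    and R: "1 \<le> R" "\<And>s. 0 \<le> s \<Longrightarrow> s \<le> real n * d \<Longrightarrow> \<bar>z s\<bar> \<le> R"
    and R': "\<And>i. i \<le> n \<Longrightarrow> scheme d x \<xi> i \<le> R"
    and err: "\<And>i s. i < n \<Longrightarrow> real i * d \<le> s \<Longrightarrow> s \<le> real (Suc i) * d \<Longrightarrow>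
      \<bar>scheme d x \<xi> (Suc i) - z s\<bar> \<le> \<epsilon>"
  shows "\<bar>drift_sum d x \<xi> n - integral {0..real n * d} (\<lambda>s. z s ^ k)\<bar> \<le> real n * d * (real k * R ^ k * \<epsilon>)"
  unfolding drift_sum_def
proof (rule riemann_sum_error)
  show "continuous_on {0..} (\<lambda>s. z s ^ k)" by (intro continuous_intros z)
  fix i s assume i: "i < n" and s: "real i * d \<le> s" "s \<le> real (Suc i) * d"
  have "0 \<le> real i * d" "real (Suc i) * d \<le> real n * d" using i d by auto
  then have s': "0 \<le> s" "s \<le> real n * d" using s by linarith+
  have "\<bar>scheme d x \<xi> (Suc i)\<bar> \<le> R"
    using R'[of "Suc i"] scheme_nonneg[of d x \<xi> "Suc i"] i d x by auto
  then have "\<bar>scheme d x \<xi> (Suc i) ^ k - z s ^ k\<bar> \<le> real k * R ^ k * \<bar>scheme d x \<xi> (Suc i) - z s\<bar>"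
    using R s' by (intro abs_power_diff_le) auto
  also have "\<dots> \<le> real k * R ^ k * \<epsilon>"
    using err[OF i s] R by (intro mult_left_mono) auto
  finally show "\<bar>scheme d x \<xi> (Suc i) ^ k - z s ^ k\<bar> \<le> real k * R ^ k * \<epsilon>" .
qed (use d in auto)

text \<open>The mesh t / (n + 1) makes t a grid point, so the full sum covers [0, t].
  \<open>scheme_error\<close>, with the oscillation of z as its \<epsilon>, puts the scheme within e
  of z at the nodes, hence within 2 e of it on each cell.\<close>

lemma drift_sum_tendsto:
  assumes sol: "reflected_solution \<psi> z l" and t: "0 < t"
  defines "d \<equiv> \<lambda>n. t / real (Suc n)"
  shows "(\<lambda>n. drift_sum (d n) (\<psi> 0) (increments \<psi> (d n)) (Suc n)) \<longlonglongrightarrow> integral {0..t} (\<lambda>s. z s ^ k)"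
proof -
  have cont: "continuous_on {0..} z" and nonneg: "\<And>s. 0 \<le> s \<Longrightarrow> 0 \<le> z s"
    using sol unfolding reflected_solution_def by auto
  have z0: "z 0 = \<psi> 0"
    using sol unfolding reflected_solution_def by (smt (verit) integral_singleton atLeastAtMost_singleton)
  have cont': "continuous_on {0..t} z" using cont by (rule continuous_on_subset) auto
  have unif: "uniformly_continuous_on {0..t} z"
    using compact_uniformly_continuous[OF cont'] by simp
  have "bounded (z ` {0..t})"
    using compact_continuous_image[OF cont'] by (simp add: compact_imp_bounded)
  then obtain R0 where R0: "\<forall>s\<in>{0..t}. \<bar>z s\<bar> \<le> R0"
    unfolding bounded_iff by auto
  \<comment> \<open>The spare 1 lets R bound the scheme as well, which stays within e \<le> 1 of z
    at the nodes.\<close>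
  define R where "R = max 1 R0 + 1"
  have R: "1 \<le> R" "\<And>s. s \<in> {0..t} \<Longrightarrow> \<bar>z s\<bar> + 1 \<le> R" using R0 by (fastforce simp: R_def)+
  have d_pos: "0 < d n" for n using t by (simp add: d_def)
  have nd: "real (Suc n) * d n = t" for n by (simp add: d_def)
  have d0: "d \<longlonglongrightarrow> 0" unfolding d_def by (rule LIMSEQ_Suc[OF lim_const_over_n])
  have key: "\<forall>\<^sub>F n in sequentially.
      \<bar>drift_sum (d n) (\<psi> 0) (increments \<psi> (d n)) (Suc n) - integral {0..t} (\<lambda>s. z s ^ k)\<bar>
        \<le> t * (real k * R ^ k * (2 * e))" if e: "0 < e" "e \<le> 1" for e
  proof -
    obtain \<eta> where \<eta>: "0 < \<eta>" "\<And>s s'. s \<in> {0..t} \<Longrightarrow> s' \<in> {0..t} \<Longrightarrow> \<bar>s' - s\<bar> < \<eta> \<Longrightarrow> \<bar>z s' - z s\<bar> < e"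
      using unif e unfolding uniformly_continuous_on_def dist_real_def by metis
    have "\<forall>\<^sub>F n in sequentially. d n < \<eta>"
      using d0 \<eta>(1) by (rule order_tendstoD)
    then show ?thesis
    proof eventually_elim
      case (elim n)
      let ?\<zeta> = "scheme (d n) (\<psi> 0) (increments \<psi> (d n))"
      have le_t: "real i * d n \<le> t" if "i \<le> Suc n" for i
      proof -
        have "real i * d n \<le> real (Suc n) * d n"
          using that d_pos[of n] by (intro mult_right_mono) auto
        then show ?thesis by (simp only: nd)
      qed
      have osc: "\<bar>z s' - z s\<bar> \<le> e" if "0 \<le> s" "s \<le> s'" "s' \<le> t" "s' - s \<le> d n" for s s'
        using \<eta>(2)[of s s'] that elim by auto
      have A: "\<bar>?\<zeta> i - z (real i * d n)\<bar> \<le> e" if "i \<le> Suc n" for i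
        by (rule scheme_error[OF sol d_pos[of n], where T=t]) (use osc le_t[OF that] in auto)
      have "\<bar>drift_sum (d n) (\<psi> 0) (increments \<psi> (d n)) (Suc n) - integral {0..real (Suc n) * d n} (\<lambda>s. z s ^ k)\<bar>
          \<le> real (Suc n) * d n * (real k * R ^ k * (2 * e))"
      proof (rule drift_sum_error)
        show "\<bar>z s\<bar> \<le> R" if "0 \<le> s" "s \<le> real (Suc n) * d n" for s
        proof -
          have "s \<in> {0..t}" using that nd[of n] by simp
          then show ?thesis using R(2)[of s] by linarith
        qed
        fix i
        show "?\<zeta> i \<le> R" if "i \<le> Suc n"
        proof -
          have "real i * d n \<in> {0..t}" using le_t[OF that] d_pos[of n] by auto
          then show ?thesis using A[OF that] R(2)[of "real i * d n"] e by linarith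
        qed
        fix s assume i: "i < Suc n" and s: "real i * d n \<le> s" "s \<le> real (Suc i) * d n"
        have "0 \<le> real i * d n" using d_pos[of n] by auto
        then have "0 \<le> s" using s by linarith
        then have "\<bar>z (real (Suc i) * d n) - z s\<bar> \<le> e"
          using s i le_t[of "Suc i"] by (intro osc) (auto simp: algebra_simps)
        then show "\<bar>?\<zeta> (Suc i) - z s\<bar> \<le> 2 * e"
          using A[of "Suc i"] i by auto
      qed (use cont d_pos R nonneg[of 0] z0 in auto)
      then show ?case by (simp only: nd)
    qed
  qed
  show ?thesis
  proof (rule tendstoI)
    fix e :: real assume e: "0 < e"
    define K where "K = t * real k * R ^ k * 2"
    have K: "0 < K" using t k_pos R by (simp add: K_def)
    define e' where "e' = min 1 (e / (2 * K))"
    have e': "0 < e'" "e' \<le> 1" using e K by (auto simp: e'_def)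
    have "K * e' \<le> e / 2" using K by (simp add: e'_def min_def field_simps)
    then have "K * e' < e" using e by simp
    then have lt: "t * (real k * R ^ k * (2 * e')) < e" by (simp add: K_def mult_ac)
    show "\<forall>\<^sub>F n in sequentially. dist (drift_sum (d n) (\<psi> 0) (increments \<psi> (d n)) (Suc n)) (integral {0..t} (\<lambda>s. z s ^ k)) < e"
      using key[OF e'] by eventually_elim (use lt in \<open>auto simp: dist_real_def\<close>)
  qed
qed

end

section \<open>Bounds and equicontinuity of the scheme, uniform in the step size\<close>

context power_drift
begin

text \<open>Summation of \<open>euler_step_ge\<close>: the driver telescopes, and the slack is the
  reflection accumulated between the two nodes.\<close>

lemma scheme_ge_sum:
  assumes d: "0 \<le> d" and "i \<le> p"
  shows "scheme d x (increments \<psi> d) i + \<psi> (real p * d) - \<psi> (real i * d)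
      + (\<Sum>r=i..<p. d * (c - scheme d x (increments \<psi> d) (Suc r) ^ k)) \<le> scheme d x (increments \<psi> d) p"
  using \<open>i \<le> p\<close>
proof (induction p rule: dec_induct)
  case (step p)
  let ?\<zeta> = "scheme d x (increments \<psi> d)"
  have "?\<zeta> p + (\<psi> (real (Suc p) * d) - \<psi> (real p * d)) + d * c \<le> ?\<zeta> (Suc p) + d * ?\<zeta> (Suc p) ^ k"
    using euler_step_ge[OF d, of "?\<zeta> p + increments \<psi> d p"]
    unfolding scheme.simps(2) by (simp only: increments_def)
  moreover have "(\<Sum>r=i..<Suc p. d * (c - ?\<zeta> (Suc r) ^ k)) =
      (\<Sum>r=i..<p. d * (c - ?\<zeta> (Suc r) ^ k)) + d * c - d * ?\<zeta> (Suc p) ^ k"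
    using step.hyps by (simp add: right_diff_distrib)
  ultimately show ?case
    using step.IH by linarith
qed auto

text \<open>Only the nodes after i have to be positive, since a step is free of reflection as soon
  as its new state is positive.\<close>

lemma scheme_eq_sum:
  assumes d: "0 \<le> d" and "i \<le> p"
    and pos: "\<And>r. i < r \<Longrightarrow> r \<le> p \<Longrightarrow> 0 < scheme d x (increments \<psi> d) r"
  shows "scheme d x (increments \<psi> d) i + \<psi> (real p * d) - \<psi> (real i * d)
      + (\<Sum>r=i..<p. d * (c - scheme d x (increments \<psi> d) (Suc r) ^ k)) = scheme d x (increments \<psi> d) p"
  using \<open>i \<le> p\<close> pos
proof (induction p rule: dec_induct)
  case (step p)
  have "0 < euler_step d (scheme d x (increments \<psi> d) p + increments \<psi> d p)"
    using step.prems[of "Suc p"] step.hyps by (simp add: scheme.simps(2))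
  let ?\<zeta> = "scheme d x (increments \<psi> d)"
  have "?\<zeta> p + (\<psi> (real (Suc p) * d) - \<psi> (real p * d)) + d * c = ?\<zeta> (Suc p) + d * ?\<zeta> (Suc p) ^ k"
    using euler_step_pos_eq[OF d \<open>0 < euler_step d _\<close>]
    unfolding scheme.simps(2) by (simp only: increments_def)
  moreover have "(\<Sum>r=i..<Suc p. d * (c - ?\<zeta> (Suc r) ^ k)) =
      (\<Sum>r=i..<p. d * (c - ?\<zeta> (Suc r) ^ k)) + d * c - d * ?\<zeta> (Suc p) ^ k"
    using step.hyps by (simp add: right_diff_distrib)
  moreover have "?\<zeta> i + \<psi> (real p * d) - \<psi> (real i * d) + (\<Sum>r=i..<p. d * (c - ?\<zeta> (Suc r) ^ k)) = ?\<zeta> p"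
    using step.prems by (intro step.IH) auto
  ultimately show ?case by linarith
qed auto

text \<open>A step that ends at a positive state gains at most the driver increment plus d
  \<bar>c\<bar>, as the power drift only pulls down. A state that has been reset to 0 lies below the
  bound because m lies below the driver.\<close>

lemma scheme_upper:
  assumes d: "0 \<le> d" and x: "0 \<le> x" and "i \<le> p" and m: "\<And>r. i \<le> r \<Longrightarrow> r \<le> p \<Longrightarrow> m \<le> \<psi> (real r * d)"
  shows "scheme d x (increments \<psi> d) p
    \<le> scheme d x (increments \<psi> d) i + (\<psi> (real p * d) - m) + real (p - i) * d * \<bar>c\<bar>"
  using \<open>i \<le> p\<close> m
proof (induction p rule: dec_induct)
  case (step p)
  let ?\<zeta> = "scheme d x (increments \<psi> d)"
  have nonneg: "0 \<le> real (p - i) * d * \<bar>c\<bar>" "0 \<le> d * \<bar>c\<bar>" using d by auto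
  have suc: "real (Suc p - i) * d * \<bar>c\<bar> = real (p - i) * d * \<bar>c\<bar> + d * \<bar>c\<bar>"
    using step.hyps by (simp add: Suc_diff_le algebra_simps)
  show ?case
  proof (cases "0 < ?\<zeta> (Suc p)")
    case True
    then have "?\<zeta> (Suc p) + d * ?\<zeta> (Suc p) ^ k = ?\<zeta> p + increments \<psi> d p + d * c"
      using euler_step_pos_eq[OF d] by (simp add: scheme.simps(2))
    moreover have "0 \<le> d * ?\<zeta> (Suc p) ^ k" using d x by (simp add: scheme_nonneg)
    moreover have "d * c \<le> d * \<bar>c\<bar>" using d by (intro mult_left_mono) auto
    moreover have "?\<zeta> p \<le> ?\<zeta> i + (\<psi> (real p * d) - m) + real (p - i) * d * \<bar>c\<bar>"
      using step by auto
    ultimately show ?thesis unfolding suc increments_def by linarith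
  next
    case False
    then show ?thesis
      using step.prems[of "Suc p"] step.hyps scheme_nonneg[OF d x, of "increments \<psi> d" i] nonneg unfolding suc
      by linarith
  qed
qed (use m assms in auto)

lemma scheme_bounded:
  assumes \<psi>: "continuous_on {0..} \<psi>" "0 \<le> \<psi> 0"
  obtains R where "1 \<le> R"
    "\<And>d p. 0 < d \<Longrightarrow> real p * d \<le> T \<Longrightarrow> scheme d (\<psi> 0) (increments \<psi> d) p \<le> R"
proof -
  have cont: "continuous_on {0..T} \<psi>" using \<psi>(1) by (rule continuous_on_subset) auto
  then have "bounded (\<psi> ` {0..T})"
    using compact_continuous_image compact_imp_bounded compact_Icc by blast
  then obtain S where S: "\<forall>s\<in>{0..T}. \<bar>\<psi> s\<bar> \<le> S" unfolding bounded_iff by auto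
  show ?thesis
  proof
    show "1 \<le> max 1 (\<psi> 0 + 2 * S + T * \<bar>c\<bar>)" by simp
    fix d :: real and p :: nat assume d: "0 < d" and p: "real p * d \<le> T"
    have mem: "real r * d \<in> {0..T}" if "r \<le> p" for r
    proof -
      have "real r * d \<le> real p * d" using that d by (intro mult_right_mono) auto
      then have "real r * d \<le> T" using p by (rule order_trans)
      then show ?thesis using d by simp
    qed
    have low: "- S \<le> \<psi> (real r * d)" if "r \<le> p" for r
      using S mem[OF that] by fastforce
    have "scheme d (\<psi> 0) (increments \<psi> d) p
      \<le> scheme d (\<psi> 0) (increments \<psi> d) 0 + (\<psi> (real p * d) - (- S)) + real (p - 0) * d * \<bar>c\<bar>"
      using d \<psi>(2) low by (intro scheme_upper) auto
    moreover have "\<psi> (real p * d) \<le> S" using S mem[of p] by fastforce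
    moreover have "real p * d * \<bar>c\<bar> \<le> T * \<bar>c\<bar>" using p by (intro mult_right_mono) auto
    ultimately show "scheme d (\<psi> 0) (increments \<psi> d) p \<le> max 1 (\<psi> 0 + 2 * S + T * \<bar>c\<bar>)"
      by simp
  qed
qed

text \<open>The upper estimate comes from \<open>scheme_upper\<close>, with m just below the driver
  on the short interval; the lower one from \<open>scheme_ge_sum\<close>, where the drift is at
  least -C because the states are bounded. Half of e is reserved for the driver, half for the
  drift.\<close>

lemma scheme_equicontinuous:
  assumes \<psi>: "continuous_on {0..} \<psi>" "0 \<le> \<psi> 0" and e: "0 < e"
  obtains \<eta> where "0 < \<eta>"
    "\<And>d i p. 0 < d \<Longrightarrow> i \<le> p \<Longrightarrow> real p * d \<le> T \<Longrightarrow> real (p - i) * d \<le> \<eta> \<Longrightarrow>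
      \<bar>scheme d (\<psi> 0) (increments \<psi> d) p - scheme d (\<psi> 0) (increments \<psi> d) i\<bar> \<le> e"
proof -
  obtain R where R: "1 \<le> R"
    "\<And>d p. 0 < d \<Longrightarrow> real p * d \<le> T \<Longrightarrow> scheme d (\<psi> 0) (increments \<psi> d) p \<le> R"
    by (rule scheme_bounded[OF \<psi>]) blast
  have cont: "continuous_on {0..T} \<psi>" using \<psi>(1) by (rule continuous_on_subset) auto
  then have "uniformly_continuous_on {0..T} \<psi>"
    using compact_uniformly_continuous by auto
  moreover have "0 < e / 2" using e by simp
  ultimately obtain \<eta>1 where \<eta>1: "0 < \<eta>1"
    "\<And>s s'. s \<in> {0..T} \<Longrightarrow> s' \<in> {0..T} \<Longrightarrow> \<bar>s' - s\<bar> < \<eta>1 \<Longrightarrow> \<bar>\<psi> s' - \<psi> s\<bar> < e / 2"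
    unfolding uniformly_continuous_on_def dist_real_def by metis
  define C where "C = \<bar>c\<bar> + R ^ k"
  have C: "0 < C" using R by (simp add: C_def add_nonneg_pos)
  define \<eta> where "\<eta> = min (\<eta>1 / 2) (e / (2 * C))"
  show ?thesis
  proof
    show "0 < \<eta>" using \<eta>1 e C by (simp add: \<eta>_def)
    fix d :: real and i p :: nat assume d: "0 < d" and ip: "i \<le> p" and p: "real p * d \<le> T"
      and close: "real (p - i) * d \<le> \<eta>"
    let ?\<zeta> = "scheme d (\<psi> 0) (increments \<psi> d)"
    have mono: "real r * d \<le> real q * d" if "r \<le> q" for r q
      using that d by (intro mult_right_mono) auto
    have diff: "real p * d - real i * d = real (p - i) * d"
      using ip by (simp add: of_nat_diff algebra_simps)
    have mem: "real r * d \<in> {0..T}" if "r \<le> p" for r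
      using order_trans[OF mono[OF that] p] d by simp
    have osc: "\<bar>\<psi> (real r * d) - \<psi> (real q * d)\<bar> < e / 2"
      if "i \<le> r" "r \<le> p" "i \<le> q" "q \<le> p" for r q
    proof (rule \<eta>1(2))
      have "\<eta> < \<eta>1" using \<eta>1 by (auto simp: \<eta>_def min_def)
      then show "\<bar>real r * d - real q * d\<bar> < \<eta>1"
        using mono[OF that(1)] mono[OF that(2)] mono[OF that(3)] mono[OF that(4)] diff close by linarith
    qed (use mem that in auto)
    have small: "real (p - i) * d * C \<le> e / 2"
    proof -
      have "real (p - i) * d * C \<le> \<eta> * C" using close C by (intro mult_right_mono) auto
      also have "\<dots> \<le> e / (2 * C) * C" using C by (intro mult_right_mono) (auto simp: \<eta>_def)
      finally show ?thesis using C by simp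
    qed
    have "?\<zeta> p \<le> ?\<zeta> i + (\<psi> (real p * d) - (\<psi> (real p * d) - e / 2)) + real (p - i) * d * \<bar>c\<bar>"
    proof (rule scheme_upper)
      show "\<psi> (real p * d) - e / 2 \<le> \<psi> (real r * d)" if "i \<le> r" "r \<le> p" for r
        using osc[of r p] that ip by linarith
    qed (use d \<psi> ip in auto)
    moreover have "real (p - i) * d * \<bar>c\<bar> \<le> real (p - i) * d * C"
      using d R by (intro mult_left_mono) (auto simp: C_def)
    ultimately have up: "?\<zeta> p - ?\<zeta> i \<le> e" using small by linarith
    have "- (real (p - i) * d * C) = (\<Sum>r=i..<p. d * (- C))"
      by simp
    also have "\<dots> \<le> (\<Sum>r=i..<p. d * (c - ?\<zeta> (Suc r) ^ k))"
    proof (intro sum_mono mult_left_mono)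
      fix r assume "r \<in> {i..<p}"
      then have "?\<zeta> (Suc r) ^ k \<le> R ^ k"
        using R(2)[OF d] mem[of "Suc r"] d \<psi> by (intro power_mono scheme_nonneg) auto
      then show "- C \<le> c - ?\<zeta> (Suc r) ^ k" by (simp add: C_def)
    qed (use d in auto)
    finally have "?\<zeta> i + \<psi> (real p * d) - \<psi> (real i * d) - real (p - i) * d * C \<le> ?\<zeta> p"
      using scheme_ge_sum[of d i p "\<psi> 0" \<psi>] d ip by auto
    then have "- e \<le> ?\<zeta> p - ?\<zeta> i" using small osc[of p i] ip by linarith
    then show "\<bar>?\<zeta> p - ?\<zeta> i\<bar> \<le> e" using up by linarith
  qed
qed

text \<open>The same monotonicity argument as for the error against an exact solution, with the run on a
  finer grid in the place of the solution.\<close>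

lemma scheme_refinement_error:
  fixes q :: nat
  assumes q: "0 < q" and d: "0 < d" and \<psi>0: "0 \<le> \<psi> 0"
    and osc: "\<And>i a. real (Suc i) * (real q * d) \<le> T \<Longrightarrow> a \<le> q \<Longrightarrow>
      \<bar>scheme d (\<psi> 0) (increments \<psi> d) (Suc i * q) - scheme d (\<psi> 0) (increments \<psi> d) (i * q + a)\<bar> \<le> \<epsilon>"
    and \<epsilon>: "0 \<le> \<epsilon>" and "real i * (real q * d) \<le> T"
  shows "\<bar>scheme (real q * d) (\<psi> 0) (increments \<psi> (real q * d)) i
      - scheme d (\<psi> 0) (increments \<psi> d) (i * q)\<bar> \<le> \<epsilon>"
  using \<open>real i * (real q * d) \<le> T\<close>
proof (induction i)
  case 0
  then show ?case using \<epsilon> by simp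
next
  case (Suc i)
  let ?D = "real q * d"
  define y where "y = scheme d (\<psi> 0) (increments \<psi> d)"
  define \<zeta> where "\<zeta> = scheme ?D (\<psi> 0) (increments \<psi> ?D)"
  have D: "0 \<le> ?D" using d by simp
  have "real i * ?D \<le> real (Suc i) * ?D" using D by (intro mult_right_mono) auto
  then have IH: "\<bar>\<zeta> i - y (i * q)\<bar> \<le> \<epsilon>" using Suc by (simp add: \<zeta>_def y_def)
  define x where "x = \<zeta> i + (\<psi> (real (Suc i) * ?D) - \<psi> (real i * ?D))"
  have z': "\<zeta> (Suc i) = euler_step ?D x"
    by (simp add: \<zeta>_def x_def scheme.simps(2) increments_def)
  have z'0: "0 \<le> \<zeta> (Suc i)" using D by (simp add: z' euler_step_nonneg)
  have le: "i * q \<le> Suc i * q" by simp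
  have time: "real (Suc i * q) * d = real (Suc i) * ?D" "real (i * q) * d = real i * ?D"
    by (simp_all add: algebra_simps)
  have near: "\<bar>y (Suc i * q) - y r\<bar> \<le> \<epsilon>" if "i * q \<le> r" "r \<le> Suc i * q" for r
    using osc[OF Suc.prems, of "r - i * q"] that by (auto simp: y_def)
  have const: "(\<Sum>r=i*q..<Suc i*q. d * (c - \<zeta> (Suc i) ^ k)) = ?D * (c - \<zeta> (Suc i) ^ k)"
    by (simp add: algebra_simps)
  have "\<zeta> (Suc i) - y (Suc i * q) \<le> \<epsilon>"
  proof (rule ccontr)
    assume "\<not> ?thesis"
    then have big: "y (Suc i * q) + \<epsilon> < \<zeta> (Suc i)" by simp
    have y0: "0 \<le> y r" for r using d \<psi>0 by (simp add: y_def scheme_nonneg)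
    then have "0 < \<zeta> (Suc i)" using big \<epsilon> by (smt (verit))
    then have eq: "\<zeta> (Suc i) + ?D * \<zeta> (Suc i) ^ k = x + ?D * c"
      using euler_step_pos_eq D by (simp add: z')
    have "(\<Sum>r=i*q..<Suc i*q. d * (c - \<zeta> (Suc i) ^ k)) \<le> (\<Sum>r=i*q..<Suc i*q. d * (c - y (Suc r) ^ k))"
    proof (intro sum_mono mult_left_mono)
      fix r assume "r \<in> {i*q..<Suc i*q}"
      then have "y (Suc r) \<le> \<zeta> (Suc i)" using near[of "Suc r"] big by auto
      then show "c - \<zeta> (Suc i) ^ k \<le> c - y (Suc r) ^ k"
        using y0 by (simp add: power_mono)
    qed (use d in auto)
    then show False
      using scheme_ge_sum[OF less_imp_le[OF d] le, of "\<psi> 0" \<psi>] eq IH big const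
      unfolding y_def[symmetric] time by (simp add: x_def algebra_simps)
  qed
  moreover have "- \<epsilon> \<le> \<zeta> (Suc i) - y (Suc i * q)"
  proof (rule ccontr)
    assume "\<not> ?thesis"
    then have big: "\<zeta> (Suc i) + \<epsilon> < y (Suc i * q)" by simp
    have low: "\<zeta> (Suc i) < y r" if "i * q \<le> r" "r \<le> Suc i * q" for r
      using near[OF that] big by linarith
    have "(\<Sum>r=i*q..<Suc i*q. d * (c - y (Suc r) ^ k)) \<le> (\<Sum>r=i*q..<Suc i*q. d * (c - \<zeta> (Suc i) ^ k))"
    proof (intro sum_mono mult_left_mono)
      fix r assume "r \<in> {i*q..<Suc i*q}"
      then have "\<zeta> (Suc i) \<le> y (Suc r)" using low[of "Suc r"] by auto
      then show "c - y (Suc r) ^ k \<le> c - \<zeta> (Suc i) ^ k"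
        using z'0 by (simp add: power_mono)
    qed (use d in auto)
    moreover have "y (i*q) + \<psi> (real (Suc i*q) * d) - \<psi> (real (i*q) * d)
      + (\<Sum>r=i*q..<Suc i*q. d * (c - y (Suc r) ^ k)) = y (Suc i*q)"
      unfolding y_def
    proof (rule scheme_eq_sum[OF less_imp_le[OF d] le])
      fix r assume "i * q < r" "r \<le> Suc i * q"
      then show "0 < scheme d (\<psi> 0) (increments \<psi> d) r"
        using low[of r] z'0 by (simp add: y_def)
    qed
    ultimately show False
      using euler_step_ge[OF D, of x] IH big const
      unfolding time by (simp add: x_def z' algebra_simps)
  qed
  ultimately show ?case by (simp add: \<zeta>_def y_def)
qed

end

section \<open>Convergence along dyadic grids and existence of a pathwise solution\<close>

context power_drift
begin

definition grid_index :: "nat \<Rightarrow> real \<Rightarrow> nat" where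
  "grid_index n t = nat \<lfloor>t * 2 ^ n\<rfloor>"

definition dyadic_path :: "(real \<Rightarrow> real) \<Rightarrow> nat \<Rightarrow> real \<Rightarrow> real" where
  "dyadic_path \<psi> n t = scheme (1 / 2 ^ n) (\<psi> 0) (increments \<psi> (1 / 2 ^ n)) (grid_index n t)"

definition reflected_path :: "(real \<Rightarrow> real) \<Rightarrow> real \<Rightarrow> real" where
  "reflected_path \<psi> t = lim (\<lambda>n. dyadic_path \<psi> n t)"

lemma grid_index_le: "0 \<le> t \<Longrightarrow> real (grid_index n t) * (1 / 2 ^ n) \<le> t"
  by (simp add: grid_index_def field_simps)

lemma grid_index_gt:
  assumes "0 \<le> t"
  shows "t < real (grid_index n t) * (1 / 2 ^ n) + 1 / 2 ^ n"
proof -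
  have "t * 2 ^ n < real (grid_index n t) + 1"
    using assms by (simp add: grid_index_def)
  then show ?thesis by (simp add: field_simps)
qed

lemma grid_index_mono: "s \<le> t \<Longrightarrow> grid_index n s \<le> grid_index n t"
  unfolding grid_index_def by (intro nat_mono floor_mono mult_right_mono) auto

lemma grid_index_grid [simp]: "grid_index n (real i * (1 / 2 ^ n)) = i"
  by (simp add: grid_index_def)

lemma grid_index_diff:
  assumes "0 \<le> s" "s \<le> t"
  shows "real (grid_index n t - grid_index n s) * (1 / 2 ^ n) \<le> t - s + 1 / 2 ^ n"
proof -
  have "real (grid_index n t - grid_index n s) = real (grid_index n t) - real (grid_index n s)"
    using grid_index_mono[OF assms(2)] by (simp add: of_nat_diff)
  then show ?thesis
    using grid_index_le[of t n] grid_index_gt[of s n] assms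
    by (simp add: diff_divide_distrib)
qed

context
  fixes \<psi> :: "real \<Rightarrow> real"
  assumes \<psi>: "continuous_on {0..} \<psi>" "0 \<le> \<psi> 0"
begin

text \<open>The mesh has to be small as well: the approximations are step functions, which may jump
  between arbitrarily close times.\<close>

lemma dyadic_path_equicontinuous:
  assumes e: "0 < e"
  obtains \<eta> where "0 < \<eta>" "\<And>n s t. 0 \<le> s \<Longrightarrow> s \<le> t \<Longrightarrow> t \<le> T \<Longrightarrow> t - s \<le> \<eta> \<Longrightarrow> 1 / 2 ^ n \<le> \<eta> \<Longrightarrow>
     \<bar>dyadic_path \<psi> n t - dyadic_path \<psi> n s\<bar> \<le> e"
proof -
  obtain \<eta> where \<eta>: "0 < \<eta>"
    "\<And>d i p. 0 < d \<Longrightarrow> i \<le> p \<Longrightarrow> real p * d \<le> T \<Longrightarrow> real (p - i) * d \<le> \<eta> \<Longrightarrow>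
      \<bar>scheme d (\<psi> 0) (increments \<psi> d) p - scheme d (\<psi> 0) (increments \<psi> d) i\<bar> \<le> e"
    by (rule scheme_equicontinuous[OF \<psi> e]) blast
  show ?thesis
  proof
    show "0 < \<eta> / 2" using \<eta> by simp
    fix n s t assume st: "0 \<le> s" "s \<le> t" "t \<le> T" "t - s \<le> \<eta> / 2" "1 / 2 ^ n \<le> \<eta> / 2"
    show "\<bar>dyadic_path \<psi> n t - dyadic_path \<psi> n s\<bar> \<le> e"
      unfolding dyadic_path_def
    proof (rule \<eta>(2))
      show "real (grid_index n t) * (1 / 2 ^ n) \<le> T"
        using grid_index_le[of t n] st by linarith
      show "real (grid_index n t - grid_index n s) * (1 / 2 ^ n) \<le> \<eta>"
        using grid_index_diff[OF st(1,2), of n] st by linarith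
    qed (use grid_index_mono st in auto)
  qed
qed

text \<open>Level m refines level n by the factor 2^(m-n). \<open>scheme_refinement_error\<close>
  compares the two runs at the last coarse node before t, and equicontinuity of the fine run covers
  the way from there to the last fine node before t.\<close>

lemma dyadic_path_cauchy:
  assumes e: "0 < e"
  obtains N where "\<And>n m t. N \<le> n \<Longrightarrow> n \<le> m \<Longrightarrow> 0 \<le> t \<Longrightarrow> t \<le> T \<Longrightarrow>
     \<bar>dyadic_path \<psi> n t - dyadic_path \<psi> m t\<bar> \<le> e"
proof -
  have "0 < e / 2" using e by simp
  from scheme_equicontinuous[OF \<psi> this, of T] obtain \<eta> where \<eta>: "0 < \<eta>"
    "\<And>d i p. 0 < d \<Longrightarrow> i \<le> p \<Longrightarrow> real p * d \<le> T \<Longrightarrow> real (p - i) * d \<le> \<eta> \<Longrightarrow>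
      \<bar>scheme d (\<psi> 0) (increments \<psi> d) p - scheme d (\<psi> 0) (increments \<psi> d) i\<bar> \<le> e / 2"
    by blast
  obtain N where N: "1 / 2 ^ N < \<eta>"
    using real_arch_pow_inv[OF \<eta>(1), of "1/2"] by (auto simp: power_one_over)
  show ?thesis
  proof
    fix n m t assume nm: "N \<le> n" "n \<le> m" and t: "0 \<le> t" "t \<le> T"
    define q :: nat where "q = 2 ^ (m - n)"
    define d :: real where "d = 1 / 2 ^ m"
    let ?y = "scheme d (\<psi> 0) (increments \<psi> d)"
    have d: "0 < d" by (simp add: d_def)
    have qd: "real q * d = 1 / 2 ^ n"
    proof -
      have "real q = 2 ^ m / 2 ^ n" using nm unfolding q_def of_nat_power by (simp add: power_diff)
      then show ?thesis by (simp add: d_def)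
    qed
    have q: "0 < q" by (simp add: q_def)
    have "(1::real) / 2 ^ n \<le> 1 / 2 ^ N" using nm by (simp add: field_simps)
    then have small: "real q * d \<le> \<eta>" using N qd by simp
    define i where "i = grid_index n t"
    have iT: "real i * (real q * d) \<le> T"
      using grid_index_le[OF t(1), of n] t by (simp add: i_def qd)
    have "\<bar>scheme (real q * d) (\<psi> 0) (increments \<psi> (real q * d)) i - ?y (i * q)\<bar> \<le> e / 2"
    proof (rule scheme_refinement_error[where T=T])
      fix j a assume j: "real (Suc j) * (real q * d) \<le> T" "a \<le> q"
      show "\<bar>?y (Suc j * q) - ?y (j * q + a)\<bar> \<le> e / 2"
      proof (rule \<eta>(2))
        show "real (Suc j * q) * d \<le> T" using j by (simp only: of_nat_mult mult.assoc)
        have "Suc j * q - (j * q + a) \<le> q" by simp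
        then have "real (Suc j * q - (j * q + a)) * d \<le> real q * d"
          using d by (intro mult_right_mono) auto
        then show "real (Suc j * q - (j * q + a)) * d \<le> \<eta>" using small by linarith
      qed (use d j in auto)
    qed (use q d \<psi> e iT in auto)
    moreover have "\<bar>?y (grid_index m t) - ?y (i * q)\<bar> \<le> e / 2"
    proof (rule \<eta>(2))
      have "real i * 2 ^ (m - n) \<le> t * 2 ^ m"
      proof -
        have "real i * (1 / 2 ^ n) * 2 ^ m \<le> t * 2 ^ m"
          using grid_index_le[OF t(1), of n] by (intro mult_right_mono) (auto simp: i_def)
        then show ?thesis using nm by (simp add: power_diff)
      qed
      then have "real (i * q) \<le> t * 2 ^ m" by (simp add: q_def)
      then have "int (i * q) \<le> \<lfloor>t * 2 ^ m\<rfloor>" by (simp only: le_floor_iff of_int_of_nat_eq)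
      then show le: "i * q \<le> grid_index m t" unfolding grid_index_def by linarith
      show "real (grid_index m t) * d \<le> T"
        using grid_index_le[OF t(1), of m] t by (simp add: d_def)
      have "real (grid_index m t - i * q) * d = real (grid_index m t) * d - real i * (1 / 2 ^ n)"
        using le by (simp add: of_nat_diff left_diff_distrib mult.assoc qd)
      also have "\<dots> \<le> 1 / 2 ^ n"
        using grid_index_le[OF t(1), of m] grid_index_gt[OF t(1), of n] by (simp add: i_def d_def)
      finally show "real (grid_index m t - i * q) * d \<le> \<eta>" using small qd by simp
    qed (use d in auto)
    ultimately show "\<bar>dyadic_path \<psi> n t - dyadic_path \<psi> m t\<bar> \<le> e"
      unfolding dyadic_path_def i_def[symmetric] d_def[symmetric] qd[symmetric] by linarith
  qed
qed

lemma dyadic_path_tendsto: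
  assumes t: "0 \<le> t"
  shows "(\<lambda>n. dyadic_path \<psi> n t) \<longlonglongrightarrow> reflected_path \<psi> t"
proof -
  have "Cauchy (\<lambda>n. dyadic_path \<psi> n t)"
    unfolding Cauchy_altdef2 dist_real_def
  proof (intro allI impI)
    fix e :: real assume "0 < e"
    then have "0 < e / 2" by simp
    from dyadic_path_cauchy[OF this, of t] obtain N where
      N: "\<And>n m s. N \<le> n \<Longrightarrow> n \<le> m \<Longrightarrow> 0 \<le> s \<Longrightarrow> s \<le> t \<Longrightarrow> \<bar>dyadic_path \<psi> n s - dyadic_path \<psi> m s\<bar> \<le> e / 2"
      by blast
    have "\<bar>dyadic_path \<psi> n t - dyadic_path \<psi> N t\<bar> < e" if "N \<le> n" for n
      using N[of N n t] that t \<open>0 < e\<close> by linarith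
    then show "\<exists>N. \<forall>n\<ge>N. \<bar>dyadic_path \<psi> n t - dyadic_path \<psi> N t\<bar> < e" by blast
  qed
  then show ?thesis
    unfolding reflected_path_def by (simp add: Cauchy_convergent_iff convergent_LIMSEQ_iff)
qed

lemma dyadic_path_uniform:
  assumes e: "0 < e"
  obtains N where "\<And>n t. N \<le> n \<Longrightarrow> 0 \<le> t \<Longrightarrow> t \<le> T \<Longrightarrow>
     \<bar>dyadic_path \<psi> n t - reflected_path \<psi> t\<bar> \<le> e"
proof -
  obtain N where N: "\<And>n m t. N \<le> n \<Longrightarrow> n \<le> m \<Longrightarrow> 0 \<le> t \<Longrightarrow> t \<le> T \<Longrightarrow>
     \<bar>dyadic_path \<psi> n t - dyadic_path \<psi> m t\<bar> \<le> e"
    by (rule dyadic_path_cauchy[OF e]) blast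
  show ?thesis
  proof
    fix n t assume n: "N \<le> n" and t: "0 \<le> t" "t \<le> T"
    have "(\<lambda>m. \<bar>dyadic_path \<psi> n t - dyadic_path \<psi> m t\<bar>) \<longlonglongrightarrow> \<bar>dyadic_path \<psi> n t - reflected_path \<psi> t\<bar>"
      by (intro tendsto_intros dyadic_path_tendsto t)
    then show "\<bar>dyadic_path \<psi> n t - reflected_path \<psi> t\<bar> \<le> e"
      using N[OF n _ t] by (intro LIMSEQ_le_const2) auto
  qed
qed

lemma eventually_pow2_le: "0 < \<eta> \<Longrightarrow> \<forall>\<^sub>F n in sequentially. 1 / 2 ^ n \<le> (\<eta>::real)"
  using order_tendstoD(2)[OF LIMSEQ_realpow_zero[of "1/2::real"], of \<eta>]
  by (auto simp: power_one_over elim: eventually_mono)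

lemma reflected_path_equicontinuous:
  assumes e: "0 < e"
  obtains \<eta> where "0 < \<eta>" "\<And>s t. 0 \<le> s \<Longrightarrow> s \<le> t \<Longrightarrow> t \<le> T \<Longrightarrow> t - s \<le> \<eta> \<Longrightarrow>
     \<bar>reflected_path \<psi> t - reflected_path \<psi> s\<bar> \<le> e"
proof -
  obtain \<eta> where \<eta>: "0 < \<eta>" "\<And>n s t. 0 \<le> s \<Longrightarrow> s \<le> t \<Longrightarrow> t \<le> T \<Longrightarrow> t - s \<le> \<eta> \<Longrightarrow> 1 / 2 ^ n \<le> \<eta> \<Longrightarrow>
     \<bar>dyadic_path \<psi> n t - dyadic_path \<psi> n s\<bar> \<le> e"
    by (rule dyadic_path_equicontinuous[OF e]) blast
  show ?thesis
  proof
    fix s t assume st: "0 \<le> s" "s \<le> t" "t \<le> T" "t - s \<le> \<eta>"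
    have "(\<lambda>n. \<bar>dyadic_path \<psi> n t - dyadic_path \<psi> n s\<bar>) \<longlonglongrightarrow> \<bar>reflected_path \<psi> t - reflected_path \<psi> s\<bar>"
      using st by (intro tendsto_intros dyadic_path_tendsto) auto
    moreover have "\<forall>\<^sub>F n in sequentially. \<bar>dyadic_path \<psi> n t - dyadic_path \<psi> n s\<bar> \<le> e"
      using eventually_pow2_le[OF \<eta>(1)] by eventually_elim (use \<eta>(2) st in auto)
    ultimately show "\<bar>reflected_path \<psi> t - reflected_path \<psi> s\<bar> \<le> e"
      by (rule tendsto_upperbound) auto
  qed (rule \<eta>)
qed

lemma continuous_reflected_path: "continuous_on {0..} (reflected_path \<psi>)"
  unfolding continuous_on_iff dist_real_def
proof (intro ballI allI impI)
  fix t e :: real assume t: "t \<in> {0..}" and e: "0 < e"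
  then have "0 < e / 2" by simp
  from reflected_path_equicontinuous[OF this, of "t + 1"] obtain \<eta> where \<eta>: "0 < \<eta>"
    "\<And>s s'. 0 \<le> s \<Longrightarrow> s \<le> s' \<Longrightarrow> s' \<le> t + 1 \<Longrightarrow> s' - s \<le> \<eta> \<Longrightarrow> \<bar>reflected_path \<psi> s' - reflected_path \<psi> s\<bar> \<le> e / 2"
    by blast
  have "\<bar>reflected_path \<psi> s - reflected_path \<psi> t\<bar> < e" if "s \<in> {0..}" "\<bar>s - t\<bar> < min 1 \<eta>" for s
    using \<eta>(2)[of s t] \<eta>(2)[of t s] that t e
    by (cases "s \<le> t") (auto simp: abs_minus_commute[of "reflected_path \<psi> s"])
  then show "\<exists>d>0. \<forall>s\<in>{0..}. \<bar>s - t\<bar> < d \<longrightarrow> \<bar>reflected_path \<psi> s - reflected_path \<psi> t\<bar> < e"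
    using \<eta>(1) by (intro exI[of _ "min 1 \<eta>"]) auto
qed

lemma reflected_path_nonneg:
  assumes "0 \<le> t" shows "0 \<le> reflected_path \<psi> t"
  by (rule LIMSEQ_le_const[OF dyadic_path_tendsto[OF assms]])
    (use \<psi> in \<open>auto simp: dyadic_path_def scheme_nonneg\<close>)

lemma grid_time_tendsto:
  assumes t: "0 \<le> t"
  shows "(\<lambda>n. real (grid_index n t) * (1 / 2 ^ n)) \<longlonglongrightarrow> t"
proof (rule tendsto_sandwich)
  have "(\<lambda>n. t - (1 / 2) ^ n) \<longlonglongrightarrow> t - 0"
    by (intro tendsto_intros LIMSEQ_realpow_zero) auto
  then show "(\<lambda>n. t - 1 / 2 ^ n) \<longlonglongrightarrow> t" by (simp add: power_one_over)
  show "\<forall>\<^sub>F n in sequentially. t - 1 / 2 ^ n \<le> real (grid_index n t) * (1 / 2 ^ n)"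
    using grid_index_gt[OF t] by (intro always_eventually allI) (smt (verit))
  show "\<forall>\<^sub>F n in sequentially. real (grid_index n t) * (1 / 2 ^ n) \<le> t"
    using grid_index_le[OF t] by simp
qed (rule tendsto_const)

text \<open>The sum only reaches the last node before t, so it is compared with the integral up to
  that node; continuity of the indefinite integral closes the gap.\<close>

lemma dyadic_drift_sum_tendsto:
  assumes t: "0 \<le> t"
  shows "(\<lambda>n. drift_sum (1 / 2 ^ n) (\<psi> 0) (increments \<psi> (1 / 2 ^ n)) (grid_index n t))
    \<longlonglongrightarrow> integral {0..t} (\<lambda>s. reflected_path \<psi> s ^ k)"
proof -
  let ?z = "reflected_path \<psi>"
  let ?p = "\<lambda>n. real (grid_index n t) * (1 / 2 ^ n)"
  let ?S = "\<lambda>n. drift_sum (1 / 2 ^ n) (\<psi> 0) (increments \<psi> (1 / 2 ^ n)) (grid_index n t)"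
  let ?I = "\<lambda>n. integral {0..?p n} (\<lambda>s. ?z s ^ k)"
  obtain R where R: "1 \<le> R"
    "\<And>d p. 0 < d \<Longrightarrow> real p * d \<le> t \<Longrightarrow> scheme d (\<psi> 0) (increments \<psi> d) p \<le> R"
    by (rule scheme_bounded[OF \<psi>]) blast
  have R': "\<bar>?z s\<bar> \<le> R" if "0 \<le> s" "s \<le> t" for s
  proof -
    have "?z s \<le> R"
    proof (rule LIMSEQ_le_const2[OF dyadic_path_tendsto[OF that(1)]], intro exI allI impI)
      fix n
      show "dyadic_path \<psi> n s \<le> R"
        unfolding dyadic_path_def using grid_index_le[OF that(1), of n] that by (intro R(2)) auto
    qed
    then show ?thesis using reflected_path_nonneg[OF that(1)] by simp
  qed
  have "(\<lambda>n. ?S n - ?I n) \<longlonglongrightarrow> 0"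
  proof (rule tendstoI)
    fix e :: real assume e: "0 < e"
    \<comment> \<open>t + 1 in place of t keeps K positive at t = 0.\<close>
    define K where "K = (t + 1) * (real k * R ^ k)"
    have K: "0 < K" using t k_pos R by (simp add: K_def)
    define e' where "e' = e / (4 * K)"
    have e': "0 < e'" using e K by (simp add: e'_def)
    obtain N where N: "\<And>n s. N \<le> n \<Longrightarrow> 0 \<le> s \<Longrightarrow> s \<le> t \<Longrightarrow> \<bar>dyadic_path \<psi> n s - ?z s\<bar> \<le> e'"
      by (rule dyadic_path_uniform[OF e', of t]) blast
    obtain \<eta> where \<eta>: "0 < \<eta>" "\<And>s s'. 0 \<le> s \<Longrightarrow> s \<le> s' \<Longrightarrow> s' \<le> t \<Longrightarrow> s' - s \<le> \<eta> \<Longrightarrow> \<bar>?z s' - ?z s\<bar> \<le> e'"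
      by (rule reflected_path_equicontinuous[OF e', of t]) blast
    show "\<forall>\<^sub>F n in sequentially. dist (?S n - ?I n) 0 < e"
      using eventually_pow2_le[OF \<eta>(1)] eventually_ge_at_top[of N]
    proof eventually_elim
      case (elim n)
      let ?d = "1 / 2 ^ n :: real"
      have mem: "real i * ?d \<le> t" if "i \<le> grid_index n t" for i
      proof -
        have "real i * ?d \<le> real (grid_index n t) * ?d"
          using that by (intro mult_right_mono) auto
        then show ?thesis using grid_index_le[OF t, of n] by (rule order_trans)
      qed
      have "\<bar>?S n - ?I n\<bar> \<le> ?p n * (real k * R ^ k * (2 * e'))"
      proof (rule drift_sum_error)
        show "\<bar>?z s\<bar> \<le> R" if "0 \<le> s" "s \<le> ?p n" for s
          using R'[of s] that grid_index_le[OF t, of n] by linarith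
        fix i
        show "scheme ?d (\<psi> 0) (increments \<psi> ?d) i \<le> R" if "i \<le> grid_index n t"
          using mem[OF that] by (intro R(2)) auto
        fix s assume i: "i < grid_index n t" and s: "real i * ?d \<le> s" "s \<le> real (Suc i) * ?d"
        have "0 \<le> real i * ?d" by simp
        then have s0: "0 \<le> s" using s by linarith
        have le: "real (Suc i) * ?d \<le> t" using mem[of "Suc i"] i by simp
        have "real (Suc i) * ?d - s \<le> \<eta>"
        proof -
          have "real (Suc i) * ?d = real i * ?d + ?d" by (simp only: of_nat_Suc distrib_right mult_1_left)
          then show ?thesis using s elim(1) by linarith
        qed
        then have "\<bar>?z (real (Suc i) * ?d) - ?z s\<bar> \<le> e'"
          using \<eta>(2)[of s "real (Suc i) * ?d"] s0 s le by blast
        moreover have "\<bar>dyadic_path \<psi> n (real (Suc i) * ?d) - ?z (real (Suc i) * ?d)\<bar> \<le> e'"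
          using le elim by (intro N) auto
        moreover have "dyadic_path \<psi> n (real (Suc i) * ?d) = scheme ?d (\<psi> 0) (increments \<psi> ?d) (Suc i)"
          unfolding dyadic_path_def by (simp only: grid_index_grid)
        ultimately show "\<bar>scheme ?d (\<psi> 0) (increments \<psi> ?d) (Suc i) - ?z s\<bar> \<le> 2 * e'" by linarith
      qed (use continuous_reflected_path \<psi> R in auto)
      also have "\<dots> \<le> (t + 1) * (real k * R ^ k * (2 * e'))"
        using mem[of "grid_index n t"] R e' by (intro mult_right_mono) auto
      also have "\<dots> = e / 2" using K by (simp add: e'_def K_def field_simps)
      finally show ?case using e by (simp add: dist_real_def)
    qed
  qed
  moreover have "?I \<longlonglongrightarrow> integral {0..t} (\<lambda>s. ?z s ^ k)"
  proof -
    have "continuous_on {0..t} (\<lambda>x. integral {0..x} (\<lambda>s. ?z s ^ k))"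
      using continuous_reflected_path
      by (intro indefinite_integral_continuous_1 integrable_continuous_interval)
        (auto intro!: continuous_intros intro: continuous_on_subset)
    then show ?thesis
      by (rule continuous_on_tendsto_compose[OF _ grid_time_tendsto[OF t]])
        (use t grid_index_le[OF t] in auto)
  qed
  ultimately have "(\<lambda>n. (?S n - ?I n) + ?I n) \<longlonglongrightarrow> 0 + integral {0..t} (\<lambda>s. ?z s ^ k)"
    by (rule tendsto_add)
  then show ?thesis by simp
qed

text \<open>Defined by the equation that it has to satisfy; what remains to be proved is that it
  increases, and only where the path is 0. Both are obtained from the discrete counterpart
  below.\<close>

definition regulator :: "real \<Rightarrow> real" where
  "regulator t = reflected_path \<psi> t - \<psi> t - integral {0..t} (\<lambda>s. c - reflected_path \<psi> s ^ k)"

definition dyadic_regulator :: "nat \<Rightarrow> nat \<Rightarrow> real" where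
  "dyadic_regulator n p = scheme (1 / 2 ^ n) (\<psi> 0) (increments \<psi> (1 / 2 ^ n)) p - \<psi> (real p * (1 / 2 ^ n))
     - (\<Sum>r=0..<p. (1 / 2 ^ n) * (c - scheme (1 / 2 ^ n) (\<psi> 0) (increments \<psi> (1 / 2 ^ n)) (Suc r) ^ k))"

lemma dyadic_regulator_tendsto:
  assumes t: "0 \<le> t"
  shows "(\<lambda>n. dyadic_regulator n (grid_index n t)) \<longlonglongrightarrow> regulator t"
proof -
  have "(\<lambda>s. reflected_path \<psi> s ^ k) integrable_on {0..t}"
    using continuous_reflected_path
    by (intro integrable_continuous_interval) (auto intro!: continuous_intros intro: continuous_on_subset)
  then have reg: "regulator t = reflected_path \<psi> t - \<psi> t - t * c + integral {0..t} (\<lambda>s. reflected_path \<psi> s ^ k)"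
    using t unfolding regulator_def by (subst Henstock_Kurzweil_Integration.integral_diff) auto
  have "dyadic_regulator n (grid_index n t) = dyadic_path \<psi> n t - \<psi> (real (grid_index n t) * (1 / 2 ^ n))
      - real (grid_index n t) * (1 / 2 ^ n) * c
      + drift_sum (1 / 2 ^ n) (\<psi> 0) (increments \<psi> (1 / 2 ^ n)) (grid_index n t)" for n
    by (simp add: dyadic_regulator_def dyadic_path_def drift_sum_def right_diff_distrib sum_subtractf
      lessThan_atLeast0)
  moreover have "(\<lambda>n. \<psi> (real (grid_index n t) * (1 / 2 ^ n))) \<longlonglongrightarrow> \<psi> t"
    by (rule continuous_on_tendsto_compose[OF \<psi>(1) grid_time_tendsto[OF t]]) (use t in auto)
  ultimately show ?thesis
    unfolding reg
    by (simp only:) (intro tendsto_intros dyadic_path_tendsto grid_time_tendsto dyadic_drift_sum_tendsto t)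
qed

text \<open>Monotonicity and constancy are inherited from \<open>dyadic_regulator\<close>: its
  increments are the slack in \<open>scheme_ge_sum\<close>, and they vanish by
  \<open>scheme_eq_sum\<close> on stretches where the scheme is positive.\<close>

lemma reflected_solution_exists: "reflected_solution \<psi> (reflected_path \<psi>) regulator"
  unfolding reflected_solution_def
proof (intro conjI allI impI)
  show "regulator 0 = 0"
  proof -
    have "dyadic_regulator n (grid_index n 0) = 0" for n
      by (simp add: dyadic_regulator_def grid_index_def)
    then show ?thesis
      using dyadic_regulator_tendsto[of 0] by (simp add: LIMSEQ_const_iff)
  qed
  show "mono_on {0..} regulator"
  proof (rule mono_onI)
    fix s t :: real assume st: "s \<in> {0..}" "t \<in> {0..}" "s \<le> t"
    have le: "dyadic_regulator n (grid_index n s) \<le> dyadic_regulator n (grid_index n t)" for n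
    proof -
      let ?\<zeta> = "scheme (1 / 2 ^ n) (\<psi> 0) (increments \<psi> (1 / 2 ^ n))"
      let ?i = "grid_index n s" and ?p = "grid_index n t"
      have ip: "?i \<le> ?p" using st grid_index_mono by simp
      have "(\<Sum>r=0..<?i. (1 / 2 ^ n) * (c - ?\<zeta> (Suc r) ^ k)) + (\<Sum>r=?i..<?p. (1 / 2 ^ n) * (c - ?\<zeta> (Suc r) ^ k))
         = (\<Sum>r=0..<?p. (1 / 2 ^ n) * (c - ?\<zeta> (Suc r) ^ k))"
        by (rule sum.atLeastLessThan_concat) (use ip in auto)
      then show ?thesis
        using scheme_ge_sum[OF _ ip, of "1 / 2 ^ n" "\<psi> 0" \<psi>] unfolding dyadic_regulator_def by auto
    qed
    show "regulator s \<le> regulator t"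
      by (rule LIMSEQ_le[OF dyadic_regulator_tendsto dyadic_regulator_tendsto]) (use st le in auto)
  qed
  fix t :: real
  show "0 \<le> t \<Longrightarrow> reflected_path \<psi> t = \<psi> t + integral {0..t} (\<lambda>s. c - reflected_path \<psi> s ^ k) + regulator t"
    by (simp add: regulator_def)
  fix s assume st: "0 \<le> s \<and> s \<le> t \<and> (\<forall>u\<in>{s..t}. 0 < reflected_path \<psi> u)"
  have "continuous_on {s..t} (reflected_path \<psi>)"
    using continuous_reflected_path by (rule continuous_on_subset) (use st in auto)
  then obtain u0 where u0: "u0 \<in> {s..t}" "\<And>u. u \<in> {s..t} \<Longrightarrow> reflected_path \<psi> u0 \<le> reflected_path \<psi> u"
    using continuous_attains_inf[of "{s..t}" "reflected_path \<psi>"] st by auto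
  \<comment> \<open>Half the minimum of the limit path on [s, t], so that uniform convergence keeps
    the scheme positive there.\<close>
  define e where "e = reflected_path \<psi> u0 / 2"
  have e: "0 < e" using u0 st by (simp add: e_def)
  obtain N where N: "\<And>n u. N \<le> n \<Longrightarrow> 0 \<le> u \<Longrightarrow> u \<le> t \<Longrightarrow> \<bar>dyadic_path \<psi> n u - reflected_path \<psi> u\<bar> \<le> e"
    by (rule dyadic_path_uniform[OF e, of t]) blast
  have "dyadic_regulator n (grid_index n s) = dyadic_regulator n (grid_index n t)" if n: "N \<le> n" for n
  proof -
    let ?d = "1 / 2 ^ n :: real"
    let ?\<zeta> = "scheme ?d (\<psi> 0) (increments \<psi> ?d)"
    let ?i = "grid_index n s" and ?p = "grid_index n t"
    have ip: "?i \<le> ?p" using st grid_index_mono by simp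
    have "(\<Sum>r=0..<?i. ?d * (c - ?\<zeta> (Suc r) ^ k)) + (\<Sum>r=?i..<?p. ?d * (c - ?\<zeta> (Suc r) ^ k))
       = (\<Sum>r=0..<?p. ?d * (c - ?\<zeta> (Suc r) ^ k))"
      by (rule sum.atLeastLessThan_concat) (use ip in auto)
    moreover have "?\<zeta> ?i + \<psi> (real ?p * ?d) - \<psi> (real ?i * ?d) + (\<Sum>r=?i..<?p. ?d * (c - ?\<zeta> (Suc r) ^ k)) = ?\<zeta> ?p"
    \<comment> \<open>The node of s may lie before s, where the limit path can vanish; but only the
      later nodes have to be positive, and these lie in [s, t].\<close>
    proof (rule scheme_eq_sum[OF _ ip])
      fix r assume r: "?i < r" "r \<le> ?p"
      have "real r * ?d \<le> real ?p * ?d" using r by (intro mult_right_mono) auto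
      then have rt: "real r * ?d \<le> t" using grid_index_le[of t n] st by linarith
      have "real (Suc ?i) * ?d \<le> real r * ?d" using r by (intro mult_right_mono) auto
      moreover have "real (Suc ?i) * ?d = real ?i * ?d + ?d"
        by (simp only: of_nat_Suc distrib_right mult_1_left)
      ultimately have sr: "s \<le> real r * ?d" using grid_index_gt[of s n] st by linarith
      have "\<bar>dyadic_path \<psi> n (real r * ?d) - reflected_path \<psi> (real r * ?d)\<bar> \<le> e"
        using n sr rt st by (intro N) auto
      moreover have "2 * e \<le> reflected_path \<psi> (real r * ?d)" using u0(2)[of "real r * ?d"] sr rt by (simp add: e_def)
      moreover have "dyadic_path \<psi> n (real r * ?d) = ?\<zeta> r"
        unfolding dyadic_path_def by (simp only: grid_index_grid)
      ultimately show "0 < ?\<zeta> r" using e by linarith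
    qed auto
    ultimately show ?thesis unfolding dyadic_regulator_def by linarith
  qed
  then have "\<forall>\<^sub>F n in sequentially. dyadic_regulator n (grid_index n s) = dyadic_regulator n (grid_index n t)"
    by (rule eventually_sequentiallyI)
  then have "(\<lambda>n. dyadic_regulator n (grid_index n t)) \<longlonglongrightarrow> regulator s"
    using dyadic_regulator_tendsto[of s] st by (auto elim: Lim_transform_eventually)
  then show "regulator s = regulator t"
    using dyadic_regulator_tendsto[of t] st by (intro LIMSEQ_unique) auto
qed (use continuous_reflected_path reflected_path_nonneg in auto)

end
end

section \<open>Brownian motion from independent Gaussian coordinates\<close>

text \<open>The hat on [0, 1] with peak 1/2, the standard deviation of a Brownian bridge at its
  midpoint.\<close>

definition tri :: "real \<Rightarrow> real" where
  "tri x = max 0 (min x (1 - x))"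

text \<open>Covariance of the Brownian bridge, extended by 0 outside the unit square so that shifted
  copies can be summed without side conditions.\<close>

definition bridge_cov :: "real \<Rightarrow> real \<Rightarrow> real" where
  "bridge_cov x y = (if 0 \<le> x \<and> x \<le> 1 \<and> 0 \<le> y \<and> y \<le> 1 then min x y * (1 - max x y) else 0)"

lemma tri_nonneg: "0 \<le> tri x"
  by (simp add: tri_def)

lemma continuous_on_tri [continuous_intros]: "continuous_on A f \<Longrightarrow> continuous_on A (\<lambda>x. tri (f x))"
  unfolding tri_def by (intro continuous_intros)

lemma tri_shift_le: "tri (x - real j) \<le> (if j = nat \<lfloor>x\<rfloor> then 1 else 0)"
proof (cases "0 < x - real j \<and> x - real j < 1")
  case True
  then have "\<lfloor>x\<rfloor> = int j" by (intro floor_unique) auto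
  then show ?thesis using True by (simp add: tri_def)
qed (auto simp: tri_def)

lemma bridge_cov_nonneg: "0 \<le> bridge_cov x y"
  by (auto simp: bridge_cov_def)

lemma bridge_cov_shift_le: "bridge_cov (x - real j) (y - real j) \<le> (if j = nat \<lfloor>x\<rfloor> then 1 else 0)"
proof (cases "0 < x - real j \<and> x - real j < 1")
  case True
  then have "\<lfloor>x\<rfloor> = int j" by (intro floor_unique) auto
  moreover have "bridge_cov (x - real j) (y - real j) \<le> 1"
    unfolding bridge_cov_def by (auto intro!: mult_le_one simp: min_def max_def)
  ultimately show ?thesis by simp
next
  case False
  then have "bridge_cov (x - real j) (y - real j) = 0"
    by (auto simp: bridge_cov_def min_def max_def not_less)
  then show ?thesis by simp
qed

lemma bridge_cov_commute: "bridge_cov x y = bridge_cov y x"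
  by (auto simp: bridge_cov_def min.commute max.commute)

text \<open>Midpoint decomposition: a bridge is a normal multiple of the hat plus independent
  bridges on the two halves, with variance scaled by 1/2.\<close>

lemma bridge_cov_step:
  "bridge_cov x y = tri x * tri y + (bridge_cov (2 * x) (2 * y) + bridge_cov (2 * x - 1) (2 * y - 1)) / 2"
proof (induction x y rule: linorder_wlog)
  case (sym x y)
  then show ?case by (metis bridge_cov_commute mult.commute)
next
  case (le x y)
  consider "x < 0" | "1 < y" | "0 \<le> x" "y \<le> 1/2" | "0 \<le> x" "x \<le> 1/2" "1/2 < y" "y \<le> 1" | "1/2 < x" "y \<le> 1"
    by linarith
  then show ?case
  proof cases
    case 3
    then show ?thesis using le by (auto simp: bridge_cov_def tri_def min_def max_def field_simps)
  next
    case 4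
    then show ?thesis using le by (auto simp: bridge_cov_def tri_def min_def max_def field_simps)
  next
    case 5
    then show ?thesis using le by (auto simp: bridge_cov_def tri_def min_def max_def field_simps)
  qed (use le in \<open>auto simp: bridge_cov_def tri_def min_def max_def\<close>)
qed

lemma bridge_cov_sum_step:
  "(\<Sum>j<2^N. bridge_cov (2^N * u - real j) (2^N * v - real j))
   = (\<Sum>j<2^N. tri (2^N * u - real j) * tri (2^N * v - real j))
     + (\<Sum>j<2^Suc N. bridge_cov (2^Suc N * u - real j) (2^Suc N * v - real j)) / 2"
proof -
  have "(\<Sum>j<2^Suc N. bridge_cov (2^Suc N * u - real j) (2^Suc N * v - real j))
      = (\<Sum>i<2^N. \<Sum>j=i*2..<i*2+2. bridge_cov (2^Suc N * u - real j) (2^Suc N * v - real j))"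
    by (subst sum.nat_group) (simp add: mult.commute)
  also have "\<dots> = (\<Sum>i<2^N. bridge_cov (2 * (2^N * u - real i)) (2 * (2^N * v - real i))
      + bridge_cov (2 * (2^N * u - real i) - 1) (2 * (2^N * v - real i) - 1))"
  proof (rule sum.cong)
    fix i :: nat
    have "{i*2..<i*2+2} = {i*2, Suc (i*2)}" by auto
    then show "(\<Sum>j=i*2..<i*2+2. bridge_cov (2^Suc N * u - real j) (2^Suc N * v - real j))
      = bridge_cov (2 * (2^N * u - real i)) (2 * (2^N * v - real i))
      + bridge_cov (2 * (2^N * u - real i) - 1) (2 * (2^N * v - real i) - 1)"
      by (simp add: algebra_simps)
  qed simp
  finally show ?thesis
    by (subst bridge_cov_step) (simp add: sum.distrib sum_divide_distrib add_divide_distrib)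
qed

text \<open>By \<open>bridge_cov_sum_step\<close> the level sums telescope to the covariance minus
  2^(-N) E N, and E N stays below 1 because at most one of its terms is nonzero.\<close>

lemma tri_covariance_sums:
  assumes "0 \<le> u" "u \<le> 1" "0 \<le> v" "v \<le> 1"
  shows "(\<lambda>N. \<Sum>n<N. (1/2)^n * (\<Sum>j<2^n. tri (2^n * u - real j) * tri (2^n * v - real j)))
    \<longlonglongrightarrow> min u v * (1 - max u v)"
proof -
  define E where "E N = (\<Sum>j<2^N. bridge_cov (2^N * u - real j) (2^N * v - real j))" for N :: nat
  have eq: "(\<Sum>n<N. (1/2)^n * (\<Sum>j<2^n. tri (2^n * u - real j) * tri (2^n * v - real j)))
      = E 0 - (1/2)^N * E N" for N
  proof (induction N)
    case (Suc N)
    have "(\<Sum>j<2^N. tri (2^N * u - real j) * tri (2^N * v - real j)) = E N - E (Suc N) / 2"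
      using bridge_cov_sum_step[of N u v] by (simp add: E_def)
    then show ?case unfolding sum.lessThan_Suc Suc by (simp add: right_diff_distrib)
  qed simp
  have bound: "\<bar>E N\<bar> \<le> 1" for N
  proof -
    have "0 \<le> E N" unfolding E_def by (intro sum_nonneg bridge_cov_nonneg)
    moreover have "E N \<le> (\<Sum>j<2^N. if j = nat \<lfloor>2^N * u\<rfloor> then 1 else 0)"
      unfolding E_def by (intro sum_mono bridge_cov_shift_le)
    moreover have "\<dots> \<le> (1::real)" by (simp add: sum.delta')
    ultimately show ?thesis by linarith
  qed
  have "(\<lambda>N. (1/2)^N * E N) \<longlonglongrightarrow> 0"
  proof (rule Lim_null_comparison)
    show "\<forall>\<^sub>F N in sequentially. norm ((1/2)^N * E N) \<le> (1/2)^N"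
      using bound by (auto simp: abs_mult intro!: always_eventually mult_left_le)
  qed (rule LIMSEQ_realpow_zero, auto)
  then have "(\<lambda>N. E 0 - (1/2)^N * E N) \<longlonglongrightarrow> E 0 - 0" by (intro tendsto_intros)
  moreover have "E 0 = min u v * (1 - max u v)" using assms by (simp add: E_def bridge_cov_def)
  ultimately show ?thesis by (simp add: eq)
qed

section \<open>Schauder functions and the series for the Brownian bridge\<close>

text \<open>The index m = 2^n + j encodes level n and position j; the function is the integral of
  the corresponding Haar function.\<close>

definition schauder :: "nat \<Rightarrow> real \<Rightarrow> real" where
  "schauder m u = (1 / sqrt 2) ^ floor_log m * tri (2 ^ floor_log m * u - real (m - 2 ^ floor_log m))"

lemma floor_log_block: "j < 2 ^ n \<Longrightarrow> floor_log (2 ^ n + j) = n"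
  by (intro floor_log_eqI) auto

lemma sum_dyadic_block:
  "(\<Sum>m=2^n..<2^Suc n. f m) = (\<Sum>j<2^n. f (2 ^ n + j :: nat))"
  using sum.shift_bounds_nat_ivl[of f 0 "2^n" "2^n"] by (simp add: lessThan_atLeast0 add.commute mult_2)

lemma sum_dyadic_blocks:
  "(\<Sum>n<N. \<Sum>m=2^n..<2^Suc n. f m) = (\<Sum>m=1..<2^N. f (m::nat))"
proof (induction N)
  case (Suc N)
  have "(\<Sum>m=1..<2^N. f m) + (\<Sum>m=2^N..<2^Suc N. f m) = (\<Sum>m=1..<2^Suc N. f m)"
    by (rule sum.atLeastLessThan_concat) auto
  then show ?case using Suc by simp
qed simp

lemma schauder_covariance:
  assumes "0 \<le> u" "u \<le> 1" "0 \<le> v" "v \<le> 1"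
  shows "(\<lambda>N. \<Sum>m=1..<2^N. schauder m u * schauder m v) \<longlonglongrightarrow> min u v * (1 - max u v)"
proof -
  have "(\<Sum>m=1..<2^N. schauder m u * schauder m v)
      = (\<Sum>n<N. (1/2)^n * (\<Sum>j<2^n. tri (2^n * u - real j) * tri (2^n * v - real j)))" for N
  proof -
    have "(\<Sum>m=2^n..<2^Suc n. schauder m u * schauder m v)
        = (1/2)^n * (\<Sum>j<2^n. tri (2^n * u - real j) * tri (2^n * v - real j))" for n
    proof -
      have half: "(1 / sqrt 2) ^ n * (1 / sqrt 2) ^ n = (1/2::real) ^ n"
        by (simp add: power_mult_distrib[symmetric])
      have "schauder (2^n + j) u * schauder (2^n + j) v
          = (1/2)^n * (tri (2^n * u - real j) * tri (2^n * v - real j))" if "j < 2^n" for j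
        using half floor_log_block[OF that] unfolding schauder_def by (simp add: mult_ac)
      then show ?thesis by (simp add: sum_dyadic_block sum_distrib_left del: power_Suc)
    qed
    then show ?thesis unfolding sum_dyadic_blocks[symmetric] by simp
  qed
  then show ?thesis using tri_covariance_sums[OF assms] by simp
qed

definition schauder_level :: "(nat \<Rightarrow> real) \<Rightarrow> nat \<Rightarrow> real \<Rightarrow> real" where
  "schauder_level \<omega> n u = (\<Sum>m=2^n..<2^Suc n. \<omega> m * schauder m u)"

definition bridge :: "(nat \<Rightarrow> real) \<Rightarrow> real \<Rightarrow> real" where
  "bridge \<omega> u = (\<Sum>n. schauder_level \<omega> n u)"

text \<open>A measurable event on which the series converges uniformly. The eighth power yields
  \<bar>\<omega> m\<bar> = O(m^(1/4)), which loses against the factor 2^(-n/2) of level n; the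
  weight m^(-2) gives the sum a finite mean.\<close>

definition tame :: "(nat \<Rightarrow> real) \<Rightarrow> bool" where
  "tame \<omega> \<longleftrightarrow> (\<Sum>m. ennreal (\<omega> (Suc m) ^ 8 / (real (Suc m))\<^sup>2)) < \<infinity>"

lemma continuous_schauder_level: "continuous_on A (schauder_level \<omega> n)"
  unfolding schauder_level_def schauder_def by (intro continuous_intros)

text \<open>At level n the index is below 2^(n+1), so the coefficients are O(2^(n/4)) and the scaled
  hats O(2^(-n/4)), which is \<open>root 4 (1/2) ^ n\<close>. At each u only one hat of the level is
  nonzero, so summing over the level costs nothing.\<close>

lemma tame_bound:
  assumes "tame \<omega>"
  obtains D where "0 \<le> D" "\<And>n u. \<bar>schauder_level \<omega> n u\<bar> \<le> D * root 4 (1/2) ^ n"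
proof -
  have "summable (\<lambda>m. \<omega> (Suc m) ^ 8 / (real (Suc m))\<^sup>2)"
    using assms unfolding tame_def by (intro summable_suminf_not_top) (auto simp: less_top)
  then have "Bseq (\<lambda>m. \<omega> (Suc m) ^ 8 / (real (Suc m))\<^sup>2)"
    by (intro convergent_imp_Bseq) (auto simp: convergent_def dest: summable_LIMSEQ_zero)
  then obtain C where C: "0 < C" "\<And>m. \<omega> (Suc m) ^ 8 / (real (Suc m))\<^sup>2 \<le> C"
    unfolding Bseq_def by (metis abs_le_D1 real_norm_def)
  have bd: "\<omega> m ^ 8 \<le> C * (real m)\<^sup>2" if "1 \<le> m" for m
    using C(2)[of "m - 1"] that by (simp add: divide_le_eq)
  define a where "a = root 4 (1/2)"
  have a: "0 < a" "a ^ 4 = 1/2" by (auto simp: a_def real_root_pow_pos2)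
  have a2: "a\<^sup>2 = 1 / sqrt 2"
  proof -
    have "(a\<^sup>2)\<^sup>2 = (1 / sqrt 2)\<^sup>2" using a by (simp add: power_mult[symmetric] power_divide)
    then show ?thesis by (rule power2_eq_imp_eq) auto
  qed
  define D where "D = max 1 C / a"
  have key: "(1 / sqrt 2) ^ n * \<bar>\<omega> m\<bar> \<le> D * a ^ n" if m: "m \<in> {2^n..<2^Suc n}" for n m
  proof -
    have m1: "1 \<le> m" using m by (auto intro: order_trans[of _ "2^n"])
    have "real m \<le> 2 ^ Suc n" using m by (metis atLeastLessThan_iff less_imp_le of_nat_le_numeral_power_cancel_iff)
    then have "(real m)\<^sup>2 \<le> (2 ^ Suc n)\<^sup>2" by (intro power_mono) auto
    also have "\<dots> = (4::real) ^ Suc n" by (simp add: power_mult[symmetric] mult.commute power2_eq_square power_mult_distrib[symmetric])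
    finally have "\<omega> m ^ 8 \<le> C * 4 ^ Suc n"
      using bd[OF m1] C(1) by (smt (verit) mult_left_mono)
    then have "(a ^ 8) ^ Suc n * \<omega> m ^ 8 \<le> (a ^ 8) ^ Suc n * (C * 4 ^ Suc n)"
      using a by (intro mult_left_mono) auto
    also have "\<dots> = C * (a ^ 8 * 4) ^ Suc n"
      by (simp only: power_mult_distrib mult_ac)
    also have "a ^ 8 * 4 = 1"
    proof -
      have "a ^ 8 = (a ^ 4)\<^sup>2" by simp
      then show ?thesis using a(2) by (simp add: power2_eq_square)
    qed
    finally have le: "(a ^ Suc n * \<bar>\<omega> m\<bar>) ^ 8 \<le> C"
      by (simp add: power_mult_distrib power_mult[symmetric] mult.commute power_even_abs)
    have "a ^ Suc n * \<bar>\<omega> m\<bar> \<le> max 1 C"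
    proof (rule ccontr)
      assume "\<not> ?thesis"
      then have big: "1 < a ^ Suc n * \<bar>\<omega> m\<bar>" "C < a ^ Suc n * \<bar>\<omega> m\<bar>" by auto
      then have "(a ^ Suc n * \<bar>\<omega> m\<bar>) ^ 1 \<le> (a ^ Suc n * \<bar>\<omega> m\<bar>) ^ 8"
        by (intro power_increasing) auto
      then show False using le big by simp
    qed
    then have "a ^ n * \<bar>\<omega> m\<bar> \<le> D" using a by (simp add: D_def field_simps)
    then have "a ^ n * (a ^ n * \<bar>\<omega> m\<bar>) \<le> a ^ n * D" using a by (intro mult_left_mono) auto
    moreover have "(1 / sqrt 2) ^ n = a ^ n * a ^ n"
      unfolding a2[symmetric] by (simp add: power2_eq_square power_mult_distrib)
    ultimately show ?thesis by (simp add: mult_ac)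
  qed
  show ?thesis
  proof
    show "0 \<le> D" using a by (simp add: D_def)
    fix n u
    have "\<bar>schauder_level \<omega> n u\<bar> \<le> (\<Sum>j<2^n. \<bar>\<omega> (2^n + j) * schauder (2^n + j) u\<bar>)"
      unfolding schauder_level_def sum_dyadic_block by (rule sum_abs)
    also have "\<dots> \<le> (\<Sum>j<2^n. if j = nat \<lfloor>2^n * u\<rfloor> then D * a ^ n else 0)"
    proof (rule sum_mono)
      fix j :: nat assume j: "j \<in> {..<2^n}"
      have s: "schauder (2^n + j) u = (1 / sqrt 2) ^ n * tri (2^n * u - real j)"
        using floor_log_block[of j n] j unfolding schauder_def by simp
      have "\<bar>\<omega> (2^n + j) * schauder (2^n + j) u\<bar> = ((1 / sqrt 2) ^ n * \<bar>\<omega> (2^n + j)\<bar>) * tri (2^n * u - real j)"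
        unfolding s by (simp add: abs_mult tri_nonneg power_abs)
      also have "\<dots> \<le> (D * a ^ n) * (if j = nat \<lfloor>2^n * u\<rfloor> then 1 else 0)"
        using j \<open>0 \<le> D\<close> a by (intro mult_mono key tri_shift_le) (auto simp: tri_nonneg)
      finally show "\<bar>\<omega> (2^n + j) * schauder (2^n + j) u\<bar> \<le> (if j = nat \<lfloor>2^n * u\<rfloor> then D * a ^ n else 0)"
        by (simp split: if_splits)
    qed
    also have "\<dots> \<le> D * a ^ n" using \<open>0 \<le> D\<close> a by (simp add: sum.delta')
    finally show "\<bar>schauder_level \<omega> n u\<bar> \<le> D * root 4 (1/2) ^ n" by (simp add: a_def)
  qed
qed

lemma tame_uniform_limit:
  assumes "tame \<omega>"
  shows "uniform_limit UNIV (\<lambda>N u. \<Sum>n<N. schauder_level \<omega> n u) (bridge \<omega>) sequentially"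
proof -
  obtain D where D: "0 \<le> D" "\<And>n u. \<bar>schauder_level \<omega> n u\<bar> \<le> D * root 4 (1/2) ^ n"
    using tame_bound[OF assms] by blast
  have "root 4 (1/2) < root 4 (1::real)" by (intro real_root_less_mono) auto
  then have "summable (\<lambda>n. D * root 4 (1/2) ^ n)"
    by (intro summable_mult summable_geometric) auto
  then show ?thesis
    unfolding bridge_def[abs_def] by (intro Weierstrass_m_test) (use D in auto)
qed

lemma continuous_bridge:
  assumes "tame \<omega>"
  shows "continuous_on UNIV (bridge \<omega>)"
  by (rule uniform_limit_theorem[OF _ tame_uniform_limit[OF assms]])
    (auto intro!: always_eventually continuous_intros continuous_schauder_level)

lemma bridge_tendsto:
  assumes "tame \<omega>"
  shows "(\<lambda>N. \<Sum>m=1..<2^N. \<omega> m * schauder m u) \<longlonglongrightarrow> bridge \<omega> u"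
  using tendsto_uniform_limitI[OF tame_uniform_limit[OF assms], of u]
  unfolding schauder_level_def sum_dyadic_blocks by simp

lemma bridge_0: "bridge \<omega> 0 = 0"
  by (simp add: bridge_def schauder_level_def schauder_def tri_def min_def)

section \<open>The product space carrying the starting point and the Wiener process\<close>

lemma distr_PiM_coordinate:
  fixes M :: "nat \<Rightarrow> real measure"
  assumes "\<And>i. prob_space (M i)" "\<And>i. sets (M i) = sets borel"
  shows "distr (PiM UNIV M) borel (\<lambda>\<omega>. \<omega> i) = M i"
proof -
  have "distr (PiM UNIV M) borel (\<lambda>\<omega>. \<omega> i) = distr (PiM UNIV M) (M i) (\<lambda>\<omega>. \<omega> i)"
    by (rule distr_cong) (use assms in auto)
  also have "\<dots> = M i" by (rule distr_PiM_component) (use assms in auto)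
  finally show ?thesis .
qed

lemma indep_vars_PiM_coordinates:
  fixes M :: "nat \<Rightarrow> real measure"
  assumes "\<And>i. prob_space (M i)" "\<And>i. sets (M i) = sets borel"
  shows "prob_space.indep_vars (PiM UNIV M) (\<lambda>_. borel) (\<lambda>i \<omega>. \<omega> i) UNIV"
proof -
  interpret P: prob_space "PiM UNIV M" by (rule prob_space_PiM) (rule assms)
  have sets: "sets (PiM UNIV M) = sets (PiM UNIV (\<lambda>_. borel))"
    by (rule sets_PiM_cong) (use assms in auto)
  have rv: "(\<lambda>\<omega>. \<omega> i) \<in> borel_measurable (PiM UNIV M)" for i
    using measurable_component_singleton[of i UNIV M] assms(2)
    by (simp cong: measurable_cong_sets)
  have "distr (PiM UNIV M) (PiM UNIV (\<lambda>_. borel)) (\<lambda>x. \<lambda>i\<in>UNIV. x i) = PiM UNIV M"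
    using distr_id2[OF sets[symmetric]] by (simp add: restrict_def)
  also have "\<dots> = PiM UNIV (\<lambda>i. distr (PiM UNIV M) borel (\<lambda>\<omega>. \<omega> i))"
    by (simp add: distr_PiM_coordinate assms)
  finally show ?thesis
    by (subst P.indep_vars_iff_distr_eq_PiM') (use rv in auto)
qed

lemma gaussian0_limit:
  assumes "prob_space M" and X: "X \<in> borel_measurable M"
    and lim: "AE \<omega> in M. (\<lambda>n. Xn n \<omega>) \<longlonglongrightarrow> X \<omega>" and gauss: "\<And>n. gaussian0 M (Xn n) (v n)"
    and v: "v \<longlonglongrightarrow> v0"
  shows "gaussian0 M X v0"
  unfolding gaussian0_def
proof (intro conjI allI X)
  interpret prob_space M by fact
  fix \<theta> :: real
  have Xn[measurable]: "Xn n \<in> borel_measurable M" for n using gauss by (simp add: gaussian0_def)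
  note X[measurable]
  have "(\<lambda>n. CLINT \<omega>|M. iexp (\<theta> * Xn n \<omega>)) \<longlonglongrightarrow> (CLINT \<omega>|M. iexp (\<theta> * X \<omega>))"
  proof (rule integral_dominated_convergence[where w="\<lambda>_. 1"])
    show "AE \<omega> in M. (\<lambda>n. iexp (\<theta> * Xn n \<omega>)) \<longlonglongrightarrow> iexp (\<theta> * X \<omega>)"
      using lim by eventually_elim (intro tendsto_intros)
  qed auto
  then have "(\<lambda>n. char (distr M borel (Xn n)) \<theta>) \<longlonglongrightarrow> char (distr M borel X) \<theta>"
    by (simp add: char_def integral_distr)
  then have "(\<lambda>n. complex_of_real (exp (- (\<theta>\<^sup>2 * v n) / 2))) \<longlonglongrightarrow> char (distr M borel X) \<theta>"
    using gauss by (simp add: gaussian0_def)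
  moreover have "(\<lambda>n. complex_of_real (exp (- (\<theta>\<^sup>2 * v n) / 2))) \<longlonglongrightarrow> complex_of_real (exp (- (\<theta>\<^sup>2 * v0) / 2))"
    by (intro tendsto_intros v) auto
  ultimately show "char (distr M borel X) \<theta> = complex_of_real (exp (- (\<theta>\<^sup>2 * v0) / 2))"
    by (rule LIMSEQ_unique)
qed

definition noise :: "real measure \<Rightarrow> (nat \<Rightarrow> real) measure" where
  "noise \<pi> = PiM UNIV (\<lambda>i. if i = 0 then \<pi> else std_normal_distribution)"

text \<open>(1 + t) times the bridge at t / (1 + t) is a Brownian motion on the whole half line,
  which saves gluing unit intervals. Off \<open>tame\<close> it is set to 0, since continuity is
  demanded of every path.\<close>

definition wiener :: "real \<Rightarrow> (nat \<Rightarrow> real) \<Rightarrow> real" where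
  "wiener t \<omega> = (if tame \<omega> then (1 + t) * bridge \<omega> (t / (1 + t)) else 0)"

lemma wiener_0: "wiener 0 \<omega> = 0"
  by (simp add: wiener_def bridge_0)

lemma continuous_wiener: "continuous_on {0..} (\<lambda>t. wiener t \<omega>)"
proof (cases "tame \<omega>")
  case True
  have "continuous_on {0..} (\<lambda>t::real. t / (1 + t))"
    by (intro continuous_intros) auto
  from continuous_on_compose2[OF continuous_bridge[OF True] this] True show ?thesis
    unfolding wiener_def by (auto intro!: continuous_intros)
qed (simp add: wiener_def)

text \<open>Coordinate 0 is reserved for the starting point; measurability in the remaining
  coordinates is what yields the independence of the two.\<close>

lemma measurable_wiener_positive_coordinates: "wiener t \<in> borel_measurable (PiM {1..} (\<lambda>_. borel))"
proof -
  have [measurable]: "(\<lambda>\<omega>. \<omega> (Suc m)) \<in> borel_measurable (PiM {1..} (\<lambda>_. borel :: real measure))" for m :: nat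
    by (intro measurable_component_singleton) auto
  have [measurable]: "Measurable.pred (PiM {1..} (\<lambda>_. borel :: real measure)) tame"
    unfolding tame_def by measurable
  have "(\<lambda>\<omega>. schauder_level \<omega> n u) \<in> borel_measurable (PiM {1..} (\<lambda>_. borel :: real measure))" for n u
    unfolding schauder_level_def
  proof (rule borel_measurable_sum)
    fix m assume "m \<in> {2^n..<2^Suc n :: nat}"
    then have "1 \<le> m" by (auto intro: order_trans[of _ "2^n"])
    then have "(\<lambda>\<omega>. \<omega> m) \<in> borel_measurable (PiM {1..} (\<lambda>_. borel :: real measure))"
      by (intro measurable_component_singleton) auto
    then show "(\<lambda>\<omega>. \<omega> m * schauder m u) \<in> borel_measurable (PiM {1..} (\<lambda>_. borel :: real measure))"
      by (rule borel_measurable_times) simp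
  qed
  then have [measurable]: "(\<lambda>\<omega>. bridge \<omega> u) \<in> borel_measurable (PiM {1..} (\<lambda>_. borel :: real measure))" for u
    unfolding bridge_def by (intro borel_measurable_suminf)
  show ?thesis unfolding wiener_def by measurable
qed

lemma wiener_restrict: "wiener t (restrict \<omega> {1..}) = wiener t \<omega>"
proof -
  have "tame (restrict \<omega> {1..}) = tame \<omega>" by (simp add: tame_def)
  moreover have "schauder_level (restrict \<omega> {1..}) n u = schauder_level \<omega> n u" for n u
    unfolding schauder_level_def
    by (intro sum.cong) (auto intro: order_trans[of _ "2^n"])
  ultimately show ?thesis by (simp add: wiener_def bridge_def)
qed

context
  fixes \<pi> :: "real measure"
  assumes \<pi>: "prob_space \<pi>" "sets \<pi> = sets borel"
begin

lemma noise_component: "prob_space (if i = 0 then \<pi> else std_normal_distribution)"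
    "sets (if i = 0 then \<pi> else std_normal_distribution) = sets borel" for i :: nat
  using \<pi> real_dist_normal_dist by (auto simp: real_distribution_def)

lemma prob_space_noise: "prob_space (noise \<pi>)"
  unfolding noise_def by (intro prob_space_PiM noise_component)


lemma sets_noise: "sets (noise \<pi>) = sets (PiM UNIV (\<lambda>_. borel))"
  unfolding noise_def by (rule sets_PiM_cong) (use noise_component in auto)

lemma measurable_noise_coordinate [measurable]: "(\<lambda>\<omega>. \<omega> i) \<in> borel_measurable (noise \<pi>)"
  unfolding measurable_cong_sets[OF sets_noise refl] by measurable

lemma distr_noise_coordinate: "distr (noise \<pi>) borel (\<lambda>\<omega>. \<omega> i) = (if i = 0 then \<pi> else std_normal_distribution)"
  unfolding noise_def by (rule distr_PiM_coordinate) (use noise_component in auto)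

lemma indep_noise: "prob_space.indep_vars (noise \<pi>) (\<lambda>_. borel) (\<lambda>i \<omega>. \<omega> i) UNIV"
  unfolding noise_def by (rule indep_vars_PiM_coordinates) (use noise_component in auto)

lemma measurable_wiener [measurable]: "wiener t \<in> borel_measurable (noise \<pi>)"
proof -
  have "(\<lambda>\<omega>. restrict \<omega> {1..}) \<in> measurable (noise \<pi>) (PiM {1..} (\<lambda>_. borel))"
    unfolding measurable_cong_sets[OF sets_noise refl] by (rule measurable_restrict_subset) auto
  from measurable_compose[OF this measurable_wiener_positive_coordinates[of t]]
  show ?thesis by (simp only: wiener_restrict)
qed

lemma noise_linear_gaussian:
  "gaussian0 (noise \<pi>) (\<lambda>\<omega>. \<Sum>m=1..<N. a m * \<omega> m) (\<Sum>m=1..<N. (a m)\<^sup>2)"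
  unfolding gaussian0_def
proof (intro conjI allI)
  interpret prob_space "noise \<pi>" by (rule prob_space_noise)
  show "(\<lambda>\<omega>. \<Sum>m=1..<N. a m * \<omega> m) \<in> borel_measurable (noise \<pi>)" by measurable
  fix \<theta> :: real
  have "indep_vars (\<lambda>_. borel) (\<lambda>i \<omega>. \<omega> i) {1..<N}"
    using indep_noise by (rule indep_vars_subset) auto
  then have "indep_vars (\<lambda>_. borel) (\<lambda>m \<omega>. a m * \<omega> m) {1..<N}"
    by (rule indep_vars_compose2[where Y="\<lambda>m x. a m * x"]) auto
  then have "char (distr (noise \<pi>) borel (\<lambda>\<omega>. \<Sum>m=1..<N. a m * \<omega> m)) \<theta>
      = (\<Prod>m=1..<N. char (distr (noise \<pi>) borel (\<lambda>\<omega>. a m * \<omega> m)) \<theta>)"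
    by (rule char_distr_sum)
  also have "\<dots> = (\<Prod>m=1..<N. complex_of_real (exp (- (\<theta> * a m)\<^sup>2 / 2)))"
  proof (rule prod.cong)
    fix m assume m: "m \<in> {1..<N}"
    have "char (distr (noise \<pi>) borel (\<lambda>\<omega>. a m * \<omega> m)) \<theta> = char (distr (noise \<pi>) borel (\<lambda>\<omega>. \<omega> m)) (\<theta> * a m)"
      by (simp add: char_def integral_distr mult.assoc)
    then show "char (distr (noise \<pi>) borel (\<lambda>\<omega>. a m * \<omega> m)) \<theta> = complex_of_real (exp (- (\<theta> * a m)\<^sup>2 / 2))"
      using m by (simp add: distr_noise_coordinate char_std_normal_distribution)
  qed simp
  also have "\<dots> = complex_of_real (exp (- (\<theta>\<^sup>2 * (\<Sum>m=1..<N. (a m)\<^sup>2)) / 2))"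
    by (simp only: of_real_prod[symmetric] exp_sum[symmetric] finite_atLeastLessThan)
      (simp add: sum_distrib_left sum_divide_distrib power_mult_distrib sum_negf)
  finally show "char (distr (noise \<pi>) borel (\<lambda>\<omega>. \<Sum>m=1..<N. a m * \<omega> m)) \<theta>
    = complex_of_real (exp (- (\<theta>\<^sup>2 * (\<Sum>m=1..<N. (a m)\<^sup>2)) / 2))" .
qed

text \<open>All these coordinates have the same finite eighth moment, so the series that defines
  \<open>tame\<close> has finite mean.\<close>

lemma AE_tame: "AE \<omega> in noise \<pi>. tame \<omega>"
proof -
  define C where "C = (LINT x|std_normal_distribution. x ^ (2 * 4))"
  have C: "(\<integral>\<^sup>+ x. ennreal (x ^ 8) \<partial>std_normal_distribution) = ennreal C"
    using std_normal_distribution_even_moments(2)[of 4] unfolding C_def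
    by (subst nn_integral_eq_integral) auto
  have C0: "0 \<le> C" unfolding C_def by (intro integral_nonneg_AE) auto
  have summ: "summable (\<lambda>m. C / (real (Suc m))\<^sup>2)"
    using summable_mult[OF inverse_squares_sums[THEN sums_summable], of C] by (simp add: add.commute)
  have "(\<integral>\<^sup>+ \<omega>. (\<Sum>m. ennreal (\<omega> (Suc m) ^ 8 / (real (Suc m))\<^sup>2)) \<partial>noise \<pi>)
      = (\<Sum>m. \<integral>\<^sup>+ \<omega>. ennreal (\<omega> (Suc m) ^ 8 / (real (Suc m))\<^sup>2) \<partial>noise \<pi>)"
    by (rule nn_integral_suminf) measurable
  also have "\<dots> = (\<Sum>m. ennreal (C / (real (Suc m))\<^sup>2))"
  proof (rule suminf_cong)
    fix m
    have "(\<integral>\<^sup>+ \<omega>. ennreal (\<omega> (Suc m) ^ 8 / (real (Suc m))\<^sup>2) \<partial>noise \<pi>)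
        = (\<integral>\<^sup>+ x. ennreal (x ^ 8 / (real (Suc m))\<^sup>2) \<partial>distr (noise \<pi>) borel (\<lambda>\<omega>. \<omega> (Suc m)))"
      by (subst nn_integral_distr) auto
    also have "\<dots> = (\<integral>\<^sup>+ x. ennreal (1 / (real (Suc m))\<^sup>2) * ennreal (x ^ 8) \<partial>std_normal_distribution)"
      by (simp add: distr_noise_coordinate ennreal_mult'[symmetric] del: of_nat_Suc)
    also have "\<dots> = ennreal (1 / (real (Suc m))\<^sup>2) * ennreal C"
      by (subst nn_integral_cmult) (auto simp: C)
    also have "\<dots> = ennreal (C / (real (Suc m))\<^sup>2)"
      using C0 by (simp add: ennreal_mult'[symmetric] del: of_nat_Suc)
    finally show "(\<integral>\<^sup>+ \<omega>. ennreal (\<omega> (Suc m) ^ 8 / (real (Suc m))\<^sup>2) \<partial>noise \<pi>) = ennreal (C / (real (Suc m))\<^sup>2)" .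
  qed
  also have "\<dots> \<noteq> \<infinity>"
  proof -
    have "(\<Sum>m. ennreal (C / (real (Suc m))\<^sup>2)) = ennreal (\<Sum>m. C / (real (Suc m))\<^sup>2)"
      by (rule suminf_ennreal_eq[OF _ summable_sums[OF summ]]) (use C0 in simp)
    then show ?thesis by (simp only: infinity_ennreal_def ennreal_neq_top not_False_eq_True)
  qed
  finally have "AE \<omega> in noise \<pi>. (\<Sum>m. ennreal (\<omega> (Suc m) ^ 8 / (real (Suc m))\<^sup>2)) \<noteq> \<infinity>"
    by (intro nn_integral_PInf_AE) measurable
  then show ?thesis by (simp add: tame_def less_top)
qed

text \<open>A linear combination of values is almost surely a limit of linear combinations of
  finitely many coordinates, hence centred Gaussian by \<open>gaussian0_limit\<close>; the variances
  converge by \<open>schauder_covariance\<close>.\<close>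

lemma std_brownian_motion_wiener: "std_brownian_motion (noise \<pi>) wiener"
  unfolding std_brownian_motion_def
proof (intro conjI allI ballI impI prob_space_noise measurable_wiener wiener_0 continuous_wiener)
  fix ts cs :: "real list" assume len: "length cs = length ts \<and> (\<forall>t\<in>set ts. 0 \<le> t)"
  let ?n = "length ts"
  define u where "u i = ts ! i / (1 + ts ! i)" for i
  define a where "a m = (\<Sum>i<?n. cs ! i * (1 + ts ! i) * schauder m (u i))" for m
  have t0: "0 \<le> ts ! i" if "i < ?n" for i using len that by auto
  have u: "0 \<le> u i" "u i \<le> 1" if "i < ?n" for i using t0[OF that] by (auto simp: u_def field_simps)
  show "gaussian0 (noise \<pi>) (\<lambda>\<omega>. \<Sum>i<?n. cs ! i * wiener (ts ! i) \<omega>)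
      (\<Sum>i<?n. \<Sum>j<?n. cs ! i * cs ! j * min (ts ! i) (ts ! j))"
  proof (rule gaussian0_limit[OF prob_space_noise])
    show "gaussian0 (noise \<pi>) (\<lambda>\<omega>. \<Sum>m=1..<2^N. a m * \<omega> m) (\<Sum>m=1..<2^N. (a m)\<^sup>2)" for N
      by (rule noise_linear_gaussian)
    show "AE \<omega> in noise \<pi>. (\<lambda>N. \<Sum>m=1..<2^N. a m * \<omega> m) \<longlonglongrightarrow> (\<Sum>i<?n. cs ! i * wiener (ts ! i) \<omega>)"
      using AE_tame
    proof eventually_elim
      case (elim \<omega>)
      have "(\<Sum>m=1..<2^N. a m * \<omega> m) = (\<Sum>i<?n. cs ! i * ((1 + ts ! i) * (\<Sum>m=1..<2^N. \<omega> m * schauder m (u i))))" for N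
        unfolding a_def sum_distrib_left sum_distrib_right
        by (subst sum.swap) (simp add: mult_ac)
      moreover have "(\<lambda>N. \<Sum>i<?n. cs ! i * ((1 + ts ! i) * (\<Sum>m=1..<2^N. \<omega> m * schauder m (u i))))
          \<longlonglongrightarrow> (\<Sum>i<?n. cs ! i * ((1 + ts ! i) * bridge \<omega> (u i)))"
        by (intro tendsto_intros bridge_tendsto elim)
      ultimately show ?case using elim by (simp add: wiener_def u_def)
    qed
    have "(\<Sum>m=1..<2^N. (a m)\<^sup>2) = (\<Sum>i<?n. \<Sum>j<?n. cs ! i * (1 + ts ! i) * (cs ! j * (1 + ts ! j)) *
        (\<Sum>m=1..<2^N. schauder m (u i) * schauder m (u j)))" for N
    proof -
      have "(\<Sum>m=1..<2^N. (a m)\<^sup>2) = (\<Sum>m=1..<2^N. \<Sum>i<?n. \<Sum>j<?n. cs ! i * (1 + ts ! i) * (cs ! j * (1 + ts ! j)) *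
        (schauder m (u i) * schauder m (u j)))"
        unfolding a_def power2_eq_square sum_product by (simp add: mult_ac)
      also have "\<dots> = (\<Sum>i<?n. \<Sum>m=1..<2^N. \<Sum>j<?n. cs ! i * (1 + ts ! i) * (cs ! j * (1 + ts ! j)) *
        (schauder m (u i) * schauder m (u j)))"
        by (rule sum.swap)
      also have "\<dots> = (\<Sum>i<?n. \<Sum>j<?n. \<Sum>m=1..<2^N. cs ! i * (1 + ts ! i) * (cs ! j * (1 + ts ! j)) *
        (schauder m (u i) * schauder m (u j)))"
        by (intro sum.cong refl sum.swap)
      finally show ?thesis by (simp add: sum_distrib_left)
    qed
    moreover have "(\<lambda>N. \<Sum>i<?n. \<Sum>j<?n. cs ! i * (1 + ts ! i) * (cs ! j * (1 + ts ! j)) *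
        (\<Sum>m=1..<2^N. schauder m (u i) * schauder m (u j)))
      \<longlonglongrightarrow> (\<Sum>i<?n. \<Sum>j<?n. cs ! i * (1 + ts ! i) * (cs ! j * (1 + ts ! j)) *
        (min (u i) (u j) * (1 - max (u i) (u j))))"
      by (intro tendsto_sum tendsto_mult tendsto_const schauder_covariance u) auto
    moreover have "cs ! i * (1 + ts ! i) * (cs ! j * (1 + ts ! j)) * (min (u i) (u j) * (1 - max (u i) (u j)))
       = cs ! i * cs ! j * min (ts ! i) (ts ! j)" if "i < ?n" "j < ?n" for i j
    proof -
      \<comment> \<open>The time change t / (1 + t) with the factor 1 + t turns the covariance of
        the bridge into that of Brownian motion.\<close>
      have main: "(1 + s) * (1 + t) * (min (s / (1 + s)) (t / (1 + t)) * (1 - max (s / (1 + s)) (t / (1 + t)))) = min s t"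
        if "0 \<le> s" "0 \<le> t" for s t :: real
      proof (cases "s \<le> t")
        case True
        then have "s / (1 + s) \<le> t / (1 + t)" using that by (simp add: field_simps)
        then have "min (s / (1 + s)) (t / (1 + t)) = s / (1 + s)" "max (s / (1 + s)) (t / (1 + t)) = t / (1 + t)"
          by simp_all
        moreover have "1 - t / (1 + t) = 1 / (1 + t)" using that by (simp add: field_simps)
        ultimately show ?thesis using True that by simp
      next
        case False
        then have "t / (1 + t) \<le> s / (1 + s)" using that by (simp add: field_simps)
        then have "min (s / (1 + s)) (t / (1 + t)) = t / (1 + t)" "max (s / (1 + s)) (t / (1 + t)) = s / (1 + s)"
          by simp_all
        moreover have "1 - s / (1 + s) = 1 / (1 + s)" using that by (simp add: field_simps)
        ultimately show ?thesis using False that by simp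
      qed
      have "cs ! i * (1 + ts ! i) * (cs ! j * (1 + ts ! j)) * (min (u i) (u j) * (1 - max (u i) (u j)))
        = cs ! i * cs ! j * ((1 + ts ! i) * (1 + ts ! j) * (min (u i) (u j) * (1 - max (u i) (u j))))"
        by (simp only: mult_ac)
      then show ?thesis unfolding u_def main[OF t0[OF that(1)] t0[OF that(2)]] .
    qed
    ultimately show "(\<lambda>N. \<Sum>m=1..<2^N. (a m)\<^sup>2) \<longlonglongrightarrow> (\<Sum>i<?n. \<Sum>j<?n. cs ! i * cs ! j * min (ts ! i) (ts ! j))"
      by simp
  qed measurable
qed

text \<open>The two families live in the \<sigma>-algebras of the disjoint coordinate blocks {0} and
  {1..}.\<close>

lemma indep_noise_wiener:
  fixes f :: "real \<Rightarrow> real"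
  assumes f: "f \<in> borel_measurable borel"
  shows "prob_space.indep_set (noise \<pi>)
    {(\<lambda>\<omega>. f (\<omega> 0)) -` S \<inter> space (noise \<pi>) | S. S \<in> sets borel}
    (sigma_sets (space (noise \<pi>)) {wiener t -` S \<inter> space (noise \<pi>) | t S. 0 \<le> t \<and> S \<in> sets borel})"
proof -
  interpret prob_space "noise \<pi>" by (rule prob_space_noise)
  let ?A = "sigma_sets (space (noise \<pi>)) {(\<lambda>\<omega>. restrict \<omega> {0}) -` S \<inter> space (noise \<pi>) | S. S \<in> sets (PiM {0} (\<lambda>_. borel))}"
  let ?B = "sigma_sets (space (noise \<pi>)) {(\<lambda>\<omega>. restrict \<omega> {1..}) -` S \<inter> space (noise \<pi>) | S. S \<in> sets (PiM {1..} (\<lambda>_. borel))}"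
  have "indep_var (PiM {0} (\<lambda>_. borel)) (\<lambda>\<omega>. restrict (\<lambda>i. \<omega> i) {0}) (PiM {1..} (\<lambda>_. borel)) (\<lambda>\<omega>. restrict (\<lambda>i. \<omega> i) {1..})"
    using indep_noise by (rule indep_var_restrict) auto
  then have AB: "indep_set ?A ?B" unfolding indep_var_eq by simp
  have A: "{(\<lambda>\<omega>. f (\<omega> 0)) -` S \<inter> space (noise \<pi>) | S. S \<in> sets borel} \<subseteq> ?A"
  proof safe
    fix S :: "real set" assume S: "S \<in> sets borel"
    have "(\<lambda>\<omega>. f (\<omega> 0)) -` S \<inter> space (PiM {0} (\<lambda>_. borel)) \<in> sets (PiM {0::nat} (\<lambda>_. borel :: real measure))"
    proof (rule measurable_sets[OF _ S])
      have "(\<lambda>\<omega>. \<omega> 0) \<in> borel_measurable (PiM {0::nat} (\<lambda>_. borel :: real measure))"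
        by (rule measurable_component_singleton) simp
      from measurable_compose[OF this f]
      show "(\<lambda>\<omega>. f (\<omega> 0)) \<in> borel_measurable (PiM {0::nat} (\<lambda>_. borel))" .
    qed
    moreover have "(\<lambda>\<omega>. f (\<omega> 0)) -` S \<inter> space (noise \<pi>) =
        (\<lambda>\<omega>. restrict \<omega> {0}) -` ((\<lambda>\<omega>. f (\<omega> 0)) -` S \<inter> space (PiM {0} (\<lambda>_. borel))) \<inter> space (noise \<pi>)"
      by (auto simp: space_PiM)
    ultimately show "(\<lambda>\<omega>. f (\<omega> 0)) -` S \<inter> space (noise \<pi>) \<in> ?A" by blast
  qed
  have B: "sigma_sets (space (noise \<pi>)) {wiener t -` S \<inter> space (noise \<pi>) | t S. 0 \<le> t \<and> S \<in> sets borel} \<subseteq> ?B"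
  proof (rule sigma_sets_mono, safe)
    fix t :: real and S :: "real set" assume S: "S \<in> sets borel"
    have "wiener t -` S \<inter> space (PiM {1..} (\<lambda>_. borel)) \<in> sets (PiM {1..} (\<lambda>_. borel))"
      by (rule measurable_sets[OF measurable_wiener_positive_coordinates S])
    moreover have "wiener t -` S \<inter> space (noise \<pi>) =
        (\<lambda>\<omega>. restrict \<omega> {1..}) -` (wiener t -` S \<inter> space (PiM {1..} (\<lambda>_. borel))) \<inter> space (noise \<pi>)"
      by (auto simp: space_PiM wiener_restrict[unfolded One_nat_def])
    ultimately show "wiener t -` S \<inter> space (noise \<pi>) \<in> ?B" by blast
  qed
  show ?thesis
    using AB A B unfolding indep_set_def by (elim indep_sets_mono_sets) (auto split: bool.split)
qed

end

declare measurable_noise_coordinate [measurable del] measurable_wiener [measurable del]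

section \<open>Existence of the stationary reflected diffusion\<close>

definition weight :: "real \<Rightarrow> nat \<Rightarrow> real \<Rightarrow> real" where
  "weight a k y = indicator {0..} y * exp (a * y - y ^ (k+1) / real (k+1))"

lemma borel_measurable_weight [measurable]: "weight a k \<in> borel_measurable borel"
  unfolding weight_def by measurable

lemma weight_nonneg: "0 \<le> weight a k y"
  by (simp add: weight_def)

text \<open>From y^(k+1) \<ge> y^2 - 1 the exponent is at most a quadratic, and completing the
  square bounds the weight by a multiple of a normal density; \<open>\<sigma>\<close> and
  \<open>m\<close> are read off from this square.\<close>

lemma integrable_weight:
  assumes k: "1 \<le> k"
  shows "integrable lborel (weight a k)"
proof -
  define \<sigma> where "\<sigma> = sqrt (real (k+1) / 2)"
  define m where "m = a * \<sigma>\<^sup>2"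
  define C where "C = exp (1 / real (k+1) + m\<^sup>2 / (2 * \<sigma>\<^sup>2)) * sqrt (2 * pi * \<sigma>\<^sup>2)"
  have \<sigma>: "0 < \<sigma>" "2 * \<sigma>\<^sup>2 = real (k+1)" by (auto simp: \<sigma>_def)
  have "weight a k y \<le> C * normal_density m \<sigma> y" for y
  proof (cases "0 \<le> y")
    case True
    have "y\<^sup>2 - 1 \<le> y ^ (k+1)"
    proof (cases "1 \<le> y")
      case True
      then have "y\<^sup>2 \<le> y ^ (k+1)" using k by (intro power_increasing) auto
      then show ?thesis by simp
    next
      case False
      then have "y\<^sup>2 \<le> 1" using \<open>0 \<le> y\<close> by (simp add: power_le_one)
      moreover have "0 \<le> y ^ (k+1)" using \<open>0 \<le> y\<close> by simp
      ultimately show ?thesis by linarith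
    qed
    then have "(y\<^sup>2 - 1) / real (k+1) \<le> y ^ (k+1) / real (k+1)"
      by (intro divide_right_mono) auto
    then have "a * y - y ^ (k+1) / real (k+1) \<le> a * y - y\<^sup>2 / real (k+1) + 1 / real (k+1)"
      by (simp add: diff_divide_distrib)
    also have "\<dots> = 1 / real (k+1) + m\<^sup>2 / (2 * \<sigma>\<^sup>2) - (y - m)\<^sup>2 / (2 * \<sigma>\<^sup>2)"
    proof -
      have "(m\<^sup>2 - (y - m)\<^sup>2) / (2 * \<sigma>\<^sup>2) = (2 * y * m - y\<^sup>2) / (2 * \<sigma>\<^sup>2)"
        by (simp add: power2_eq_square algebra_simps)
      also have "\<dots> = a * y - y\<^sup>2 / (2 * \<sigma>\<^sup>2)"
        using \<sigma>(1) by (simp add: m_def diff_divide_distrib)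
      finally show ?thesis unfolding \<sigma>(2)[symmetric] by (simp add: diff_divide_distrib)
    qed
    finally have "exp (a * y - y ^ (k+1) / real (k+1))
        \<le> exp (1 / real (k+1) + m\<^sup>2 / (2 * \<sigma>\<^sup>2)) * exp (- (y - m)\<^sup>2 / (2 * \<sigma>\<^sup>2))"
      by (simp add: exp_add[symmetric])
    also have "\<dots> = C * normal_density m \<sigma> y"
      using \<sigma>(1) by (simp add: C_def normal_density_def)
    finally show ?thesis using True by (simp add: weight_def)
  next
    case False
    then show ?thesis by (simp add: weight_def C_def)
  qed
  then have le: "norm (weight a k y) \<le> norm (C * normal_density m \<sigma> y)" for y
    using weight_nonneg[of a k y] by (smt (verit) real_norm_def)
  have "integrable lborel (\<lambda>y. C * normal_density m \<sigma> y)"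
    using \<sigma>(1) by (intro integrable_mult_right integrable_normal_density)
  then show ?thesis
    by (rule Bochner_Integration.integrable_bound) (use le in simp_all)
qed

definition mass :: "real \<Rightarrow> nat \<Rightarrow> real" where
  "mass a k = (LINT y|lborel. weight a k y)"

lemma mass_pos:
  assumes k: "1 \<le> k"
  shows "0 < mass a k"
proof -
  have "0 \<le> mass a k" unfolding mass_def by (intro integral_nonneg_AE) (auto simp: weight_nonneg)
  moreover have "mass a k \<noteq> 0"
  proof
    assume "mass a k = 0"
    then have "AE y in lborel. weight a k y = 0"
      unfolding mass_def using integral_nonneg_eq_0_iff_AE[OF integrable_weight[OF k]]
      by (auto simp: weight_nonneg)
    then have "AE y in lborel. y \<notin> {0..1::real}"
      by eventually_elim (auto simp: weight_def indicator_def)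
    then have "emeasure lborel {0..1::real} = 0"
      by (subst (asm) AE_iff_measurable[of "{0..1}"]) auto
    then show False by simp
  qed
  ultimately show ?thesis by simp
qed

lemma stat_density_eq: "stat_density a k x = weight a k x / mass a k"
  by (simp add: stat_density_def mass_def weight_def set_lebesgue_integral_def indicator_def)

definition stat_law :: "real \<Rightarrow> nat \<Rightarrow> real measure" where
  "stat_law a k = density lborel (\<lambda>x. ennreal (stat_density a k x))"

lemma borel_measurable_stat_density [measurable]: "stat_density a k \<in> borel_measurable borel"
  unfolding stat_density_eq[abs_def] by measurable

lemma stat_density_nonneg: "1 \<le> k \<Longrightarrow> 0 \<le> stat_density a k x"
  using mass_pos[of k a] by (simp add: stat_density_eq weight_nonneg)

lemma sets_stat_law [simp]: "sets (stat_law a k) = sets borel"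
  by (simp add: stat_law_def)

lemma prob_space_stat_law:
  assumes k: "1 \<le> k"
  shows "prob_space (stat_law a k)"
proof (rule prob_spaceI)
  have "emeasure (stat_law a k) (space (stat_law a k)) = (\<integral>\<^sup>+ x. ennreal (stat_density a k x) \<partial>lborel)"
    by (simp add: stat_law_def emeasure_density)
  also have "\<dots> = ennreal (LINT x|lborel. stat_density a k x)"
    using integrable_weight[OF k] stat_density_nonneg[OF k]
    by (intro nn_integral_eq_integral) (auto simp: stat_density_eq)
  also have "(LINT x|lborel. stat_density a k x) = 1"
    using mass_pos[OF k, of a] by (simp add: stat_density_eq mass_def[symmetric])
  finally show "emeasure (stat_law a k) (space (stat_law a k)) = 1" by simp
qed

lemma borel_measurable_cosh [measurable]: "(cosh :: real \<Rightarrow> real) \<in> borel_measurable borel"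
  by (intro borel_measurable_continuous_onI continuous_on_cosh continuous_on_id)

text \<open>An exponential factor only shifts the linear coefficient by 1 up or down, so the product
  with the density is again a combination of weights.\<close>

lemma integrable_cosh_stat_law:
  assumes k: "1 \<le> k"
  shows "integrable (stat_law a k) cosh"
proof -
  have "stat_density a k x *\<^sub>R cosh x = (weight (a + 1) k x + weight (a - 1) k x) / (2 * mass a k)" for x
    by (simp add: stat_density_eq weight_def cosh_def field_simps exp_add[symmetric] exp_diff[symmetric] indicator_def)
  moreover have "integrable lborel (\<lambda>x. (weight (a + 1) k x + weight (a - 1) k x) / (2 * mass a k))"
    using integrable_weight[OF k] by simp
  ultimately have "integrable lborel (\<lambda>x. stat_density a k x *\<^sub>R cosh x)" by simp
  then show ?thesis
    unfolding stat_law_def using stat_density_nonneg[OF k] by (subst integrable_density) auto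
qed

lemma AE_stat_law_nonneg: "AE x in stat_law a k. 0 \<le> x"
  unfolding stat_law_def by (subst AE_density) (auto simp: stat_density_def)

lemma continuous_on_atLeastI:
  fixes f :: "real \<Rightarrow> real"
  assumes "\<And>T. continuous_on {0..T} f"
  shows "continuous_on {0..} f"
  unfolding continuous_on_eq_continuous_within
proof
  fix t :: real assume t: "t \<in> {0..}"
  then have "continuous (at t within {0..t+1}) f"
    using assms[of "t + 1"] unfolding continuous_on_eq_continuous_within by auto
  moreover have "at t within {0..t+1} = at t within {0..}"
    by (rule at_within_nhd[of t "{..<t+1}"]) auto
  ultimately show "continuous (at t within {0..}) f" by simp
qed

context power_drift
begin

lemma measurable_scheme:
  assumes d: "0 \<le> d" and x: "x \<in> borel_measurable M"
    and "\<And>i. i < n \<Longrightarrow> (\<lambda>\<omega>. \<xi> \<omega> i) \<in> borel_measurable M"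
  shows "(\<lambda>\<omega>. scheme d (x \<omega>) (\<xi> \<omega>) n) \<in> borel_measurable M"
  using assms(3)
proof (induction n)
  case (Suc n)
  have "(\<lambda>\<omega>. scheme d (x \<omega>) (\<xi> \<omega>) n + \<xi> \<omega> n) \<in> borel_measurable M"
    by (intro borel_measurable_add Suc) auto
  from measurable_compose[OF this borel_measurable_euler_step[OF d]]
  show ?case by (simp add: scheme.simps(2))
qed (use x in simp)

text \<open>The pathwise construction is applied to every outcome; Z and L are measurable as
  pointwise limits of the dyadic scheme, which is a measurable function of finitely many values of
  the driver.\<close>

theorem refl_diffusion_setup_exists:
  "\<exists>(M :: (nat \<Rightarrow> real) measure) B Z L. refl_diffusion_setup M c k B Z L"
proof -
  define \<pi> where "\<pi> = stat_law c k"
  have \<pi>: "prob_space \<pi>" "sets \<pi> = sets borel"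
    using prob_space_stat_law[OF k_pos] by (simp_all add: \<pi>_def)
  define M where "M = noise \<pi>"
  \<comment> \<open>The cutoff makes every starting point nonnegative, as the pathwise conditions
    require of all outcomes. It leaves the law unchanged, which is concentrated on nonnegative
    values.\<close>
  define \<psi> where "\<psi> \<omega> t = max 0 (\<omega> 0) + sqrt 2 * wiener t \<omega>" for \<omega> :: "nat \<Rightarrow> real" and t
  define Z where "Z t \<omega> = reflected_path (\<psi> \<omega>) t" for t \<omega>
  define L where "L t \<omega> = regulator (\<psi> \<omega>) t" for t \<omega>
  have \<psi>0: "\<psi> \<omega> 0 = max 0 (\<omega> 0)" for \<omega> by (simp add: \<psi>_def wiener_0)
  have \<psi>: "continuous_on {0..} (\<psi> \<omega>)" "0 \<le> \<psi> \<omega> 0" for \<omega>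
    unfolding \<psi>0 unfolding \<psi>_def by (auto intro!: continuous_intros continuous_wiener)
  have sol: "reflected_solution (\<psi> \<omega>) (\<lambda>t. Z t \<omega>) (\<lambda>t. L t \<omega>)" for \<omega>
    using reflected_solution_exists[OF \<psi>[of \<omega>]] by (simp add: Z_def[abs_def] L_def[abs_def])
  have Z0: "Z 0 \<omega> = max 0 (\<omega> 0)" for \<omega>
    using sol[of \<omega>] \<psi>0[of \<omega>] unfolding reflected_solution_def
    by (smt (verit) integral_singleton atLeastAtMost_singleton)
  have [measurable]: "wiener t \<in> borel_measurable M" "(\<lambda>\<omega>. \<omega> i) \<in> borel_measurable M" for t i
    unfolding M_def by (rule measurable_wiener[OF \<pi>], rule measurable_noise_coordinate[OF \<pi>])
  have [measurable]: "(\<lambda>\<omega>. \<psi> \<omega> t) \<in> borel_measurable M" for t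
    unfolding \<psi>_def by measurable
  have [measurable]: "(\<lambda>\<omega>. scheme (1 / 2 ^ n) (\<psi> \<omega> 0) (increments (\<psi> \<omega>) (1 / 2 ^ n)) i) \<in> borel_measurable M" for n i
    by (rule measurable_scheme) (auto simp: increments_def)
  have mZ: "Z t \<in> borel_measurable M" if "0 \<le> t" for t
    unfolding Z_def
  proof (rule borel_measurable_LIMSEQ_real[where u="\<lambda>n \<omega>. dyadic_path (\<psi> \<omega>) n t"])
    show "(\<lambda>n. dyadic_path (\<psi> \<omega>) n t) \<longlonglongrightarrow> reflected_path (\<psi> \<omega>) t" for \<omega>
      by (rule dyadic_path_tendsto[OF \<psi> that])
  qed (simp add: dyadic_path_def)
  have mL: "L t \<in> borel_measurable M" if "0 \<le> t" for t
    unfolding L_def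
  proof (rule borel_measurable_LIMSEQ_real[where u="\<lambda>n \<omega>. dyadic_regulator (\<psi> \<omega>) n (grid_index n t)"])
    show "(\<lambda>n. dyadic_regulator (\<psi> \<omega>) n (grid_index n t)) \<longlonglongrightarrow> regulator (\<psi> \<omega>) t" for \<omega>
      by (rule dyadic_regulator_tendsto[OF \<psi> that])
    show "(\<lambda>\<omega>. dyadic_regulator (\<psi> \<omega>) n (grid_index n t)) \<in> borel_measurable M" for n
      unfolding dyadic_regulator_def[OF \<psi>] by measurable
  qed
  have Z0_fun: "Z 0 = (\<lambda>\<omega>. max 0 (\<omega> 0))" using Z0 by auto
  have AE0: "AE \<omega> in M. 0 \<le> \<omega> 0"
  proof -
    have "distr M borel (\<lambda>\<omega>. \<omega> 0) = stat_law c k"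
      using distr_noise_coordinate[OF \<pi>, of 0] by (simp add: M_def \<pi>_def[symmetric])
    then have "AE x in distr M borel (\<lambda>\<omega>. \<omega> 0). 0 \<le> x"
      using AE_stat_law_nonneg[of c k] by (simp only:)
    then show ?thesis by (rule AE_distrD[rotated]) measurable
  qed
  have dist: "distr M lborel (Z 0) = \<pi>"
  proof -
    have "distr M lborel (Z 0) = distr M borel (\<lambda>\<omega>. \<omega> 0)"
      unfolding Z0_fun using AE0 by (intro distr_cong_AE) (auto elim: AE_mp simp: max_def)
    then show ?thesis by (simp add: M_def distr_noise_coordinate[OF \<pi>])
  qed
  have "refl_diffusion_setup M c k wiener Z L"
    unfolding refl_diffusion_setup_def
  proof (intro conjI ballI)
    show "std_brownian_motion M wiener" unfolding M_def by (rule std_brownian_motion_wiener[OF \<pi>])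
    show "distributed M lborel (Z 0) (\<lambda>x. ennreal (stat_density c k x))"
      unfolding distributed_def using dist mZ[of 0] by (simp add: \<pi>_def stat_law_def)
    show "prob_space.indep_set M {Z 0 -` S \<inter> space M |S. S \<in> sets borel}
      (sigma_sets (space M) {wiener t -` S \<inter> space M |t S. 0 \<le> t \<and> S \<in> sets borel})"
      unfolding M_def Z0_fun by (rule indep_noise_wiener[OF \<pi>]) measurable
    show "\<forall>t\<ge>0. Z t \<in> borel_measurable M \<and> L t \<in> borel_measurable M" using mZ mL by auto
    fix \<omega>
    note sol = sol[of \<omega>, unfolded reflected_solution_def]
    show contZ: "continuous_on {0..} (\<lambda>t. Z t \<omega>)" using sol by auto
    have L_eq: "L t \<omega> = Z t \<omega> - \<psi> \<omega> t - integral {0..t} (\<lambda>s. c - Z s \<omega> ^ k)" if "0 \<le> t" for t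
      using sol that by auto
    \<comment> \<open>Continuity of L is read off from the equation, whose other terms are
      continuous.\<close>
    have "continuous_on {0..} (\<lambda>t. integral {0..t} (\<lambda>s. c - Z s \<omega> ^ k))"
      by (intro continuous_on_atLeastI indefinite_integral_continuous_1 integrable_continuous_interval)
        (auto intro!: continuous_intros intro: continuous_on_subset[OF contZ])
    then have "continuous_on {0..} (\<lambda>t. Z t \<omega> - \<psi> \<omega> t - integral {0..t} (\<lambda>s. c - Z s \<omega> ^ k))"
      using contZ \<psi>(1)[of \<omega>] by (intro continuous_intros)
    then show "continuous_on {0..} (\<lambda>t. L t \<omega>)"
      by (rule continuous_on_eq) (use L_eq in auto)
    show "\<forall>t\<ge>0. Z t \<omega> = Z 0 \<omega> + sqrt 2 * wiener t \<omega> + integral {0..t} (\<lambda>s. c - Z s \<omega> ^ k) + L t \<omega>"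
      using L_eq by (simp add: \<psi>_def Z0)
    show "L 0 \<omega> = 0" "mono_on {0..} (\<lambda>t. L t \<omega>)" "\<forall>t\<ge>0. 0 \<le> Z t \<omega>"
      "\<forall>s t. 0 \<le> s \<and> s \<le> t \<and> (\<forall>u\<in>{s..t}. 0 < Z u \<omega>) \<longrightarrow> L s \<omega> = L t \<omega>"
      using sol by blast+
  qed
  then show ?thesis by blast
qed

end

section \<open>Independence from characteristic functions\<close>

context prob_space
begin

text \<open>Tilting the measure by a positive density built from \<open>G\<close> leaves the characteristic function of
  \<open>Y\<close> unchanged, so Levy's uniqueness theorem shows that \<open>G\<close> does not see the value of \<open>Y\<close>.\<close>

lemma expectation_indicator_of_char_real:
  fixes G Y :: "'a \<Rightarrow> real"
  assumes [measurable]: "Y \<in> borel_measurable M" "G \<in> borel_measurable M" "S \<in> sets borel"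
    and K: "\<And>\<omega>. \<bar>G \<omega>\<bar> \<le> K"
    and char: "\<And>\<eta>. (CLINT \<omega>|M. complex_of_real (G \<omega>) * iexp (\<eta> * Y \<omega>)) = complex_of_real a * char (distr M borel Y) \<eta>"
  shows "expectation (\<lambda>\<omega>. G \<omega> * indicator S (Y \<omega>)) = a * prob (Y -` S \<inter> space M)"
proof -
  interpret Y: real_distribution "distr M borel Y" by simp
  have intG[simp]: "integrable M G"
    by (rule integrable_const_bound[of _ K]) (use K in auto)
  have EG: "expectation G = a"
    using char[of 0] Y.char_zero by simp
  have K0: "0 \<le> K" using K[of undefined] by linarith
  \<comment> \<open>The mean of K + 1 + G, a function that is at least 1; dividing by it makes H a
    probability density.\<close>
  define m where "m = K + 1 + a"
  have "- K \<le> a"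
  proof -
    have "expectation (\<lambda>_. - K) \<le> expectation G"
      using K by (intro integral_mono) (auto simp: abs_le_iff minus_le_iff)
    then show ?thesis using EG by (simp add: prob_space)
  qed
  then have m: "0 < m" by (simp add: m_def)
  define H where "H \<omega> = (K + 1 + G \<omega>) / m" for \<omega>
  have H: "0 \<le> H \<omega>" for \<omega> using K[of \<omega>] m by (auto simp: H_def abs_le_iff)
  have [measurable]: "H \<in> borel_measurable M" unfolding H_def by measurable
  have intH: "integrable M H" unfolding H_def by simp
  have EH: "expectation H = 1" unfolding H_def using m by (simp add: EG prob_space m_def)
  define N where "N = density M (\<lambda>\<omega>. ennreal (H \<omega>))"
  interpret N: prob_space N
  proof
    have "emeasure N (space N) = (\<integral>\<^sup>+ \<omega>. ennreal (H \<omega>) \<partial>M)"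
      by (simp add: N_def emeasure_density cong: nn_integral_cong)
    also have "\<dots> = 1" using nn_integral_eq_integral[OF intH] H EH by simp
    finally show "emeasure N (space N) = 1" .
  qed
  have [measurable]: "Y \<in> borel_measurable N" by (simp add: N_def)
  have sp: "space N = space M" by (simp add: N_def)
  interpret NY: real_distribution "distr N borel Y"
    by (rule N.real_distribution_distr) simp
  have "char (distr N borel Y) = char (distr M borel Y)"
  proof
    fix \<eta>
    have int: "integrable M (\<lambda>\<omega>. iexp (\<eta> * Y \<omega>))"
      by (rule integrable_const_bound[of _ 1]) auto
    have intG': "integrable M (\<lambda>\<omega>. complex_of_real (G \<omega>) * iexp (\<eta> * Y \<omega>))"
      by (rule integrable_const_bound[of _ K]) (use K in \<open>auto simp: norm_mult\<close>)
    have "char (distr N borel Y) \<eta> = (CLINT \<omega>|N. iexp (\<eta> * Y \<omega>))"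
      by (simp add: char_def integral_distr)
    also have "\<dots> = (CLINT \<omega>|M. H \<omega> *\<^sub>R iexp (\<eta> * Y \<omega>))"
      unfolding N_def using H by (subst integral_density) auto
    also have "\<dots> = (CLINT \<omega>|M. complex_of_real ((K + 1) / m) * iexp (\<eta> * Y \<omega>)
        + complex_of_real (1 / m) * (complex_of_real (G \<omega>) * iexp (\<eta> * Y \<omega>)))"
      by (intro Bochner_Integration.integral_cong) (auto simp: H_def scaleR_conv_of_real add_divide_distrib algebra_simps)
    also have "\<dots> = complex_of_real ((K + 1) / m) * (CLINT \<omega>|M. iexp (\<eta> * Y \<omega>))
        + complex_of_real (1 / m) * (CLINT \<omega>|M. complex_of_real (G \<omega>) * iexp (\<eta> * Y \<omega>))"
      using int intG' by (subst Bochner_Integration.integral_add) auto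
    also have "\<dots> = complex_of_real ((K + 1) / m + a / m) * char (distr M borel Y) \<eta>"
      unfolding char by (simp add: char_def integral_distr algebra_simps)
    also have "(K + 1) / m + a / m = 1" using m by (simp add: m_def add_divide_distrib[symmetric])
    finally show "char (distr N borel Y) \<eta> = char (distr M borel Y) \<eta>" by simp
  qed
  then have eq: "distr N borel Y = distr M borel Y"
    by (intro Levy_uniqueness NY.real_distribution_axioms Y.real_distribution_axioms)
  have "prob (Y -` S \<inter> space M) = measure (distr M borel Y) S"
    by (simp add: measure_distr)
  also have "\<dots> = measure N (Y -` S \<inter> space M)"
    unfolding eq[symmetric] by (simp add: measure_distr sp)
  also have "\<dots> = (LINT \<omega>|N. indicator S (Y \<omega>))"
  proof -
    have "(LINT \<omega>|N. indicator S (Y \<omega>)) = (LINT \<omega>|N. indicator (Y -` S \<inter> space N) \<omega> :: real)"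
      by (intro Bochner_Integration.integral_cong) (auto simp: indicator_def)
    also have "\<dots> = measure N (Y -` S \<inter> space N)" by simp
    finally show ?thesis by (simp add: sp)
  qed
  also have "\<dots> = expectation (\<lambda>\<omega>. H \<omega> * indicator S (Y \<omega>))"
    unfolding N_def using H by (subst integral_density) auto
  also have "\<dots> = expectation (\<lambda>\<omega>. (K + 1) / m * indicator S (Y \<omega>) + 1 / m * (G \<omega> * indicator S (Y \<omega>)))"
    by (intro Bochner_Integration.integral_cong) (auto simp: H_def add_divide_distrib algebra_simps)
  also have "\<dots> = (K + 1) / m * expectation (\<lambda>\<omega>. indicator S (Y \<omega>)) + 1 / m * expectation (\<lambda>\<omega>. G \<omega> * indicator S (Y \<omega>))"
  proof -
    have "integrable M (\<lambda>\<omega>. indicator S (Y \<omega>) :: real)"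
      by (rule integrable_const_bound[of _ 1]) (auto simp: indicator_def)
    moreover have "integrable M (\<lambda>\<omega>. G \<omega> * indicator S (Y \<omega>))"
      by (rule integrable_const_bound[of _ K]) (use K K0 in \<open>auto simp: indicator_def\<close>)
    ultimately show ?thesis by (subst Bochner_Integration.integral_add) auto
  qed
  also have "expectation (\<lambda>\<omega>. indicator S (Y \<omega>)) = prob (Y -` S \<inter> space M)"
  proof -
    have "expectation (\<lambda>\<omega>. indicator S (Y \<omega>) :: real) = expectation (indicator (Y -` S \<inter> space M))"
      by (intro Bochner_Integration.integral_cong) (auto simp: indicator_def)
    then show ?thesis by simp
  qed
  finally have "prob (Y -` S \<inter> space M) * m = (K + 1) * prob (Y -` S \<inter> space M) + expectation (\<lambda>\<omega>. G \<omega> * indicator S (Y \<omega>))"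
    using m by (simp add: field_simps)
  then show ?thesis by (simp add: m_def algebra_simps)
qed

text \<open>Real and imaginary part of G satisfy the hypothesis separately, because conjugating G
  amounts to passing from \<eta> to -\<eta>, where the characteristic function is the conjugate
  one.\<close>

lemma expectation_indicator_of_char:
  fixes G :: "'a \<Rightarrow> complex" and Y :: "'a \<Rightarrow> real"
  assumes [measurable]: "Y \<in> borel_measurable M" "G \<in> borel_measurable M" "S \<in> sets borel"
    and K: "\<And>\<omega>. norm (G \<omega>) \<le> K"
    and char: "\<And>\<eta>. (CLINT \<omega>|M. G \<omega> * iexp (\<eta> * Y \<omega>)) = a * char (distr M borel Y) \<eta>"
  shows "(CLINT \<omega>|M. G \<omega> * complex_of_real (indicator S (Y \<omega>))) = a * complex_of_real (prob (Y -` S \<inter> space M))"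
proof -
  have intG: "integrable M (\<lambda>\<omega>. G \<omega> * iexp (\<eta> * Y \<omega>))" for \<eta>
    by (rule integrable_const_bound[of _ K]) (use K in \<open>auto simp: norm_mult\<close>)
  have char_neg: "char (distr M borel Y) (- \<eta>) = cnj (char (distr M borel Y) \<eta>)" for \<eta>
  proof -
    have "(CLINT \<omega>|M. cnj (iexp (\<eta> * Y \<omega>))) = cnj (CLINT \<omega>|M. iexp (\<eta> * Y \<omega>))"
      by (rule Bochner_Integration.integral_cnj)
    then show ?thesis by (simp add: char_def integral_distr exp_cnj)
  qed
  have char_cnj: "(CLINT \<omega>|M. cnj (G \<omega>) * iexp (\<eta> * Y \<omega>)) = cnj a * char (distr M borel Y) \<eta>" for \<eta>
  proof -
    have "(CLINT \<omega>|M. cnj (G \<omega>) * iexp (\<eta> * Y \<omega>)) = (CLINT \<omega>|M. cnj (G \<omega> * iexp ((- \<eta>) * Y \<omega>)))"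
      by (simp add: exp_cnj)
    also have "\<dots> = cnj (a * char (distr M borel Y) (- \<eta>))"
      unfolding char[symmetric] by (rule Bochner_Integration.integral_cnj)
    finally show ?thesis unfolding char_neg by simp
  qed
  have [measurable]: "(\<lambda>\<omega>. cnj (G \<omega>)) \<in> borel_measurable M"
    by (rule borel_measurable_continuous_on[of cnj]) (auto intro: continuous_intros)
  have intC: "integrable M (\<lambda>\<omega>. cnj (G \<omega>) * iexp (\<eta> * Y \<omega>))" for \<eta>
    by (rule integrable_const_bound[of _ K]) (use K in \<open>auto simp: norm_mult\<close>)
  have re: "complex_of_real (Re z) = (z + cnj z) / 2" and im: "complex_of_real (Im z) = (z - cnj z) / (2 * \<i>)" for z
    by (simp_all add: complex_eq_iff complex_add_cnj complex_diff_cnj)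
  have ReG: "expectation (\<lambda>\<omega>. Re (G \<omega>) * indicator S (Y \<omega>)) = Re a * prob (Y -` S \<inter> space M)"
  proof (rule expectation_indicator_of_char_real[where K=K])
    fix \<eta>
    have "(CLINT \<omega>|M. complex_of_real (Re (G \<omega>)) * iexp (\<eta> * Y \<omega>))
        = (CLINT \<omega>|M. (G \<omega> * iexp (\<eta> * Y \<omega>) + cnj (G \<omega>) * iexp (\<eta> * Y \<omega>)) / 2)"
      unfolding re by (simp add: algebra_simps)
    also have "\<dots> = ((CLINT \<omega>|M. G \<omega> * iexp (\<eta> * Y \<omega>)) + (CLINT \<omega>|M. cnj (G \<omega>) * iexp (\<eta> * Y \<omega>))) / 2"
      by (simp only: Bochner_Integration.integral_add[OF intG intC] integral_divide_zero)
    also have "\<dots> = complex_of_real (Re a) * char (distr M borel Y) \<eta>"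
      unfolding char char_cnj re by (simp add: field_simps)
    finally show "(CLINT \<omega>|M. complex_of_real (Re (G \<omega>)) * iexp (\<eta> * Y \<omega>)) = complex_of_real (Re a) * char (distr M borel Y) \<eta>" .
  qed (use K in \<open>auto intro: order_trans[OF abs_Re_le_cmod]\<close>)
  have ImG: "expectation (\<lambda>\<omega>. Im (G \<omega>) * indicator S (Y \<omega>)) = Im a * prob (Y -` S \<inter> space M)"
  proof (rule expectation_indicator_of_char_real[where K=K])
    fix \<eta>
    have "(CLINT \<omega>|M. complex_of_real (Im (G \<omega>)) * iexp (\<eta> * Y \<omega>))
        = (CLINT \<omega>|M. (G \<omega> * iexp (\<eta> * Y \<omega>) - cnj (G \<omega>) * iexp (\<eta> * Y \<omega>)) / (2 * \<i>))"
      unfolding im by (simp add: algebra_simps)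
    also have "\<dots> = ((CLINT \<omega>|M. G \<omega> * iexp (\<eta> * Y \<omega>)) - (CLINT \<omega>|M. cnj (G \<omega>) * iexp (\<eta> * Y \<omega>))) / (2 * \<i>)"
      by (simp only: Bochner_Integration.integral_diff[OF intG intC] integral_divide_zero)
    also have "\<dots> = complex_of_real (Im a) * char (distr M borel Y) \<eta>"
      unfolding char char_cnj im by (simp add: field_simps)
    finally show "(CLINT \<omega>|M. complex_of_real (Im (G \<omega>)) * iexp (\<eta> * Y \<omega>)) = complex_of_real (Im a) * char (distr M borel Y) \<eta>" .
  qed (use K in \<open>auto intro: order_trans[OF abs_Im_le_cmod]\<close>)
  have K0: "0 \<le> K" using K[of undefined] norm_ge_zero order_trans by blast
  have int: "integrable M (\<lambda>\<omega>. G \<omega> * complex_of_real (indicator S (Y \<omega>)))"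
    by (rule integrable_const_bound[of _ K]) (use K K0 in \<open>auto simp: norm_mult indicator_def\<close>)
  show ?thesis
  proof (rule complex_eqI)
    show "Re (CLINT \<omega>|M. G \<omega> * complex_of_real (indicator S (Y \<omega>))) = Re (a * complex_of_real (prob (Y -` S \<inter> space M)))"
      using ReG int by (simp flip: integral_Re)
    show "Im (CLINT \<omega>|M. G \<omega> * complex_of_real (indicator S (Y \<omega>))) = Im (a * complex_of_real (prob (Y -` S \<inter> space M)))"
      using ImG int by (simp flip: integral_Im)
  qed
qed

text \<open>The variables are converted one after the other: once the first m exponentials have been
  replaced by indicators, the product of these with the later exponentials is the bounded G of
  \<open>expectation_indicator_of_char\<close> for the next variable.\<close>

lemma prob_Inter_of_joint_char:
  fixes X :: "nat \<Rightarrow> 'a \<Rightarrow> real"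
  assumes X[measurable]: "\<And>j. X j \<in> borel_measurable M" and S[measurable]: "\<And>j. S j \<in> sets borel"
    and char: "\<And>\<theta>. (CLINT \<omega>|M. iexp (\<Sum>j<n. \<theta> j * X j \<omega>)) = (\<Prod>j<n. char (distr M borel (X j)) (\<theta> j))"
  shows "prob {\<omega>\<in>space M. \<forall>j<n. X j \<omega> \<in> S j} = (\<Prod>j<n. prob (X j -` S j \<inter> space M))"
proof -
  let ?W = "\<lambda>m \<omega>. \<Prod>j<m. indicator (S j) (X j \<omega>) :: real"
  have W: "0 \<le> ?W m \<omega>" "?W m \<omega> \<le> 1" for m \<omega>
    by (auto intro!: prod_nonneg prod_le_1 simp: indicator_def)
  have claim: "(CLINT \<omega>|M. complex_of_real (?W m \<omega>) * iexp (\<Sum>j=m..<n. \<theta> j * X j \<omega>))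
      = complex_of_real (\<Prod>j<m. prob (X j -` S j \<inter> space M)) * (\<Prod>j=m..<n. char (distr M borel (X j)) (\<theta> j))"
    if "m \<le> n" for m \<theta>
    using that
  proof (induction m arbitrary: \<theta>)
    case 0
    then show ?case using char[of \<theta>] by (simp add: lessThan_atLeast0)
  next
    case (Suc m)
    let ?G = "\<lambda>\<omega>. complex_of_real (?W m \<omega>) * iexp (\<Sum>j=Suc m..<n. \<theta> j * X j \<omega>)"
    let ?a = "complex_of_real (\<Prod>j<m. prob (X j -` S j \<inter> space M)) * (\<Prod>j=Suc m..<n. char (distr M borel (X j)) (\<theta> j))"
    have "(CLINT \<omega>|M. ?G \<omega> * complex_of_real (indicator (S m) (X m \<omega>))) = ?a * complex_of_real (prob (X m -` S m \<inter> space M))"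
    proof (rule expectation_indicator_of_char[where K=1])
      show "norm (?G \<omega>) \<le> 1" for \<omega> using W[of \<omega> m] by (simp add: norm_mult del: of_real_prod)
      fix \<eta>
      let ?\<theta> = "\<theta>(m := \<eta>)"
      have "(\<Sum>j=m..<n. ?\<theta> j * X j \<omega>) = \<eta> * X m \<omega> + (\<Sum>j=Suc m..<n. \<theta> j * X j \<omega>)" for \<omega>
        using Suc.prems by (subst sum.atLeast_Suc_lessThan) auto
      then have "?G \<omega> * iexp (\<eta> * X m \<omega>) = complex_of_real (?W m \<omega>) * iexp (\<Sum>j=m..<n. ?\<theta> j * X j \<omega>)" for \<omega>
        by (simp only: mult.assoc exp_add[symmetric]) (simp add: algebra_simps)
      then have "(CLINT \<omega>|M. ?G \<omega> * iexp (\<eta> * X m \<omega>)) = (CLINT \<omega>|M. complex_of_real (?W m \<omega>) * iexp (\<Sum>j=m..<n. ?\<theta> j * X j \<omega>))"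
        by (simp only:)
      also have "\<dots> = complex_of_real (\<Prod>j<m. prob (X j -` S j \<inter> space M)) * (\<Prod>j=m..<n. char (distr M borel (X j)) (?\<theta> j))"
        using Suc by (intro Suc.IH) auto
      also have "(\<Prod>j=m..<n. char (distr M borel (X j)) (?\<theta> j))
          = char (distr M borel (X m)) \<eta> * (\<Prod>j=Suc m..<n. char (distr M borel (X j)) (\<theta> j))"
        using Suc.prems by (subst prod.atLeast_Suc_lessThan) auto
      finally show "(CLINT \<omega>|M. ?G \<omega> * iexp (\<eta> * X m \<omega>)) = ?a * char (distr M borel (X m)) \<eta>"
        by (simp only: mult_ac)
    qed measurable
    then show ?case by (simp add: mult_ac)
  qed
  have "prob {\<omega>\<in>space M. \<forall>j<n. X j \<omega> \<in> S j} = expectation (?W n)"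
  proof -
    have "expectation (?W n) = expectation (indicator {\<omega>\<in>space M. \<forall>j<n. X j \<omega> \<in> S j})"
    proof (intro Bochner_Integration.integral_cong refl)
      fix \<omega> assume "\<omega> \<in> space M"
      show "?W n \<omega> = indicator {\<omega>\<in>space M. \<forall>j<n. X j \<omega> \<in> S j} \<omega>"
      proof (cases "\<forall>j<n. X j \<omega> \<in> S j")
        case False
        then obtain j where "j < n" "X j \<omega> \<notin> S j" by auto
        then have "?W n \<omega> = 0" by (intro prod_zero) (auto intro!: bexI[of _ j])
        then show ?thesis using False by (simp add: indicator_def)
      qed (use \<open>\<omega> \<in> space M\<close> in simp)
    qed
    then show ?thesis by simp
  qed
  also have "complex_of_real (expectation (?W n)) = (CLINT \<omega>|M. complex_of_real (?W n \<omega>))"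
    by (rule integral_complex_of_real[symmetric])
  also have "\<dots> = complex_of_real (\<Prod>j<n. prob (X j -` S j \<inter> space M))"
    using claim[of n "\<lambda>_. 0"] by simp
  finally show ?thesis by (simp only: of_real_eq_iff)
qed

end

section \<open>Variance of coordinatewise Lipschitz functions\<close>

text \<open>The mean square of h about a is the variance of h plus the squared distance of its mean
  from a. The variance is at most the mean square about h m, with m the mean of x, and there the
  Lipschitz bound applies.\<close>

lemma lipschitz_second_moment:
  fixes P :: "real measure" and h :: "real \<Rightarrow> real"
  assumes "prob_space P" and [measurable_cong]: "sets P = sets borel" and sq: "integrable P (\<lambda>x. x\<^sup>2)"
    and lip: "\<And>x y. \<bar>h y - h x\<bar> \<le> \<bar>y - x\<bar>"
  shows "integrable P h"
    and "(\<integral>\<^sup>+ x. ennreal ((h x - a)\<^sup>2) \<partial>P)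
      \<le> ennreal ((LINT x|P. (x - (LINT y|P. y))\<^sup>2) + ((LINT x|P. h x) - a)\<^sup>2)"
proof -
  interpret prob_space P by fact
  have "continuous_on UNIV h"
    unfolding continuous_on_iff dist_real_def using lip by (metis order_le_less_trans)
  then have [measurable]: "h \<in> borel_measurable borel" by (rule borel_measurable_continuous_onI)
  define m where "m = (LINT y|P. y)"
  have ix: "integrable P (\<lambda>x. x)"
    by (rule square_integrable_imp_integrable[OF _ sq]) auto
  have isq: "integrable P (\<lambda>x. (x - m)\<^sup>2)"
    using ix sq by (simp add: power2_diff)
  have ihm: "integrable P (\<lambda>x. (h x - h m)\<^sup>2)"
  proof (rule Bochner_Integration.integrable_bound[OF isq])
    show "AE x in P. norm ((h x - h m)\<^sup>2) \<le> norm ((x - m)\<^sup>2)"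
      using lip by (auto intro!: AE_I2 simp: abs_le_square_iff[symmetric])
  qed measurable
  have ihm1: "integrable P (\<lambda>x. h x - h m)"
    by (rule square_integrable_imp_integrable[OF _ ihm]) measurable
  from Bochner_Integration.integrable_add[OF this, of "\<lambda>_. h m"] show ih: "integrable P h" by simp
  have ih2: "integrable P (\<lambda>x. (h x)\<^sup>2)"
  proof -
    have "integrable P (\<lambda>x. (h x - h m)\<^sup>2 + 2 * h m * h x - (h m)\<^sup>2)"
      using ihm ih by auto
    then show ?thesis by (simp add: power2_eq_square algebra_simps)
  qed
  define g where "g = (LINT x|P. h x)"
  have expand: "(LINT x|P. (h x - b)\<^sup>2) = (LINT x|P. (h x)\<^sup>2) - 2 * b * g + b\<^sup>2" for b
    using ih ih2 by (simp add: power2_diff g_def prob_space algebra_simps)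
  have "(LINT x|P. (h x - h m)\<^sup>2) \<le> (LINT x|P. (x - m)\<^sup>2)"
    by (rule integral_mono[OF ihm isq]) (use lip in \<open>auto simp: abs_le_square_iff[symmetric]\<close>)
  moreover have "(LINT x|P. (h x - a)\<^sup>2) = (LINT x|P. (h x - h m)\<^sup>2) - (g - h m)\<^sup>2 + (g - a)\<^sup>2"
    unfolding expand by (simp add: power2_eq_square algebra_simps)
  ultimately have "(LINT x|P. (h x - a)\<^sup>2) \<le> (LINT x|P. (x - m)\<^sup>2) + (g - a)\<^sup>2"
    using zero_le_power2[of "g - h m"] by linarith
  moreover have "(\<integral>\<^sup>+ x. ennreal ((h x - a)\<^sup>2) \<partial>P) = ennreal (LINT x|P. (h x - a)\<^sup>2)"
  proof (rule nn_integral_eq_integral)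
    show "integrable P (\<lambda>x. (h x - a)\<^sup>2)" using ih ih2 by (simp add: power2_diff)
  qed simp
  ultimately show "(\<integral>\<^sup>+ x. ennreal ((h x - a)\<^sup>2) \<partial>P)
      \<le> ennreal ((LINT x|P. (x - (LINT y|P. y))\<^sup>2) + ((LINT x|P. h x) - a)\<^sup>2)"
    unfolding m_def g_def by (simp only: ennreal_leI)
qed

text \<open>A form of the Efron--Stein inequality.\<close>

lemma lipschitz_variance_PiM:
  fixes P :: "'i \<Rightarrow> real measure" and f :: "('i \<Rightarrow> real) \<Rightarrow> real"
  assumes "finite I" and P: "\<And>i. prob_space (P i)" "\<And>i. sets (P i) = sets borel" "\<And>i. integrable (P i) (\<lambda>x. x\<^sup>2)"
    and "f \<in> borel_measurable (PiM I P)"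
    and "\<And>v i y. i \<in> I \<Longrightarrow> \<bar>f (v(i := y)) - f v\<bar> \<le> \<bar>y - v i\<bar>"
  shows "\<exists>a. (\<integral>\<^sup>+ v. ennreal ((f v - a)\<^sup>2) \<partial>PiM I P)
    \<le> ennreal (\<Sum>i\<in>I. LINT x|P i. (x - (LINT y|P i. y))\<^sup>2)"
  using \<open>finite I\<close> assms(5,6)
proof (induction I arbitrary: f rule: finite_induct)
  case empty
  interpret prob_space "P i" for i by (rule P)
  interpret product_prob_space P "{}" by unfold_locales
  have "(\<integral>\<^sup>+ v. ennreal ((f v - f (\<lambda>_. undefined))\<^sup>2) \<partial>PiM {} P) = 0"
    by (simp add: nn_integral_empty)
  then show ?case by (intro exI[of _ "f (\<lambda>_. undefined)"]) simp
next
  case (insert i I)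
  interpret Pi: prob_space "P i" by (rule P)
  interpret PI: prob_space "PiM I P" by (rule prob_space_PiM) (rule P)
  interpret pair_sigma_finite "P i" "PiM I P" ..
  note f[measurable] = insert.prems(1)
  let ?v = "\<lambda>i. LINT x|P i. (x - (LINT y|P i. y))\<^sup>2"
  \<comment> \<open>Integrating out coordinate i keeps the Lipschitz bound in the others and, by
    \<open>lipschitz_second_moment\<close>, costs the variance of that coordinate. The centre a is
    the one that the induction hypothesis yields for g.\<close>
  define g where "g v = (LINT x|P i. f (v(i := x)))" for v
  have lip1: "\<bar>f (v(i := y)) - f (v(i := x))\<bar> \<le> \<bar>y - x\<bar>" for v x y
    using insert.prems(2)[of i "v(i := x)" y] by (simp only: fun_upd_upd fun_upd_same insert_iff simp_thms)
  have one: "integrable (P i) (\<lambda>x. f (v(i := x)))"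
    "(\<integral>\<^sup>+ x. ennreal ((f (v(i := x)) - a)\<^sup>2) \<partial>P i) \<le> ennreal (?v i + (g v - a)\<^sup>2)" for v a
    unfolding g_def by (rule lipschitz_second_moment[OF P]; rule lip1)+
  have upd[measurable]: "(\<lambda>(x, v). v(i := x)) \<in> measurable (P i \<Otimes>\<^sub>M PiM I P) (PiM (insert i I) P)"
    using measurable_compose[OF measurable_pair_swap' measurable_add_dim[of i I P]]
    by (simp add: split_beta')
  have fupd: "(\<lambda>(v, x). f (v(i := x))) \<in> borel_measurable (PiM I P \<Otimes>\<^sub>M P i)"
    using measurable_compose[OF measurable_add_dim f] by (simp add: split_beta')
  have g[measurable]: "g \<in> borel_measurable (PiM I P)"
    unfolding g_def using fupd by (intro Pi.borel_measurable_lebesgue_integral) simp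
  have "\<bar>g (v(j := y)) - g v\<bar> \<le> \<bar>y - v j\<bar>" if "j \<in> I" for v j y
  proof -
    have ij: "i \<noteq> j" using that insert.hyps by auto
    have "g (v(j := y)) - g v = (LINT x|P i. f ((v(i := x))(j := y)) - f (v(i := x)))"
      unfolding g_def using one(1)[of "v(j := y)"] one(1)[of v] ij by (simp add: fun_upd_twist)
    also have "\<bar>\<dots>\<bar> \<le> (LINT x|P i. \<bar>f ((v(i := x))(j := y)) - f (v(i := x))\<bar>)"
      by (rule integral_abs_bound)
    also have "\<dots> \<le> (LINT x|P i. \<bar>y - v j\<bar>)"
    proof (rule integral_mono)
      show "integrable (P i) (\<lambda>x. \<bar>f ((v(i := x))(j := y)) - f (v(i := x))\<bar>)"
        using one(1)[of "v(j := y)"] one(1)[of v] ij by (simp add: fun_upd_twist)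
      show "\<bar>f ((v(i := x))(j := y)) - f (v(i := x))\<bar> \<le> \<bar>y - v j\<bar>" for x
        using insert.prems(2)[of j "v(i := x)" y] that ij
        by (simp only: fun_upd_apply insert_iff simp_thms if_False) (simp add: fun_upd_def)
    qed simp
    finally show ?thesis by (simp add: Pi.prob_space)
  qed
  then obtain a where a: "(\<integral>\<^sup>+ v. ennreal ((g v - a)\<^sup>2) \<partial>PiM I P) \<le> ennreal (\<Sum>i\<in>I. ?v i)"
    using insert.IH[OF g] by blast
  have v0: "0 \<le> ?v i" for i by (intro integral_nonneg_AE) auto
  have "(\<integral>\<^sup>+ v. ennreal ((f v - a)\<^sup>2) \<partial>PiM (insert i I) P)
      = (\<integral>\<^sup>+ v. ennreal ((f v - a)\<^sup>2) \<partial>distr (P i \<Otimes>\<^sub>M PiM I P) (PiM (insert i I) P) (\<lambda>(x, v). v(i := x)))"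
    using P(1) by (subst distr_pair_PiM_eq_PiM) auto
  also have "\<dots> = (\<integral>\<^sup>+ z. ennreal ((f ((snd z)(i := fst z)) - a)\<^sup>2) \<partial>(P i \<Otimes>\<^sub>M PiM I P))"
    by (subst nn_integral_distr) (auto simp: split_beta')
  also have "\<dots> = (\<integral>\<^sup>+ v. (\<integral>\<^sup>+ x. ennreal ((f (v(i := x)) - a)\<^sup>2) \<partial>P i) \<partial>PiM I P)"
  proof -
    have "(\<lambda>z. ennreal ((f ((snd z)(i := fst z)) - a)\<^sup>2)) \<in> borel_measurable (P i \<Otimes>\<^sub>M PiM I P)"
      using measurable_compose[OF upd f] by (simp add: split_beta')
    from nn_integral_snd[OF this] show ?thesis by simp
  qed
  also have "\<dots> \<le> (\<integral>\<^sup>+ v. ennreal (?v i) + ennreal ((g v - a)\<^sup>2) \<partial>PiM I P)"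
    using one(2) v0[of i] by (intro nn_integral_mono) (auto simp: g_def ennreal_plus[symmetric] simp del: ennreal_plus)
  also have "\<dots> = ennreal (?v i) + (\<integral>\<^sup>+ v. ennreal ((g v - a)\<^sup>2) \<partial>PiM I P)"
    by (subst nn_integral_add) (auto simp: PI.emeasure_space_1)
  also have "\<dots> \<le> ennreal (?v i) + ennreal (\<Sum>i\<in>I. ?v i)"
    using a by (intro add_mono) auto
  also have "\<dots> = ennreal (\<Sum>i\<in>insert i I. ?v i)"
    using insert.hyps v0 by (simp add: ennreal_plus[symmetric] sum_nonneg del: ennreal_plus)
  finally show ?case by blast
qed

section \<open>Law of the starting point and the Brownian increments\<close>

text \<open>Centred normal law with standard deviation \<bar>s\<bar>, defined as an image measure so
  that the degenerate case s = 0 is included.\<close>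

definition gauss_law :: "real \<Rightarrow> real measure" where
  "gauss_law s = distr std_normal_distribution borel (\<lambda>x. s * x)"

lemma sets_gauss_law [simp]: "sets (gauss_law s) = sets borel"
  by (simp add: gauss_law_def)

lemma real_distribution_gauss_law: "real_distribution (gauss_law s)"
proof -
  interpret real_distribution std_normal_distribution by (rule real_dist_normal_dist)
  show ?thesis unfolding gauss_law_def by (rule real_distribution_distr) simp
qed

lemma prob_space_gauss_law: "prob_space (gauss_law s)"
  using real_distribution_gauss_law by (simp add: real_distribution_def)

lemma char_gauss_law: "char (gauss_law s) \<theta> = complex_of_real (exp (- (\<theta>\<^sup>2 * s\<^sup>2) / 2))"
proof -
  have "char (gauss_law s) \<theta> = char std_normal_distribution (\<theta> * s)"
    by (simp add: char_def gauss_law_def integral_distr mult.assoc)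
  then show ?thesis by (simp add: char_std_normal_distribution power_mult_distrib)
qed

lemma integrable_gauss_law_square: "integrable (gauss_law s) (\<lambda>x. x\<^sup>2)"
  unfolding gauss_law_def
  using std_normal_distribution_even_moments(2)[of 1]
  by (subst integrable_distr_eq) (auto simp: power_mult_distrib)

lemma gauss_law_mean: "(LINT x|gauss_law s. x) = 0"
  unfolding gauss_law_def using integral_std_normal_distribution_moment_odd[of 1]
  by (subst integral_distr) auto

lemma gauss_law_second_moment: "(LINT x|gauss_law s. x\<^sup>2) = s\<^sup>2"
  unfolding gauss_law_def using std_normal_distribution_even_moments(1)[of 1]
  by (subst integral_distr) (auto simp: power_mult_distrib)

lemma std_normal_exp: "(\<integral>\<^sup>+ x. ennreal (exp (s * x)) \<partial>std_normal_distribution) = ennreal (exp (s\<^sup>2 / 2))"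
proof -
  have "std_normal_density x * exp (s * x) = exp (s\<^sup>2 / 2) * normal_density s 1 x" for x
  proof -
    have "exp (- x\<^sup>2 / 2) * exp (s * x) = exp (s\<^sup>2 / 2) * exp (- (x - s)\<^sup>2 / 2)"
      unfolding exp_add[symmetric] by (simp add: power2_eq_square field_simps)
    then show ?thesis by (simp add: normal_density_def)
  qed
  then have "(\<integral>\<^sup>+ x. ennreal (exp (s * x)) \<partial>std_normal_distribution)
      = (\<integral>\<^sup>+ x. ennreal (exp (s\<^sup>2 / 2) * normal_density s 1 x) \<partial>lborel)"
    by (subst nn_integral_density) (auto simp: ennreal_mult'[symmetric])
  also have "\<dots> = ennreal (LINT x|lborel. exp (s\<^sup>2 / 2) * normal_density s 1 x)"
    by (intro nn_integral_eq_integral) auto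
  finally show ?thesis by simp
qed

lemma gauss_law_cosh: "(\<integral>\<^sup>+ x. ennreal (cosh (a + x)) \<partial>gauss_law s) = ennreal (cosh a * exp (s\<^sup>2 / 2))"
proof -
  have "ennreal (cosh (a + s * x)) = ennreal (exp a / 2) * ennreal (exp (s * x)) + ennreal (exp (- a) / 2) * ennreal (exp ((- s) * x))" for x
  proof -
    have "exp a * exp (s * x) = exp (a + s * x)" "exp (- a) * exp ((- s) * x) = exp (- (a + s * x))"
      by (simp_all add: exp_add[symmetric])
    then have "cosh (a + s * x) = exp a / 2 * exp (s * x) + exp (- a) / 2 * exp ((- s) * x)"
      by (simp add: cosh_field_def)
    then show ?thesis by (simp only: ennreal_plus ennreal_mult' mult_nonneg_nonneg exp_ge_zero divide_nonneg_nonneg zero_le_numeral)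
  qed
  then have "(\<integral>\<^sup>+ x. ennreal (cosh (a + x)) \<partial>gauss_law s)
      = (\<integral>\<^sup>+ x. ennreal (exp a / 2) * ennreal (exp (s * x)) + ennreal (exp (- a) / 2) * ennreal (exp ((- s) * x)) \<partial>std_normal_distribution)"
    unfolding gauss_law_def by (subst nn_integral_distr) auto
  also have "\<dots> = ennreal (exp a / 2) * ennreal (exp (s\<^sup>2 / 2)) + ennreal (exp (- a) / 2) * ennreal (exp ((- s)\<^sup>2 / 2))"
    by (simp only: nn_integral_add nn_integral_cmult borel_measurable_times_ennreal measurable_const
        std_normal_exp[symmetric]) (subst nn_integral_add; simp add: nn_integral_cmult)
  also have "\<dots> = ennreal (cosh a * exp (s\<^sup>2 / 2))"
    by (simp add: cosh_def ennreal_mult'[symmetric] ennreal_plus[symmetric] field_simps del: ennreal_plus)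
  finally show ?thesis .
qed

text \<open>The weights \<theta> j and -\<theta> j sit at the times (j + 1) d and j d; the mixed
  second difference of min over the grid is d on the diagonal and 0 elsewhere.\<close>

lemma brownian_increments_gaussian:
  assumes B: "std_brownian_motion M B" and d: "0 \<le> d"
  shows "gaussian0 M (\<lambda>\<omega>. \<Sum>j<n. \<theta> j * (B (real (Suc j) * d) \<omega> - B (real j * d) \<omega>)) (d * (\<Sum>j<n. (\<theta> j)\<^sup>2))"
proof -
  define ts where "ts = map (\<lambda>j. real (Suc j) * d) [0..<n] @ map (\<lambda>j. real j * d) [0..<n]"
  define cs where "cs = map \<theta> [0..<n] @ map (\<lambda>j. - \<theta> j) [0..<n]"
  have len: "length ts = n + n" "length cs = n + n" by (simp_all add: ts_def cs_def)
  have nn: "\<forall>t\<in>set ts. 0 \<le> t" using d by (auto simp: ts_def)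
  have ts: "ts ! i = real (Suc i) * d" "cs ! i = \<theta> i" "ts ! (n + i) = real i * d" "cs ! (n + i) = - \<theta> i" if "i < n" for i
    using that by (simp_all add: ts_def cs_def nth_append)
  have split: "(\<Sum>i<n+n. f i) = (\<Sum>i<n. f i + f (n + i))" for f :: "nat \<Rightarrow> real"
  proof -
    have "(\<Sum>i<n+n. f i) = (\<Sum>i=0..<n. f i) + (\<Sum>i=n..<n+n. f i)"
      by (simp add: lessThan_atLeast0 sum.atLeastLessThan_concat)
    also have "(\<Sum>i=n..<n+n. f i) = (\<Sum>i=0..<n. f (n + i))"
      using sum.shift_bounds_nat_ivl[of f 0 n n] by (simp add: add.commute)
    finally show ?thesis by (simp add: sum.distrib lessThan_atLeast0)
  qed
  have "gaussian0 M (\<lambda>\<omega>. \<Sum>i<length ts. cs ! i * B (ts ! i) \<omega>)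
      (\<Sum>i<length ts. \<Sum>j<length ts. cs ! i * cs ! j * min (ts ! i) (ts ! j))"
  proof -
    have "length cs = length ts" by (simp only: len)
    with B nn show ?thesis unfolding std_brownian_motion_def by blast
  qed
  moreover have "(\<Sum>i<length ts. cs ! i * B (ts ! i) \<omega>)
      = (\<Sum>j<n. \<theta> j * (B (real (Suc j) * d) \<omega> - B (real j * d) \<omega>))" for \<omega>
    unfolding len split
  proof (intro sum.cong refl)
    fix i assume "i \<in> {..<n}"
    then have i: "i < n" by simp
    show "cs ! i * B (ts ! i) \<omega> + cs ! (n + i) * B (ts ! (n + i)) \<omega> = \<theta> i * (B (real (Suc i) * d) \<omega> - B (real i * d) \<omega>)"
      unfolding ts[OF i] by (simp only: algebra_simps)
  qed
  moreover have "(\<Sum>i<length ts. \<Sum>j<length ts. cs ! i * cs ! j * min (ts ! i) (ts ! j)) = d * (\<Sum>j<n. (\<theta> j)\<^sup>2)"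
  proof -
    have "(\<Sum>i<length ts. \<Sum>j<length ts. cs ! i * cs ! j * min (ts ! i) (ts ! j))
        = (\<Sum>i<n. \<Sum>j<n. if i = j then d * (\<theta> i)\<^sup>2 else 0)"
      unfolding len split sum.distrib[symmetric]
    proof (intro sum.cong refl)
      fix i j assume "i \<in> {..<n}" "j \<in> {..<n}"
      then have ij: "i < n" "j < n" by auto
      have m: "min (real a * d) (real b * d) = real (min a b) * d" for a b :: nat
        using d by (cases "a \<le> b") (auto simp: min_def mult_right_mono dest: order_antisym[OF mult_right_mono])
      have "real (min (Suc i) (Suc j)) - real (min (Suc i) j) - real (min i (Suc j)) + real (min i j) = (if i = j then 1 else 0)"
        by (auto simp: min_def)
      then have "\<theta> i * \<theta> j * d * (real (min (Suc i) (Suc j)) - real (min (Suc i) j) - real (min i (Suc j)) + real (min i j))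
          = (if i = j then d * (\<theta> i)\<^sup>2 else 0)"
        by (simp add: power2_eq_square)
      then show "cs ! i * cs ! j * min (ts ! i) (ts ! j) + cs ! i * cs ! (n + j) * min (ts ! i) (ts ! (n + j)) +
          (cs ! (n + i) * cs ! j * min (ts ! (n + i)) (ts ! j) + cs ! (n + i) * cs ! (n + j) * min (ts ! (n + i)) (ts ! (n + j)))
          = (if i = j then d * (\<theta> i)\<^sup>2 else 0)"
        unfolding ts[OF ij(1)] ts[OF ij(2)] m by (simp add: algebra_simps del: of_nat_Suc of_nat_min)
    qed
    also have "\<dots> = d * (\<Sum>j<n. (\<theta> j)\<^sup>2)" by (simp add: sum_distrib_left)
    finally show ?thesis .
  qed
  ultimately show ?thesis by simp
qed

context power_drift
begin

definition noise_law :: "real \<Rightarrow> nat \<Rightarrow> real measure" where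
  "noise_law d i = (if i = 0 then stat_law c k else gauss_law (sqrt (2 * d)))"

lemma noise_law: "prob_space (noise_law d i)" "sets (noise_law d i) = sets borel"
  using prob_space_stat_law[OF k_pos] prob_space_gauss_law by (simp_all add: noise_law_def)

definition driver :: "(real \<Rightarrow> 'a \<Rightarrow> real) \<Rightarrow> (real \<Rightarrow> 'a \<Rightarrow> real) \<Rightarrow> 'a \<Rightarrow> real \<Rightarrow> real" where
  "driver B Z \<omega> t = Z 0 \<omega> + sqrt 2 * B t \<omega>"

definition noise_vec :: "(real \<Rightarrow> 'a \<Rightarrow> real) \<Rightarrow> (real \<Rightarrow> 'a \<Rightarrow> real) \<Rightarrow> real \<Rightarrow> nat \<Rightarrow> 'a \<Rightarrow> real" where
  "noise_vec B Z d i \<omega> = (case i of 0 \<Rightarrow> Z 0 \<omega> | Suc j \<Rightarrow> increments (driver B Z \<omega>) d j)"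

context
  fixes M :: "'a measure" and B Z L
  assumes rd: "refl_diffusion_setup M c k B Z L"
begin

lemma rd_brownian: "std_brownian_motion M B" and rd_prob_space: "prob_space M"
  and rd_measurable_B: "0 \<le> t \<Longrightarrow> B t \<in> borel_measurable M"
  and rd_measurable_Z: "0 \<le> t \<Longrightarrow> Z t \<in> borel_measurable M"
  using rd unfolding refl_diffusion_setup_def std_brownian_motion_def by auto

lemma rd_solution:
  assumes \<omega>: "\<omega> \<in> space M"
  shows "reflected_solution (driver B Z \<omega>) (\<lambda>t. Z t \<omega>) (\<lambda>t. L t \<omega>)"
proof -
  have "B 0 \<omega> = 0" using rd_brownian \<omega> unfolding std_brownian_motion_def by auto
  with rd \<omega> show ?thesis
    unfolding refl_diffusion_setup_def reflected_solution_def driver_def by blast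
qed

lemma driver_0: "\<omega> \<in> space M \<Longrightarrow> driver B Z \<omega> 0 = Z 0 \<omega>"
  using rd_brownian unfolding std_brownian_motion_def driver_def by auto

lemma noise_vec_Suc: "noise_vec B Z d (Suc j) \<omega> = sqrt 2 * (B (real (Suc j) * d) \<omega> - B (real j * d) \<omega>)"
  by (simp add: noise_vec_def increments_def driver_def algebra_simps)

lemma measurable_noise_vec:
  assumes d: "0 \<le> d" shows "noise_vec B Z d i \<in> borel_measurable M"
proof (cases i)
  case 0
  then show ?thesis using rd_measurable_Z[of 0] by (simp add: noise_vec_def[abs_def])
next
  case (Suc j)
  have "B (real (Suc j) * d) \<in> borel_measurable M" "B (real j * d) \<in> borel_measurable M"
    using d by (intro rd_measurable_B; simp)+
  then show ?thesis unfolding Suc noise_vec_Suc[abs_def] by measurable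
qed

lemma distr_noise_vec:
  assumes d: "0 \<le> d" shows "distr M borel (noise_vec B Z d i) = noise_law d i"
proof (cases i)
  case 0
  have "distr M lborel (Z 0) = stat_law c k"
    using rd unfolding refl_diffusion_setup_def distributed_def stat_law_def by auto
  moreover have "distr M lborel (Z 0) = distr M borel (Z 0)"
    by (rule distr_cong) auto
  ultimately show ?thesis using 0 by (simp add: noise_law_def noise_vec_def[abs_def])
next
  case (Suc j)
  interpret prob_space M by (rule rd_prob_space)
  note mv = measurable_noise_vec[OF d, of i]
  show ?thesis
  proof (rule Levy_uniqueness)
    show "real_distribution (distr M borel (noise_vec B Z d i))"
      using mv by (rule real_distribution_distr)
    show "real_distribution (noise_law d i)"
      using Suc real_distribution_gauss_law by (simp add: noise_law_def)
    show "char (distr M borel (noise_vec B Z d i)) = char (noise_law d i)"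
    proof
      fix \<theta>
      have "gaussian0 M (\<lambda>\<omega>. \<Sum>l<Suc j. (if l = j then sqrt 2 else 0) * (B (real (Suc l) * d) \<omega> - B (real l * d) \<omega>))
          (d * (\<Sum>l<Suc j. (if l = j then sqrt 2 else 0)\<^sup>2))"
        by (rule brownian_increments_gaussian[OF rd_brownian d])
      moreover have "(\<lambda>\<omega>. \<Sum>l<Suc j. (if l = j then sqrt 2 else 0) * (B (real (Suc l) * d) \<omega> - B (real l * d) \<omega>)) = noise_vec B Z d i"
        unfolding Suc noise_vec_Suc[abs_def] by (simp add: fun_eq_iff del: of_nat_Suc)
      moreover have "(\<Sum>l<Suc j. (if l = j then sqrt 2 else 0)\<^sup>2) = (2::real)" by simp
      ultimately have "gaussian0 M (noise_vec B Z d i) (d * 2)" by simp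
      then show "char (distr M borel (noise_vec B Z d i)) \<theta> = char (noise_law d i) \<theta>"
        using d Suc by (simp add: gaussian0_def noise_law_def char_gauss_law mult_ac)
    qed
  qed
qed

lemma increments_joint_char:
  assumes d: "0 \<le> d"
  shows "(CLINT \<omega>|M. iexp (\<Sum>j<n. \<theta> j * noise_vec B Z d (Suc j) \<omega>))
    = (\<Prod>j<n. char (distr M borel (noise_vec B Z d (Suc j))) (\<theta> j))"
proof -
  have g: "gaussian0 M (\<lambda>\<omega>. \<Sum>j<n. (\<theta> j * sqrt 2) * (B (real (Suc j) * d) \<omega> - B (real j * d) \<omega>))
      (d * (\<Sum>j<n. (\<theta> j * sqrt 2)\<^sup>2))"
    by (rule brownian_increments_gaussian[OF rd_brownian d])
  have eq: "(\<Sum>j<n. (\<theta> j * sqrt 2) * (B (real (Suc j) * d) \<omega> - B (real j * d) \<omega>)) = (\<Sum>j<n. \<theta> j * noise_vec B Z d (Suc j) \<omega>)" for \<omega>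
    unfolding noise_vec_Suc by (simp only: mult.assoc)
  have [measurable]: "noise_vec B Z d i \<in> borel_measurable M" for i by (rule measurable_noise_vec[OF d])
  have "(CLINT \<omega>|M. iexp (\<Sum>j<n. \<theta> j * noise_vec B Z d (Suc j) \<omega>))
      = char (distr M borel (\<lambda>\<omega>. \<Sum>j<n. \<theta> j * noise_vec B Z d (Suc j) \<omega>)) 1"
    by (simp add: char_def integral_distr)
  also have "\<dots> = complex_of_real (exp (- (d * (\<Sum>j<n. (\<theta> j * sqrt 2)\<^sup>2)) / 2))"
    using g unfolding eq gaussian0_def by simp
  also have "\<dots> = complex_of_real (\<Prod>j<n. exp (- ((\<theta> j)\<^sup>2 * (sqrt (2 * d))\<^sup>2) / 2))"
    using d by (simp add: exp_sum[symmetric] sum_distrib_left sum_divide_distrib power_mult_distrib sum_negf mult_ac del: of_real_exp)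
  also have "\<dots> = (\<Prod>j<n. char (distr M borel (noise_vec B Z d (Suc j))) (\<theta> j))"
    unfolding distr_noise_vec[OF d] by (simp add: noise_law_def char_gauss_law)
  finally show ?thesis .
qed

text \<open>On product sets the starting point splits off by the independence in the setup, because
  the event about the increments lies in the \<sigma>-algebra of B; the increments factor by
  \<open>prob_Inter_of_joint_char\<close>.\<close>

lemma joint_law:
  assumes d: "0 \<le> d"
  shows "distr M (PiM {..n} (\<lambda>_. borel)) (\<lambda>\<omega>. \<lambda>i\<in>{..n}. noise_vec B Z d i \<omega>) = PiM {..n} (noise_law d)"
proof -
  interpret prob_space M by (rule rd_prob_space)
  interpret P: prob_space "noise_law d i" for i by (rule noise_law)
  interpret product_sigma_finite "noise_law d" by unfold_locales
  have [measurable]: "noise_vec B Z d i \<in> borel_measurable M" for i by (rule measurable_noise_vec[OF d])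
  show ?thesis
  proof (rule PiM_eqI)
    show "sets (distr M (PiM {..n} (\<lambda>_. borel)) (\<lambda>\<omega>. \<lambda>i\<in>{..n}. noise_vec B Z d i \<omega>)) = sets (PiM {..n} (noise_law d))"
      by (simp, rule sets_PiM_cong) (auto simp: noise_law)
    fix A assume "\<And>i. i \<in> {..n} \<Longrightarrow> A i \<in> sets (noise_law d i)"
    then have A: "A i \<in> sets borel" if "i \<le> n" for i using that by (simp add: noise_law)
    \<comment> \<open>Filled up with \<open>UNIV\<close> from n on, so that every member of the
      sequence is a Borel set.\<close>
    define S where "S j = (if j < n then A (Suc j) else UNIV)" for j
    have S[measurable]: "S j \<in> sets borel" for j using A by (simp add: S_def)
    note [measurable] = A[of 0, simplified]
    let ?E0 = "Z 0 -` A 0 \<inter> space M"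
    let ?E1 = "{\<omega>\<in>space M. \<forall>j<n. noise_vec B Z d (Suc j) \<omega> \<in> S j}"
    let ?gen = "{B t -` S \<inter> space M | t S. 0 \<le> t \<and> S \<in> sets borel}"
    have E1: "?E1 \<in> sigma_sets (space M) ?gen"
    proof -
      define N where "N = sigma (space M) ?gen"
      have gen: "?gen \<subseteq> Pow (space M)" by auto
      have sp: "space N = space M" and se: "sets N = sigma_sets (space M) ?gen"
        using gen by (simp_all add: N_def sets_measure_of space_measure_of)
      have BN: "B t \<in> borel_measurable N" if "0 \<le> t" for t
        by (rule measurableI) (use that in \<open>auto simp: sp se intro!: sigma_sets.Basic\<close>)
      have "noise_vec B Z d (Suc j) \<in> borel_measurable N" for j
      proof -
        have "B (real (Suc j) * d) \<in> borel_measurable N" "B (real j * d) \<in> borel_measurable N"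
          using d by (intro BN; simp)+
        then show ?thesis unfolding noise_vec_Suc[abs_def] by measurable
      qed
      note [measurable] = this
      have "{\<omega>\<in>space N. \<forall>j<n. noise_vec B Z d (Suc j) \<omega> \<in> S j} \<in> sets N" by measurable
      then show ?thesis by (simp add: sp se)
    qed
    have "indep_set {Z 0 -` S \<inter> space M | S. S \<in> sets borel} (sigma_sets (space M) ?gen)"
      using rd unfolding refl_diffusion_setup_def by auto
    then have "prob (?E0 \<inter> ?E1) = prob ?E0 * prob ?E1"
      by (rule indep_setD) (use A[of 0] E1 in auto)
    also have "prob ?E1 = (\<Prod>j<n. prob (noise_vec B Z d (Suc j) -` S j \<inter> space M))"
      by (rule prob_Inter_of_joint_char) (use increments_joint_char[OF d] in auto)
    also have "\<dots> = (\<Prod>j<n. measure (noise_law d (Suc j)) (A (Suc j)))"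
      by (intro prod.cong refl) (auto simp: S_def A distr_noise_vec[OF d, symmetric] measure_distr)
    also have "prob ?E0 = measure (noise_law d 0) (A 0)"
    proof -
      have "noise_vec B Z d 0 = Z 0" by (simp add: noise_vec_def fun_eq_iff)
      then show ?thesis
        unfolding distr_noise_vec[OF d, symmetric] using rd_measurable_Z[of 0]
        by (subst measure_distr) (auto simp: A)
    qed
    finally have "prob (?E0 \<inter> ?E1) = (\<Prod>i\<le>n. measure (noise_law d i) (A i))"
      unfolding lessThan_Suc_atMost[symmetric] prod.lessThan_Suc_shift by simp
    moreover have "(\<lambda>\<omega>. \<lambda>i\<in>{..n}. noise_vec B Z d i \<omega>) -` (PiE {..n} A) \<inter> space M = ?E0 \<inter> ?E1"
    proof -
      have all: "(\<forall>i\<le>n. Q i) \<longleftrightarrow> Q 0 \<and> (\<forall>j<n. Q (Suc j))" for Q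
        by (metis Suc_le_eq le0 not0_implies_Suc)
      have "(\<lambda>\<omega>. \<lambda>i\<in>{..n}. noise_vec B Z d i \<omega>) -` (PiE {..n} A) \<inter> space M
          = {\<omega>\<in>space M. \<forall>i\<le>n. noise_vec B Z d i \<omega> \<in> A i}"
        by (auto simp: PiE_iff)
      also have "\<dots> = {\<omega>\<in>space M. Z 0 \<omega> \<in> A 0 \<and> (\<forall>j<n. noise_vec B Z d (Suc j) \<omega> \<in> A (Suc j))}"
        unfolding all by (simp add: noise_vec_def)
      also have "\<dots> = ?E0 \<inter> ?E1" by (auto simp: S_def)
      finally show ?thesis .
    qed
    moreover have "PiE {..n} A \<in> sets (PiM {..n} (\<lambda>_. borel))"
      by (rule sets_PiM_I_finite) (use A in auto)
    ultimately show "emeasure (distr M (PiM {..n} (\<lambda>_. borel)) (\<lambda>\<omega>. \<lambda>i\<in>{..n}. noise_vec B Z d i \<omega>)) (PiE {..n} A)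
        = (\<Prod>i\<le>n. emeasure (noise_law d i) (A i))"
      by (subst emeasure_distr) (auto simp: emeasure_eq_measure P.emeasure_eq_measure prod_ennreal)
  qed simp
qed

end
end

section \<open>Moment bounds for the outflow\<close>

lemma power_le_cosh:
  fixes x :: real
  shows "x ^ (2 * m) \<le> 2 * fact (2 * m) * cosh x"
proof -
  have "\<bar>x\<bar> ^ (2 * m) / fact (2 * m) \<le> exp \<bar>x\<bar>"
  proof -
    have "(\<lambda>n. \<bar>x\<bar> ^ n / fact n) sums exp \<bar>x\<bar>"
      using exp_converges[of "\<bar>x\<bar>"] by (simp add: field_simps)
    then have "(\<Sum>n\<in>{2 * m}. \<bar>x\<bar> ^ n / fact n) \<le> exp \<bar>x\<bar>"
      unfolding sums_iff using sum_le_suminf[of "\<lambda>n. \<bar>x\<bar> ^ n / fact n" "{2 * m}"] by auto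
    then show ?thesis by simp
  qed
  also have "exp \<bar>x\<bar> \<le> 2 * cosh x"
  proof -
    have "exp \<bar>x\<bar> \<le> 2 * cosh \<bar>x\<bar>" by (simp add: cosh_field_def)
    then show ?thesis by (simp add: cosh_real_abs)
  qed
  finally show ?thesis by (simp add: field_simps power_even_abs)
qed

lemma cosh_add_le: "cosh (x + u :: real) \<le> cosh x * exp \<bar>u\<bar>"
proof -
  have "exp (x + u) \<le> exp x * exp \<bar>u\<bar>" "exp (- (x + u)) \<le> exp (- x) * exp \<bar>u\<bar>"
    by (simp_all add: exp_add[symmetric])
  then show ?thesis by (simp add: cosh_field_def field_simps)
qed

context prob_space
begin

lemma variance_le_second_moment:
  assumes [measurable]: "Y \<in> borel_measurable M" and W: "0 \<le> W"
    and le: "(\<integral>\<^sup>+ \<omega>. ennreal ((Y \<omega> - b)\<^sup>2) \<partial>M) \<le> ennreal W"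
  shows "expectation (\<lambda>\<omega>. (Y \<omega> - expectation Y)\<^sup>2) \<le> W"
proof -
  have fin: "(\<integral>\<^sup>+ \<omega>. ennreal ((Y \<omega> - b)\<^sup>2) \<partial>M) < \<infinity>" using le by (rule le_less_trans) simp
  have i2: "integrable M (\<lambda>\<omega>. (Y \<omega> - b)\<^sup>2)"
    by (rule integrableI_nonneg) (use fin in auto)
  have i1: "integrable M (\<lambda>\<omega>. Y \<omega> - b)"
    by (rule square_integrable_imp_integrable[OF _ i2]) measurable
  from Bochner_Integration.integrable_add[OF i1, of "\<lambda>_. b"] have iY: "integrable M Y" by simp
  have "(Y \<omega> - expectation Y)\<^sup>2 = (Y \<omega> - b)\<^sup>2 - 2 * (expectation Y - b) * (Y \<omega> - b) + (expectation Y - b)\<^sup>2" for \<omega>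
    by (simp add: power2_eq_square algebra_simps)
  then have "expectation (\<lambda>\<omega>. (Y \<omega> - expectation Y)\<^sup>2)
      = expectation (\<lambda>\<omega>. (Y \<omega> - b)\<^sup>2 - 2 * (expectation Y - b) * (Y \<omega> - b) + (expectation Y - b)\<^sup>2)"
    by simp
  also have "\<dots> = expectation (\<lambda>\<omega>. (Y \<omega> - b)\<^sup>2) - 2 * (expectation Y - b) * (expectation Y - b) + (expectation Y - b)\<^sup>2"
    using i1 i2 iY by (simp add: prob_space)
  also have "\<dots> \<le> expectation (\<lambda>\<omega>. (Y \<omega> - b)\<^sup>2)"
    using zero_le_square[of "expectation Y - b"] unfolding power2_eq_square[of "expectation Y - b"] mult.assoc
    by linarith
  also have "\<dots> \<le> W"
    using le W nn_integral_eq_integral[OF i2] by (simp add: ennreal_le_iff)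
  finally show ?thesis .
qed

text \<open>The centres a n are not controlled, so they are removed by comparing two outcomes: by
  Fatou, J bounds the mean square distance of Y from its value at a fixed outcome. By Fatou again
  the mean of J is at most 4 V, hence some outcome has J \<le> 5 V, and the value of Y there serves
  as a centre for \<open>variance_le_second_moment\<close>.\<close>

lemma variance_limit_bound:
  fixes Y :: "'a \<Rightarrow> real"
  assumes Yn[measurable]: "\<And>n. Yn n \<in> borel_measurable M"
    and lim: "\<And>\<omega>. \<omega> \<in> space M \<Longrightarrow> (\<lambda>n. Yn n \<omega>) \<longlonglongrightarrow> Y \<omega>" and V: "0 < V"
    and a: "\<And>n. (\<integral>\<^sup>+ \<omega>. ennreal ((Yn n \<omega> - a n)\<^sup>2) \<partial>M) \<le> ennreal V"
  shows "expectation (\<lambda>\<omega>. (Y \<omega> - expectation Y)\<^sup>2) \<le> 5 * V"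
proof -
  have Y[measurable]: "Y \<in> borel_measurable M"
    by (rule borel_measurable_LIMSEQ_real[OF lim Yn])
  define J where "J \<omega> = liminf (\<lambda>n. 2 * ennreal ((Yn n \<omega> - a n)\<^sup>2) + 2 * ennreal V)" for \<omega>
  have [measurable]: "J \<in> borel_measurable M" unfolding J_def by measurable
  have inner: "(\<integral>\<^sup>+ \<omega>'. ennreal ((Y \<omega>' - Y \<omega>)\<^sup>2) \<partial>M) \<le> J \<omega>" if \<omega>: "\<omega> \<in> space M" for \<omega>
  proof -
    have "(\<integral>\<^sup>+ \<omega>'. ennreal ((Y \<omega>' - Y \<omega>)\<^sup>2) \<partial>M) = (\<integral>\<^sup>+ \<omega>'. liminf (\<lambda>n. ennreal ((Yn n \<omega>' - Yn n \<omega>)\<^sup>2)) \<partial>M)"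
    proof (rule nn_integral_cong)
      fix \<omega>' assume "\<omega>' \<in> space M"
      then have "(\<lambda>n. ennreal ((Yn n \<omega>' - Yn n \<omega>)\<^sup>2)) \<longlonglongrightarrow> ennreal ((Y \<omega>' - Y \<omega>)\<^sup>2)"
        using lim \<omega> by (intro tendsto_ennrealI tendsto_intros) auto
      then show "ennreal ((Y \<omega>' - Y \<omega>)\<^sup>2) = liminf (\<lambda>n. ennreal ((Yn n \<omega>' - Yn n \<omega>)\<^sup>2))"
        by (intro lim_imp_Liminf[symmetric]) auto
    qed
    also have "\<dots> \<le> liminf (\<lambda>n. \<integral>\<^sup>+ \<omega>'. ennreal ((Yn n \<omega>' - Yn n \<omega>)\<^sup>2) \<partial>M)"
      by (rule nn_integral_liminf) measurable
    also have "\<dots> \<le> J \<omega>"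
      unfolding J_def
    proof (intro Liminf_mono always_eventually allI)
      fix n
      have "(x - y)\<^sup>2 \<le> 2 * (y - e)\<^sup>2 + 2 * (x - e)\<^sup>2" for x y e :: real
        using zero_le_power2[of "(x - e) + (y - e)"] by (simp add: power2_eq_square algebra_simps)
      then have "(\<integral>\<^sup>+ \<omega>'. ennreal ((Yn n \<omega>' - Yn n \<omega>)\<^sup>2) \<partial>M)
          \<le> (\<integral>\<^sup>+ \<omega>'. ennreal (2 * (Yn n \<omega> - a n)\<^sup>2 + 2 * (Yn n \<omega>' - a n)\<^sup>2) \<partial>M)"
        by (intro nn_integral_mono ennreal_leI)
      also have "\<dots> = (\<integral>\<^sup>+ \<omega>'. 2 * ennreal ((Yn n \<omega> - a n)\<^sup>2) + 2 * ennreal ((Yn n \<omega>' - a n)\<^sup>2) \<partial>M)"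
        by (simp add: ennreal_mult')
      also have "\<dots> = 2 * ennreal ((Yn n \<omega> - a n)\<^sup>2) + 2 * (\<integral>\<^sup>+ \<omega>'. ennreal ((Yn n \<omega>' - a n)\<^sup>2) \<partial>M)"
        by (subst nn_integral_add) (auto simp: emeasure_space_1 nn_integral_cmult)
      also have "\<dots> \<le> 2 * ennreal ((Yn n \<omega> - a n)\<^sup>2) + 2 * ennreal V"
        by (intro add_mono mult_left_mono a) auto
      finally show "(\<integral>\<^sup>+ \<omega>'. ennreal ((Yn n \<omega>' - Yn n \<omega>)\<^sup>2) \<partial>M) \<le> 2 * ennreal ((Yn n \<omega> - a n)\<^sup>2) + 2 * ennreal V" .
    qed
    finally show ?thesis .
  qed
  have "(\<integral>\<^sup>+ \<omega>. J \<omega> \<partial>M) \<le> liminf (\<lambda>n. \<integral>\<^sup>+ \<omega>. 2 * ennreal ((Yn n \<omega> - a n)\<^sup>2) + 2 * ennreal V \<partial>M)"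
    unfolding J_def by (rule nn_integral_liminf) measurable
  also have "\<dots> \<le> liminf (\<lambda>n. ennreal (4 * V))"
  proof (intro Liminf_mono always_eventually allI)
    fix n
    have "(\<integral>\<^sup>+ \<omega>. 2 * ennreal ((Yn n \<omega> - a n)\<^sup>2) + 2 * ennreal V \<partial>M)
        = 2 * (\<integral>\<^sup>+ \<omega>. ennreal ((Yn n \<omega> - a n)\<^sup>2) \<partial>M) + 2 * ennreal V"
      by (subst nn_integral_add) (auto simp: emeasure_space_1 nn_integral_cmult)
    also have "\<dots> \<le> 2 * ennreal V + 2 * ennreal V"
      by (intro add_mono mult_left_mono a) auto
    also have "\<dots> = ennreal (2 * V) + ennreal (2 * V)" using V by (simp add: ennreal_mult')
    also have "\<dots> = ennreal (4 * V)" using V by (subst ennreal_plus[symmetric]) auto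
    finally show "(\<integral>\<^sup>+ \<omega>. 2 * ennreal ((Yn n \<omega> - a n)\<^sup>2) + 2 * ennreal V \<partial>M) \<le> ennreal (4 * V)" .
  qed
  also have "\<dots> = ennreal (4 * V)" by (simp add: Liminf_const)
  finally have J: "(\<integral>\<^sup>+ \<omega>. J \<omega> \<partial>M) \<le> ennreal (4 * V)" .
  have "\<exists>\<omega>\<in>space M. J \<omega> \<le> ennreal (5 * V)"
  proof (rule ccontr)
    assume "\<not> ?thesis"
    then have "(\<integral>\<^sup>+ \<omega>. ennreal (5 * V) \<partial>M) \<le> (\<integral>\<^sup>+ \<omega>. J \<omega> \<partial>M)"
      by (intro nn_integral_mono) (auto simp: not_le intro: less_imp_le)
    then have "ennreal (5 * V) \<le> ennreal (4 * V)" using J by (simp add: emeasure_space_1)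
    then show False using V by (simp add: ennreal_le_iff)
  qed
  then obtain \<omega> where "\<omega> \<in> space M" "J \<omega> \<le> ennreal (5 * V)" by blast
  then have "(\<integral>\<^sup>+ \<omega>'. ennreal ((Y \<omega>' - Y \<omega>)\<^sup>2) \<partial>M) \<le> ennreal (5 * V)"
    using inner by (meson order_trans)
  then show ?thesis using V by (intro variance_le_second_moment[where b="Y \<omega>"]) auto
qed

text \<open>X contributes 2 t and A only O(t^2), so the critical term is the covariance. The
  arithmetic-geometric mean inequality with weights sqrt t and 1 / sqrt t bounds it by
  O(t^(3/2)).\<close>

lemma variance_perturbation:
  assumes [measurable]: "X \<in> borel_measurable M" "A \<in> borel_measurable M"
    and X2: "integrable M (\<lambda>\<omega>. (X \<omega>)\<^sup>2)" and EX: "expectation X = 0" and EX2: "expectation (\<lambda>\<omega>. (X \<omega>)\<^sup>2) = 2 * t"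
    and A2: "(\<integral>\<^sup>+ \<omega>. ennreal ((A \<omega>)\<^sup>2) \<partial>M) \<le> ennreal (C * t\<^sup>2)" and t: "0 < t" and C: "0 \<le> C"
  shows "\<bar>expectation (\<lambda>\<omega>. ((X \<omega> - A \<omega>) - expectation (\<lambda>\<omega>. X \<omega> - A \<omega>))\<^sup>2) - 2 * t\<bar>
    \<le> (2 + C) * t * sqrt t + C * t\<^sup>2"
proof -
  have "(\<integral>\<^sup>+ \<omega>. ennreal ((A \<omega>)\<^sup>2) \<partial>M) < \<infinity>" using A2 by (rule le_less_trans) simp
  then have iA2: "integrable M (\<lambda>\<omega>. (A \<omega>)\<^sup>2)" by (intro integrableI_nonneg) auto
  have EA2: "expectation (\<lambda>\<omega>. (A \<omega>)\<^sup>2) \<le> C * t\<^sup>2"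
    using A2 nn_integral_eq_integral[OF iA2] C by (simp add: ennreal_le_iff)
  have iX: "integrable M X" by (rule square_integrable_imp_integrable[OF _ X2]) measurable
  have iA: "integrable M A" by (rule square_integrable_imp_integrable[OF _ iA2]) measurable
  have iXA: "integrable M (\<lambda>\<omega>. X \<omega> * A \<omega>)"
  proof (rule Bochner_Integration.integrable_bound[OF Bochner_Integration.integrable_add[OF X2 iA2]])
    have "\<bar>x * y\<bar> \<le> \<bar>x\<^sup>2 + y\<^sup>2\<bar>" for x y :: real
    proof -
      have "2 * (\<bar>x\<bar> * \<bar>y\<bar>) \<le> x\<^sup>2 + y\<^sup>2"
        using zero_le_power2[of "\<bar>x\<bar> - \<bar>y\<bar>"] by (simp add: power2_diff)
      moreover have "0 \<le> \<bar>x\<bar> * \<bar>y\<bar>" by simp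
      ultimately show ?thesis by (simp only: abs_mult)
    qed
    then show "AE \<omega> in M. norm (X \<omega> * A \<omega>) \<le> norm ((X \<omega>)\<^sup>2 + (A \<omega>)\<^sup>2)" by simp
  qed measurable
  have amgm: "2 * \<bar>x * y\<bar> \<le> sqrt t * x\<^sup>2 + y\<^sup>2 / sqrt t" for x y
  proof -
    have "0 \<le> (sqrt t * \<bar>x\<bar> - \<bar>y\<bar>)\<^sup>2 / sqrt t" using t by simp
    also have "\<dots> = (t * x\<^sup>2 + y\<^sup>2 - 2 * (sqrt t * \<bar>x * y\<bar>)) / sqrt t"
      using t by (simp add: power2_diff power_mult_distrib abs_mult mult_ac)
    also have "\<dots> = sqrt t * x\<^sup>2 + y\<^sup>2 / sqrt t - 2 * \<bar>x * y\<bar>"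
      using t by (simp add: field_simps)
    finally show ?thesis by simp
  qed
  have "2 * \<bar>expectation (\<lambda>\<omega>. X \<omega> * A \<omega>)\<bar> \<le> expectation (\<lambda>\<omega>. 2 * \<bar>X \<omega> * A \<omega>\<bar>)"
    using integral_abs_bound[of M "\<lambda>\<omega>. X \<omega> * A \<omega>"] by simp
  also have "\<dots> \<le> expectation (\<lambda>\<omega>. sqrt t * (X \<omega>)\<^sup>2 + (A \<omega>)\<^sup>2 / sqrt t)"
    by (rule integral_mono) (use iXA X2 iA2 amgm in auto)
  also have "\<dots> = sqrt t * (2 * t) + expectation (\<lambda>\<omega>. (A \<omega>)\<^sup>2) / sqrt t"
    using X2 iA2 by (simp add: EX2)
  also have "\<dots> \<le> sqrt t * (2 * t) + C * t\<^sup>2 / sqrt t"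
    using EA2 t by (intro add_left_mono divide_right_mono) auto
  also have "C * t\<^sup>2 / sqrt t = C * t * sqrt t"
    using t by (simp add: field_simps power2_eq_square)
  finally have cross: "2 * \<bar>expectation (\<lambda>\<omega>. X \<omega> * A \<omega>)\<bar> \<le> (2 + C) * t * sqrt t"
    by (simp add: algebra_simps)
  let ?m = "expectation A"
  have mean: "expectation (\<lambda>\<omega>. X \<omega> - A \<omega>) = - ?m" using iX iA EX by simp
  have "((X \<omega> - A \<omega>) - (- ?m))\<^sup>2 = (X \<omega>)\<^sup>2 - 2 * (X \<omega> * A \<omega>) + (A \<omega>)\<^sup>2 + 2 * ?m * X \<omega> - 2 * ?m * A \<omega> + ?m\<^sup>2" for \<omega>
    by (simp add: power2_eq_square algebra_simps)
  then have "expectation (\<lambda>\<omega>. ((X \<omega> - A \<omega>) - expectation (\<lambda>\<omega>. X \<omega> - A \<omega>))\<^sup>2)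
      = 2 * t - 2 * expectation (\<lambda>\<omega>. X \<omega> * A \<omega>) + expectation (\<lambda>\<omega>. (A \<omega>)\<^sup>2) - ?m\<^sup>2"
    unfolding mean using X2 iA2 iXA iX iA EX EX2 by (simp add: prob_space power2_eq_square[of ?m])
  moreover have "?m\<^sup>2 \<le> expectation (\<lambda>\<omega>. (A \<omega>)\<^sup>2)"
  proof -
    have "0 \<le> expectation (\<lambda>\<omega>. (A \<omega> - ?m)\<^sup>2)" by (intro integral_nonneg_AE) auto
    also have "\<dots> = expectation (\<lambda>\<omega>. (A \<omega>)\<^sup>2) - ?m\<^sup>2"
      using iA iA2 by (simp add: power2_diff prob_space power2_eq_square[of ?m])
    finally show ?thesis by simp
  qed
  ultimately show ?thesis using cross EA2 zero_le_power2[of ?m] by linarith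
qed

end

section \<open>Moments of the scheme and their passage to the diffusion\<close>

context power_drift
begin

definition cosh_mean :: real where
  "cosh_mean = (LINT x|stat_law c k. cosh x)"

definition start_variance :: real where
  "start_variance = (LINT x|stat_law c k. (x - (LINT y|stat_law c k. y))\<^sup>2)"

lemma cosh_mean_nonneg: "0 \<le> cosh_mean"
  unfolding cosh_mean_def by (intro integral_nonneg_AE) auto

lemma start_variance_nonneg: "0 \<le> start_variance"
  unfolding start_variance_def by (intro integral_nonneg_AE) auto

lemma measurable_noise_coord:
  assumes "i \<le> n" shows "(\<lambda>v. v i) \<in> borel_measurable (PiM {..n} (noise_law d))"
  using measurable_component_singleton[of i "{..n}" "noise_law d"] assms
  by (simp cong: measurable_cong_sets add: noise_law)

lemma measurable_scheme_PiM:
  assumes "0 \<le> d"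
  shows "(\<lambda>v. scheme d (v 0) (\<lambda>i. v (Suc i)) n) \<in> borel_measurable (PiM {..n} (noise_law d))"
  by (intro measurable_scheme assms measurable_noise_coord) auto

lemma nn_integral_PiM_atMost_Suc:
  assumes f: "f \<in> borel_measurable (PiM {..Suc n} (noise_law d))"
  shows "(\<integral>\<^sup>+ v. f v \<partial>PiM {..Suc n} (noise_law d))
    = (\<integral>\<^sup>+ v. (\<integral>\<^sup>+ x. f (v(Suc n := x)) \<partial>gauss_law (sqrt (2 * d))) \<partial>PiM {..n} (noise_law d))"
proof -
  interpret P: prob_space "noise_law d (Suc n)" by (rule noise_law)
  interpret I: prob_space "PiM {..n} (noise_law d)" by (rule prob_space_PiM) (rule noise_law)
  interpret pair_sigma_finite "noise_law d (Suc n)" "PiM {..n} (noise_law d)" ..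
  note f' = f[unfolded atMost_Suc]
  have upd: "(\<lambda>(x, v). v(Suc n := x)) \<in> measurable (noise_law d (Suc n) \<Otimes>\<^sub>M PiM {..n} (noise_law d)) (PiM (insert (Suc n) {..n}) (noise_law d))"
    using measurable_compose[OF measurable_pair_swap' measurable_add_dim[of "Suc n" "{..n}" "noise_law d"]]
    by (simp add: split_beta')
  have "(\<integral>\<^sup>+ v. f v \<partial>PiM {..Suc n} (noise_law d))
      = (\<integral>\<^sup>+ v. f v \<partial>distr (noise_law d (Suc n) \<Otimes>\<^sub>M PiM {..n} (noise_law d)) (PiM (insert (Suc n) {..n}) (noise_law d)) (\<lambda>(x, v). v(Suc n := x)))"
    unfolding atMost_Suc by (subst distr_pair_PiM_eq_PiM) (auto intro: noise_law)
  also have "\<dots> = (\<integral>\<^sup>+ z. f ((snd z)(Suc n := fst z)) \<partial>(noise_law d (Suc n) \<Otimes>\<^sub>M PiM {..n} (noise_law d)))"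
    using upd f' by (subst nn_integral_distr) (auto simp: split_beta')
  also have "\<dots> = (\<integral>\<^sup>+ v. (\<integral>\<^sup>+ x. f (v(Suc n := x)) \<partial>noise_law d (Suc n)) \<partial>PiM {..n} (noise_law d))"
  proof -
    have "(\<lambda>z. f ((snd z)(Suc n := fst z))) \<in> borel_measurable (noise_law d (Suc n) \<Otimes>\<^sub>M PiM {..n} (noise_law d))"
      using measurable_compose[OF upd f'] by (simp add: split_beta')
    from nn_integral_snd[OF this] show ?thesis by simp
  qed
  finally show ?thesis by (simp add: noise_law_def)
qed

lemma cosh_euler_step:
  assumes d: "0 \<le> d"
  shows "(\<integral>\<^sup>+ x. ennreal (cosh (euler_step d (z + x))) \<partial>gauss_law (sqrt (2 * d)))
    \<le> ennreal (cosh z * exp ((1 + \<bar>c\<bar>) * d))"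
proof -
  have "cosh (euler_step d y) \<le> cosh (d * c + y)" for y
  proof -
    have "0 \<le> euler_step d y" "0 \<le> d * euler_step d y ^ k" using d by (simp_all add: euler_step_nonneg)
    then have "euler_step d y \<le> \<bar>d * c + y\<bar>" using euler_step_sum[OF d, of y] by linarith
    then have "cosh (euler_step d y) \<le> cosh \<bar>d * c + y\<bar>"
      using d by (subst cosh_real_nonneg_le_iff) (auto simp: euler_step_nonneg)
    then show ?thesis by (simp add: cosh_real_abs)
  qed
  then have "cosh (euler_step d (z + x)) \<le> cosh ((d * c + z) + x)" for x
    by (metis add.assoc)
  then have "(\<integral>\<^sup>+ x. ennreal (cosh (euler_step d (z + x))) \<partial>gauss_law (sqrt (2 * d)))
      \<le> (\<integral>\<^sup>+ x. ennreal (cosh ((d * c + z) + x)) \<partial>gauss_law (sqrt (2 * d)))"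
    by (intro nn_integral_mono ennreal_leI)
  also have "\<dots> = ennreal (cosh (z + d * c) * exp d)"
    unfolding gauss_law_cosh using d by (simp add: add.commute)
  also have "\<dots> \<le> ennreal (cosh z * exp ((1 + \<bar>c\<bar>) * d))"
  proof (rule ennreal_leI)
    have "cosh (z + d * c) * exp d \<le> (cosh z * exp \<bar>d * c\<bar>) * exp d"
      by (intro mult_right_mono cosh_add_le) auto
    also have "\<dots> = cosh z * exp ((1 + \<bar>c\<bar>) * d)"
      using d by (simp add: abs_mult exp_add[symmetric] algebra_simps)
    finally show "cosh (z + d * c) * exp d \<le> cosh z * exp ((1 + \<bar>c\<bar>) * d)" .
  qed
  finally show ?thesis .
qed

text \<open>Integrating out the last increment costs one factor of \<open>cosh_euler_step\<close>;
  over n steps these depend only on the elapsed time n d and not on the mesh.\<close>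

lemma cosh_scheme_PiM:
  assumes d: "0 \<le> d"
  shows "(\<integral>\<^sup>+ v. ennreal (cosh (scheme d (v 0) (\<lambda>i. v (Suc i)) n)) \<partial>PiM {..n} (noise_law d))
    \<le> ennreal (cosh_mean * exp ((1 + \<bar>c\<bar>) * (real n * d)))"
proof (induction n)
  case 0
  interpret prob_space "noise_law d i" for i by (rule noise_law)
  interpret product_sigma_finite "noise_law d" by unfold_locales
  have "(\<lambda>x. ennreal (cosh x)) \<in> borel_measurable (noise_law d 0)"
    by (simp add: measurable_cong_sets[OF noise_law(2) refl])
  from product_nn_integral_singleton[OF this]
  have "(\<integral>\<^sup>+ v. ennreal (cosh (v 0)) \<partial>PiM {0} (noise_law d)) = (\<integral>\<^sup>+ x. ennreal (cosh x) \<partial>stat_law c k)"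
    by (simp add: noise_law_def)
  also have "\<dots> = ennreal cosh_mean"
    unfolding cosh_mean_def using integrable_cosh_stat_law[OF k_pos] by (intro nn_integral_eq_integral) auto
  finally show ?case by simp
next
  case (Suc n)
  let ?F = "\<lambda>n v. scheme d (v 0) (\<lambda>i. v (Suc i)) n"
  have step: "?F (Suc n) (v(Suc n := x)) = euler_step d (?F n v + x)" for v x
  proof -
    have "scheme d (v 0) (\<lambda>i. (v(Suc n := x)) (Suc i)) n = ?F n v" by (rule scheme_cong) auto
    then show ?thesis by (simp add: scheme.simps(2))
  qed
  have meas: "(\<lambda>v. ennreal (cosh (?F n v))) \<in> borel_measurable (PiM {..n} (noise_law d))" for n
    using measurable_scheme_PiM[OF d, of n] by measurable
  have "(\<integral>\<^sup>+ v. ennreal (cosh (?F (Suc n) v)) \<partial>PiM {..Suc n} (noise_law d))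
      = (\<integral>\<^sup>+ v. (\<integral>\<^sup>+ x. ennreal (cosh (euler_step d (?F n v + x))) \<partial>gauss_law (sqrt (2 * d))) \<partial>PiM {..n} (noise_law d))"
    using nn_integral_PiM_atMost_Suc[OF meas[of "Suc n"]] unfolding step .
  also have "\<dots> \<le> (\<integral>\<^sup>+ v. ennreal (exp ((1 + \<bar>c\<bar>) * d)) * ennreal (cosh (?F n v)) \<partial>PiM {..n} (noise_law d))"
    by (intro nn_integral_mono order_trans[OF cosh_euler_step[OF d]]) (simp add: ennreal_mult'[symmetric] mult.commute)
  also have "\<dots> = ennreal (exp ((1 + \<bar>c\<bar>) * d)) * (\<integral>\<^sup>+ v. ennreal (cosh (?F n v)) \<partial>PiM {..n} (noise_law d))"
    by (rule nn_integral_cmult) (rule meas)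
  also have "\<dots> \<le> ennreal (exp ((1 + \<bar>c\<bar>) * d)) * ennreal (cosh_mean * exp ((1 + \<bar>c\<bar>) * (real n * d)))"
    by (intro mult_left_mono Suc) auto
  also have "\<dots> = ennreal (cosh_mean * exp ((1 + \<bar>c\<bar>) * (real (Suc n) * d)))"
    by (simp add: ennreal_mult'[symmetric] exp_add[symmetric] algebra_simps cosh_mean_nonneg)
  finally show ?case .
qed

lemma integrable_stat_law_square: "integrable (stat_law c k) (\<lambda>x. x\<^sup>2)"
proof (rule Bochner_Integration.integrable_bound[of _ "\<lambda>x. 2 * fact 2 * cosh x"])
  show "integrable (stat_law c k) (\<lambda>x. 2 * fact 2 * cosh x)"
    using integrable_cosh_stat_law[OF k_pos] by simp
  show "(\<lambda>x. x\<^sup>2) \<in> borel_measurable (stat_law c k)"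
    by (simp add: measurable_cong_sets[OF sets_stat_law refl])
  show "AE x in stat_law c k. norm (x\<^sup>2) \<le> norm (2 * fact 2 * cosh x)"
    using power_le_cosh[of _ 1] by (intro AE_I2) simp
qed

lemma measurable_outflow_PiM:
  assumes d: "0 \<le> d"
  shows "outflow d n \<in> borel_measurable (PiM {..n} (noise_law d))"
proof -
  have 1: "(\<lambda>v. v (Suc i)) \<in> borel_measurable (PiM {..n} (noise_law d))" if "i < n" for i
    using that by (intro measurable_noise_coord) auto
  have 2: "(\<lambda>v. scheme d (v 0) (\<lambda>i. v (Suc i)) (Suc i)) \<in> borel_measurable (PiM {..n} (noise_law d))" if "i < n" for i
    by (intro measurable_scheme d measurable_noise_coord) (use that in auto)
  show ?thesis
    unfolding outflow_def drift_sum_def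
    by (intro borel_measurable_diff borel_measurable_sum borel_measurable_times borel_measurable_const borel_measurable_power 1 2) auto
qed

text \<open>The coordinate variances of \<open>lipschitz_variance_PiM\<close> are that of the
  starting point and 2 d for each of the n increments.\<close>

lemma outflow_PiM:
  assumes d: "0 \<le> d"
  shows "\<exists>a. (\<integral>\<^sup>+ v. ennreal ((outflow d n v - a)\<^sup>2) \<partial>PiM {..n} (noise_law d))
    \<le> ennreal (start_variance + 2 * (real n * d))"
proof -
  have "\<exists>a. (\<integral>\<^sup>+ v. ennreal ((outflow d n v - a)\<^sup>2) \<partial>PiM {..n} (noise_law d))
      \<le> ennreal (\<Sum>i\<in>{..n}. LINT x|noise_law d i. (x - (LINT y|noise_law d i. y))\<^sup>2)"
  proof (rule lipschitz_variance_PiM)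
    show "integrable (noise_law d i) (\<lambda>x. x\<^sup>2)" for i
      by (simp add: noise_law_def integrable_stat_law_square integrable_gauss_law_square)
  qed (use outflow_lipschitz[OF d] measurable_outflow_PiM[OF d] in \<open>auto simp: noise_law\<close>)
  moreover have "(\<Sum>i\<in>{..n}. LINT x|noise_law d i. (x - (LINT y|noise_law d i. y))\<^sup>2) = start_variance + 2 * (real n * d)"
  proof -
    have "(\<Sum>i\<in>{..n}. LINT x|noise_law d i. (x - (LINT y|noise_law d i. y))\<^sup>2)
       = start_variance + (\<Sum>i<n. 2 * d)"
      unfolding lessThan_Suc_atMost[symmetric] sum.lessThan_Suc_shift
      using d by (simp add: noise_law_def start_variance_def gauss_law_mean gauss_law_second_moment)
    then show ?thesis by simp
  qed
  ultimately show ?thesis by simp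
qed

context
  fixes M :: "'a measure" and B Z L
  assumes rd: "refl_diffusion_setup M c k B Z L"
begin

lemma nn_integral_noise_vec:
  assumes d: "0 \<le> d" and f: "f \<in> borel_measurable (PiM {..n} (noise_law d))"
  shows "(\<integral>\<^sup>+ \<omega>. f (\<lambda>i\<in>{..n}. noise_vec B Z d i \<omega>) \<partial>M) = (\<integral>\<^sup>+ v. f v \<partial>PiM {..n} (noise_law d))"
proof -
  have sets: "sets (PiM {..n} (\<lambda>_. borel)) = sets (PiM {..n} (noise_law d))"
    by (rule sets_PiM_cong) (auto simp: noise_law)
  have "f \<in> borel_measurable (PiM {..n} (\<lambda>_. borel))"
    using f by (simp add: measurable_cong_sets[OF sets refl])
  moreover have "(\<lambda>\<omega>. \<lambda>i\<in>{..n}. noise_vec B Z d i \<omega>) \<in> measurable M (PiM {..n} (\<lambda>_. borel))"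
    by (intro measurable_restrict measurable_noise_vec[OF rd d])
  ultimately show ?thesis
    unfolding joint_law[OF rd d, symmetric] by (subst nn_integral_distr) auto
qed

lemma scheme_noise_vec:
  fixes n :: nat and d :: real
  assumes "\<omega> \<in> space M"
  defines "v \<equiv> \<lambda>i\<in>{..n}. noise_vec B Z d i \<omega>"
  shows "m \<le> n \<Longrightarrow> scheme d (v 0) (\<lambda>i. v (Suc i)) m = scheme d (driver B Z \<omega> 0) (increments (driver B Z \<omega>) d) m"
proof -
  assume m: "m \<le> n"
  have "scheme d (v 0) (\<lambda>i. v (Suc i)) m = scheme d (v 0) (increments (driver B Z \<omega>) d) m"
    by (rule scheme_cong) (use m in \<open>auto simp: v_def noise_vec_def\<close>)
  moreover have "v 0 = driver B Z \<omega> 0"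
    using driver_0[OF rd assms(1)] by (simp add: v_def noise_vec_def)
  ultimately show ?thesis by simp
qed

lemma outflow_noise_vec:
  assumes \<omega>: "\<omega> \<in> space M"
  shows "outflow d n (\<lambda>i\<in>{..n}. noise_vec B Z d i \<omega>)
    = sqrt 2 * B (real n * d) \<omega> - drift_sum d (driver B Z \<omega> 0) (increments (driver B Z \<omega>) d) n"
proof -
  have "(\<Sum>i<n. (\<lambda>i\<in>{..n}. noise_vec B Z d i \<omega>) (Suc i)) = (\<Sum>i<n. driver B Z \<omega> (real (Suc i) * d) - driver B Z \<omega> (real i * d))"
    by (intro sum.cong) (auto simp: noise_vec_def increments_def)
  also have "\<dots> = driver B Z \<omega> (real n * d) - driver B Z \<omega> 0"
    using sum_lessThan_telescope[of "\<lambda>i. driver B Z \<omega> (real i * d)" n] by simp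
  also have "\<dots> = sqrt 2 * B (real n * d) \<omega>"
    using driver_0[OF rd \<omega>] by (simp add: driver_def)
  finally have 1: "(\<Sum>i<n. (\<lambda>i\<in>{..n}. noise_vec B Z d i \<omega>) (Suc i)) = sqrt 2 * B (real n * d) \<omega>" .
  have 2: "drift_sum d ((\<lambda>i\<in>{..n}. noise_vec B Z d i \<omega>) 0) (\<lambda>i. (\<lambda>i\<in>{..n}. noise_vec B Z d i \<omega>) (Suc i)) n
      = drift_sum d (driver B Z \<omega> 0) (increments (driver B Z \<omega>) d) n"
    unfolding drift_sum_def by (intro sum.cong refl) (use scheme_noise_vec[OF \<omega>] in auto)
  show ?thesis unfolding outflow_def 1 2 ..
qed

lemma measurable_scheme_driver:
  assumes d: "0 \<le> d"
  shows "(\<lambda>\<omega>. scheme d (driver B Z \<omega> 0) (increments (driver B Z \<omega>) d) n) \<in> borel_measurable M"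
proof (rule measurable_scheme[OF d])
  have dr: "(\<lambda>\<omega>. driver B Z \<omega> t) \<in> borel_measurable M" if "0 \<le> t" for t
    unfolding driver_def using rd_measurable_B[OF rd that] rd_measurable_Z[OF rd order_refl] by measurable
  show "(\<lambda>\<omega>. driver B Z \<omega> 0) \<in> borel_measurable M" by (rule dr) simp
  show "(\<lambda>\<omega>. increments (driver B Z \<omega>) d i) \<in> borel_measurable M" for i
    unfolding increments_def using d by (intro borel_measurable_diff dr) auto
qed

lemma measurable_drift_sum_driver:
  assumes d: "0 \<le> d"
  shows "(\<lambda>\<omega>. drift_sum d (driver B Z \<omega> 0) (increments (driver B Z \<omega>) d) n) \<in> borel_measurable M"
  unfolding drift_sum_def
  by (intro borel_measurable_sum borel_measurable_times borel_measurable_const borel_measurable_power measurable_scheme_driver d)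

text \<open>For every mesh the discretised functional obeys \<open>outflow_PiM\<close> with the same
  bound, and it converges for each outcome by \<open>drift_sum_tendsto\<close>; the factor 5 is that
  of \<open>variance_limit_bound\<close>.\<close>

lemma outflow_variance:
  assumes t: "0 < t"
  shows "(LINT \<omega>|M. (sqrt 2 * B t \<omega> - integral {0..t} (\<lambda>s. Z s \<omega> ^ k)
      - (LINT \<omega>|M. sqrt 2 * B t \<omega> - integral {0..t} (\<lambda>s. Z s \<omega> ^ k)))\<^sup>2) \<le> 5 * (start_variance + 2 * t)"
proof -
  interpret prob_space M by (rule rd_prob_space[OF rd])
  define d where "d n = t / real (Suc n)" for n
  have d: "0 \<le> d n" "real (Suc n) * d n = t" for n using t by (simp_all add: d_def)
  let ?A = "\<lambda>n \<omega>. drift_sum (d n) (driver B Z \<omega> 0) (increments (driver B Z \<omega>) (d n)) (Suc n)"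
  have "\<exists>a. (\<integral>\<^sup>+ \<omega>. ennreal ((sqrt 2 * B t \<omega> - ?A n \<omega> - a)\<^sup>2) \<partial>M) \<le> ennreal (start_variance + 2 * t)" for n
  proof -
    obtain a where a: "(\<integral>\<^sup>+ v. ennreal ((outflow (d n) (Suc n) v - a)\<^sup>2) \<partial>PiM {..Suc n} (noise_law (d n)))
        \<le> ennreal (start_variance + 2 * t)"
      using outflow_PiM[OF d(1), of "Suc n" n] unfolding d(2) by blast
    note [measurable] = measurable_outflow_PiM[OF d(1)]
    have "(\<integral>\<^sup>+ \<omega>. ennreal ((sqrt 2 * B t \<omega> - ?A n \<omega> - a)\<^sup>2) \<partial>M)
        = (\<integral>\<^sup>+ \<omega>. ennreal ((outflow (d n) (Suc n) (\<lambda>i\<in>{..Suc n}. noise_vec B Z (d n) i \<omega>) - a)\<^sup>2) \<partial>M)"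
      using outflow_noise_vec[of _ "d n" "Suc n", unfolded d(2)] by (intro nn_integral_cong) simp
    also have "\<dots> = (\<integral>\<^sup>+ v. ennreal ((outflow (d n) (Suc n) v - a)\<^sup>2) \<partial>PiM {..Suc n} (noise_law (d n)))"
      by (rule nn_integral_noise_vec[OF d(1)]) measurable
    finally show ?thesis using a by (intro exI[of _ a]) (simp only:)
  qed
  then have "\<forall>n. \<exists>a. (\<integral>\<^sup>+ \<omega>. ennreal ((sqrt 2 * B t \<omega> - ?A n \<omega> - a)\<^sup>2) \<partial>M) \<le> ennreal (start_variance + 2 * t)"
    by (rule allI)
  from choice[OF this] obtain a where
    a: "\<forall>n. (\<integral>\<^sup>+ \<omega>. ennreal ((sqrt 2 * B t \<omega> - ?A n \<omega> - a n)\<^sup>2) \<partial>M) \<le> ennreal (start_variance + 2 * t)"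
    by (elim exE)
  show ?thesis
  proof (rule variance_limit_bound[where Yn="\<lambda>n \<omega>. sqrt 2 * B t \<omega> - ?A n \<omega>" and a=a])
    show "(\<lambda>\<omega>. sqrt 2 * B t \<omega> - ?A n \<omega>) \<in> borel_measurable M" for n
      using t by (intro borel_measurable_diff borel_measurable_times borel_measurable_const
          measurable_drift_sum_driver d rd_measurable_B[OF rd]) auto
    show "(\<lambda>n. sqrt 2 * B t \<omega> - ?A n \<omega>) \<longlonglongrightarrow> sqrt 2 * B t \<omega> - integral {0..t} (\<lambda>s. Z s \<omega> ^ k)" if "\<omega> \<in> space M" for \<omega>
      unfolding d_def by (intro tendsto_intros drift_sum_tendsto[OF rd_solution[OF rd that] t])
    show "0 < start_variance + 2 * t" using t start_variance_nonneg by linarith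
  qed (rule a[rule_format])
qed

definition drift_const :: real where
  "drift_const = 2 * fact (2 * k) * cosh_mean * exp (1 + \<bar>c\<bar>)"

lemma drift_const_nonneg: "0 \<le> drift_const"
  by (simp add: drift_const_def cosh_mean_nonneg)

text \<open>Cauchy--Schwarz turns the square of the Riemann sum into t d times the sum of the powers
  2 k of the states. Each of these is at most a multiple of cosh, whose mean is bounded for times up
  to 1, and Fatou passes to the integral.\<close>

lemma drift_second_moment:
  assumes t: "0 < t" "t \<le> 1"
  shows "(\<lambda>\<omega>. integral {0..t} (\<lambda>s. Z s \<omega> ^ k)) \<in> borel_measurable M"
    and "(\<integral>\<^sup>+ \<omega>. ennreal ((integral {0..t} (\<lambda>s. Z s \<omega> ^ k))\<^sup>2) \<partial>M) \<le> ennreal (drift_const * t\<^sup>2)"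
proof -
  interpret prob_space M by (rule rd_prob_space[OF rd])
  define d where "d n = t / real (Suc n)" for n
  have d: "0 \<le> d n" "real (Suc n) * d n = t" for n using t by (simp_all add: d_def)
  let ?\<zeta> = "\<lambda>n \<omega>. scheme (d n) (driver B Z \<omega> 0) (increments (driver B Z \<omega>) (d n))"
  let ?A = "\<lambda>n \<omega>. drift_sum (d n) (driver B Z \<omega> 0) (increments (driver B Z \<omega>) (d n)) (Suc n)"
  have [measurable]: "?A n \<in> borel_measurable M" for n by (rule measurable_drift_sum_driver[OF d(1)])
  have lim: "(\<lambda>n. ?A n \<omega>) \<longlonglongrightarrow> integral {0..t} (\<lambda>s. Z s \<omega> ^ k)" if "\<omega> \<in> space M" for \<omega>
    unfolding d_def by (intro drift_sum_tendsto[OF rd_solution[OF rd that] t(1)])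
  show m[measurable]: "(\<lambda>\<omega>. integral {0..t} (\<lambda>s. Z s \<omega> ^ k)) \<in> borel_measurable M"
    by (rule borel_measurable_LIMSEQ_real[OF lim]) measurable
  have cosh_le: "(\<integral>\<^sup>+ \<omega>. ennreal (cosh (?\<zeta> n \<omega> i)) \<partial>M) \<le> ennreal (cosh_mean * exp (1 + \<bar>c\<bar>))" if i: "i \<le> Suc n" for n i
  proof -
    have "(\<integral>\<^sup>+ \<omega>. ennreal (cosh (?\<zeta> n \<omega> i)) \<partial>M)
        = (\<integral>\<^sup>+ v. ennreal (cosh (scheme (d n) (v 0) (\<lambda>j. v (Suc j)) i)) \<partial>PiM {..i} (noise_law (d n)))"
    proof (subst nn_integral_noise_vec[OF d(1), symmetric])
      show "(\<lambda>v. ennreal (cosh (scheme (d n) (v 0) (\<lambda>j. v (Suc j)) i))) \<in> borel_measurable (PiM {..i} (noise_law (d n)))"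
        using measurable_scheme_PiM[OF d(1)] by measurable
    qed (intro nn_integral_cong, use scheme_noise_vec[of _ i i "d n"] in simp)
    also have "\<dots> \<le> ennreal (cosh_mean * exp ((1 + \<bar>c\<bar>) * (real i * d n)))"
      by (rule cosh_scheme_PiM[OF d(1)])
    also have "\<dots> \<le> ennreal (cosh_mean * exp (1 + \<bar>c\<bar>))"
    proof -
      have "real i * d n \<le> real (Suc n) * d n" using i d by (intro mult_right_mono) auto
      then have "real i * d n \<le> 1" using d(2)[of n] t by linarith
      then have "(1 + \<bar>c\<bar>) * (real i * d n) \<le> (1 + \<bar>c\<bar>) * 1" by (intro mult_left_mono) auto
      then show ?thesis by (intro ennreal_leI mult_left_mono cosh_mean_nonneg) simp
    qed
    finally show ?thesis .
  qed
  have second: "(\<integral>\<^sup>+ \<omega>. ennreal ((?A n \<omega>)\<^sup>2) \<partial>M) \<le> ennreal (drift_const * t\<^sup>2)" for n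
  proof -
    define K :: real where "K = t * d n * (2 * fact (2 * k))"
    have K: "0 \<le> K" using t d by (simp add: K_def)
    have pt: "(?A n \<omega>)\<^sup>2 \<le> K * (\<Sum>i<Suc n. cosh (?\<zeta> n \<omega> (Suc i)))" for \<omega>
    proof -
      have "(?A n \<omega>)\<^sup>2 = (d n)\<^sup>2 * (\<Sum>i<Suc n. ?\<zeta> n \<omega> (Suc i) ^ k)\<^sup>2"
        unfolding drift_sum_def sum_distrib_left[symmetric] by (simp add: power_mult_distrib)
      also have "\<dots> \<le> (d n)\<^sup>2 * (real (Suc n) * (\<Sum>i<Suc n. (?\<zeta> n \<omega> (Suc i) ^ k)\<^sup>2))"
        using sum_squared_le_sum_of_squares[of "\<lambda>i. ?\<zeta> n \<omega> (Suc i) ^ k" "{..<Suc n}"]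
        by (intro mult_left_mono) (auto simp: mult.commute)
      also have "\<dots> = t * d n * (\<Sum>i<Suc n. ?\<zeta> n \<omega> (Suc i) ^ (2 * k))"
      proof -
        have "(d n)\<^sup>2 * (real (Suc n) * x) = t * d n * x" for x
          using d(2)[of n] by (simp only: power2_eq_square) (metis mult.assoc mult.commute)
        then show ?thesis by (simp add: power_mult[symmetric] mult.commute[of k 2] del: of_nat_Suc)
      qed
      also have "\<dots> \<le> t * d n * (\<Sum>i<Suc n. 2 * fact (2 * k) * cosh (?\<zeta> n \<omega> (Suc i)))"
        using t d by (intro mult_left_mono sum_mono power_le_cosh) auto
      also have "\<dots> = K * (\<Sum>i<Suc n. cosh (?\<zeta> n \<omega> (Suc i)))"
        unfolding sum_distrib_left[symmetric] by (simp add: K_def mult.assoc)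
      finally show ?thesis .
    qed
    have meas: "(\<lambda>\<omega>. ennreal (cosh (?\<zeta> n \<omega> i))) \<in> borel_measurable M" for i
      using measurable_scheme_driver[OF d(1)] by measurable
    have "(\<integral>\<^sup>+ \<omega>. ennreal ((?A n \<omega>)\<^sup>2) \<partial>M) \<le> (\<integral>\<^sup>+ \<omega>. ennreal K * (\<Sum>i<Suc n. ennreal (cosh (?\<zeta> n \<omega> (Suc i)))) \<partial>M)"
    proof (intro nn_integral_mono)
      fix \<omega>
      have "ennreal K * (\<Sum>i<Suc n. ennreal (cosh (?\<zeta> n \<omega> (Suc i)))) = ennreal (K * (\<Sum>i<Suc n. cosh (?\<zeta> n \<omega> (Suc i))))"
        using K by (subst sum_ennreal) (auto simp: ennreal_mult' sum_nonneg)
      then show "ennreal ((?A n \<omega>)\<^sup>2) \<le> ennreal K * (\<Sum>i<Suc n. ennreal (cosh (?\<zeta> n \<omega> (Suc i))))"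
        using pt by (simp only: ennreal_leI)
    qed
    also have "\<dots> = ennreal K * (\<Sum>i<Suc n. \<integral>\<^sup>+ \<omega>. ennreal (cosh (?\<zeta> n \<omega> (Suc i))) \<partial>M)"
    proof -
      have "(\<lambda>\<omega>. \<Sum>i<Suc n. ennreal (cosh (?\<zeta> n \<omega> (Suc i)))) \<in> borel_measurable M"
        by (intro borel_measurable_sum meas)
      then show ?thesis by (simp only: nn_integral_cmult nn_integral_sum meas)
    qed
    also have "\<dots> \<le> ennreal K * (\<Sum>i<Suc n. ennreal (cosh_mean * exp (1 + \<bar>c\<bar>)))"
      by (intro mult_left_mono sum_mono cosh_le) auto
    also have "\<dots> = ennreal (K * (real (Suc n) * (cosh_mean * exp (1 + \<bar>c\<bar>))))"
      using K cosh_mean_nonneg by (subst sum_ennreal) (auto simp: ennreal_mult' simp del: sum.lessThan_Suc)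
    also have "K * (real (Suc n) * (cosh_mean * exp (1 + \<bar>c\<bar>))) = drift_const * t\<^sup>2"
    proof -
      have "K * (real (Suc n) * (cosh_mean * exp (1 + \<bar>c\<bar>)))
          = t * (real (Suc n) * d n) * (2 * fact (2 * k) * (cosh_mean * exp (1 + \<bar>c\<bar>)))"
        unfolding K_def by (simp only: mult_ac)
      then show ?thesis unfolding d(2) drift_const_def power2_eq_square by (simp only: mult_ac)
    qed
    finally show ?thesis .
  qed
  have "(\<integral>\<^sup>+ \<omega>. ennreal ((integral {0..t} (\<lambda>s. Z s \<omega> ^ k))\<^sup>2) \<partial>M) = (\<integral>\<^sup>+ \<omega>. liminf (\<lambda>n. ennreal ((?A n \<omega>)\<^sup>2)) \<partial>M)"
  proof (rule nn_integral_cong)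
    fix \<omega> assume "\<omega> \<in> space M"
    then have "(\<lambda>n. ennreal ((?A n \<omega>)\<^sup>2)) \<longlonglongrightarrow> ennreal ((integral {0..t} (\<lambda>s. Z s \<omega> ^ k))\<^sup>2)"
      using lim by (intro tendsto_ennrealI tendsto_intros) auto
    then show "ennreal ((integral {0..t} (\<lambda>s. Z s \<omega> ^ k))\<^sup>2) = liminf (\<lambda>n. ennreal ((?A n \<omega>)\<^sup>2))"
      by (intro lim_imp_Liminf[symmetric]) auto
  qed
  also have "\<dots> \<le> liminf (\<lambda>n. \<integral>\<^sup>+ \<omega>. ennreal ((?A n \<omega>)\<^sup>2) \<partial>M)"
    by (rule nn_integral_liminf) measurable
  also have "\<dots> \<le> liminf (\<lambda>n. ennreal (drift_const * t\<^sup>2))"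
    by (intro Liminf_mono always_eventually allI second)
  finally show "(\<integral>\<^sup>+ \<omega>. ennreal ((integral {0..t} (\<lambda>s. Z s \<omega> ^ k))\<^sup>2) \<partial>M) \<le> ennreal (drift_const * t\<^sup>2)"
    by (simp add: Liminf_const)
qed

text \<open>The Brownian part is the X of \<open>variance_perturbation\<close> and the drift
  integral its A, with \<open>drift_const\<close> as C.\<close>

lemma outflow_variance_small_time:
  assumes t: "0 < t" "t \<le> 1"
  shows "\<bar>(LINT \<omega>|M. (sqrt 2 * B t \<omega> - integral {0..t} (\<lambda>s. Z s \<omega> ^ k)
      - (LINT \<omega>|M. sqrt 2 * B t \<omega> - integral {0..t} (\<lambda>s. Z s \<omega> ^ k)))\<^sup>2) - 2 * t\<bar>
    \<le> (2 + drift_const) * t * sqrt t + drift_const * t\<^sup>2"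
proof -
  interpret prob_space M by (rule rd_prob_space[OF rd])
  have [measurable]: "B t \<in> borel_measurable M" using t by (intro rd_measurable_B[OF rd]) auto
  have law: "distr M borel (\<lambda>\<omega>. sqrt 2 * B t \<omega>) = gauss_law (sqrt (2 * t))"
  proof -
    have "distr M borel (\<lambda>\<omega>. sqrt 2 * B t \<omega>) = distr M borel (noise_vec B Z t (Suc 0))"
    proof (rule distr_cong)
      fix \<omega> assume "\<omega> \<in> space M"
      then have "B 0 \<omega> = 0" using rd_brownian[OF rd] unfolding std_brownian_motion_def by auto
      then show "sqrt 2 * B t \<omega> = noise_vec B Z t (Suc 0) \<omega>" unfolding noise_vec_Suc[OF rd] by simp
    qed auto
    then show ?thesis using distr_noise_vec[OF rd, of t "Suc 0"] t by (simp add: noise_law_def)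
  qed
  show ?thesis
  proof (rule variance_perturbation)
    have "integrable (distr M borel (\<lambda>\<omega>. sqrt 2 * B t \<omega>)) (\<lambda>x. x\<^sup>2)"
      unfolding law by (rule integrable_gauss_law_square)
    then show "integrable M (\<lambda>\<omega>. (sqrt 2 * B t \<omega>)\<^sup>2)" by (subst (asm) integrable_distr_eq) auto
    have "(LINT x|distr M borel (\<lambda>\<omega>. sqrt 2 * B t \<omega>). x) = 0" unfolding law by (rule gauss_law_mean)
    then show "expectation (\<lambda>\<omega>. sqrt 2 * B t \<omega>) = 0" by (subst (asm) integral_distr) auto
    have "(LINT x|distr M borel (\<lambda>\<omega>. sqrt 2 * B t \<omega>). x\<^sup>2) = 2 * t"
      unfolding law gauss_law_second_moment using t by simp
    then show "expectation (\<lambda>\<omega>. (sqrt 2 * B t \<omega>)\<^sup>2) = 2 * t" by (subst (asm) integral_distr) auto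
  qed (use t drift_second_moment[OF t] drift_const_nonneg in auto)
qed

end
end

section \<open>Nonnegativity, boundedness and behaviour at 0 of \<open>w_fun\<close>\<close>

text \<open>Since a realisation exists, the value picked by \<open>SOME\<close> belongs to one, and
  every bound proved for an arbitrary realisation is a bound for \<open>w_fun\<close>.\<close>

lemma w_fun_realisation:
  assumes k: "1 \<le> k" and t: "t \<noteq> 0"
  obtains M :: "(nat \<Rightarrow> real) measure" and B Z L where "refl_diffusion_setup M c k B Z L"
    "w_fun c k t = (LINT \<omega>|M. (sqrt 2 * B t \<omega> - integral {0..t} (\<lambda>s. Z s \<omega> ^ k)
      - (LINT \<omega>|M. sqrt 2 * B t \<omega> - integral {0..t} (\<lambda>s. Z s \<omega> ^ k)))\<^sup>2) / (2 * t)"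
proof -
  interpret power_drift c k by standard (rule k)
  let ?P = "\<lambda>v. \<exists>(M :: (nat \<Rightarrow> real) measure) B Z L. refl_diffusion_setup M c k B Z L \<and>
        (let Y = (\<lambda>\<omega>. sqrt 2 * B t \<omega> - integral {0..t} (\<lambda>s. (Z s \<omega>) ^ k)) in
         v = (LINT \<omega>|M. (Y \<omega> - (LINT \<omega>'|M. Y \<omega>'))\<^sup>2) / (2 * t))"
  have "\<exists>v. ?P v" using refl_diffusion_setup_exists unfolding Let_def by blast
  then have "?P (SOME v. ?P v)" by (rule someI_ex)
  then have "?P (w_fun c k t)" unfolding w_fun_def using t by simp
  then show ?thesis using that unfolding Let_def by blast
qed

lemma w_fun_nonneg:
  assumes k: "1 \<le> k" and t: "0 \<le> t"
  shows "0 \<le> w_fun c k t"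
proof (cases "t = 0")
  case True
  then show ?thesis by (simp add: w_fun_def)
next
  case False
  obtain M :: "(nat \<Rightarrow> real) measure" and B Z L where
    "w_fun c k t = (LINT \<omega>|M. (sqrt 2 * B t \<omega> - integral {0..t} (\<lambda>s. Z s \<omega> ^ k)
      - (LINT \<omega>|M. sqrt 2 * B t \<omega> - integral {0..t} (\<lambda>s. Z s \<omega> ^ k)))\<^sup>2) / (2 * t)"
    using w_fun_realisation[OF k False] by blast
  then show ?thesis using t by (simp add: integral_nonneg_AE)
qed

lemma w_fun_large_time:
  assumes k: "1 \<le> k" and t: "0 < t"
  shows "w_fun c k t \<le> 5 * (power_drift.start_variance c k + 2 * t) / (2 * t)"
proof -
  interpret power_drift c k by standard (rule k)
  obtain M :: "(nat \<Rightarrow> real) measure" and B Z L where "refl_diffusion_setup M c k B Z L"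
    "w_fun c k t = (LINT \<omega>|M. (sqrt 2 * B t \<omega> - integral {0..t} (\<lambda>s. Z s \<omega> ^ k)
      - (LINT \<omega>|M. sqrt 2 * B t \<omega> - integral {0..t} (\<lambda>s. Z s \<omega> ^ k)))\<^sup>2) / (2 * t)"
    using w_fun_realisation[OF k, of t c] t by blast
  then show ?thesis using outflow_variance[of M B Z L t] t by (simp add: divide_right_mono)
qed

lemma w_fun_small_time:
  assumes k: "1 \<le> k"
  obtains C where "0 \<le> C" "\<And>t. 0 < t \<Longrightarrow> t \<le> 1 \<Longrightarrow> \<bar>w_fun c k t - 1\<bar> \<le> C * sqrt t"
proof -
  interpret power_drift c k by standard (rule k)
  define C where "C = 2 * fact (2 * k) * cosh_mean * exp (1 + \<bar>c\<bar>)"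
  have C: "0 \<le> C" by (simp add: C_def cosh_mean_nonneg)
  show ?thesis
  proof
    show "0 \<le> 1 + C" using C by simp
    fix t :: real assume t: "0 < t" "t \<le> 1"
    obtain M :: "(nat \<Rightarrow> real) measure" and B Z L where rd: "refl_diffusion_setup M c k B Z L"
      and w: "w_fun c k t = (LINT \<omega>|M. (sqrt 2 * B t \<omega> - integral {0..t} (\<lambda>s. Z s \<omega> ^ k)
        - (LINT \<omega>|M. sqrt 2 * B t \<omega> - integral {0..t} (\<lambda>s. Z s \<omega> ^ k)))\<^sup>2) / (2 * t)" (is "_ = ?V / (2 * t)")
      using w_fun_realisation[OF k, of t c] t by blast
    have "\<bar>?V - 2 * t\<bar> \<le> (2 + C) * t * sqrt t + C * t\<^sup>2"
      using outflow_variance_small_time[OF rd t] drift_const_def[OF rd] by (simp add: C_def)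
    also have "C * t\<^sup>2 \<le> C * t * sqrt t"
    proof -
      have "t \<le> sqrt t" using t by (simp add: real_le_rsqrt power2_eq_square mult_left_le)
      then have "(C * t) * t \<le> (C * t) * sqrt t" using C t by (intro mult_left_mono) auto
      then show ?thesis by (simp add: power2_eq_square mult.assoc)
    qed
    finally have "\<bar>?V - 2 * t\<bar> \<le> (1 + C) * sqrt t * (2 * t)" by (simp add: algebra_simps)
    then have "\<bar>?V - 2 * t\<bar> / (2 * t) \<le> (1 + C) * sqrt t" using t by (simp add: divide_le_eq)
    moreover have "w_fun c k t - 1 = (?V - 2 * t) / (2 * t)" unfolding w using t by (simp add: field_simps)
    ultimately show "\<bar>w_fun c k t - 1\<bar> \<le> (1 + C) * sqrt t" using t by simp
  qed
qed

text \<open>For t > 1 the variance of the starting point is divided by 2 t and stays bounded; times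
  up to 1 are covered by the estimate at 0.\<close>

lemma w_fun_bounded:
  assumes k: "1 \<le> k"
  obtains K where "1 \<le> K" "\<And>t. 0 \<le> t \<Longrightarrow> w_fun c k t \<le> K"
proof -
  interpret power_drift c k by standard (rule k)
  obtain C where C: "0 \<le> C" "\<And>t. 0 < t \<Longrightarrow> t \<le> 1 \<Longrightarrow> \<bar>w_fun c k t - 1\<bar> \<le> C * sqrt t"
    using w_fun_small_time[OF k] by blast
  define v where "v = start_variance"
  have v: "0 \<le> v" using start_variance_nonneg by (simp add: v_def)
  define K where "K = 11 + C + 5 * v"
  have "1 \<le> K" unfolding K_def using C(1) v by linarith
  moreover have "w_fun c k t \<le> K" if t: "0 \<le> t" for t
  proof -
    consider "t = 0" | "0 < t" "t \<le> 1" | "1 < t" using t by linarith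
    then show ?thesis
    proof cases
      case 1
      then show ?thesis using C(1) v by (simp add: w_fun_def K_def)
    next
      case 2
      then have "C * sqrt t \<le> C * 1" using C by (intro mult_left_mono) auto
      then show ?thesis using C(2)[OF 2] v unfolding K_def by linarith
    next
      case 3
      have "w_fun c k t \<le> 5 * (v + 2 * t) / (2 * t)"
        using 3 unfolding v_def by (intro w_fun_large_time[OF k]) auto
      also have "\<dots> = 5 * v / (2 * t) + 5" using 3 by (simp add: field_simps)
      also have "5 * v / (2 * t) \<le> 5 * v / 1"
        using 3 v by (intro divide_left_mono) auto
      finally show ?thesis using C(1) v by (simp add: K_def)
    qed
  qed
  ultimately show ?thesis by (rule that)
qed

lemma w_fun_tendsto:
  assumes k: "1 \<le> k"
  shows "(w_fun c k \<longlongrightarrow> 1) (at_right 0)"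
proof -
  obtain C where C: "0 \<le> C" "\<And>t. 0 < t \<Longrightarrow> t \<le> 1 \<Longrightarrow> \<bar>w_fun c k t - 1\<bar> \<le> C * sqrt t"
    using w_fun_small_time[OF k] by blast
  have "((\<lambda>t. w_fun c k t - 1) \<longlongrightarrow> 0) (at_right 0)"
  proof (rule Lim_null_comparison)
    show "\<forall>\<^sub>F t in at_right 0. norm (w_fun c k t - 1) \<le> C * sqrt t"
      unfolding eventually_at_right_field using C(2) by (intro exI[of _ 1]) auto
    have "((\<lambda>t. C * sqrt t) \<longlongrightarrow> C * sqrt 0) (at_right 0)" by (intro tendsto_intros)
    then show "((\<lambda>t. C * sqrt t) \<longlongrightarrow> 0) (at_right 0)" by simp
  qed
  then show ?thesis by (simp add: LIM_zero_iff)
qed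

section \<open>Index of dispersion of a stationary renewal process\<close>

lemma borel_measurable_tail:
  assumes "real_distribution G"
  shows "(\<lambda>x. measure G {x<..}) \<in> borel_measurable borel"
proof -
  interpret real_distribution G by (rule assms)
  have "mono (\<lambda>x. - measure G {x<..})"
    by (intro monoI) (auto intro!: finite_measure_mono)
  then have "(\<lambda>x. - (- measure G {x<..})) \<in> borel_measurable borel"
    by (intro borel_measurable_uminus borel_measurable_mono)
  then show ?thesis by simp
qed

lemma AE_equilibrium_measure_nonneg:
  assumes "real_distribution G"
  shows "AE x in equilibrium_measure G. 0 \<le> x"
  unfolding equilibrium_measure_def using borel_measurable_tail[OF assms] by (subst AE_density) auto

text \<open>Tonelli applied to the indicator of 0 \<le> x < u: the tail of a nonnegative variable
  integrates to its mean.\<close>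

lemma equilibrium_measure_prob_space:
  assumes G: "real_distribution G" "AE u in G. 0 \<le> u" "integrable G (\<lambda>u. u)" "(LINT u|G. u) = m" and m: "0 < m"
  shows "prob_space (equilibrium_measure G)"
proof
  interpret real_distribution G by (rule G)
  interpret pair_sigma_finite lborel G ..
  have sp: "space (equilibrium_measure G) = UNIV" by (simp add: equilibrium_measure_def)
  note tail_meas = borel_measurable_tail[OF real_distribution_axioms]
  have "emeasure (equilibrium_measure G) (space (equilibrium_measure G))
      = (\<integral>\<^sup>+ x. ennreal (if 0 \<le> x then measure G {x<..} / m else 0) \<partial>lborel)"
    unfolding equilibrium_measure_def using tail_meas G(4) by (subst emeasure_density) auto
  also have "\<dots> = (\<integral>\<^sup>+ x. ennreal (1 / m) * (\<integral>\<^sup>+ u. indicator {z. 0 \<le> fst z \<and> fst z < snd z} (x, u) \<partial>G) \<partial>lborel)"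
  proof (intro nn_integral_cong)
    fix x :: real
    have "(\<integral>\<^sup>+ u. indicator {z. 0 \<le> fst z \<and> fst z < snd z} (x, u) \<partial>G) = (\<integral>\<^sup>+ u. (if 0 \<le> x then indicator {x<..} u else 0) \<partial>G)"
      by (intro nn_integral_cong) (auto simp: indicator_def)
    also have "\<dots> = (if 0 \<le> x then ennreal (measure G {x<..}) else 0)"
      by (simp add: emeasure_eq_measure)
    finally show "ennreal (if 0 \<le> x then measure G {x<..} / m else 0) = ennreal (1 / m) * (\<integral>\<^sup>+ u. indicator {z. 0 \<le> fst z \<and> fst z < snd z} (x, u) \<partial>G)"
      using m by (auto simp: ennreal_mult'[symmetric])
  qed
  also have "\<dots> = ennreal (1 / m) * (\<integral>\<^sup>+ x. (\<integral>\<^sup>+ u. indicator {z. 0 \<le> fst z \<and> fst z < snd z} (x, u) \<partial>G) \<partial>lborel)"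
  proof (rule nn_integral_cmult)
    show "(\<lambda>x. \<integral>\<^sup>+ u. indicator {z. 0 \<le> fst z \<and> fst z < snd z} (x, u) \<partial>G) \<in> borel_measurable lborel" by measurable
  qed
  also have "(\<integral>\<^sup>+ x. (\<integral>\<^sup>+ u. indicator {z. 0 \<le> fst z \<and> fst z < snd z} (x, u) \<partial>G) \<partial>lborel)
      = (\<integral>\<^sup>+ u. (\<integral>\<^sup>+ x. indicator {z. 0 \<le> fst z \<and> fst z < snd z} (x, u) \<partial>lborel) \<partial>G)"
  proof (rule Fubini'[symmetric])
    have "{z. 0 \<le> fst z \<and> fst z < snd z} \<inter> space (lborel \<Otimes>\<^sub>M G) \<in> sets (lborel \<Otimes>\<^sub>M (G :: real measure))" by measurable
    moreover have "{z. 0 \<le> fst z \<and> fst z < snd z} \<inter> space (lborel \<Otimes>\<^sub>M G) = {z. 0 \<le> fst z \<and> fst z < snd z}"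
      by (auto simp: space_pair_measure)
    ultimately show "(\<lambda>(x, u). indicator {z. 0 \<le> fst z \<and> fst z < snd z} (x, u)) \<in> borel_measurable (lborel \<Otimes>\<^sub>M G)"
      by simp
  qed
  also have "\<dots> = (\<integral>\<^sup>+ u. ennreal u \<partial>G)"
  proof (rule nn_integral_cong_AE)
    show "AE u in G. (\<integral>\<^sup>+ x. indicator {z. 0 \<le> fst z \<and> fst z < snd z} (x, u) \<partial>lborel) = ennreal u"
      using G(2)
    proof eventually_elim
      case (elim u)
      have "(\<integral>\<^sup>+ x. indicator {z. 0 \<le> fst z \<and> fst z < snd z} (x, u) \<partial>lborel) = (\<integral>\<^sup>+ x. indicator {0..<u} x \<partial>lborel)"
        by (intro nn_integral_cong) (auto simp: indicator_def)
      then show ?case using elim by simp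
    qed
  qed
  also have "\<dots> = ennreal m" using nn_integral_eq_integral[OF G(3,2)] G(4) by simp
  finally show "emeasure (equilibrium_measure G) (space (equilibrium_measure G)) = 1"
    using m by (simp add: ennreal_mult'[symmetric])
qed

lemma equilibrium_measure_scale:
  assumes G: "real_distribution G" and l: "0 < l"
  shows "equilibrium_measure (distr G borel (\<lambda>u. u / l)) = distr (equilibrium_measure G) borel (\<lambda>u. u / l)"
proof (rule measure_eqI)
  interpret real_distribution G by (rule G)
  show "sets (equilibrium_measure (distr G borel (\<lambda>u. u / l))) = sets (distr (equilibrium_measure G) borel (\<lambda>u. u / l))"
    by (simp add: equilibrium_measure_def)
  note tail_meas = borel_measurable_tail[OF real_distribution_axioms]
  note [measurable] = tail_meas
  have [measurable]: "(\<lambda>x. measure G {l * x<..}) \<in> borel_measurable borel"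
    by (rule measurable_compose[OF _ tail_meas]) measurable
  let ?m = "LINT u|G. u"
  define g where "g x = (if 0 \<le> x then measure G {x<..} / ?m else 0)" for x
  have [measurable]: "g \<in> borel_measurable borel" unfolding g_def by measurable
  have m': "(LINT u|distr G borel (\<lambda>u. u / l). u) = ?m / l" by (subst integral_distr) auto
  have tail: "measure (distr G borel (\<lambda>u. u / l)) {x<..} = measure G {l * x<..}" for x
  proof -
    have "(\<lambda>u. u / l) -` {x<..} \<inter> space G = {l * x<..}" using l by (auto simp: field_simps)
    then show ?thesis by (subst measure_distr) auto
  qed
  fix A assume "A \<in> sets (equilibrium_measure (distr G borel (\<lambda>u. u / l)))"
  then have A[measurable]: "A \<in> sets borel" by (simp add: equilibrium_measure_def)
  have "emeasure (distr (equilibrium_measure G) borel (\<lambda>u. u / l)) A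
      = emeasure (density lborel (\<lambda>x. ennreal (g x))) ((\<lambda>u. u / l) -` A)"
    unfolding equilibrium_measure_def g_def by (subst emeasure_distr) auto
  also have "\<dots> = (\<integral>\<^sup>+ u. ennreal (g u) * indicator A (u / l) \<partial>lborel)"
  proof -
    have "(\<lambda>u. u / l) -` A \<inter> space borel \<in> sets borel" by (rule measurable_sets[OF _ A]) measurable
    then show ?thesis by (subst emeasure_density) (auto intro!: nn_integral_cong simp: indicator_def)
  qed
  also have "\<dots> = ennreal \<bar>l\<bar> * (\<integral>\<^sup>+ x. ennreal (g (0 + l * x)) * indicator A ((0 + l * x) / l) \<partial>lborel)"
    by (rule nn_integral_real_affine) (use l in auto)
  also have "\<dots> = (\<integral>\<^sup>+ x. ennreal \<bar>l\<bar> * (ennreal (g (0 + l * x)) * indicator A ((0 + l * x) / l)) \<partial>lborel)"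
    by (rule nn_integral_cmult[symmetric]) measurable
  also have "\<dots> = (\<integral>\<^sup>+ x. ennreal (if 0 \<le> x then measure G {l * x<..} / (?m / l) else 0) * indicator A x \<partial>lborel)"
  proof (intro nn_integral_cong)
    fix x
    have "l * g (l * x) = (if 0 \<le> x then measure G {l * x<..} / (?m / l) else 0)"
      using l by (simp add: g_def zero_le_mult_iff)
    then show "ennreal \<bar>l\<bar> * (ennreal (g (0 + l * x)) * indicator A ((0 + l * x) / l))
        = ennreal (if 0 \<le> x then measure G {l * x<..} / (?m / l) else 0) * indicator A x"
      using l by (simp add: ennreal_mult'[symmetric] mult.assoc[symmetric] del: mult.assoc)
  qed
  also have "\<dots> = emeasure (equilibrium_measure (distr G borel (\<lambda>u. u / l))) A"
    unfolding equilibrium_measure_def m' tail by (subst emeasure_density) auto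
  finally show "emeasure (equilibrium_measure (distr G borel (\<lambda>u. u / l))) A
    = emeasure (distr (equilibrium_measure G) borel (\<lambda>u. u / l)) A" by simp
qed

lemma measurable_renewal_count:
  "(\<lambda>\<omega>. real (renewal_count t \<omega>)) \<in> borel_measurable (PiM UNIV (\<lambda>_. borel))"
proof -
  have "(\<lambda>\<omega>. card {n::nat. (\<Sum>i\<le>n. \<omega> i) \<le> t}) \<in> measurable (PiM UNIV (\<lambda>_. borel)) (count_space UNIV)"
  proof (rule measurable_card)
    fix n :: nat
    have "{\<omega> \<in> space (PiM UNIV (\<lambda>_. borel)). (\<Sum>i\<le>n. \<omega> i) \<le> t} \<in> sets (PiM UNIV (\<lambda>_. borel :: real measure))"
      by measurable
    then show "{\<omega> \<in> space (PiM UNIV (\<lambda>_. borel)). n \<in> {n. (\<Sum>i\<le>n. \<omega> i) \<le> t}} \<in> sets (PiM UNIV (\<lambda>_. borel))"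
      by simp
  qed
  then show ?thesis unfolding renewal_count_def by measurable
qed

section \<open>Time change and second moment of the renewal count at unit rate\<close>

context
  fixes U :: "real measure"
  assumes U: "real_distribution U" "AE u in U. 0 \<le> u" "integrable U (\<lambda>u. u)" "(LINT u|U. u) = 1"
begin

abbreviation (input) interarrival_law where
  "interarrival_law \<equiv> (\<lambda>n::nat. if n = 0 then equilibrium_measure U else U)"

lemma interarrival_law: "prob_space (interarrival_law n)" "sets (interarrival_law n) = sets borel"
proof -
  interpret real_distribution U by (rule U)
  show "prob_space (interarrival_law n)"
    using equilibrium_measure_prob_space[OF U zero_less_one] prob_space_axioms by simp
  show "sets (interarrival_law n) = sets borel"
    by (simp add: equilibrium_measure_def)
qed

lemma prob_space_renewal: "prob_space (renewal_measure U)"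
  unfolding renewal_measure_def by (intro prob_space_PiM interarrival_law)

lemma sets_renewal: "sets (renewal_measure U) = sets (PiM UNIV (\<lambda>_. borel))"
  unfolding renewal_measure_def by (intro sets_PiM_cong interarrival_law refl)

lemma renewal_measure_scale:
  assumes l: "0 < l"
  shows "renewal_measure (distr U borel (\<lambda>u. u / l)) = distr (renewal_measure U) (PiM UNIV (\<lambda>_. borel)) (\<lambda>\<omega> n. \<omega> n / l)"
proof -
  interpret prob_space "renewal_measure U" by (rule prob_space_renewal)
  have coord: "(\<lambda>\<omega>. \<omega> i) \<in> borel_measurable (renewal_measure U)" for i
    unfolding measurable_cong_sets[OF sets_renewal refl] by measurable
  have "indep_vars (\<lambda>_. borel) (\<lambda>i \<omega>. \<omega> i) UNIV"
    unfolding renewal_measure_def by (rule indep_vars_PiM_coordinates[OF interarrival_law])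
  then have "indep_vars (\<lambda>_. borel) (\<lambda>i \<omega>. \<omega> i / l) UNIV"
    by (rule indep_vars_compose2[where Y="\<lambda>i x. x / l"]) auto
  then have "distr (renewal_measure U) (PiM UNIV (\<lambda>_. borel)) (\<lambda>\<omega>. \<lambda>i\<in>UNIV. \<omega> i / l)
      = PiM UNIV (\<lambda>i. distr (renewal_measure U) borel (\<lambda>\<omega>. \<omega> i / l))"
    by (subst (asm) indep_vars_iff_distr_eq_PiM') (use coord in auto)
  moreover have "distr (renewal_measure U) borel (\<lambda>\<omega>. \<omega> i / l) = distr (interarrival_law i) borel (\<lambda>u. u / l)" for i
  proof -
    have "distr (renewal_measure U) borel (\<lambda>\<omega>. \<omega> i / l) = distr (distr (renewal_measure U) borel (\<lambda>\<omega>. \<omega> i)) borel (\<lambda>u. u / l)"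
      using coord by (subst distr_distr) (auto simp: comp_def)
    also have "distr (renewal_measure U) borel (\<lambda>\<omega>. \<omega> i) = interarrival_law i"
      unfolding renewal_measure_def by (rule distr_PiM_coordinate[OF interarrival_law])
    finally show ?thesis .
  qed
  moreover have "(if i = 0 then equilibrium_measure (distr U borel (\<lambda>u. u / l)) else distr U borel (\<lambda>u. u / l))
      = distr (interarrival_law i) borel (\<lambda>u. u / l)" for i :: nat
    using equilibrium_measure_scale[OF U(1) l] by simp
  ultimately show ?thesis
    unfolding renewal_measure_def[of "distr U borel (\<lambda>u. u / l)"] by (simp add: restrict_def)
qed

text \<open>Dividing all inter-arrival times by l makes the count at s the unit-rate count at l s,
  and the normalising factor is l s on both sides. Thus the index of dispersion depends on the rate
  only through its argument.\<close>

lemma renewal_idc_scale: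
  assumes l: "0 < l"
  shows "renewal_idc (distr U borel (\<lambda>u. u / l)) s = renewal_idc U (l * s)"
proof -
  interpret real_distribution U by (rule U)
  have T: "(\<lambda>\<omega> n. \<omega> n / l) \<in> measurable (renewal_measure U) (PiM UNIV (\<lambda>_. borel))"
    unfolding measurable_cong_sets[OF sets_renewal refl] by (rule measurable_PiM_single') auto
  have count: "renewal_count s (\<lambda>n. \<omega> n / l) = renewal_count (l * s) \<omega>" for \<omega> :: "nat \<Rightarrow> real"
    using l by (simp add: renewal_count_def sum_divide_distrib[symmetric] divide_le_eq mult.commute)
  have int: "(LINT \<omega>|renewal_measure (distr U borel (\<lambda>u. u / l)). f (real (renewal_count s \<omega>)))
      = (LINT \<omega>|renewal_measure U. f (real (renewal_count (l * s) \<omega>)))"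
    if [measurable]: "f \<in> borel_measurable borel" for f :: "real \<Rightarrow> real"
    unfolding renewal_measure_scale[OF l]
    using measurable_compose[OF measurable_renewal_count that] by (subst integral_distr[OF T]) (auto simp: count)
  have mean: "(LINT u|distr U borel (\<lambda>u. u / l). u) = 1 / l"
    using U(4) by (subst integral_distr) auto
  show ?thesis
    unfolding renewal_idc_def Let_def mean U(4)
    using int[of "\<lambda>x. x"] int[of "\<lambda>x. (x - _)\<^sup>2"] by simp
qed

lemma renewal_idc_nonneg: "0 \<le> t \<Longrightarrow> 0 \<le> renewal_idc U t"
  unfolding renewal_idc_def Let_def U(4) by (intro divide_nonneg_nonneg integral_nonneg_AE) auto

text \<open>If the transform were 1, then u = 0 almost surely, against the mean 1.\<close>

lemma laplace_lt_1: "(LINT u|U. exp (- u)) < 1" "0 \<le> (LINT u|U. exp (- u))" "integrable U (\<lambda>u. exp (- u))"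
proof -
  interpret real_distribution U by (rule U)
  show i: "integrable U (\<lambda>u. exp (- u))"
    by (rule integrable_const_bound[of _ 1]) (use U(2) in auto)
  show "0 \<le> (LINT u|U. exp (- u))" by (intro integral_nonneg_AE) auto
  have i': "integrable U (\<lambda>u. 1 - exp (- u))" using i by simp
  have "0 \<le> (LINT u|U. 1 - exp (- u))" using U(2) by (intro integral_nonneg_AE) auto
  moreover have "(LINT u|U. 1 - exp (- u)) \<noteq> 0"
  proof
    assume "(LINT u|U. 1 - exp (- u)) = 0"
    then have "AE u in U. 1 - exp (- u) = 0"
      using integral_nonneg_eq_0_iff_AE[OF i'] U(2) by auto
    then have "AE u in U. u = 0" by eventually_elim auto
    then have "(LINT u|U. u) = (LINT u|U. 0)" by (intro integral_cong_AE) auto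
    then show False using U(4) by simp
  qed
  moreover have "(LINT u|U. 1 - exp (- u)) = 1 - (LINT u|U. exp (- u))"
    using i by (simp add: prob_space[unfolded space_eq_univ])
  ultimately show "(LINT u|U. exp (- u)) < 1" by linarith
qed

lemma renewal_laplace:
  "(\<integral>\<^sup>+ \<omega>. ennreal (exp (- (\<Sum>i\<le>n. \<omega> i))) \<partial>renewal_measure U) \<le> ennreal ((LINT u|U. exp (- u)) ^ n)"
proof -
  interpret prob_space "renewal_measure U" by (rule prob_space_renewal)
  interpret E: prob_space "equilibrium_measure U" using interarrival_law(1)[of 0] by simp
  have coord[measurable]: "(\<lambda>\<omega>. \<omega> i) \<in> borel_measurable (renewal_measure U)" for i
    unfolding measurable_cong_sets[OF sets_renewal refl] by measurable
  have "indep_vars (\<lambda>_. borel) (\<lambda>i \<omega>. \<omega> i) UNIV"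
    unfolding renewal_measure_def by (rule indep_vars_PiM_coordinates[OF interarrival_law])
  then have "indep_vars (\<lambda>_. borel) (\<lambda>i \<omega>. \<omega> i) {..n}" by (rule indep_vars_subset) auto
  then have ind: "indep_vars (\<lambda>_. borel) (\<lambda>i \<omega>. ennreal (exp (- \<omega> i))) {..n}"
    by (rule indep_vars_compose2[where Y="\<lambda>i x. ennreal (exp (- x))"]) auto
  have one: "(\<integral>\<^sup>+ \<omega>. ennreal (exp (- \<omega> i)) \<partial>renewal_measure U) = (\<integral>\<^sup>+ x. ennreal (exp (- x)) \<partial>interarrival_law i)" for i
  proof -
    have "distr (renewal_measure U) borel (\<lambda>\<omega>. \<omega> i) = interarrival_law i"
      unfolding renewal_measure_def by (rule distr_PiM_coordinate[OF interarrival_law])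
    from this[symmetric] show ?thesis by (simp add: nn_integral_distr)
  qed
  have zero: "(\<integral>\<^sup>+ x. ennreal (exp (- x)) \<partial>equilibrium_measure U) \<le> 1"
  proof -
    have "AE x in equilibrium_measure U. 0 \<le> x" by (rule AE_equilibrium_measure_nonneg[OF U(1)])
    then have "(\<integral>\<^sup>+ x. ennreal (exp (- x)) \<partial>equilibrium_measure U) \<le> (\<integral>\<^sup>+ x. 1 \<partial>equilibrium_measure U)"
      by (intro nn_integral_mono_AE) (auto simp: ennreal_le_1 elim: eventually_mono)
    then show ?thesis by (simp add: E.emeasure_space_1)
  qed
  have suc: "(\<integral>\<^sup>+ x. ennreal (exp (- x)) \<partial>U) = ennreal (LINT u|U. exp (- u))"
    by (rule nn_integral_eq_integral[OF laplace_lt_1(3)]) auto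
  have "ennreal (exp (- (\<Sum>i\<le>n. \<omega> i))) = (\<Prod>i\<le>n. ennreal (exp (- \<omega> i)))" for \<omega> :: "nat \<Rightarrow> real"
    by (simp add: prod_ennreal exp_sum[symmetric] sum_negf)
  then have "(\<integral>\<^sup>+ \<omega>. ennreal (exp (- (\<Sum>i\<le>n. \<omega> i))) \<partial>renewal_measure U)
      = (\<Prod>i\<le>n. \<integral>\<^sup>+ \<omega>. ennreal (exp (- \<omega> i)) \<partial>renewal_measure U)"
    using indep_vars_nn_integral[OF _ ind] by simp
  also have "\<dots> = (\<integral>\<^sup>+ x. ennreal (exp (- x)) \<partial>equilibrium_measure U) * (\<Prod>i<n. ennreal (LINT u|U. exp (- u)))"
    unfolding one lessThan_Suc_atMost[symmetric] prod.lessThan_Suc_shift by (simp add: suc)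
  also have "\<dots> \<le> 1 * (\<Prod>i<n. ennreal (LINT u|U. exp (- u)))"
    by (intro mult_right_mono zero) auto
  finally show ?thesis using laplace_lt_1(2) by (simp add: ennreal_power)
qed

text \<open>The square of a count N is the sum of 2 n + 1 over n < N, and each such n has a partial
  sum of at most t, so the factor exp (t - partial sum) is at least 1. If infinitely many partial
  sums are at most t, \<open>card\<close> is 0 and the left side vanishes.\<close>

lemma renewal_count_square_le:
  assumes nonneg: "\<And>n. 0 \<le> \<omega> n"
  shows "ennreal ((real (renewal_count t \<omega>))\<^sup>2) \<le> (\<Sum>n. ennreal (real (2 * n + 1) * exp t) * ennreal (exp (- (\<Sum>i\<le>n. \<omega> i))))"
proof (cases "finite {n. (\<Sum>i\<le>n. \<omega> i) \<le> t}")
  case True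
  define S where "S = {n. (\<Sum>i\<le>n. \<omega> i) \<le> t}"
  define m where "m = (LEAST n. n \<notin> S)"
  have fin: "finite S" using True by (simp add: S_def)
  then have "\<exists>n. n \<notin> S" using ex_new_if_finite[OF infinite_UNIV_nat] by blast
  then have m: "m \<notin> S" unfolding m_def by (rule LeastI_ex)
  have down: "n' \<in> S" if "n \<in> S" "n' \<le> n" for n n'
  proof -
    have "(\<Sum>i\<le>n'. \<omega> i) \<le> (\<Sum>i\<le>n. \<omega> i)" using that nonneg by (intro sum_mono2) auto
    then show ?thesis using that by (simp add: S_def)
  qed
  have "S = {..<m}"
  proof (intro set_eqI iffI)
    fix n assume "n \<in> S"
    then have "\<not> m \<le> n" using down m by blast
    then show "n \<in> {..<m}" by simp
  next
    fix n assume "n \<in> {..<m}"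
    then show "n \<in> S" using not_less_Least[of n "\<lambda>n. n \<notin> S"] by (auto simp: m_def)
  qed
  have sq: "(real m)\<^sup>2 = (\<Sum>n<m. real (2 * n + 1))" for m
    by (induction m) (auto simp: power2_eq_square algebra_simps)
  have "(real (renewal_count t \<omega>))\<^sup>2 = (\<Sum>n<m. real (2 * n + 1))"
    using \<open>S = {..<m}\<close> sq[of m] by (simp add: renewal_count_def S_def)
  also have "\<dots> \<le> (\<Sum>n<m. (real (2 * n + 1) * exp t) * exp (- (\<Sum>i\<le>n. \<omega> i)))"
  proof (rule sum_mono)
    fix n assume "n \<in> {..<m}"
    then have "(\<Sum>i\<le>n. \<omega> i) \<le> t" using \<open>S = {..<m}\<close> by (auto simp: S_def)
    then have "1 \<le> exp t * exp (- (\<Sum>i\<le>n. \<omega> i))" by (simp add: exp_add[symmetric])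
    then have "real (2 * n + 1) * 1 \<le> real (2 * n + 1) * (exp t * exp (- (\<Sum>i\<le>n. \<omega> i)))"
      by (intro mult_left_mono) auto
    then show "real (2 * n + 1) \<le> (real (2 * n + 1) * exp t) * exp (- (\<Sum>i\<le>n. \<omega> i))"
      by (simp add: mult.assoc)
  qed
  finally have "ennreal ((real (renewal_count t \<omega>))\<^sup>2) \<le> ennreal (\<Sum>n<m. (real (2 * n + 1) * exp t) * exp (- (\<Sum>i\<le>n. \<omega> i)))"
    by (rule ennreal_leI)
  also have "\<dots> = (\<Sum>n<m. ennreal (real (2 * n + 1) * exp t) * ennreal (exp (- (\<Sum>i\<le>n. \<omega> i))))"
    by (subst sum_ennreal[symmetric]) (auto simp: ennreal_mult')
  also have "\<dots> \<le> (\<Sum>n. ennreal (real (2 * n + 1) * exp t) * ennreal (exp (- (\<Sum>i\<le>n. \<omega> i))))"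
    by (rule sum_le_suminf) auto
  finally show ?thesis .
next
  case False
  then show ?thesis by (simp add: renewal_count_def)
qed

text \<open>For t > 0 the product t * renewal_idc U t is the variance of the count. It is bounded by
  the series of \<open>renewal_count_square_le\<close>, whose terms decay geometrically in the mean
  by \<open>renewal_laplace\<close>.\<close>

lemma renewal_variance_bounded:
  obtains C where "0 \<le> C" "\<And>t. 0 \<le> t \<Longrightarrow> t \<le> T \<Longrightarrow> t * renewal_idc U t \<le> C"
proof -
  interpret prob_space "renewal_measure U" by (rule prob_space_renewal)
  define q where "q = (LINT u|U. exp (- u))"
  have q: "0 \<le> q" "q < 1" using laplace_lt_1 by (auto simp: q_def)
  have [measurable]: "(\<lambda>\<omega>. \<omega> i) \<in> borel_measurable (renewal_measure U)" for i
    unfolding measurable_cong_sets[OF sets_renewal refl] by measurable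
  have count[measurable]: "(\<lambda>\<omega>. real (renewal_count t \<omega>)) \<in> borel_measurable (renewal_measure U)" for t
    unfolding measurable_cong_sets[OF sets_renewal refl] by (rule measurable_renewal_count)
  have summ: "summable (\<lambda>n. (real (2 * n + 1) * exp T) * q ^ n)"
  proof -
    \<comment> \<open>\<open>diffs\<close> of the constant sequence 1 is n + 1; the coefficient 2 n
      + 1 is twice this minus 1.\<close>
    have "summable (\<lambda>n. diffs (\<lambda>_. 1::real) n * q ^ n)"
      by (rule termdiff_converges[where K=1]) (use q in \<open>auto intro: summable_geometric\<close>)
    then have "summable (\<lambda>n. 2 * exp T * (diffs (\<lambda>_. 1) n * q ^ n) - exp T * q ^ n)"
      using q by (intro summable_diff summable_mult summable_geometric) auto
    then show ?thesis by (simp add: diffs_def algebra_simps)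
  qed
  define C where "C = (\<Sum>n. (real (2 * n + 1) * exp T) * q ^ n)"
  have C0: "0 \<le> C" unfolding C_def using q summ by (intro suminf_nonneg) auto
  have AE_nn: "AE \<omega> in renewal_measure U. \<forall>n. 0 \<le> \<omega> n"
  proof -
    have "AE x in equilibrium_measure U. 0 \<le> x" by (rule AE_equilibrium_measure_nonneg[OF U(1)])
    then have "AE x in interarrival_law n. 0 \<le> x" for n using U(2) by simp
    then show ?thesis
      unfolding AE_all_countable renewal_measure_def by (intro allI AE_PiM_component interarrival_law) auto
  qed
  have second: "(\<integral>\<^sup>+ \<omega>. ennreal ((real (renewal_count t \<omega>))\<^sup>2) \<partial>renewal_measure U) \<le> ennreal C" if t: "t \<le> T" for t
  proof -
    have "(\<integral>\<^sup>+ \<omega>. ennreal ((real (renewal_count t \<omega>))\<^sup>2) \<partial>renewal_measure U)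
        \<le> (\<integral>\<^sup>+ \<omega>. (\<Sum>n. ennreal (real (2 * n + 1) * exp t) * ennreal (exp (- (\<Sum>i\<le>n. \<omega> i)))) \<partial>renewal_measure U)"
      by (intro nn_integral_mono_AE) (use AE_nn in eventually_elim, rule renewal_count_square_le, auto)
    also have "\<dots> = (\<Sum>n. \<integral>\<^sup>+ \<omega>. ennreal (real (2 * n + 1) * exp t) * ennreal (exp (- (\<Sum>i\<le>n. \<omega> i))) \<partial>renewal_measure U)"
      by (rule nn_integral_suminf) measurable
    also have "\<dots> \<le> (\<Sum>n. ennreal ((real (2 * n + 1) * exp T) * q ^ n))"
    proof (intro suminf_le allI)
      fix n
      have "(\<integral>\<^sup>+ \<omega>. ennreal (real (2 * n + 1) * exp t) * ennreal (exp (- (\<Sum>i\<le>n. \<omega> i))) \<partial>renewal_measure U)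
          = ennreal (real (2 * n + 1) * exp t) * (\<integral>\<^sup>+ \<omega>. ennreal (exp (- (\<Sum>i\<le>n. \<omega> i))) \<partial>renewal_measure U)"
        by (rule nn_integral_cmult) measurable
      also have "\<dots> \<le> ennreal (real (2 * n + 1) * exp T) * ennreal (q ^ n)"
        unfolding q_def using t by (intro mult_mono renewal_laplace ennreal_leI mult_left_mono) auto
      also have "\<dots> = ennreal ((real (2 * n + 1) * exp T) * q ^ n)"
        using q by (intro ennreal_mult'[symmetric]) simp
      finally show "(\<integral>\<^sup>+ \<omega>. ennreal (real (2 * n + 1) * exp t) * ennreal (exp (- (\<Sum>i\<le>n. \<omega> i))) \<partial>renewal_measure U)
        \<le> ennreal ((real (2 * n + 1) * exp T) * q ^ n)" .
    qed auto
    also have "\<dots> = ennreal C"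
      unfolding C_def by (rule suminf_ennreal_eq[OF _ summable_sums[OF summ]]) (use q in auto)
    finally show ?thesis .
  qed
  show ?thesis
  proof
    show "0 \<le> C" by (rule C0)
    fix t assume t: "0 \<le> t" "t \<le> T"
    let ?A = "\<lambda>\<omega>. real (renewal_count t \<omega>)"
    have i2: "integrable (renewal_measure U) (\<lambda>\<omega>. (?A \<omega>)\<^sup>2)"
    proof (rule integrableI_nonneg)
      show "(\<integral>\<^sup>+ \<omega>. ennreal ((?A \<omega>)\<^sup>2) \<partial>renewal_measure U) < \<infinity>"
        using second[OF t(2)] by (rule le_less_trans) simp
    qed auto
    have i1: "integrable (renewal_measure U) ?A"
      by (rule square_integrable_imp_integrable[OF _ i2]) measurable
    have "expectation (\<lambda>\<omega>. (?A \<omega> - expectation ?A)\<^sup>2) = expectation (\<lambda>\<omega>. (?A \<omega>)\<^sup>2) - (expectation ?A)\<^sup>2"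
      by (rule variance_eq[OF i1 i2])
    also have "\<dots> \<le> expectation (\<lambda>\<omega>. (?A \<omega>)\<^sup>2)" by simp
    also have "\<dots> \<le> C"
      using second[OF t(2)] nn_integral_eq_integral[OF i2] C0 by (simp add: ennreal_le_iff)
    finally have "expectation (\<lambda>\<omega>. (?A \<omega> - expectation ?A)\<^sup>2) \<le> C" .
    then show "t * renewal_idc U t \<le> C"
      using t C0 by (cases "t = 0") (simp_all add: renewal_idc_def Let_def U(4))
  qed
qed

end

section \<open>Asymptotics of the fixed point\<close>

lemma powr_tendsto_0_right: "0 < e \<Longrightarrow> ((\<lambda>\<alpha>::real. \<alpha> powr e) \<longlongrightarrow> 0) (at_right 0)"
proof -
  assume e: "0 < e"
  have "((\<lambda>\<alpha>::real. \<alpha> powr e) \<longlongrightarrow> 0 powr e) (at_right 0)"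
    by (rule tendsto_powr') (use e in \<open>auto simp: eventually_at_filter\<close>)
  then show ?thesis by simp
qed

lemma powr_neg_at_top_right: "e < 0 \<Longrightarrow> filterlim (\<lambda>\<alpha>::real. \<alpha> powr e) at_top (at_right 0)"
proof -
  assume e: "e < 0"
  have "filterlim (\<lambda>\<alpha>::real. inverse (\<alpha> powr (- e))) at_top (at_right 0)"
    by (rule filterlim_inverse_at_top[OF powr_tendsto_0_right])
      (use e in \<open>auto simp: eventually_at_filter\<close>)
  then show ?thesis by (simp add: powr_minus)
qed

text \<open>Expansion of the square of 2 \<theta> sqrt s - b sqrt x. It trades the square root for a
  slope \<theta> and is sharp at the s where this square vanishes, so no constant is lost.\<close>

lemma mult_sqrt_le_young:
  fixes b x s \<theta> :: real
  assumes "0 < \<theta>" "0 \<le> x" "0 \<le> s"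
  shows "b * sqrt (x * s) \<le> \<theta> * s + b\<^sup>2 * x / (4 * \<theta>)"
proof -
  have "0 \<le> (2 * \<theta> * sqrt s - b * sqrt x)\<^sup>2 / (4 * \<theta>)" using assms by simp
  also have "\<dots> = (4 * \<theta>\<^sup>2 * s + b\<^sup>2 * x - 4 * \<theta> * (b * (sqrt x * sqrt s))) / (4 * \<theta>)"
    using assms by (simp add: power2_diff power_mult_distrib algebra_simps)
  also have "\<dots> = \<theta> * s + b\<^sup>2 * x / (4 * \<theta>) - b * sqrt (x * s)"
    using assms by (simp add: field_simps power2_eq_square real_sqrt_mult)
  finally show ?thesis by simp
qed

text \<open>Every sequence tending to 0 has a subsequence along which f converges, and P determines
  the limit. A sequence along which f stays away from l would have a subsequence with limit l, a
  contradiction.\<close>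

lemma tendsto_unique_limit_point:
  fixes f :: "real \<Rightarrow> real"
  assumes bdd: "\<forall>\<^sub>F x in at_right 0. f x \<in> {A..B}"
    and lim: "\<And>X l. (\<And>n::nat. 0 < X n) \<Longrightarrow> X \<longlonglongrightarrow> 0 \<Longrightarrow> (\<lambda>n. f (X n)) \<longlonglongrightarrow> l \<Longrightarrow> P l"
    and uniq: "\<And>l l'. P l \<Longrightarrow> P l' \<Longrightarrow> l = l'"
  obtains l where "P l" "(f \<longlongrightarrow> l) (at_right 0)"
proof -
  obtain e where e: "0 < e" "\<And>x. 0 < x \<Longrightarrow> x < e \<Longrightarrow> f x \<in> {A..B}"
    using bdd unfolding eventually_at_right_field by auto
  have sub: "\<exists>l r. strict_mono r \<and> (\<lambda>n. f (X (r n))) \<longlonglongrightarrow> l \<and> P l"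
    if X: "\<And>n::nat. 0 < X n" "\<And>n. X n < e" "X \<longlonglongrightarrow> 0" for X
  proof -
    have "\<forall>n. (f \<circ> X) n \<in> {A..B}" using e(2) X by auto
    then obtain l r where r: "strict_mono r" "((f \<circ> X) \<circ> r) \<longlonglongrightarrow> l"
      using compact_imp_seq_compact[OF compact_Icc[of A B]] unfolding seq_compact_def by metis
    then have fl: "(\<lambda>n. f (X (r n))) \<longlonglongrightarrow> l" by (simp add: comp_def)
    moreover have "P l"
    proof (rule lim[OF _ _ fl])
      show "0 < X (r n)" for n by (rule X)
      show "(\<lambda>n. X (r n)) \<longlonglongrightarrow> 0" using LIMSEQ_subseq_LIMSEQ[OF X(3) r(1)] by (simp add: comp_def)
    qed
    ultimately show ?thesis using r(1) by blast
  qed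
  have "(\<lambda>n. e / real (Suc (Suc n))) \<longlonglongrightarrow> 0"
    by (rule LIMSEQ_Suc[OF LIMSEQ_Suc[OF lim_const_over_n]])
  moreover have "e / real (Suc (Suc n)) < e" for n
    using e(1) by (simp add: divide_less_eq)
  ultimately obtain l where l: "P l"
    using sub[of "\<lambda>n. e / real (Suc (Suc n))"] e(1) by auto
  have "(f \<longlongrightarrow> l) (at_right 0)"
  proof (rule tendstoI)
    fix d :: real assume d: "0 < d"
    show "\<forall>\<^sub>F x in at_right 0. dist (f x) l < d"
    proof (rule sequentially_imp_eventually_at_right[OF e(1)])
      fix X :: "nat \<Rightarrow> real" assume X: "\<And>n. 0 < X n" "\<And>n. X n < e" "decseq X" "X \<longlonglongrightarrow> 0"
      show "\<forall>\<^sub>F n in sequentially. dist (f (X n)) l < d"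
      proof (rule ccontr)
        assume "\<not> ?thesis"
        then have "\<exists>\<^sub>F n in sequentially. \<not> dist (f (X n)) l < d" by (simp add: frequently_def)
        then have "infinite {n. \<not> dist (f (X n)) l < d}" by (simp add: cofinite_eq_sequentially[symmetric] frequently_cofinite)
        from infinite_enumerate[OF this] obtain r :: "nat \<Rightarrow> nat" where r: "strict_mono r" "\<And>n. \<not> dist (f (X (r n))) l < d" by auto
        have "(\<lambda>n. X (r n)) \<longlonglongrightarrow> 0" using LIMSEQ_subseq_LIMSEQ[OF X(4) r(1)] by (simp add: comp_def)
        then obtain l' r' where r': "(\<lambda>n. f (X (r (r' n)))) \<longlonglongrightarrow> l'" "P l'"
          using sub[of "\<lambda>n. X (r n)"] X by auto
        then have "(\<lambda>n. f (X (r (r' n)))) \<longlonglongrightarrow> l" using uniq[OF l] by auto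
        then have "\<forall>\<^sub>F n in sequentially. dist (f (X (r (r' n)))) l < d" using d by (rule tendstoD)
        then show False using r(2) by (auto simp: eventually_sequentially)
      qed
    qed
  qed
  with l show ?thesis by (rule that)
qed

section \<open>The fixed point equation in abstract form\<close>

text \<open>Collects what the analysis uses of F, w and the index of dispersion. Here
  \<open>idc\<close> belongs to the unit-rate process, and \<open>idc_local\<close> speaks of the
  variance t * idc t, the quantity bounded by \<open>renewal_variance_bounded\<close>.\<close>

locale rq_asymptotics =
  fixes F w idc :: "real \<Rightarrow> real" and k :: nat
    and \<beta> \<mu> b \<gamma> c ca2 cs2 \<tau> K :: real and Z :: "real \<Rightarrow> real"
  assumes k_pos: "1 \<le> k" and pos: "0 < \<beta>" "0 < \<mu>" "0 < b" "0 < \<gamma>" "0 < \<tau>"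
    and cs2: "0 \<le> cs2" and cx2: "0 < ca2 + cs2"
    and F_mono: "mono F" and F_range: "\<And>x. 0 \<le> F x" "\<And>x. F x \<le> 1" and F_0: "F 0 = 0"
    and F_asymp: "((\<lambda>x. F x / x ^ k) \<longlongrightarrow> \<beta>) (at_right 0)"
    and w_range: "\<And>x. 0 \<le> x \<Longrightarrow> 0 \<le> w x" "\<And>x. 0 \<le> x \<Longrightarrow> w x \<le> K" and K_pos: "0 < K"
    and w_0: "(w \<longlongrightarrow> 1) (at_right 0)"
    and idc_nonneg: "\<And>t. 0 \<le> t \<Longrightarrow> 0 \<le> idc t" and idc_lim: "(idc \<longlongrightarrow> ca2) at_top"
    and idc_local: "\<And>T. \<exists>C\<ge>0. \<forall>t. 0 \<le> t \<longrightarrow> t \<le> T \<longrightarrow> t * idc t \<le> C"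
begin

definition h :: real where "h = real k / (real k + 1)"
definition cx2' :: real where "cx2' = ca2 + cs2"
definition \<rho> :: "real \<Rightarrow> real" where "\<rho> \<alpha> = 1 + c * \<alpha> powr \<gamma>"
definition Iw :: "real \<Rightarrow> real \<Rightarrow> real" where
  "Iw \<alpha> s = idc (\<rho> \<alpha> * \<mu> * s) / max (\<rho> \<alpha>) 1 + (1 - 1 / max (\<rho> \<alpha>) 1) + cs2"
text \<open>The effective load after abandonment: p \<alpha> - 1 is the coefficient of s in the
  fixed point equation, and G below is the expression under its square root.\<close>

definition p :: "real \<Rightarrow> real" where "p \<alpha> = \<rho> \<alpha> * (1 - F (\<alpha> * Z \<alpha>))"
definition G :: "real \<Rightarrow> real \<Rightarrow> real" where
  "G \<alpha> s = Iw \<alpha> s * w (\<alpha> powr (2 * h) * \<tau> * s) * (p \<alpha> * s / \<mu>)"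

lemma h: "0 < h" "h < 1" "real k * (1 - h) = h"
  using k_pos by (auto simp: h_def field_simps)

lemma cx2': "0 < cx2'" using cx2 by (simp add: cx2'_def)

lemma F_pos: "0 < x \<Longrightarrow> 0 < F x"
proof -
  assume x: "0 < x"
  have "\<forall>\<^sub>F y in at_right 0. 0 < F y / y ^ k" using F_asymp pos(1) by (rule order_tendstoD)
  moreover have "\<forall>\<^sub>F y in at_right 0. 0 < y \<and> y < x"
    using x by (auto simp: eventually_at_right_field)
  ultimately have "\<forall>\<^sub>F y in at_right 0. 0 < F y \<and> y < x"
    by eventually_elim (auto simp: zero_less_divide_iff)
  then obtain y where "0 < F y" "y < x"
    using eventually_happens[of _ "at_right (0::real)"] trivial_limit_at_right_real by blast
  then show ?thesis using F_mono by (meson less_imp_le monoD order_less_le_trans)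
qed

lemma F_scale_small:
  assumes D: "0 < D" and e: "0 < e" and g: "g < real k * e"
  shows "((\<lambda>\<alpha>. F (D * \<alpha> powr e) / \<alpha> powr g) \<longlongrightarrow> 0) (at_right 0)"
proof -
  have x0: "filterlim (\<lambda>\<alpha>. D * \<alpha> powr e) (at_right 0) (at_right 0)"
    unfolding filterlim_at
  proof
    show "((\<lambda>\<alpha>. D * \<alpha> powr e) \<longlongrightarrow> 0) (at_right 0)"
      using tendsto_mult_right_zero[OF powr_tendsto_0_right[OF e], of D] by simp
    show "\<forall>\<^sub>F \<alpha> in at_right 0. D * \<alpha> powr e \<in> {0<..} \<and> D * \<alpha> powr e \<noteq> 0"
      using D by (auto simp: eventually_at_filter)
  qed
  have "((\<lambda>\<alpha>. (F (D * \<alpha> powr e) / (D * \<alpha> powr e) ^ k) * (D ^ k * \<alpha> powr (real k * e - g))) \<longlongrightarrow> \<beta> * (D ^ k * 0)) (at_right 0)"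
    using g by (intro tendsto_intros filterlim_compose[OF F_asymp x0] powr_tendsto_0_right) auto
  then have "((\<lambda>\<alpha>. (F (D * \<alpha> powr e) / (D * \<alpha> powr e) ^ k) * (D ^ k * \<alpha> powr (real k * e - g))) \<longlongrightarrow> 0) (at_right 0)"
    by simp
  moreover have "\<forall>\<^sub>F \<alpha> in at_right 0. (F (D * \<alpha> powr e) / (D * \<alpha> powr e) ^ k) * (D ^ k * \<alpha> powr (real k * e - g)) = F (D * \<alpha> powr e) / \<alpha> powr g"
    unfolding eventually_at_filter
  proof (intro always_eventually allI impI)
    fix \<alpha> :: real assume "\<alpha> \<noteq> 0" "\<alpha> \<in> {0<..}"
    then have \<alpha>: "0 < \<alpha>" by simp
    have "(\<alpha> powr e) ^ k = \<alpha> powr (real k * e)" using \<alpha> by (simp add: powr_realpow[symmetric] powr_powr mult.commute)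
    then show "(F (D * \<alpha> powr e) / (D * \<alpha> powr e) ^ k) * (D ^ k * \<alpha> powr (real k * e - g)) = F (D * \<alpha> powr e) / \<alpha> powr g"
      using \<alpha> D by (simp add: power_mult_distrib powr_diff)
  qed
  ultimately show ?thesis by (rule Lim_transform_eventually)
qed

lemma rho_tendsto: "(\<rho> \<longlongrightarrow> 1) (at_right 0)"
proof -
  have "(\<rho> \<longlongrightarrow> 1 + c * 0) (at_right 0)"
    unfolding \<rho>_def using pos by (intro tendsto_intros powr_tendsto_0_right)
  then show ?thesis by simp
qed

text \<open>Beyond a threshold T the limit gives idc < ca2 + e; up to T the local constant takes
  over.\<close>

lemma idc_linear_bound:
  assumes e: "0 < e"
  obtains C where "0 \<le> C" "\<And>t. 0 \<le> t \<Longrightarrow> t * idc t \<le> C + (ca2 + e) * t"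
proof -
  have "\<forall>\<^sub>F t in at_top. idc t < ca2 + e" using idc_lim e by (intro order_tendstoD) auto
  then obtain T where T: "\<And>t. T \<le> t \<Longrightarrow> idc t < ca2 + e" by (auto simp: eventually_at_top_linorder)
  obtain C where C: "0 \<le> C" "\<And>t. 0 \<le> t \<Longrightarrow> t \<le> T \<Longrightarrow> t * idc t \<le> C" using idc_local[of T] by blast
  have "0 < ca2 + e"
    using T[of "max T 0"] idc_nonneg[of "max T 0"] by auto
  show ?thesis
  proof
    fix t :: real assume t: "0 \<le> t"
    show "t * idc t \<le> C + (ca2 + e) * t"
    proof (cases "t \<le> T")
      case True
      then show ?thesis using C(2)[OF t True] \<open>0 < ca2 + e\<close> t by (smt (verit) mult_nonneg_nonneg)
    next
      case False
      then have "t * idc t \<le> t * (ca2 + e)" using T[of t] t by (intro mult_left_mono) auto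
      then show ?thesis using C(1) by (simp add: mult.commute)
    qed
  qed (rule C)
qed

text \<open>Only the product s * Iw is controlled for small s, hence the additive constant, which
  disappears after scaling. One half of e is spent on the index of dispersion, the other on the
  correction 1 - 1 / max (\<rho> \<alpha>) 1, which tends to 0.\<close>

lemma Iw_linear_bound:
  assumes e: "0 < e"
  obtains C where "0 \<le> C" "\<forall>\<^sub>F \<alpha> in at_right 0. \<forall>s\<ge>0. 0 \<le> Iw \<alpha> s \<and> s * Iw \<alpha> s \<le> C + (cx2' + e) * s"
proof -
  obtain C where C: "0 \<le> C" "\<And>t. 0 \<le> t \<Longrightarrow> t * idc t \<le> C + (ca2 + e/2) * t"
    using idc_linear_bound[of "e/2"] e by auto
  have ev: "\<forall>\<^sub>F \<alpha> in at_right 0. 1/2 < \<rho> \<alpha>" "\<forall>\<^sub>F \<alpha> in at_right 0. \<rho> \<alpha> < 1 + e/2"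
    by (rule order_tendstoD[OF rho_tendsto]; use e in simp)+
  show ?thesis
  proof
    show "0 \<le> 2 * C / \<mu>" using C pos by simp
    show "\<forall>\<^sub>F \<alpha> in at_right 0. \<forall>s\<ge>0. 0 \<le> Iw \<alpha> s \<and> s * Iw \<alpha> s \<le> 2 * C / \<mu> + (cx2' + e) * s"
      using ev
    proof eventually_elim
      case (elim \<alpha>)
      show ?case
      proof (intro allI impI)
        fix s :: real assume s: "0 \<le> s"
        let ?r = "max (\<rho> \<alpha>) 1"
        define L where "L = \<rho> \<alpha> * \<mu>"
        have l: "\<mu> / 2 \<le> L" "0 < L" using elim(1) pos unfolding L_def by (auto simp: mult_right_mono[of "1/2" "\<rho> \<alpha>" \<mu>, simplified])
        have idc0: "0 \<le> idc (L * s)" using l s by (intro idc_nonneg) auto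
        have r: "1 \<le> ?r" "0 \<le> 1 - 1 / ?r" by auto
        have r2: "1 - 1 / ?r \<le> e / 2"
        proof -
          have "1 - 1 / ?r = (?r - 1) / ?r" by (simp add: field_simps)
          also have "\<dots> \<le> (?r - 1) / 1" by (intro divide_left_mono) auto
          also have "\<dots> \<le> e / 2" using elim(2) e by auto
          finally show ?thesis .
        qed
        have nn: "0 \<le> Iw \<alpha> s" unfolding Iw_def L_def[symmetric] using idc0 r cs2 by (intro add_nonneg_nonneg divide_nonneg_nonneg) auto
        have "s * idc (L * s) = ((L * s) * idc (L * s)) / L" using l by simp
        also have "\<dots> \<le> (C + (ca2 + e/2) * (L * s)) / L"
          using C(2)[of "L * s"] l s by (intro divide_right_mono) auto
        also have "\<dots> = C / L + (ca2 + e/2) * s" using l by (simp add: field_simps)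
        also have "C / L \<le> C / (\<mu> / 2)" using C l pos by (intro divide_left_mono) auto
        finally have A: "s * idc (L * s) \<le> 2 * C / \<mu> + (ca2 + e/2) * s" by (simp add: mult.commute)
        have "s * (idc (L * s) / ?r) = (s * idc (L * s)) / ?r" by simp
        also have "\<dots> \<le> (s * idc (L * s)) / 1"
          using s idc0 by (intro divide_left_mono) auto
        finally have B: "s * (idc (L * s) / ?r) \<le> 2 * C / \<mu> + (ca2 + e/2) * s" using A by simp
        have "s * (1 - 1 / ?r) \<le> s * (e / 2)" using r2 s by (intro mult_left_mono) auto
        moreover have "s * Iw \<alpha> s = s * (idc (L * s) / ?r) + s * (1 - 1 / ?r) + s * cs2"
          by (simp only: Iw_def L_def distrib_left)
        moreover have "(ca2 + e/2) * s + s * (e / 2) + s * cs2 = (cx2' + e) * s"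
          by (simp add: cx2'_def algebra_simps)
        ultimately have "s * Iw \<alpha> s \<le> 2 * C / \<mu> + (cx2' + e) * s"
          using B by linarith
        with nn show "0 \<le> Iw \<alpha> s \<and> s * Iw \<alpha> s \<le> 2 * C / \<mu> + (cx2' + e) * s" ..
      qed
    qed
  qed
qed

lemma Iw_tendsto:
  assumes u: "0 < u" and \<kappa>: "0 < \<kappa>"
  shows "((\<lambda>\<alpha>. Iw \<alpha> (u * \<alpha> powr (- 2 * \<kappa>))) \<longlongrightarrow> cx2') (at_right 0)"
proof -
  have "filterlim (\<lambda>\<alpha>. (\<rho> \<alpha> * \<mu> * u) * \<alpha> powr (- 2 * \<kappa>)) at_top (at_right 0)"
  proof (rule filterlim_tendsto_pos_mult_at_top)
    show "((\<lambda>\<alpha>. \<rho> \<alpha> * \<mu> * u) \<longlongrightarrow> 1 * \<mu> * u) (at_right 0)" by (intro tendsto_intros rho_tendsto)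
  qed (use u \<kappa> pos powr_neg_at_top_right[of "- 2 * \<kappa>"] in auto)
  from filterlim_compose[OF idc_lim this]
  have "((\<lambda>\<alpha>. idc (\<rho> \<alpha> * \<mu> * (u * \<alpha> powr (- 2 * \<kappa>)))) \<longlongrightarrow> ca2) (at_right 0)" by (simp add: mult.assoc)
  then have "((\<lambda>\<alpha>. Iw \<alpha> (u * \<alpha> powr (- 2 * \<kappa>))) \<longlongrightarrow> ca2 / max 1 1 + (1 - 1 / max 1 1) + cs2) (at_right 0)"
    unfolding Iw_def by (intro tendsto_intros rho_tendsto) auto
  then show ?thesis by (simp add: cx2'_def)
qed

lemma eventually_right_pos: "\<forall>\<^sub>F \<alpha> in at_right (0::real). 0 < \<alpha>"
  by (auto simp: eventually_at_filter)

lemma eventually_rho_pos: "\<forall>\<^sub>F \<alpha> in at_right 0. 0 < \<rho> \<alpha>"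
  using rho_tendsto by (rule order_tendstoD) simp

end

text \<open>\<open>Z_ge\<close> and \<open>Z_le\<close> are the two halves of the statement that Z
  \<alpha> is the supremum, each usable on its own.\<close>

locale rq_solution = rq_asymptotics +
  assumes Z_nonneg: "\<And>\<alpha>. 0 < \<alpha> \<Longrightarrow> 0 < \<rho> \<alpha> \<Longrightarrow> 0 \<le> Z \<alpha>"
    and Z_ge: "\<And>\<alpha> s. 0 < \<alpha> \<Longrightarrow> 0 < \<rho> \<alpha> \<Longrightarrow> 0 \<le> s \<Longrightarrow> (p \<alpha> - 1) * s + b * sqrt (G \<alpha> s) \<le> Z \<alpha>"
    and Z_le: "\<And>\<alpha> B. 0 < \<alpha> \<Longrightarrow> 0 < \<rho> \<alpha> \<Longrightarrow> (\<And>s. 0 \<le> s \<Longrightarrow> (p \<alpha> - 1) * s + b * sqrt (G \<alpha> s) \<le> B) \<Longrightarrow> Z \<alpha> \<le> B"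
begin

lemma p_nonneg: "0 < \<rho> \<alpha> \<Longrightarrow> 0 \<le> p \<alpha>"
  unfolding p_def using F_range by (intro mult_nonneg_nonneg) auto

lemma Iw_nonneg:
  assumes "0 < \<rho> \<alpha>" "0 \<le> s"
  shows "0 \<le> Iw \<alpha> s"
  unfolding Iw_def using assms pos cs2 by (intro add_nonneg_nonneg divide_nonneg_nonneg idc_nonneg) auto

lemma G_nonneg: "0 < \<rho> \<alpha> \<Longrightarrow> 0 \<le> s \<Longrightarrow> 0 \<le> G \<alpha> s"
  unfolding G_def using pos p_nonneg Iw_nonneg w_range(1)
  by (intro mult_nonneg_nonneg divide_nonneg_nonneg) auto

text \<open>A positive linear coefficient would make the supremum infinite.\<close>

lemma p_le_1:
  assumes \<alpha>: "0 < \<alpha>" "0 < \<rho> \<alpha>"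
  shows "p \<alpha> \<le> 1"
proof (rule ccontr)
  assume "\<not> p \<alpha> \<le> 1"
  then have g: "0 < p \<alpha> - 1" by simp
  define s where "s = (Z \<alpha> + 1) / (p \<alpha> - 1)"
  have s: "0 \<le> s" using g Z_nonneg[OF \<alpha>] by (simp add: s_def)
  have "(p \<alpha> - 1) * s + b * sqrt (G \<alpha> s) \<le> Z \<alpha>" by (rule Z_ge[OF \<alpha> s])
  moreover have "(p \<alpha> - 1) * s = Z \<alpha> + 1" using g by (simp add: s_def)
  moreover have "0 \<le> b * sqrt (G \<alpha> s)" using pos G_nonneg[OF \<alpha>(2) s] by simp
  ultimately show False by linarith
qed

lemma p_minus_1: "p \<alpha> - 1 = c * \<alpha> powr \<gamma> - \<rho> \<alpha> * F (\<alpha> * Z \<alpha>)"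
  by (simp add: p_def \<rho>_def algebra_simps)

text \<open>If the slope is at most -\<theta>, then \<open>mult_sqrt_le_young\<close> with this
  \<theta> cancels the linear term and leaves a bound free of s. For \<theta> \<le> 1 its constant
  part is also at most a multiple of 1 / \<theta>.\<close>

lemma Z_crude_bound:
  obtains D where "0 < D" "\<forall>\<^sub>F \<alpha> in at_right 0. \<forall>\<theta>. 0 < \<theta> \<longrightarrow> \<theta> \<le> 1 \<longrightarrow> p \<alpha> - 1 \<le> - \<theta> \<longrightarrow> Z \<alpha> \<le> D / \<theta>"
proof -
  obtain C where C: "0 \<le> C" "\<forall>\<^sub>F \<alpha> in at_right 0. \<forall>s\<ge>0. 0 \<le> Iw \<alpha> s \<and> s * Iw \<alpha> s \<le> C + (cx2' + 1) * s"
    using Iw_linear_bound[OF zero_less_one] by blast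
  define C1 where "C1 = C * K / \<mu>"
  define E1 where "E1 = (cx2' + 1) * K / \<mu>"
  have C1: "0 \<le> C1" "0 < E1" using C(1) K_pos pos cx2' by (auto simp: C1_def E1_def)
  define D where "D = b * sqrt C1 + b\<^sup>2 * E1 / 4"
  show ?thesis
  proof
    show "0 < D" unfolding D_def using C1 pos by (intro add_nonneg_pos) auto
    show "\<forall>\<^sub>F \<alpha> in at_right 0. \<forall>\<theta>. 0 < \<theta> \<longrightarrow> \<theta> \<le> 1 \<longrightarrow> p \<alpha> - 1 \<le> - \<theta> \<longrightarrow> Z \<alpha> \<le> D / \<theta>"
      using C(2) eventually_right_pos eventually_rho_pos
    proof eventually_elim
      case (elim \<alpha>)
      show ?case
      proof (intro allI impI)
        fix \<theta> :: real assume \<theta>: "0 < \<theta>" "\<theta> \<le> 1" "p \<alpha> - 1 \<le> - \<theta>"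
        have "Z \<alpha> \<le> b * sqrt C1 + b\<^sup>2 * E1 / (4 * \<theta>)"
        proof (rule Z_le[OF elim(2,3)])
          fix s :: real assume s: "0 \<le> s"
          let ?w = "w (\<alpha> powr (2 * h) * \<tau> * s)"
          have w: "0 \<le> ?w" "?w \<le> K" using s pos by (auto intro!: w_range)
          have I: "0 \<le> s * Iw \<alpha> s" "s * Iw \<alpha> s \<le> C + (cx2' + 1) * s" using elim(1) s by auto
          have "G \<alpha> s = (s * Iw \<alpha> s) * ?w * (p \<alpha> / \<mu>)" by (simp add: G_def)
          also have "\<dots> \<le> (C + (cx2' + 1) * s) * K * (1 / \<mu>)"
            using I w p_le_1[OF elim(2,3)] p_nonneg[OF elim(3)] pos C(1) cx2' s
            by (intro mult_mono divide_right_mono mult_nonneg_nonneg add_nonneg_nonneg) auto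
          also have "\<dots> = C1 + E1 * s" by (simp add: C1_def E1_def add_divide_distrib algebra_simps)
          finally have "sqrt (G \<alpha> s) \<le> sqrt (C1 + E1 * s)" by (rule real_sqrt_le_mono)
          also have "\<dots> \<le> sqrt C1 + sqrt (E1 * s)" using C1 s by (intro sqrt_add_le_add_sqrt) auto
          finally have "b * sqrt (G \<alpha> s) \<le> b * (sqrt C1 + sqrt (E1 * s))" using pos by (intro mult_left_mono) auto
          moreover have "b * sqrt (E1 * s) \<le> \<theta> * s + b\<^sup>2 * E1 / (4 * \<theta>)"
            using C1 s \<theta> by (intro mult_sqrt_le_young) auto
          moreover have "(p \<alpha> - 1) * s \<le> - \<theta> * s" using \<theta> s by (intro mult_right_mono) auto
          ultimately show "(p \<alpha> - 1) * s + b * sqrt (G \<alpha> s) \<le> b * sqrt C1 + b\<^sup>2 * E1 / (4 * \<theta>)"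
            by (simp add: distrib_left)
        qed
        also have "\<dots> \<le> D / \<theta>"
        proof -
          have "b * sqrt C1 \<le> (b * sqrt C1) / \<theta>" using \<theta> pos C1 by (simp add: pos_le_divide_eq mult_left_le)
          moreover have "D / \<theta> = (b * sqrt C1) / \<theta> + b\<^sup>2 * E1 / (4 * \<theta>)" by (simp add: D_def add_divide_distrib)
          ultimately show ?thesis by linarith
        qed
        finally show "Z \<alpha> \<le> D / \<theta>" .
      qed
    qed
  qed
qed

text \<open>If Z = O(\<alpha>^(-g)), then F (\<alpha> Z) = O(\<alpha>^(k (1 - g))), and k (1 - g) >
  g for g < h. The predicate Q lets the bound on Z be conditional, which is how it occurs in a proof
  by contradiction.\<close>

lemma F_scaled_bound:
  assumes D: "0 < D" and g: "0 < g" "g < h"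
    and Z: "\<forall>\<^sub>F \<alpha> in at_right 0. Q \<alpha> \<longrightarrow> Z \<alpha> \<le> D / \<alpha> powr g" and e: "0 < e"
  shows "\<forall>\<^sub>F \<alpha> in at_right 0. Q \<alpha> \<longrightarrow> F (\<alpha> * Z \<alpha>) < e * \<alpha> powr g"
proof -
  have "0 < 1 - g" using g h by linarith
  moreover have "g < real k * (1 - g)"
  proof -
    have "real k * (1 - h) < real k * (1 - g)" using g k_pos by (intro mult_strict_left_mono) auto
    then show ?thesis using h(3) g by linarith
  qed
  ultimately have "((\<lambda>\<alpha>. F (D * \<alpha> powr (1 - g)) / \<alpha> powr g) \<longlongrightarrow> 0) (at_right 0)"
    by (rule F_scale_small[OF D])
  then have "\<forall>\<^sub>F \<alpha> in at_right 0. F (D * \<alpha> powr (1 - g)) / \<alpha> powr g < e" using e by (rule order_tendstoD)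
  then show ?thesis using Z eventually_right_pos
  proof eventually_elim
    case (elim \<alpha>)
    show ?case
    proof
      assume "Q \<alpha>"
      then have "\<alpha> * Z \<alpha> \<le> \<alpha> * (D / \<alpha> powr g)" using elim by (intro mult_left_mono) auto
      also have "\<dots> = D * \<alpha> powr (1 - g)" using elim(3) by (simp add: powr_diff)
      finally have "F (\<alpha> * Z \<alpha>) \<le> F (D * \<alpha> powr (1 - g))" by (rule monoD[OF F_mono])
      also have "\<dots> < e * \<alpha> powr g" using elim by (simp add: divide_less_eq)
      finally show "F (\<alpha> * Z \<alpha>) < e * \<alpha> powr g" .
    qed
  qed
qed

subsection \<open>Overloaded regime\<close>

context
  assumes over: "\<gamma> < h" "0 < c"
begin

text \<open>The lower bound is \<open>p_le_1\<close>. If the ratio reached a > 1, the slope would be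
  at most -(a - 1) c \<alpha>^\<gamma>, so Z = O(\<alpha>^(-\<gamma>)) by
  \<open>Z_crude_bound\<close>; then F (\<alpha> Z) would be o(\<alpha>^\<gamma>), against the lower
  bound.\<close>

lemma overloaded_abandonment: "((\<lambda>\<alpha>. \<rho> \<alpha> / (\<rho> \<alpha> - 1) * F (\<alpha> * Z \<alpha>)) \<longlongrightarrow> 1) (at_right 0)"
proof (rule order_tendstoI)
  fix a :: real assume a: "a < 1"
  show "\<forall>\<^sub>F \<alpha> in at_right 0. a < \<rho> \<alpha> / (\<rho> \<alpha> - 1) * F (\<alpha> * Z \<alpha>)"
    using eventually_right_pos eventually_rho_pos
  proof eventually_elim
    case (elim \<alpha>)
    have cp: "0 < c * \<alpha> powr \<gamma>" using over elim by simp
    have "c * \<alpha> powr \<gamma> \<le> \<rho> \<alpha> * F (\<alpha> * Z \<alpha>)"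
      using p_le_1[OF elim] p_minus_1[of \<alpha>] by linarith
    then have "1 \<le> \<rho> \<alpha> * F (\<alpha> * Z \<alpha>) / (c * \<alpha> powr \<gamma>)" using cp by (simp add: le_divide_eq)
    then show ?case using a by (simp add: \<rho>_def)
  qed
next
  fix a :: real assume a: "1 < a"
  define \<eta> where "\<eta> = a - 1"
  have \<eta>: "0 < \<eta>" using a by (simp add: \<eta>_def)
  obtain D where D: "0 < D" "\<forall>\<^sub>F \<alpha> in at_right 0. \<forall>\<theta>. 0 < \<theta> \<longrightarrow> \<theta> \<le> 1 \<longrightarrow> p \<alpha> - 1 \<le> - \<theta> \<longrightarrow> Z \<alpha> \<le> D / \<theta>"
    by (rule Z_crude_bound) blast
  have "((\<lambda>\<alpha>. \<eta> * c * \<alpha> powr \<gamma>) \<longlongrightarrow> \<eta> * c * 0) (at_right 0)"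
    using pos by (intro tendsto_intros powr_tendsto_0_right)
  then have small: "\<forall>\<^sub>F \<alpha> in at_right 0. \<eta> * c * \<alpha> powr \<gamma> < 1" by (rule order_tendstoD) simp
  have "\<forall>\<^sub>F \<alpha> in at_right 0. p \<alpha> - 1 \<le> - (\<eta> * c * \<alpha> powr \<gamma>) \<longrightarrow> Z \<alpha> \<le> (D / (\<eta> * c)) / \<alpha> powr \<gamma>"
    using D(2) small eventually_right_pos
  proof eventually_elim
    case (elim \<alpha>)
    have "0 < \<eta> * c * \<alpha> powr \<gamma>" using \<eta> over elim by simp
    then have "p \<alpha> - 1 \<le> - (\<eta> * c * \<alpha> powr \<gamma>) \<longrightarrow> Z \<alpha> \<le> D / (\<eta> * c * \<alpha> powr \<gamma>)"
      using elim(1)[rule_format, of "\<eta> * c * \<alpha> powr \<gamma>"] elim(2) by auto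
    then show ?case by simp
  qed
  then have F_small: "\<forall>\<^sub>F \<alpha> in at_right 0. p \<alpha> - 1 \<le> - (\<eta> * c * \<alpha> powr \<gamma>) \<longrightarrow> F (\<alpha> * Z \<alpha>) < (c / 2) * \<alpha> powr \<gamma>"
    using D(1) \<eta> over pos by (intro F_scaled_bound[of "D / (\<eta> * c)"]) auto
  have rho2: "\<forall>\<^sub>F \<alpha> in at_right 0. \<rho> \<alpha> < 2" by (rule order_tendstoD[OF rho_tendsto]) simp
  show "\<forall>\<^sub>F \<alpha> in at_right 0. \<rho> \<alpha> / (\<rho> \<alpha> - 1) * F (\<alpha> * Z \<alpha>) < a"
    using F_small rho2 eventually_right_pos eventually_rho_pos
  proof eventually_elim
    case (elim \<alpha>)
    have cp: "0 < c * \<alpha> powr \<gamma>" using over elim by simp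
    have "\<rho> \<alpha> * F (\<alpha> * Z \<alpha>) < a * (c * \<alpha> powr \<gamma>)"
    proof (rule ccontr)
      assume "\<not> ?thesis"
      then have "p \<alpha> - 1 \<le> - (\<eta> * c * \<alpha> powr \<gamma>)"
        unfolding p_minus_1 by (simp add: \<eta>_def algebra_simps)
      then have "F (\<alpha> * Z \<alpha>) < (c / 2) * \<alpha> powr \<gamma>" using elim(1) by blast
      then have "2 * F (\<alpha> * Z \<alpha>) < c * \<alpha> powr \<gamma>" by simp
      moreover have "\<rho> \<alpha> * F (\<alpha> * Z \<alpha>) \<le> 2 * F (\<alpha> * Z \<alpha>)" using elim F_range by (intro mult_right_mono) auto
      moreover have "c * \<alpha> powr \<gamma> \<le> \<rho> \<alpha> * F (\<alpha> * Z \<alpha>)"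
        using p_le_1[OF elim(3,4)] p_minus_1[of \<alpha>] by linarith
      ultimately show False by linarith
    qed
    then show ?case using cp by (simp add: \<rho>_def divide_less_eq)
  qed
qed

text \<open>As F (\<alpha> Z) has order \<alpha>^\<gamma> and F is positive off 0, \<alpha> Z tends
  to 0 from the right, and there F x ~ \<beta> x^k can be solved for x.\<close>

lemma overloaded_wait: "((\<lambda>\<alpha>. \<alpha> powr (1 - \<gamma> / real k) * Z \<alpha>) \<longlongrightarrow> (c / \<beta>) powr (1 / real k)) (at_right 0)"
proof -
  let ?x = "\<lambda>\<alpha>. \<alpha> * Z \<alpha>"
  have ev: "\<forall>\<^sub>F \<alpha> in at_right 0. \<rho> \<alpha> / (\<rho> \<alpha> - 1) * F (?x \<alpha>) / \<rho> \<alpha> * c = F (?x \<alpha>) / \<alpha> powr \<gamma>"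
    using eventually_right_pos eventually_rho_pos
    by eventually_elim (use over in \<open>simp add: \<rho>_def\<close>)
  have "((\<lambda>\<alpha>. \<rho> \<alpha> / (\<rho> \<alpha> - 1) * F (?x \<alpha>) / \<rho> \<alpha> * c) \<longlongrightarrow> 1 / 1 * c) (at_right 0)"
    by (intro tendsto_intros overloaded_abandonment rho_tendsto) auto
  from Lim_transform_eventually[OF this ev]
  have Fx: "((\<lambda>\<alpha>. F (?x \<alpha>) / \<alpha> powr \<gamma>) \<longlongrightarrow> c) (at_right 0)" by simp
  have "((\<lambda>\<alpha>. F (?x \<alpha>) / \<alpha> powr \<gamma> * \<alpha> powr \<gamma>) \<longlongrightarrow> c * 0) (at_right 0)"
    using pos by (intro tendsto_intros Fx powr_tendsto_0_right)
  then have "((\<lambda>\<alpha>. F (?x \<alpha>) / \<alpha> powr \<gamma> * \<alpha> powr \<gamma>) \<longlongrightarrow> 0) (at_right 0)" by (simp only: mult_zero_right)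
  moreover have "\<forall>\<^sub>F \<alpha> in at_right 0. F (?x \<alpha>) / \<alpha> powr \<gamma> * \<alpha> powr \<gamma> = F (?x \<alpha>)"
    using eventually_right_pos by eventually_elim simp
  ultimately have F0: "((\<lambda>\<alpha>. F (?x \<alpha>)) \<longlongrightarrow> 0) (at_right 0)"
    by (rule Lim_transform_eventually)
  have Fpos: "\<forall>\<^sub>F \<alpha> in at_right 0. 0 < ?x \<alpha>"
  proof -
    have "\<forall>\<^sub>F \<alpha> in at_right 0. 0 < F (?x \<alpha>) / \<alpha> powr \<gamma>" using Fx over(2) by (rule order_tendstoD)
    then show ?thesis
    proof eventually_elim
      case (elim \<alpha>)
      show ?case
      proof (rule ccontr)
        assume "\<not> 0 < ?x \<alpha>"
        then have "F (?x \<alpha>) \<le> F 0" by (intro monoD[OF F_mono]) simp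
        then show False using elim F_0 F_range(1)[of "?x \<alpha>"] by simp
      qed
    qed
  qed
  have x0: "filterlim ?x (at_right 0) (at_right 0)"
    unfolding filterlim_at
  proof
    show "\<forall>\<^sub>F \<alpha> in at_right 0. ?x \<alpha> \<in> {0<..} \<and> ?x \<alpha> \<noteq> 0" using Fpos by eventually_elim auto
    show "(?x \<longlongrightarrow> 0) (at_right 0)"
    proof (rule order_tendstoI)
      fix a :: real assume "a < 0"
      then show "\<forall>\<^sub>F \<alpha> in at_right 0. a < ?x \<alpha>" using Fpos by (auto elim: eventually_mono)
    next
      fix a :: real assume "0 < a"
      then have "\<forall>\<^sub>F \<alpha> in at_right 0. F (?x \<alpha>) < F a" using F_pos by (intro order_tendstoD[OF F0])
      then show "\<forall>\<^sub>F \<alpha> in at_right 0. ?x \<alpha> < a"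
        by eventually_elim (use F_mono in \<open>meson linorder_not_le monoD\<close>)
    qed
  qed
  have "((\<lambda>\<alpha>. (F (?x \<alpha>) / \<alpha> powr \<gamma>) / (F (?x \<alpha>) / ?x \<alpha> ^ k)) \<longlongrightarrow> c / \<beta>) (at_right 0)"
    using pos by (intro tendsto_intros Fx filterlim_compose[OF F_asymp x0]) auto
  then have "((\<lambda>\<alpha>. ((F (?x \<alpha>) / \<alpha> powr \<gamma>) / (F (?x \<alpha>) / ?x \<alpha> ^ k)) powr (1 / real k)) \<longlongrightarrow> (c / \<beta>) powr (1 / real k)) (at_right 0)"
    using over pos by (intro tendsto_powr tendsto_const) auto
  moreover have "\<forall>\<^sub>F \<alpha> in at_right 0. ((F (?x \<alpha>) / \<alpha> powr \<gamma>) / (F (?x \<alpha>) / ?x \<alpha> ^ k)) powr (1 / real k) = \<alpha> powr (1 - \<gamma> / real k) * Z \<alpha>"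
    using Fpos eventually_right_pos
  proof eventually_elim
    case (elim \<alpha>)
    have "0 < F (?x \<alpha>)" by (rule F_pos[OF elim(1)])
    then have "(F (?x \<alpha>) / \<alpha> powr \<gamma>) / (F (?x \<alpha>) / ?x \<alpha> ^ k) = ?x \<alpha> ^ k / \<alpha> powr \<gamma>" by simp
    moreover have "(?x \<alpha> ^ k / \<alpha> powr \<gamma>) powr (1 / real k) = ?x \<alpha> / \<alpha> powr (\<gamma> / real k)"
      using elim k_pos by (simp add: powr_divide powr_realpow[symmetric] powr_powr)
    moreover have "?x \<alpha> / \<alpha> powr (\<gamma> / real k) = \<alpha> powr (1 - \<gamma> / real k) * Z \<alpha>"
      using elim by (simp add: powr_diff)
    ultimately show ?case by simp
  qed
  ultimately show ?thesis by (rule Lim_transform_eventually)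
qed

end

end

context rq_solution
begin

subsection \<open>Underloaded regime\<close>

text \<open>Near 0 the limit 1 suffices; from d on the line with slope K / d exceeds the global
  bound K.\<close>

lemma w_linear_bound:
  assumes e: "0 < e"
  obtains M where "0 \<le> M" "\<And>x. 0 < x \<Longrightarrow> w x \<le> 1 + e + M * x"
proof -
  have "\<forall>\<^sub>F x in at_right 0. w x < 1 + e" by (rule order_tendstoD[OF w_0]) (use e in simp)
  then obtain d where d: "0 < d" "\<And>x. 0 < x \<Longrightarrow> x < d \<Longrightarrow> w x < 1 + e"
    unfolding eventually_at_right_field by auto
  show ?thesis
  proof
    show M: "0 \<le> K / d" using K_pos d by simp
    fix x :: real assume x: "0 < x"
    show "w x \<le> 1 + e + K / d * x"
    proof (cases "x < d")
      case True
      then show ?thesis using d(2)[OF x True] mult_nonneg_nonneg[OF M less_imp_le[OF x]] by linarith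
    next
      case False
      have "K / d * d \<le> K / d * x" using False M by (intro mult_left_mono) auto
      then show ?thesis using w_range(2)[of x] x d(1) e by simp
    qed
  qed
qed

context
  assumes under: "\<gamma> < h" "c < 0"
begin

text \<open>Abandonment only lowers the slope, which is therefore at most c \<alpha>^\<gamma> < 0,
  and the bound of \<open>Z_crude_bound\<close> holds unconditionally.\<close>

lemma underloaded_F: "((\<lambda>\<alpha>. F (\<alpha> * Z \<alpha>) / \<alpha> powr \<gamma>) \<longlongrightarrow> 0) (at_right 0)"
proof -
  obtain D where D: "0 < D" "\<forall>\<^sub>F \<alpha> in at_right 0. \<forall>\<theta>. 0 < \<theta> \<longrightarrow> \<theta> \<le> 1 \<longrightarrow> p \<alpha> - 1 \<le> - \<theta> \<longrightarrow> Z \<alpha> \<le> D / \<theta>"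
    by (rule Z_crude_bound) blast
  have "((\<lambda>\<alpha>. - c * \<alpha> powr \<gamma>) \<longlongrightarrow> - c * 0) (at_right 0)"
    using pos by (intro tendsto_intros powr_tendsto_0_right)
  then have small: "\<forall>\<^sub>F \<alpha> in at_right 0. - c * \<alpha> powr \<gamma> < 1" by (rule order_tendstoD) simp
  have Zb: "\<forall>\<^sub>F \<alpha> in at_right 0. True \<longrightarrow> Z \<alpha> \<le> (D / (- c)) / \<alpha> powr \<gamma>"
    using D(2) small eventually_right_pos eventually_rho_pos
  proof eventually_elim
    case (elim \<alpha>)
    have "0 < - c * \<alpha> powr \<gamma>" using under elim by (intro mult_pos_pos) auto
    moreover have "0 \<le> \<rho> \<alpha> * F (\<alpha> * Z \<alpha>)" using elim F_range by (intro mult_nonneg_nonneg) auto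
    then have "p \<alpha> - 1 \<le> - (- c * \<alpha> powr \<gamma>)" unfolding p_minus_1 by simp
    ultimately have "Z \<alpha> \<le> D / (- c * \<alpha> powr \<gamma>)"
      using elim(1)[rule_format, of "- c * \<alpha> powr \<gamma>"] elim(2) by auto
    then show ?case by simp
  qed
  show ?thesis
  proof (rule order_tendstoI)
    fix a :: real assume "a < 0"
    then show "\<forall>\<^sub>F \<alpha> in at_right 0. a < F (\<alpha> * Z \<alpha>) / \<alpha> powr \<gamma>"
      using F_range by (intro always_eventually allI) (auto intro: less_le_trans)
  next
    fix a :: real assume a: "0 < a"
    have Dc: "0 < D / (- c)" using D(1) under by (intro divide_pos_pos) auto
    have "\<forall>\<^sub>F \<alpha> in at_right 0. True \<longrightarrow> F (\<alpha> * Z \<alpha>) < a * \<alpha> powr \<gamma>"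
      by (rule F_scaled_bound[OF Dc pos(4) under(1) Zb a])
    then show "\<forall>\<^sub>F \<alpha> in at_right 0. F (\<alpha> * Z \<alpha>) / \<alpha> powr \<gamma> < a"
      using eventually_right_pos by eventually_elim (simp add: divide_less_eq)
  qed
qed

lemma underloaded_slope: "((\<lambda>\<alpha>. (p \<alpha> - 1) / \<alpha> powr \<gamma>) \<longlongrightarrow> c) (at_right 0)"
proof -
  have "((\<lambda>\<alpha>. c - \<rho> \<alpha> * (F (\<alpha> * Z \<alpha>) / \<alpha> powr \<gamma>)) \<longlongrightarrow> c - 1 * 0) (at_right 0)"
    by (intro tendsto_intros rho_tendsto underloaded_F)
  then have "((\<lambda>\<alpha>. c - \<rho> \<alpha> * (F (\<alpha> * Z \<alpha>) / \<alpha> powr \<gamma>)) \<longlongrightarrow> c) (at_right 0)" by simp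
  moreover have "\<forall>\<^sub>F \<alpha> in at_right 0. c - \<rho> \<alpha> * (F (\<alpha> * Z \<alpha>) / \<alpha> powr \<gamma>) = (p \<alpha> - 1) / \<alpha> powr \<gamma>"
    using eventually_right_pos by eventually_elim (simp add: p_minus_1 diff_divide_distrib)
  ultimately show ?thesis by (rule Lim_transform_eventually)
qed

lemma underloaded_p: "(p \<longlongrightarrow> 1) (at_right 0)"
proof -
  have "((\<lambda>\<alpha>. 1 + (p \<alpha> - 1) / \<alpha> powr \<gamma> * \<alpha> powr \<gamma>) \<longlongrightarrow> 1 + c * 0) (at_right 0)"
    using pos by (intro tendsto_intros underloaded_slope powr_tendsto_0_right)
  then have "((\<lambda>\<alpha>. 1 + (p \<alpha> - 1) / \<alpha> powr \<gamma> * \<alpha> powr \<gamma>) \<longlongrightarrow> 1) (at_right 0)" by simp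
  moreover have "\<forall>\<^sub>F \<alpha> in at_right 0. 1 + (p \<alpha> - 1) / \<alpha> powr \<gamma> * \<alpha> powr \<gamma> = p \<alpha>"
    using eventually_right_pos by eventually_elim simp
  ultimately show ?thesis by (rule Lim_transform_eventually)
qed

text \<open>Bounding w by 1 + e + M x splits the bound on G into a constant, a linear and a
  quadratic term in s. The quadratic one yields a multiple of \<alpha>^h s outside the root,
  negligible against the slope of order \<alpha>^\<gamma>. The linear one is met by Young's
  inequality with the whole remaining slope, which keeps the constant sharp.\<close>

lemma underloaded_upper:
  assumes e: "0 < e" "e \<le> 1" and a: "b\<^sup>2 * ((cx2' + e) * (1 + e) / \<mu>) / (4 * (- c)) < a"
  shows "\<forall>\<^sub>F \<alpha> in at_right 0. \<alpha> powr \<gamma> * Z \<alpha> < a"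
proof -
  obtain C where C: "0 \<le> C" "\<forall>\<^sub>F \<alpha> in at_right 0. \<forall>s\<ge>0. 0 \<le> Iw \<alpha> s \<and> s * Iw \<alpha> s \<le> C + (cx2' + e) * s"
    using Iw_linear_bound[OF e(1)] by blast
  obtain M where M: "0 \<le> M" "\<And>x. 0 < x \<Longrightarrow> w x \<le> 1 + e + M * x" using w_linear_bound[OF e(1)] by blast
  define E where "E = cx2' + e"
  have E: "0 < E" using cx2' e by (simp add: E_def)
  define A1 where "A1 = C * K / \<mu>"
  define A2 where "A2 = E * (1 + e) / \<mu>"
  define A3 where "A3 = E * M * \<tau> / \<mu>"
  have A: "0 \<le> A1" "0 \<le> A2" "0 \<le> A3" using C K_pos E e M pos by (auto simp: A1_def A2_def A3_def)
  let ?r = "b * sqrt A3"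
  have lim: "((\<lambda>\<alpha>. \<alpha> powr \<gamma> * (b * sqrt A1) + b\<^sup>2 * A2 / (4 * (- c - ?r * \<alpha> powr (h - \<gamma>))))
      \<longlongrightarrow> 0 * (b * sqrt A1) + b\<^sup>2 * A2 / (4 * (- c - ?r * 0))) (at_right 0)"
    using under pos by (intro tendsto_intros powr_tendsto_0_right) auto
  have "0 * (b * sqrt A1) + b\<^sup>2 * A2 / (4 * (- c - ?r * 0)) < a" using a by (simp add: A2_def E_def)
  from order_tendstoD(2)[OF lim this]
  have ev1: "\<forall>\<^sub>F \<alpha> in at_right 0. \<alpha> powr \<gamma> * (b * sqrt A1) + b\<^sup>2 * A2 / (4 * (- c - ?r * \<alpha> powr (h - \<gamma>))) < a" .
  have "((\<lambda>\<alpha>. - c - ?r * \<alpha> powr (h - \<gamma>)) \<longlongrightarrow> - c - ?r * 0) (at_right 0)"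
    using under by (intro tendsto_intros powr_tendsto_0_right) auto
  then have ev2: "\<forall>\<^sub>F \<alpha> in at_right 0. 0 < - c - ?r * \<alpha> powr (h - \<gamma>)" using under by (intro order_tendstoD) auto
  show ?thesis
    using C(2) ev1 ev2 eventually_right_pos eventually_rho_pos
  proof eventually_elim
    case (elim \<alpha>)
    define \<theta> where "\<theta> = (- c - ?r * \<alpha> powr (h - \<gamma>)) * \<alpha> powr \<gamma>"
    have \<theta>: "0 < \<theta>" using elim by (simp add: \<theta>_def)
    have \<theta>_eq: "\<theta> = - c * \<alpha> powr \<gamma> - ?r * \<alpha> powr h"
    proof -
      have "\<alpha> powr (h - \<gamma>) * \<alpha> powr \<gamma> = \<alpha> powr h" using elim(4) by (simp add: powr_add[symmetric])
      then show ?thesis unfolding \<theta>_def by (simp only: left_diff_distrib mult.assoc)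
    qed
    have p1: "p \<alpha> - 1 \<le> c * \<alpha> powr \<gamma>"
      unfolding p_minus_1 using elim F_range by (simp add: mult_nonneg_nonneg)
    have "Z \<alpha> \<le> b * sqrt A1 + b\<^sup>2 * A2 / (4 * \<theta>)"
    proof (rule Z_le[OF elim(4,5)])
      fix s :: real assume s: "0 \<le> s"
      let ?x = "\<alpha> powr (2 * h) * \<tau> * s"
      have sq: "\<alpha> powr (2 * h) = (\<alpha> powr h)\<^sup>2" using elim(4) by (simp add: powr_realpow[symmetric] powr_powr mult.commute)
      have "G \<alpha> s \<le> A1 + A2 * s + A3 * (\<alpha> powr h * s)\<^sup>2"
      proof (cases "s = 0")
        case True
        then show ?thesis using A by (simp add: G_def)
      next
        case False
        then have s': "0 < s" using s by simp
        have x: "0 < ?x" using s' elim pos by simp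
        have I: "0 \<le> s * Iw \<alpha> s" "s * Iw \<alpha> s \<le> C + E * s" using elim(1) s by (auto simp: E_def)
        have w: "0 \<le> w ?x" "w ?x \<le> K" "w ?x \<le> 1 + e + M * ?x" using x w_range[of ?x] M(2)[of ?x] by auto
        have "G \<alpha> s = (s * Iw \<alpha> s) * w ?x * (p \<alpha> / \<mu>)" by (simp add: G_def)
        also have "\<dots> \<le> (C + E * s) * w ?x * (1 / \<mu>)"
          using I w p_le_1[OF elim(4,5)] p_nonneg[OF elim(5)] pos C(1) E s
          by (intro mult_mono divide_right_mono mult_nonneg_nonneg add_nonneg_nonneg) auto
        also have "\<dots> = (C * w ?x + E * s * w ?x) / \<mu>" by (simp add: distrib_right)
        also have "\<dots> \<le> (C * K + E * s * (1 + e + M * ?x)) / \<mu>"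
          using w C(1) E s pos by (intro divide_right_mono add_mono mult_left_mono) auto
        also have "\<dots> = A1 + A2 * s + A3 * (\<alpha> powr h * s)\<^sup>2"
          unfolding A1_def A2_def A3_def sq by (simp add: add_divide_distrib power2_eq_square algebra_simps)
        finally show ?thesis .
      qed
      then have "sqrt (G \<alpha> s) \<le> sqrt (A1 + A2 * s + A3 * (\<alpha> powr h * s)\<^sup>2)" by (rule real_sqrt_le_mono)
      also have "\<dots> \<le> sqrt (A1 + A2 * s) + sqrt (A3 * (\<alpha> powr h * s)\<^sup>2)"
        using A s by (intro sqrt_add_le_add_sqrt) auto
      also have "sqrt (A1 + A2 * s) \<le> sqrt A1 + sqrt (A2 * s)"
        using A s by (intro sqrt_add_le_add_sqrt) auto
      also have "sqrt (A3 * (\<alpha> powr h * s)\<^sup>2) = sqrt A3 * (\<alpha> powr h * s)"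
        using s by (simp add: real_sqrt_mult)
      finally have "b * sqrt (G \<alpha> s) \<le> b * (sqrt A1 + sqrt (A2 * s) + sqrt A3 * (\<alpha> powr h * s))"
        using pos by (intro mult_left_mono) auto
      moreover have "b * sqrt (A2 * s) \<le> \<theta> * s + b\<^sup>2 * A2 / (4 * \<theta>)"
        using A s \<theta> by (intro mult_sqrt_le_young) auto
      moreover have "(p \<alpha> - 1) * s \<le> (c * \<alpha> powr \<gamma>) * s" using p1 s by (intro mult_right_mono) auto
      ultimately show "(p \<alpha> - 1) * s + b * sqrt (G \<alpha> s) \<le> b * sqrt A1 + b\<^sup>2 * A2 / (4 * \<theta>)"
        unfolding \<theta>_eq by (simp add: algebra_simps)
    qed
    then have "\<alpha> powr \<gamma> * Z \<alpha> \<le> \<alpha> powr \<gamma> * (b * sqrt A1 + b\<^sup>2 * A2 / (4 * \<theta>))"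
      by (intro mult_left_mono) auto
    also have "\<dots> = \<alpha> powr \<gamma> * (b * sqrt A1) + b\<^sup>2 * A2 / (4 * (- c - ?r * \<alpha> powr (h - \<gamma>)))"
      using elim(3,4) by (simp add: \<theta>_def distrib_left)
    finally show ?case using elim(2) by linarith
  qed
qed

lemma underloaded_lower:
  "\<exists>f. (f \<longlongrightarrow> b\<^sup>2 * cx2' / (4 * \<mu> * (- c))) (at_right 0) \<and> (\<forall>\<^sub>F \<alpha> in at_right 0. f \<alpha> \<le> \<alpha> powr \<gamma> * Z \<alpha>)"
proof -
  \<comment> \<open>The maximiser of c u + b sqrt (cx2' u / \<mu>), the limit of the rescaled
    expression. The supremum is tested only at s = u \<alpha>^(-2\<gamma>).\<close>
  define u where "u = b\<^sup>2 * cx2' / (4 * \<mu> * c\<^sup>2)"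
  have u: "0 < u" using pos cx2' under by (simp add: u_def)
  define s where "s \<alpha> = u * \<alpha> powr (- 2 * \<gamma>)" for \<alpha>
  define f where "f \<alpha> = (p \<alpha> - 1) / \<alpha> powr \<gamma> * u + b * sqrt (Iw \<alpha> (s \<alpha>) * w (\<tau> * u * \<alpha> powr (2 * (h - \<gamma>))) * (p \<alpha> * u / \<mu>))" for \<alpha>
  have wl: "((\<lambda>\<alpha>. w (\<tau> * u * \<alpha> powr (2 * (h - \<gamma>)))) \<longlongrightarrow> 1) (at_right 0)"
  proof (rule filterlim_compose[OF w_0])
    show "filterlim (\<lambda>\<alpha>. \<tau> * u * \<alpha> powr (2 * (h - \<gamma>))) (at_right 0) (at_right 0)"
      unfolding filterlim_at
    proof
      have "((\<lambda>\<alpha>. \<tau> * u * \<alpha> powr (2 * (h - \<gamma>))) \<longlongrightarrow> \<tau> * u * 0) (at_right 0)"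
        using under by (intro tendsto_intros powr_tendsto_0_right) auto
      then show "((\<lambda>\<alpha>. \<tau> * u * \<alpha> powr (2 * (h - \<gamma>))) \<longlongrightarrow> 0) (at_right 0)" by simp
      show "\<forall>\<^sub>F \<alpha> in at_right 0. \<tau> * u * \<alpha> powr (2 * (h - \<gamma>)) \<in> {0<..} \<and> \<tau> * u * \<alpha> powr (2 * (h - \<gamma>)) \<noteq> 0"
        using eventually_right_pos by eventually_elim (use u pos in auto)
    qed
  qed
  have "(f \<longlongrightarrow> c * u + b * sqrt (cx2' * 1 * (1 * u / \<mu>))) (at_right 0)"
    unfolding f_def s_def
    using pos by (intro tendsto_intros underloaded_slope wl underloaded_p Iw_tendsto[OF u pos(4)]) auto
  moreover have "c * u + b * sqrt (cx2' * 1 * (1 * u / \<mu>)) = b\<^sup>2 * cx2' / (4 * \<mu> * (- c))"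
  proof -
    have "cx2' * 1 * (1 * u / \<mu>) = (b * cx2' / (2 * \<mu> * (- c)))\<^sup>2"
      unfolding u_def using pos under by (simp add: power2_eq_square field_simps)
    moreover have "0 \<le> b * cx2' / (2 * \<mu> * (- c))"
      using pos cx2' under by (intro divide_nonneg_nonneg mult_nonneg_nonneg) auto
    ultimately have S: "sqrt (cx2' * 1 * (1 * u / \<mu>)) = b * cx2' / (2 * \<mu> * (- c))"
      by (simp only: real_sqrt_abs abs_of_nonneg)
    have cu: "c * u = b\<^sup>2 * cx2' / (4 * \<mu> * c)" unfolding u_def using under by (simp add: power2_eq_square)
    show ?thesis unfolding S cu using pos under by (simp add: field_simps power2_eq_square)
  qed
  ultimately have "(f \<longlongrightarrow> b\<^sup>2 * cx2' / (4 * \<mu> * (- c))) (at_right 0)" by simp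
  moreover have "\<forall>\<^sub>F \<alpha> in at_right 0. f \<alpha> \<le> \<alpha> powr \<gamma> * Z \<alpha>"
    using eventually_right_pos eventually_rho_pos
  proof eventually_elim
    case (elim \<alpha>)
    have s0: "0 \<le> s \<alpha>" using u by (simp add: s_def)
    let ?a = "\<alpha> powr \<gamma>"
    have a: "0 < ?a" using elim by simp
    have sa: "s \<alpha> = u / ?a\<^sup>2"
      using elim(1) by (simp add: s_def powr_minus powr_realpow[symmetric] powr_powr mult.commute field_simps)
    have arg: "\<alpha> powr (2 * h) * \<tau> * s \<alpha> = \<tau> * u * \<alpha> powr (2 * (h - \<gamma>))"
      using elim(1) by (simp add: s_def right_diff_distrib powr_diff powr_minus field_simps)
    have "?a * ((p \<alpha> - 1) * s \<alpha> + b * sqrt (G \<alpha> (s \<alpha>))) \<le> ?a * Z \<alpha>"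
      using Z_ge[OF elim s0] a by (intro mult_left_mono) auto
    moreover have "?a * ((p \<alpha> - 1) * s \<alpha>) = (p \<alpha> - 1) / ?a * u"
      unfolding sa using a by (simp add: power2_eq_square)
    moreover have "?a * (b * sqrt (G \<alpha> (s \<alpha>))) = b * sqrt (Iw \<alpha> (s \<alpha>) * w (\<tau> * u * \<alpha> powr (2 * (h - \<gamma>))) * (p \<alpha> * u / \<mu>))"
    proof -
      have "?a * sqrt (G \<alpha> (s \<alpha>)) = sqrt (?a\<^sup>2 * G \<alpha> (s \<alpha>))" using a by (simp add: real_sqrt_mult)
      moreover have "?a\<^sup>2 * G \<alpha> (s \<alpha>) = Iw \<alpha> (s \<alpha>) * w (\<tau> * u * \<alpha> powr (2 * (h - \<gamma>))) * (p \<alpha> * (?a\<^sup>2 * s \<alpha>) / \<mu>)"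
        unfolding G_def arg by simp
      moreover have "?a\<^sup>2 * s \<alpha> = u" unfolding sa using a by simp
      ultimately show ?thesis by (simp add: mult.left_commute)
    qed
    ultimately show ?case by (simp add: f_def distrib_left)
  qed
  ultimately show ?thesis by blast
qed

lemma underloaded_limit: "((\<lambda>\<alpha>. \<alpha> powr \<gamma> * Z \<alpha>) \<longlongrightarrow> b\<^sup>2 * cx2' / (4 * \<mu> * (- c))) (at_right 0)"
proof (rule order_tendstoI)
  fix a assume a: "a < b\<^sup>2 * cx2' / (4 * \<mu> * (- c))"
  obtain f where f: "(f \<longlongrightarrow> b\<^sup>2 * cx2' / (4 * \<mu> * (- c))) (at_right 0)" "\<forall>\<^sub>F \<alpha> in at_right 0. f \<alpha> \<le> \<alpha> powr \<gamma> * Z \<alpha>"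
    using underloaded_lower by blast
  have "\<forall>\<^sub>F \<alpha> in at_right 0. a < f \<alpha>" using f(1) a by (rule order_tendstoD)
  then show "\<forall>\<^sub>F \<alpha> in at_right 0. a < \<alpha> powr \<gamma> * Z \<alpha>" using f(2) by eventually_elim linarith
next
  fix a assume a: "b\<^sup>2 * cx2' / (4 * \<mu> * (- c)) < a"
  have "((\<lambda>e. b\<^sup>2 * ((cx2' + e) * (1 + e) / \<mu>) / (4 * (- c))) \<longlongrightarrow> b\<^sup>2 * ((cx2' + 0) * (1 + 0) / \<mu>) / (4 * (- c))) (at_right 0)"
    using under pos by (intro tendsto_intros) auto
  moreover have "b\<^sup>2 * ((cx2' + 0) * (1 + 0) / \<mu>) / (4 * (- c)) < a" using a by (simp add: mult_ac)
  ultimately have "\<forall>\<^sub>F e in at_right 0. b\<^sup>2 * ((cx2' + e) * (1 + e) / \<mu>) / (4 * (- c)) < a" by (rule order_tendstoD)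
  moreover have "\<forall>\<^sub>F e in at_right 0. 0 < e \<and> e \<le> (1::real)"
    by (auto simp: eventually_at_right_field intro: exI[of _ 1])
  ultimately have "\<forall>\<^sub>F e in at_right 0. 0 < e \<and> e \<le> 1 \<and> b\<^sup>2 * ((cx2' + e) * (1 + e) / \<mu>) / (4 * (- c)) < a"
    by eventually_elim auto
  then obtain e where "0 < e" "e \<le> 1" "b\<^sup>2 * ((cx2' + e) * (1 + e) / \<mu>) / (4 * (- c)) < a"
    using eventually_happens[of _ "at_right (0::real)"] trivial_limit_at_right_real by blast
  then show "\<forall>\<^sub>F \<alpha> in at_right 0. \<alpha> powr \<gamma> * Z \<alpha> < a" by (rule underloaded_upper)
qed

theorem underloaded:
  "((\<lambda>\<alpha>. (- c) * \<mu> * \<alpha> powr \<gamma> * Z \<alpha>) \<longlongrightarrow> b\<^sup>2 / 2 * (cx2' / 2)) (at_right 0)"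
  "((\<lambda>\<alpha>. Z \<alpha> / (\<rho> \<alpha> / (\<mu> * (1 - \<rho> \<alpha>)))) \<longlongrightarrow> b\<^sup>2 / 2 * (cx2' / 2)) (at_right 0)"
proof -
  have "((\<lambda>\<alpha>. (- c) * \<mu> * (\<alpha> powr \<gamma> * Z \<alpha>)) \<longlongrightarrow> (- c) * \<mu> * (b\<^sup>2 * cx2' / (4 * \<mu> * (- c)))) (at_right 0)"
    by (intro tendsto_intros underloaded_limit)
  moreover have "(- c) * \<mu> * (b\<^sup>2 * cx2' / (4 * \<mu> * (- c))) = b\<^sup>2 / 2 * (cx2' / 2)" using pos under by simp
  ultimately show A: "((\<lambda>\<alpha>. (- c) * \<mu> * \<alpha> powr \<gamma> * Z \<alpha>) \<longlongrightarrow> b\<^sup>2 / 2 * (cx2' / 2)) (at_right 0)"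
    by (simp only: mult.assoc)
  have "((\<lambda>\<alpha>. (- c) * \<mu> * \<alpha> powr \<gamma> * Z \<alpha> / \<rho> \<alpha>) \<longlongrightarrow> b\<^sup>2 / 2 * (cx2' / 2) / 1) (at_right 0)"
    by (intro tendsto_divide A rho_tendsto) auto
  moreover have "(- c) * \<mu> * \<alpha> powr \<gamma> * Z \<alpha> / \<rho> \<alpha> = Z \<alpha> / (\<rho> \<alpha> / (\<mu> * (1 - \<rho> \<alpha>)))" for \<alpha>
    by (simp add: \<rho>_def mult_ac)
  ultimately show "((\<lambda>\<alpha>. Z \<alpha> / (\<rho> \<alpha> / (\<mu> * (1 - \<rho> \<alpha>)))) \<longlongrightarrow> b\<^sup>2 / 2 * (cx2' / 2)) (at_right 0)"
    by simp
qed

end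

end

context rq_solution
begin

subsection \<open>Critically loaded regime\<close>

definition cbar :: real where "cbar = (if \<gamma> = h then c else 0)"

definition q :: "real \<Rightarrow> real" where "q u = b * sqrt (cx2' / \<mu> * w (\<tau> * u) * u)"

text \<open>l is the least upper bound of the limiting expression, written with inequalities so that
  limits can be inserted directly.\<close>

definition critical_solution :: "real \<Rightarrow> bool" where
  "critical_solution l \<longleftrightarrow> 0 < l \<and> (\<forall>u\<ge>0. (cbar - \<beta> * l ^ k) * u + q u \<le> l) \<and>
     (\<forall>S. (\<forall>u\<ge>0. (cbar - \<beta> * l ^ k) * u + q u \<le> S) \<longrightarrow> l \<le> S)"

lemma critical_solution_unique_le:
  assumes l: "critical_solution l" and l': "critical_solution l'"
  shows "l' \<le> l"
proof (rule ccontr)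
  assume "\<not> l' \<le> l"
  then have lt: "l < l'" by simp
  have "0 < l" using l by (simp add: critical_solution_def)
  have "(cbar - \<beta> * l' ^ k) * u + q u \<le> l" if u: "0 \<le> u" for u
  proof -
    have "\<beta> * l ^ k \<le> \<beta> * l' ^ k" using lt \<open>0 < l\<close> pos by (intro mult_left_mono power_mono) auto
    then have "(cbar - \<beta> * l' ^ k) * u \<le> (cbar - \<beta> * l ^ k) * u" using u by (intro mult_right_mono) auto
    moreover have "(cbar - \<beta> * l ^ k) * u + q u \<le> l" using l u by (simp add: critical_solution_def)
    ultimately show ?thesis by linarith
  qed
  then have "l' \<le> l" using l' by (simp add: critical_solution_def)
  then show False using lt by simp
qed

lemma q_le: "0 \<le> u \<Longrightarrow> q u \<le> b * sqrt (cx2' * K / \<mu>) * sqrt u"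
proof -
  assume u: "0 \<le> u"
  have "cx2' / \<mu> * w (\<tau> * u) * u \<le> cx2' * K / \<mu> * u"
    using u pos cx2' w_range(2)[of "\<tau> * u"] by (simp add: divide_right_mono mult_left_mono mult_right_mono)
  then have "sqrt (cx2' / \<mu> * w (\<tau> * u) * u) \<le> sqrt (cx2' * K / \<mu>) * sqrt u"
    unfolding real_sqrt_mult[symmetric] by (rule real_sqrt_le_mono)
  then show ?thesis unfolding q_def using pos by (simp add: mult.assoc)
qed

lemma q_nonneg: "0 \<le> u \<Longrightarrow> 0 \<le> q u"
  unfolding q_def using pos cx2' w_range(1)[of "\<tau> * u"] by simp

context
  assumes crit: "h \<le> \<gamma>"
begin

lemma critical_drift: "((\<lambda>\<alpha>. c * \<alpha> powr (\<gamma> - h)) \<longlongrightarrow> cbar) (at_right 0)"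
proof (cases "\<gamma> = h")
  case True
  have "\<forall>\<^sub>F \<alpha> in at_right 0. c = c * \<alpha> powr (\<gamma> - h)"
    using eventually_right_pos by eventually_elim (simp add: True)
  then have "((\<lambda>\<alpha>. c * \<alpha> powr (\<gamma> - h)) \<longlongrightarrow> c) (at_right 0)"
    by (rule Lim_transform_eventually[OF tendsto_const])
  moreover have "cbar = c" unfolding cbar_def using True by simp
  ultimately show ?thesis by (simp only:)
next
  case False
  then have "((\<lambda>\<alpha>. c * \<alpha> powr (\<gamma> - h)) \<longlongrightarrow> c * 0) (at_right 0)"
    using crit by (intro tendsto_intros powr_tendsto_0_right) auto
  then show ?thesis using False by (simp add: cbar_def)
qed

lemma slope_eq:
  assumes \<alpha>: "0 < \<alpha>"
  shows "(p \<alpha> - 1) / \<alpha> powr h = c * \<alpha> powr (\<gamma> - h) - \<rho> \<alpha> * (F (\<alpha> * Z \<alpha>) / \<alpha> powr h)"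
  using \<alpha> by (simp add: p_minus_1 diff_divide_distrib powr_diff)

text \<open>Once \<alpha>^h Z exceeds Y0, abandonment outweighs the drift so far that the slope is
  at most -\<alpha>^h, and \<open>Z_crude_bound\<close> with \<theta> = \<alpha>^h gives \<alpha>^h
  Z \<le> D.\<close>

lemma critical_bounded:
  obtains Y where "\<forall>\<^sub>F \<alpha> in at_right 0. \<alpha> powr h * Z \<alpha> \<in> {0..Y}"
proof -
  obtain D where D: "0 < D" "\<forall>\<^sub>F \<alpha> in at_right 0. \<forall>\<theta>. 0 < \<theta> \<longrightarrow> \<theta> \<le> 1 \<longrightarrow> p \<alpha> - 1 \<le> - \<theta> \<longrightarrow> Z \<alpha> \<le> D / \<theta>"
    by (rule Z_crude_bound) blast
  \<comment> \<open>Halving both \<rho> and \<beta> leaves a quarter of \<beta> Y0^k. This is at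
    least \<bar>cbar\<bar> + 2, one more than the bound \<bar>cbar\<bar> + 1 on the drift.\<close>
  define Y0 where "Y0 = max 1 (4 * (\<bar>cbar\<bar> + 2) / \<beta>)"
  have Y0: "1 \<le> Y0" "4 * (\<bar>cbar\<bar> + 2) \<le> \<beta> * Y0"
  proof -
    show "1 \<le> Y0" by (simp add: Y0_def)
    have "4 * (\<bar>cbar\<bar> + 2) / \<beta> \<le> Y0" by (simp add: Y0_def)
    then show "4 * (\<bar>cbar\<bar> + 2) \<le> \<beta> * Y0" using pos by (simp add: pos_divide_le_eq mult.commute)
  qed
  have "Y0 \<le> Y0 ^ k" using Y0 k_pos power_increasing[of 1 k Y0] by simp
  then have "\<beta> * Y0 \<le> \<beta> * Y0 ^ k" using pos by (intro mult_left_mono) auto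
  with Y0 have Y0k: "4 * (\<bar>cbar\<bar> + 2) \<le> \<beta> * Y0 ^ k" by linarith
  have x0: "filterlim (\<lambda>\<alpha>. Y0 * \<alpha> powr (1 - h)) (at_right 0) (at_right 0)"
    unfolding filterlim_at
  proof
    have "((\<lambda>\<alpha>. Y0 * \<alpha> powr (1 - h)) \<longlongrightarrow> Y0 * 0) (at_right 0)"
      using h by (intro tendsto_intros powr_tendsto_0_right) auto
    then show "((\<lambda>\<alpha>. Y0 * \<alpha> powr (1 - h)) \<longlongrightarrow> 0) (at_right 0)" by simp
    show "\<forall>\<^sub>F \<alpha> in at_right 0. Y0 * \<alpha> powr (1 - h) \<in> {0<..} \<and> Y0 * \<alpha> powr (1 - h) \<noteq> 0"
      using eventually_right_pos by eventually_elim (use Y0 in auto)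
  qed
  have ev1: "\<forall>\<^sub>F \<alpha> in at_right 0. \<beta> / 2 < F (Y0 * \<alpha> powr (1 - h)) / (Y0 * \<alpha> powr (1 - h)) ^ k"
    by (rule order_tendstoD[OF filterlim_compose[OF F_asymp x0]]) (use pos in simp)
  have ev2: "\<forall>\<^sub>F \<alpha> in at_right 0. 1 / 2 < \<rho> \<alpha>" by (rule order_tendstoD[OF rho_tendsto]) simp
  have ev3: "\<forall>\<^sub>F \<alpha> in at_right 0. c * \<alpha> powr (\<gamma> - h) < \<bar>cbar\<bar> + 1"
    by (rule order_tendstoD[OF critical_drift]) linarith
  have ev4: "\<forall>\<^sub>F \<alpha> in at_right 0. \<alpha> powr h < 1"
    by (rule order_tendstoD[OF powr_tendsto_0_right[OF h(1)]]) simp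
  have "\<forall>\<^sub>F \<alpha> in at_right 0. \<alpha> powr h * Z \<alpha> \<in> {0..max Y0 D}"
    using D(2) ev1 ev2 ev3 ev4 eventually_right_pos eventually_rho_pos
  proof eventually_elim
    case (elim \<alpha>)
    let ?y = "\<alpha> powr h * Z \<alpha>"
    have ap: "0 < \<alpha> powr h" using elim by simp
    have "?y \<le> max Y0 D"
    proof (rule ccontr)
      assume "\<not> ?y \<le> max Y0 D"
      then have big: "Y0 < ?y" "D < ?y" by auto
      have x: "\<alpha> * Z \<alpha> = \<alpha> powr (1 - h) * ?y" using elim by (simp add: powr_diff)
      have "\<alpha> powr (1 - h) * Y0 \<le> \<alpha> powr (1 - h) * ?y" using big by (intro mult_left_mono) auto
      then have "Y0 * \<alpha> powr (1 - h) \<le> \<alpha> * Z \<alpha>" unfolding x by (simp only: mult.commute[of Y0])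
      then have "F (Y0 * \<alpha> powr (1 - h)) \<le> F (\<alpha> * Z \<alpha>)" by (rule monoD[OF F_mono])
      moreover have "(Y0 * \<alpha> powr (1 - h)) ^ k = Y0 ^ k * \<alpha> powr h"
      proof -
        have "(\<alpha> powr (1 - h)) ^ k = \<alpha> powr (real k * (1 - h))"
          using elim by (simp add: powr_realpow[symmetric] powr_powr mult.commute)
        then show ?thesis by (simp add: power_mult_distrib h(3))
      qed
      then have "\<beta> / 2 * (Y0 ^ k * \<alpha> powr h) < F (Y0 * \<alpha> powr (1 - h))"
        using elim(2) Y0 ap by (simp add: less_divide_eq)
      ultimately have "\<beta> / 2 * Y0 ^ k * \<alpha> powr h \<le> F (\<alpha> * Z \<alpha>)" by (simp add: mult.assoc)
      then have Fh: "\<beta> / 2 * Y0 ^ k \<le> F (\<alpha> * Z \<alpha>) / \<alpha> powr h" using ap by (simp add: pos_le_divide_eq)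
      have "1 / 2 * (\<beta> / 2 * Y0 ^ k) \<le> \<rho> \<alpha> * (F (\<alpha> * Z \<alpha>) / \<alpha> powr h)"
        using Fh elim(3) pos Y0 by (intro mult_mono) auto
      then have "(p \<alpha> - 1) / \<alpha> powr h \<le> - 1"
        using slope_eq[OF elim(6)] elim(4) Y0k by simp
      then have "p \<alpha> - 1 \<le> - (\<alpha> powr h)" using ap by (simp add: divide_le_eq)
      then have "Z \<alpha> \<le> D / \<alpha> powr h" using elim(1) ap elim(5) by (meson less_imp_le)
      then have "?y \<le> D" using ap by (simp add: pos_le_divide_eq mult.commute)
      then show False using big by simp
    qed
    then show ?case using Z_nonneg[OF elim(6,7)] by simp
  qed
  then show ?thesis by (rule that)
qed

text \<open>Multiplying by \<alpha>^h and substituting s = u \<alpha>^(-2h) leaves an expression in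
  u whose slope and square root converge. The bound from below follows at each u separately; for the
  other half limit and supremum have to be exchanged, which takes estimates uniform in u.\<close>

lemma critical_limit_point:
  fixes X :: "nat \<Rightarrow> real"
  assumes X: "\<And>n. 0 < X n" "X \<longlonglongrightarrow> 0" and l: "(\<lambda>n. X n powr h * Z (X n)) \<longlonglongrightarrow> l"
  shows "critical_solution l"
proof -
  let ?y = "\<lambda>n. X n powr h * Z (X n)" and ?x = "\<lambda>n. X n * Z (X n)"
  define a where "a n = (p (X n) - 1) / X n powr h" for n
  define a0 where "a0 = cbar - \<beta> * l ^ k"
  have Xr: "filterlim X (at_right 0) sequentially"
    unfolding filterlim_at using X by (auto intro!: always_eventually simp: less_imp_neq[symmetric])
  note ev = eventually_compose_filterlim[OF _ Xr]
  have rho: "\<forall>\<^sub>F n in sequentially. 0 < \<rho> (X n)" by (rule ev[OF eventually_rho_pos])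
  have l0: "0 \<le> l"
  proof (rule tendsto_lowerbound[OF l])
    show "\<forall>\<^sub>F n in sequentially. 0 \<le> ?y n"
      using rho by eventually_elim (use X Z_nonneg in auto)
  qed simp
  have x_eq: "?x n = X n powr (1 - h) * ?y n" for n
    using X(1)[of n] by (simp add: powr_diff)
  have Xpow: "(\<lambda>n. X n powr e) \<longlonglongrightarrow> 0" if "0 < e" for e
    by (rule filterlim_compose[OF powr_tendsto_0_right[OF that] Xr])
  have x0: "?x \<longlonglongrightarrow> 0"
  proof -
    have "(\<lambda>n. X n powr (1 - h) * ?y n) \<longlonglongrightarrow> 0 * l" using h by (intro tendsto_intros Xpow l) auto
    then show ?thesis unfolding x_eq by simp
  qed
  \<comment> \<open>The quotient F x / x^k is completed by its limit at 0, since \<alpha> Z may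
    vanish along the sequence.\<close>
  define r where "r x = (if x = 0 then \<beta> else F x / x ^ k)" for x
  have r: "(\<lambda>n. r (?x n)) \<longlonglongrightarrow> \<beta>"
  proof (rule tendstoI)
    fix e :: real assume e: "0 < e"
    from tendstoD[OF F_asymp e] obtain d where d: "0 < d" "\<And>x. 0 < x \<Longrightarrow> x < d \<Longrightarrow> dist (F x / x ^ k) \<beta> < e"
      unfolding eventually_at_right_field by auto
    have "\<forall>\<^sub>F n in sequentially. ?x n < d" using x0 d(1) by (rule order_tendstoD)
    then show "\<forall>\<^sub>F n in sequentially. dist (r (?x n)) \<beta> < e"
      using rho
    proof eventually_elim
      case (elim n)
      have "0 \<le> ?x n" using X(1)[of n] Z_nonneg[OF X(1) elim(2)] by simp
      then show ?case using elim d(2)[of "?x n"] e by (cases "?x n = 0") (auto simp: r_def)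
    qed
  qed
  have Fh: "F (?x n) / X n powr h = r (?x n) * ?y n ^ k" for n
  proof (cases "?x n = 0")
    case True
    then have "Z (X n) = 0" using X(1)[of n] by simp
    then show ?thesis using F_0 k_pos by (simp add: power_0_left)
  next
    case False
    have "?x n ^ k = X n powr h * ?y n ^ k"
    proof -
      have "(X n powr (1 - h)) ^ k = X n powr (real k * (1 - h))"
        using X(1)[of n] by (simp add: powr_realpow[symmetric] powr_powr mult.commute)
      then show ?thesis unfolding x_eq power_mult_distrib[of "X n powr (1 - h)"] by (simp add: h(3))
    qed
    moreover have "r (?x n) = F (?x n) / ?x n ^ k" using False by (simp add: r_def)
    moreover have "?y n \<noteq> 0" using False X(1)[of n] by auto
    ultimately show ?thesis using False X(1)[of n] by (simp only:) (simp add: power_mult_distrib)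
  qed
  have a: "a \<longlonglongrightarrow> a0"
  proof -
    have "(\<lambda>n. c * X n powr (\<gamma> - h) - \<rho> (X n) * (r (?x n) * ?y n ^ k)) \<longlonglongrightarrow> cbar - 1 * (\<beta> * l ^ k)"
      by (intro tendsto_intros r l filterlim_compose[OF critical_drift Xr] filterlim_compose[OF rho_tendsto Xr])
    then show ?thesis unfolding a_def slope_eq[OF X(1)] Fh a0_def by simp
  qed
  have a_neg: "\<forall>\<^sub>F n in sequentially. a n \<le> 0"
    using rho by eventually_elim (use p_le_1 X in \<open>auto simp: a_def divide_le_0_iff\<close>)
  have a0: "a0 \<le> 0" by (rule tendsto_upperbound[OF a a_neg]) simp
  have pl: "(\<lambda>n. p (X n)) \<longlonglongrightarrow> 1"
  proof -
    have "(\<lambda>n. 1 + a n * X n powr h) \<longlonglongrightarrow> 1 + a0 * 0" using h by (intro tendsto_intros a Xpow)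
    moreover have "1 + a n * X n powr h = p (X n)" for n using X(1)[of n] by (simp add: a_def)
    ultimately show ?thesis by simp
  qed
  \<comment> \<open>\<alpha>^(2h) G at the rescaled point; the argument of w has become \<tau> u,
    the same for all n.\<close>
  define H where "H n u = Iw (X n) (u * X n powr (- 2 * h)) * w (\<tau> * u) * (p (X n) * u / \<mu>)" for n u
  have scale: "X n powr h * ((p (X n) - 1) * (u * X n powr (- 2 * h)) + b * sqrt (G (X n) (u * X n powr (- 2 * h))))
      = a n * u + b * sqrt (H n u)" for n u
  proof -
    let ?a = "X n powr h"
    have ap: "0 < ?a" using X(1)[of n] by simp
    have s: "X n powr (- 2 * h) = 1 / ?a\<^sup>2"
      using X(1)[of n] by (simp add: powr_minus powr_realpow[symmetric] powr_powr mult.commute field_simps)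
    have arg: "X n powr (2 * h) * \<tau> * (u * X n powr (- 2 * h)) = \<tau> * u"
      using X(1)[of n] by (simp add: powr_minus field_simps)
    have "?a * sqrt (G (X n) (u * X n powr (- 2 * h))) = sqrt (?a\<^sup>2 * G (X n) (u * X n powr (- 2 * h)))"
      using ap by (simp add: real_sqrt_mult)
    also have "?a\<^sup>2 * G (X n) (u * X n powr (- 2 * h)) = H n u"
    proof -
      have "?a\<^sup>2 * (u * X n powr (- 2 * h)) = u" unfolding s using ap by simp
      then have "p (X n) * (?a\<^sup>2 * (u * X n powr (- 2 * h))) / \<mu> = p (X n) * u / \<mu>" by simp
      moreover have "?a\<^sup>2 * G (X n) (u * X n powr (- 2 * h))
          = Iw (X n) (u * X n powr (- 2 * h)) * w (\<tau> * u) * (p (X n) * (?a\<^sup>2 * (u * X n powr (- 2 * h))) / \<mu>)"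
        unfolding G_def arg by simp
      ultimately show ?thesis unfolding H_def by (simp only:)
    qed
    finally have "?a * sqrt (G (X n) (u * X n powr (- 2 * h))) = sqrt (H n u)" .
    moreover have "?a * ((p (X n) - 1) * (u * X n powr (- 2 * h))) = a n * u"
      unfolding s a_def using ap by (simp add: power2_eq_square)
    ultimately show ?thesis by (simp add: distrib_left mult.left_commute[of _ b])
  qed
  have lower: "a0 * u + q u \<le> l" if u: "0 \<le> u" for u
  proof (cases "u = 0")
    case True
    then show ?thesis using l0 by (simp add: q_def)
  next
    case False
    then have u': "0 < u" using u by simp
    have "(\<lambda>n. a n * u + b * sqrt (H n u)) \<longlonglongrightarrow> a0 * u + b * sqrt (cx2' * w (\<tau> * u) * (1 * u / \<mu>))"
      unfolding H_def
      using pos by (intro tendsto_intros a pl filterlim_compose[OF Iw_tendsto[OF u' h(1)] Xr]) auto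
    moreover have "b * sqrt (cx2' * w (\<tau> * u) * (1 * u / \<mu>)) = q u" by (simp add: q_def)
    ultimately have lim: "(\<lambda>n. a n * u + b * sqrt (H n u)) \<longlonglongrightarrow> a0 * u + q u" by simp
    show ?thesis
    proof (rule tendsto_le[OF _ l lim])
      show "\<forall>\<^sub>F n in sequentially. a n * u + b * sqrt (H n u) \<le> ?y n"
        using rho
      proof eventually_elim
        case (elim n)
        show ?case
          unfolding scale[symmetric] using Z_ge[OF X(1) elim, of "u * X n powr (- 2 * h)"] u
          by (intro mult_left_mono) auto
      qed
    qed simp
  qed
  \<comment> \<open>For l = 0 the inequality \<open>lower\<close> reads q u \<le> -cbar u; but near
    0 the function q is at least a multiple of sqrt u, because w tends to 1 there.\<close>
  have l_pos: "0 < l"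
  proof (rule ccontr)
    assume "\<not> 0 < l"
    then have lz: "l = 0" using l0 by simp
    then have a0c: "a0 = cbar" using k_pos by (simp add: a0_def power_0_left)
    define \<kappa> where "\<kappa> = b * sqrt (cx2' / \<mu> / 2)"
    have \<kappa>: "0 < \<kappa>" using pos cx2' by (simp add: \<kappa>_def)
    have "\<forall>\<^sub>F x in at_right 0. 1 / 2 < w x" by (rule order_tendstoD[OF w_0]) simp
    then obtain d where d: "0 < d" "\<And>x. 0 < x \<Longrightarrow> x < d \<Longrightarrow> 1 / 2 < w x"
      unfolding eventually_at_right_field by auto
    \<comment> \<open>Below d / \<tau> the bound w > 1/2 is available; below the second number the
      linear term is smaller than \<kappa> sqrt u.\<close>
    define m where "m = min (d / \<tau>) ((\<kappa> / (\<bar>cbar\<bar> + 1))\<^sup>2)"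
    have m: "0 < m" using d pos \<kappa> by (simp add: m_def)
    define u where "u = m / 2"
    have u: "0 < u" "u < m" using m by (auto simp: u_def)
    have "\<tau> * u < d" using u pos by (simp add: m_def pos_less_divide_eq mult.commute)
    then have wu: "1 / 2 < w (\<tau> * u)" using u pos by (intro d(2)) auto
    have "cx2' / \<mu> / 2 * u \<le> cx2' / \<mu> * w (\<tau> * u) * u"
      using wu u pos cx2' by (intro mult_right_mono) (auto simp: mult_left_mono[of "1/2" "w (\<tau> * u)" "cx2' / \<mu>", simplified])
    then have "\<kappa> * sqrt u \<le> q u"
      unfolding \<kappa>_def q_def mult.assoc real_sqrt_mult[symmetric] using pos by (intro mult_left_mono real_sqrt_le_mono) auto
    then have "\<kappa> * sqrt u \<le> - cbar * u" using lower[of u] u lz a0c by simp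
    also have "\<dots> \<le> \<bar>cbar\<bar> * u" using u by (intro mult_right_mono) auto
    also have "\<dots> = \<bar>cbar\<bar> * sqrt u * sqrt u" using u by simp
    finally have "\<kappa> \<le> \<bar>cbar\<bar> * sqrt u" using u by (simp add: mult_le_cancel_right_pos)
    moreover have "sqrt u \<le> \<kappa> / (\<bar>cbar\<bar> + 1)"
      using u \<kappa> by (intro real_le_lsqrt) (auto simp: m_def)
    then have "\<bar>cbar\<bar> * sqrt u \<le> \<bar>cbar\<bar> * (\<kappa> / (\<bar>cbar\<bar> + 1))" by (intro mult_left_mono) auto
    moreover have "\<bar>cbar\<bar> * (\<kappa> / (\<bar>cbar\<bar> + 1)) < \<kappa>" using \<kappa> by (simp add: divide_less_eq distrib_left mult.commute)
    ultimately show False by linarith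
  qed
  \<comment> \<open>Uniform in u: the constant C of \<open>Iw_linear_bound\<close> carries the
    factor \<alpha>^(2h), which makes it at most e^2 under the root and hence b e outside.\<close>
  have approx: "\<forall>\<^sub>F n in sequentially. \<forall>u\<ge>0. b * sqrt (H n u) \<le> (1 + e) * q u + b * e" if e: "0 < e" for e
  proof -
    obtain C where C: "0 \<le> C" "\<forall>\<^sub>F \<alpha> in at_right 0. \<forall>s\<ge>0. 0 \<le> Iw \<alpha> s \<and> s * Iw \<alpha> s \<le> C + (cx2' + cx2' * e) * s"
      using Iw_linear_bound[of "cx2' * e"] e cx2' by auto
    have "(\<lambda>n. C * K / \<mu> * X n powr (2 * h)) \<longlonglongrightarrow> C * K / \<mu> * 0"
      using h by (intro tendsto_intros Xpow) auto
    then have "\<forall>\<^sub>F n in sequentially. C * K / \<mu> * X n powr (2 * h) < e\<^sup>2" using e by (intro order_tendstoD) auto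
    with ev[OF C(2)] rho show ?thesis
    proof eventually_elim
      case (elim n)
      show ?case
      proof (intro allI impI)
        fix u :: real assume u: "0 \<le> u"
        let ?s = "u * X n powr (- 2 * h)" and ?A = "X n powr (2 * h)"
        have A: "0 < ?A" "u = ?A * ?s" using X(1)[of n] by (simp_all add: powr_minus)
        have w: "0 \<le> w (\<tau> * u)" "w (\<tau> * u) \<le> K" using u pos by (auto intro!: w_range)
        have s0: "0 \<le> ?s" using u by simp
        have I: "0 \<le> ?s * Iw (X n) ?s" "?s * Iw (X n) ?s \<le> C + (cx2' + cx2' * e) * ?s"
          using elim(1) s0 by auto
        have "u * Iw (X n) ?s = ?A * (?s * Iw (X n) ?s)" using A(2) by (simp only: mult.assoc[symmetric])
        also have "\<dots> \<le> ?A * (C + (cx2' + cx2' * e) * ?s)" using I A by (intro mult_left_mono) auto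
        also have "\<dots> = ?A * C + (cx2' + cx2' * e) * (?A * ?s)" by (simp add: algebra_simps)
        also have "?A * ?s = u" using A(2) by simp
        finally have uI: "u * Iw (X n) ?s \<le> ?A * C + (cx2' + cx2' * e) * u" .
        have uI0: "0 \<le> u * Iw (X n) ?s" using elim(1) s0 u by simp
        have "H n u = (u * Iw (X n) ?s) * w (\<tau> * u) * (p (X n) / \<mu>)" by (simp add: H_def)
        also have "\<dots> \<le> (?A * C + (cx2' + cx2' * e) * u) * w (\<tau> * u) * (1 / \<mu>)"
          using uI uI0 w p_le_1[OF X(1) elim(2)] p_nonneg[OF elim(2)] pos
          by (intro mult_mono divide_right_mono mult_nonneg_nonneg) auto
        also have "\<dots> = ?A * C * w (\<tau> * u) / \<mu> + (1 + e) * (cx2' / \<mu> * w (\<tau> * u) * u)"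
          by (simp add: add_divide_distrib algebra_simps)
        also have "?A * C * w (\<tau> * u) / \<mu> \<le> ?A * C * K / \<mu>"
          using w A C(1) pos by (intro divide_right_mono mult_left_mono) auto
        also have "?A * C * K / \<mu> \<le> e\<^sup>2" using elim(3) by (simp add: mult_ac)
        also have "(1 + e) * (cx2' / \<mu> * w (\<tau> * u) * u) \<le> (1 + e)\<^sup>2 * (cx2' / \<mu> * w (\<tau> * u) * u)"
          using e u w cx2' pos by (intro mult_right_mono) (auto simp: power2_eq_square)
        finally have "sqrt (H n u) \<le> sqrt (e\<^sup>2 + (1 + e)\<^sup>2 * (cx2' / \<mu> * w (\<tau> * u) * u))"
          by (intro real_sqrt_le_mono) simp
        also have "\<dots> \<le> sqrt (e\<^sup>2) + sqrt ((1 + e)\<^sup>2 * (cx2' / \<mu> * w (\<tau> * u) * u))"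
          using u w cx2' pos by (intro sqrt_add_le_add_sqrt) auto
        also have "\<dots> = e + (1 + e) * sqrt (cx2' / \<mu> * w (\<tau> * u) * u)"
        proof -
          have "sqrt (e\<^sup>2) = e" "sqrt ((1 + e)\<^sup>2) = 1 + e" using e by simp_all
          then show ?thesis by (simp only: real_sqrt_mult)
        qed
        finally have "b * sqrt (H n u) \<le> b * (e + (1 + e) * sqrt (cx2' / \<mu> * w (\<tau> * u) * u))"
          using pos by (intro mult_left_mono) auto
        also have "\<dots> = (1 + e) * q u + b * e" by (simp add: q_def algebra_simps)
        finally show "b * sqrt (H n u) \<le> (1 + e) * q u + b * e" .
      qed
    qed
  qed
  have y_le: "?y n \<le> B" if "0 < \<rho> (X n)" and "\<And>u. 0 \<le> u \<Longrightarrow> a n * u + b * sqrt (H n u) \<le> B" for n B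
  proof -
    let ?a = "X n powr h"
    have ap: "0 < ?a" using X(1)[of n] by simp
    have "Z (X n) \<le> B / ?a"
    proof (rule Z_le[OF X(1) that(1)])
      fix s :: real assume s: "0 \<le> s"
      let ?u = "s * X n powr (2 * h)"
      have su: "?u * X n powr (- 2 * h) = s" using X(1)[of n] by (simp add: powr_minus)
      have "?a * ((p (X n) - 1) * s + b * sqrt (G (X n) s)) \<le> B"
        using that(2)[of ?u] s scale[of n ?u] unfolding su by simp
      then show "(p (X n) - 1) * s + b * sqrt (G (X n) s) \<le> B / ?a" using ap by (simp add: pos_le_divide_eq mult.commute)
    qed
    then show ?thesis using ap by (simp add: pos_le_divide_eq mult.commute)
  qed
  have upper: "l \<le> S" if S: "\<And>u. 0 \<le> u \<Longrightarrow> a0 * u + q u \<le> S" for S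
  proof -
    have S0: "0 \<le> S" using S[of 0] by (simp add: q_def)
    obtain U where U: "0 \<le> U" "\<And>e. 0 < e \<Longrightarrow> e \<le> 1 \<Longrightarrow> l \<le> (1 + e) * S + e * (1 + \<bar>a0\<bar>) * U + b * e"
    proof (cases "a0 = 0")
      case True
      show ?thesis
      proof (rule that[of 0])
        fix e :: real assume e: "0 < e" "e \<le> 1"
        have "\<forall>\<^sub>F n in sequentially. ?y n \<le> (1 + e) * S + b * e"
          using approx[OF e(1)] a_neg rho
        proof eventually_elim
          case (elim n)
          show ?case
          proof (rule y_le[OF elim(3)])
            fix u :: real assume u: "0 \<le> u"
            have "b * sqrt (H n u) \<le> (1 + e) * q u + b * e" using elim(1) u by blast
            moreover have "(1 + e) * q u \<le> (1 + e) * S" using S[OF u] True e by (intro mult_left_mono) auto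
            moreover have "a n * u \<le> 0" using elim(2) u by (rule mult_nonpos_nonneg)
            ultimately show "a n * u + b * sqrt (H n u) \<le> (1 + e) * S + b * e" by linarith
          qed
        qed
        from tendsto_upperbound[OF l this] show "l \<le> (1 + e) * S + e * (1 + \<bar>a0\<bar>) * 0 + b * e" by simp
      qed simp
    next
      case False
      then have a0n: "a0 < 0" using a0 by simp
      define Q where "Q = b * sqrt (cx2' * K / \<mu>)"
      have Q: "0 \<le> Q" using pos cx2' K_pos by (simp add: Q_def)
      \<comment> \<open>From U on, half of the limiting slope outweighs twice the bound Q sqrt u on
        q, so the expression is at most b e. Below U the error of the slope costs at most e (1 +
        \<bar>a0\<bar>) U.\<close>
      define U where "U = (4 * Q / (- a0))\<^sup>2"
      show ?thesis
      proof (rule that[of U])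
        show U0: "0 \<le> U" by (simp add: U_def)
        fix e :: real assume e: "0 < e" "e \<le> 1"
        have ea: "\<forall>\<^sub>F n in sequentially. a n < a0 / 2" by (rule order_tendstoD[OF a]) (use a0n in simp)
        have eb: "\<forall>\<^sub>F n in sequentially. a n < a0 + e" by (rule order_tendstoD[OF a]) (use e in simp)
        let ?B = "(1 + e) * S + e * (1 + \<bar>a0\<bar>) * U + b * e"
        have "\<forall>\<^sub>F n in sequentially. ?y n \<le> ?B"
          using approx[OF e(1)] ea eb rho
        proof eventually_elim
          case (elim n)
          show ?case
          proof (rule y_le[OF elim(4)])
            fix u :: real assume u: "0 \<le> u"
            have bH: "b * sqrt (H n u) \<le> (1 + e) * q u + b * e" using elim(1) u by blast
            have nn: "0 \<le> (1 + e) * S" "0 \<le> e * (1 + \<bar>a0\<bar>) * U" using S0 e U0 by auto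
            show "a n * u + b * sqrt (H n u) \<le> ?B"
            proof (cases "U \<le> u")
              case True
              have "4 * Q / (- a0) \<le> sqrt u" using True a0n Q unfolding U_def by (intro real_le_rsqrt)
              then have "4 * Q \<le> sqrt u * (- a0)" using a0n by (subst (asm) pos_divide_le_eq) auto
              then have "4 * Q * sqrt u \<le> (sqrt u * (- a0)) * sqrt u" using u by (intro mult_right_mono) auto
              then have *: "2 * (Q * sqrt u) \<le> - (a0 / 2) * u" using u by (simp add: mult_ac)
              have "(1 + e) * q u \<le> 2 * (Q * sqrt u)"
                using q_le[OF u] q_nonneg[OF u] e unfolding Q_def by (intro mult_mono) auto
              moreover have "a n * u \<le> a0 / 2 * u" using elim(2) u by (intro mult_right_mono) auto
              ultimately show ?thesis using * bH nn by linarith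
            next
              case False
              have "(1 + e) * (a0 * u + q u) \<le> (1 + e) * S" using S[OF u] e by (intro mult_left_mono) auto
              moreover have "a n * u \<le> (a0 + e) * u" using elim(3) u by (intro mult_right_mono) auto
              moreover have "e * (1 + \<bar>a0\<bar>) * u \<le> e * (1 + \<bar>a0\<bar>) * U" using False e by (intro mult_left_mono) auto
              moreover have "(a0 + e) * u = (1 + e) * (a0 * u) + e * (1 + \<bar>a0\<bar>) * u" using a0n by (simp add: algebra_simps)
              ultimately show ?thesis using bH by (simp add: distrib_left)
            qed
          qed
        qed
        from tendsto_upperbound[OF l this] show "l \<le> ?B" by simp
      qed
    qed
    have "((\<lambda>e. (1 + e) * S + e * (1 + \<bar>a0\<bar>) * U + b * e) \<longlongrightarrow> (1 + 0) * S + 0 * (1 + \<bar>a0\<bar>) * U + b * 0) (at_right 0)"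
      by (intro tendsto_intros)
    moreover have "\<forall>\<^sub>F e in at_right 0. l \<le> (1 + e) * S + e * (1 + \<bar>a0\<bar>) * U + b * e"
      unfolding eventually_at_right_field using U(2) by (intro exI[of _ 1]) auto
    ultimately have "l \<le> (1 + 0) * S + 0 * (1 + \<bar>a0\<bar>) * U + b * 0" by (rule tendsto_lowerbound) simp
    then show ?thesis by simp
  qed
  show ?thesis
    unfolding critical_solution_def a0_def[symmetric] using l_pos lower upper by blast
qed

theorem critical:
  obtains l where "critical_solution l" "((\<lambda>\<alpha>. \<alpha> powr h * Z \<alpha>) \<longlongrightarrow> l) (at_right 0)"
proof -
  obtain Y where Y: "\<forall>\<^sub>F \<alpha> in at_right 0. \<alpha> powr h * Z \<alpha> \<in> {0..Y}" by (rule critical_bounded)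
  show ?thesis
    by (rule tendsto_unique_limit_point[OF Y, of critical_solution])
      (use critical_limit_point critical_solution_unique_le that in \<open>auto intro: antisym\<close>)
qed

end
end

section \<open>The theorem\<close>

text \<open>Repeated use of L'Hopital: the induction is on the number m of powers in the
  denominator, starting from the continuity of the k-th derivative at 0. One-sided derivatives
  become ordinary ones at each x > 0.\<close>

lemma iterated_derivative_quotient:
  fixes Fd :: "nat \<Rightarrow> real \<Rightarrow> real"
  assumes der: "\<And>j x. j < k \<Longrightarrow> 0 \<le> x \<Longrightarrow> (Fd j has_real_derivative Fd (Suc j) x) (at x within {0..})"
    and cont: "\<And>j. j \<le> k \<Longrightarrow> continuous_on {0..} (Fd j)"
    and zero: "\<And>j. j < k \<Longrightarrow> Fd j 0 = 0"
  shows "((\<lambda>x. Fd 0 x / x ^ k) \<longlongrightarrow> Fd k 0 / fact k) (at_right 0)"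
proof -
  have at0: "(Fd j \<longlongrightarrow> Fd j 0) (at_right 0)" if "j \<le> k" for j
  proof -
    have "(Fd j \<longlongrightarrow> Fd j 0) (at 0 within {0..})"
      using cont[OF that] by (auto simp: continuous_on_def)
    then show ?thesis by (rule tendsto_within_subset) auto
  qed
  have "((\<lambda>x. Fd (k - m) x / x ^ m) \<longlongrightarrow> Fd k 0 / fact m) (at_right 0)" if "m \<le> k" for m
    using that
  proof (induction m)
    case 0
    then show ?case using at0[of k] by simp
  next
    case (Suc m)
    let ?j = "k - Suc m"
    have j: "?j < k" "Suc ?j = k - m" using Suc.prems by auto
    show ?case
    proof (rule lhopital_right_0[where f' = "Fd (k - m)" and g' = "\<lambda>x. real (Suc m) * x ^ m"])
      show "(Fd ?j \<longlongrightarrow> 0) (at_right 0)" using at0[of ?j] zero[OF j(1)] by simp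
      have "((\<lambda>x. x ^ Suc m) \<longlongrightarrow> 0 ^ Suc m) (at_right (0::real))" by (intro tendsto_intros)
      then show "((\<lambda>x. x ^ Suc m) \<longlongrightarrow> 0) (at_right (0::real))" by simp
      have pos: "\<forall>\<^sub>F x in at_right (0::real). 0 < x" by (auto simp: eventually_at_filter)
      show "\<forall>\<^sub>F x in at_right 0. x ^ Suc m \<noteq> (0::real)" using pos by eventually_elim simp
      show "\<forall>\<^sub>F x in at_right 0. real (Suc m) * x ^ m \<noteq> 0" using pos by eventually_elim simp
      show "\<forall>\<^sub>F x in at_right 0. (Fd ?j has_real_derivative Fd (k - m) x) (at x)"
        unfolding eventually_at_filter
      proof (intro always_eventually allI impI)
        fix x :: real assume "x \<noteq> 0" "x \<in> {0<..}"
        then have x: "0 < x" by simp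
        have "(Fd ?j has_real_derivative Fd (Suc ?j) x) (at x within {0..})" using x j by (intro der) auto
        moreover have "at x within {0..} = at x" using x by (intro at_within_interior) (simp add: interior_real_atLeast)
        ultimately show "(Fd ?j has_real_derivative Fd (k - m) x) (at x)" by (simp only: j)
      qed
      show "\<forall>\<^sub>F x in at_right 0. ((\<lambda>x. x ^ Suc m) has_real_derivative real (Suc m) * x ^ m) (at x)"
        using DERIV_pow[of "Suc m"] by (intro always_eventually allI) simp
      have "((\<lambda>x. Fd (k - m) x / x ^ m / real (Suc m)) \<longlongrightarrow> Fd k 0 / fact m / real (Suc m)) (at_right 0)"
        by (rule tendsto_divide[OF Suc.IH tendsto_const]) (use Suc.prems in auto)
      then show "((\<lambda>x. Fd (k - m) x / (real (Suc m) * x ^ m)) \<longlongrightarrow> Fd k 0 / fact (Suc m)) (at_right 0)"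
        by (simp add: mult.commute)
    qed
  qed
  from this[of k] show ?thesis by simp
qed

text \<open>U is the inter-arrival law at unit rate, from which the law at rate lam \<alpha> arises
  by scaling, so ca2 is one number for all \<alpha>. The suprema are taken in \<open>ereal\<close>,
  which makes their finiteness part of the equations. The equation for Z is asked where \<rho>
  \<alpha> > 0; for c < 0 this excludes large \<alpha>.\<close>

theorem theorem4:
  fixes U Dt :: "real measure" and Fd :: "nat \<Rightarrow> real \<Rightarrow> real" and k :: nat
    and ca2 cs2 \<mu> b \<gamma> c :: real and Z :: "real \<Rightarrow> real"
    and F Fbar :: "real \<Rightarrow> real" and h \<beta> cx2 \<tau> cbar ct :: real
    and \<rho> lam :: "real \<Rightarrow> real" and Ia Iw :: "real \<Rightarrow> real \<Rightarrow> real"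
    and Zhat_eq :: "real \<Rightarrow> bool"
  assumes defF: "F = cdf Dt"
    and def1: "Fbar = (\<lambda>x. 1 - F x)"
    and def2: "h = real k / (real k + 1)"
    and def3: "\<beta> = Fd k 0 / fact k"
    and def4: "\<rho> = (\<lambda>\<alpha>. 1 + c * \<alpha> powr \<gamma>)"
    and def5: "lam = (\<lambda>\<alpha>. \<rho> \<alpha> * \<mu>)"
    and def6: "cx2 = ca2 + cs2"
    and def7: "\<tau> = (cx2 / (2 * \<mu>)) powr ((real k - 1) / (real k + 1)) * \<beta> powr (2 / (real k + 1))"
    and def8: "cbar = (if \<gamma> = h then c else 0)"
    and def9: "ct = cbar * (cx2 / (2 * \<mu>)) powr (- real k / (real k + 1)) * \<beta> powr (- 1 / (real k + 1))"
    and def10: "Ia = (\<lambda>\<alpha> s. renewal_idc (distr U borel (\<lambda>u. u / lam \<alpha>)) s)"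
    and def11: "Iw = (\<lambda>\<alpha> s. Ia \<alpha> s / max (\<rho> \<alpha>) 1 + (1 - 1 / max (\<rho> \<alpha>) 1) + cs2)"
    and def12: "Zhat_eq = (\<lambda>Zh. ereal Zh = (SUP u\<in>{0..}. ereal ((cbar - \<beta> * Zh ^ k) * u
                     + b * sqrt (cx2 / \<mu> * w_fun ct k (\<tau> * u) * u))))"
    and U: "real_distribution U" "AE u in U. 0 \<le> u" "integrable U (\<lambda>u. u)" "(LINT u|U. u) = 1"
    and ca: "((\<lambda>s. renewal_idc U s) \<longlongrightarrow> ca2) at_top"
    and cs: "0 \<le> cs2"
    and Dt: "real_distribution Dt" "AE x in Dt. 0 \<le> x" "integrable Dt (\<lambda>x. x)" "(LINT x|Dt. x) = 1"
      "\<forall>x\<ge>0. \<forall>\<epsilon>>0. 0 < measure Dt {x - \<epsilon><..<x + \<epsilon>}"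
    and Fd0: "\<forall>x\<ge>0. Fd 0 x = F x"
    and Fdiff: "\<forall>j<max 2 k. \<forall>x\<ge>0. (Fd j has_real_derivative Fd (Suc j) x) (at x within {0..})"
    and Fcont: "\<forall>j\<le>max 2 k. continuous_on {0..} (Fd j)"
    and loc: "1 \<le> k" "\<forall>j<k. Fd j 0 = 0" "Fd k 0 \<noteq> 0"
    and pars: "0 < \<mu>" "0 < b" "0 < \<gamma>"
    and cx: "0 < cx2"
    and Zsol: "\<forall>\<alpha>>0. 0 < \<rho> \<alpha> \<longrightarrow> 0 \<le> Z \<alpha> \<and>
       ereal (Z \<alpha>) = (SUP s\<in>{0..}. ereal (lam \<alpha> * Fbar (\<alpha> * Z \<alpha>) * s / \<mu> - s
          + b * sqrt (Iw \<alpha> s * w_fun ct k (\<alpha> powr (2 * h) * \<tau> * s)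
                      * (lam \<alpha> * Fbar (\<alpha> * Z \<alpha>) * s / \<mu>\<^sup>2))))"
  shows "(\<gamma> < h \<and> c < 0 \<longrightarrow>
            ((\<lambda>\<alpha>. (- c) * \<mu> * \<alpha> powr \<gamma> * Z \<alpha>) \<longlongrightarrow> b\<^sup>2 / 2 * (cx2 / 2)) (at_right 0) \<and>
            ((\<lambda>\<alpha>. Z \<alpha> / (\<rho> \<alpha> / (\<mu> * (1 - \<rho> \<alpha>)))) \<longlongrightarrow> b\<^sup>2 / 2 * (cx2 / 2)) (at_right 0))
       \<and> (h \<le> \<gamma> \<longrightarrow>
            (\<exists>Zh>0. ((\<lambda>\<alpha>. \<alpha> powr h * Z \<alpha>) \<longlongrightarrow> Zh) (at_right 0) \<and> Zhat_eq Zh \<and>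
                    (\<forall>y>0. Zhat_eq y \<longrightarrow> y = Zh)))
       \<and> (\<gamma> < h \<and> 0 < c \<longrightarrow>
            ((\<lambda>\<alpha>. \<alpha> powr (1 - \<gamma> / real k) * Z \<alpha>) \<longlongrightarrow> (c / \<beta>) powr (1 / real k)) (at_right 0) \<and>
            ((\<lambda>\<alpha>. \<rho> \<alpha> / (\<rho> \<alpha> - 1) * F (\<alpha> * Z \<alpha>)) \<longlongrightarrow> 1) (at_right 0))"
proof -
  interpret D: real_distribution Dt by (rule Dt)
  have F_range: "0 \<le> F x" "F x \<le> 1" for x
    unfolding defF by (rule D.cdf_nonneg, rule D.cdf_bounded_prob)
  have F_mono: "mono F"
    unfolding defF by (intro monoI D.cdf_nondecreasing)
  have F_0: "F 0 = 0" using Fd0 loc by auto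
  have "((\<lambda>x. Fd 0 x / x ^ k) \<longlongrightarrow> Fd k 0 / fact k) (at_right 0)"
    by (rule iterated_derivative_quotient) (use Fdiff Fcont loc in auto)
  then have F_asymp: "((\<lambda>x. F x / x ^ k) \<longlongrightarrow> \<beta>) (at_right 0)"
    unfolding def3 by (rule Lim_transform_eventually) (use Fd0 in \<open>auto simp: eventually_at_filter\<close>)
  have "0 \<le> \<beta>"
    by (rule tendsto_lowerbound[OF F_asymp]) (use F_range in \<open>auto simp: eventually_at_filter\<close>)
  \<comment> \<open>The sign comes from F \<ge> 0; the local condition itself only excludes the
    value 0.\<close>
  then have \<beta>: "0 < \<beta>" using loc(3) by (simp add: def3 order_less_le)
  have \<tau>: "0 < \<tau>" unfolding def7 using \<beta> cx pars by simp
  obtain K where K: "1 \<le> K" "\<And>t. 0 \<le> t \<Longrightarrow> w_fun ct k t \<le> K"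
    using w_fun_bounded[OF loc(1)] by blast
  interpret A: rq_asymptotics F "w_fun ct k" "renewal_idc U" k \<beta> \<mu> b \<gamma> c ca2 cs2 \<tau> K Z
  proof
    show "\<exists>C\<ge>0. \<forall>t. 0 \<le> t \<longrightarrow> t \<le> T \<longrightarrow> t * renewal_idc U t \<le> C" for T
      using renewal_variance_bounded[OF U, of T] by metis
  qed (use loc \<beta> pars \<tau> cs cx def6 F_mono F_range F_0 F_asymp w_fun_nonneg[OF loc(1)] K w_fun_tendsto[OF loc(1)]
      renewal_idc_nonneg[OF U] ca in auto)
  have h: "A.h = h" and cx2': "A.cx2' = cx2" and \<rho>: "A.\<rho> = \<rho>"
    by (auto simp: A.h_def def2 A.cx2'_def def6 A.\<rho>_def fun_eq_iff def4)
  have term_eq: "lam \<alpha> * Fbar (\<alpha> * Z \<alpha>) * s / \<mu> - s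
          + b * sqrt (Iw \<alpha> s * w_fun ct k (\<alpha> powr (2 * h) * \<tau> * s) * (lam \<alpha> * Fbar (\<alpha> * Z \<alpha>) * s / \<mu>\<^sup>2))
      = (A.p \<alpha> - 1) * s + b * sqrt (A.G \<alpha> s)" if \<alpha>: "0 < \<rho> \<alpha>" for \<alpha> s
  proof -
    have p: "A.p \<alpha> = \<rho> \<alpha> * Fbar (\<alpha> * Z \<alpha>)" by (simp add: A.p_def \<rho> def1)
    have "0 < lam \<alpha>" using \<alpha> pars by (simp add: def5)
    from renewal_idc_scale[OF U this] have "Iw \<alpha> s = A.Iw \<alpha> s"
      unfolding def11 def10 A.Iw_def \<rho> by (simp add: def5)
    moreover have "lam \<alpha> * Fbar (\<alpha> * Z \<alpha>) * s / \<mu>\<^sup>2 = A.p \<alpha> * s / \<mu>"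
      unfolding p def5 using pars by (simp add: power2_eq_square)
    moreover have "lam \<alpha> * Fbar (\<alpha> * Z \<alpha>) * s / \<mu> - s = (A.p \<alpha> - 1) * s"
      unfolding p def5 using pars by (simp add: algebra_simps)
    ultimately show ?thesis by (simp only: A.G_def h)
  qed
  have sup: "ereal (Z \<alpha>) = (SUP s\<in>{0..}. ereal ((A.p \<alpha> - 1) * s + b * sqrt (A.G \<alpha> s)))"
    if "0 < \<alpha>" "0 < \<rho> \<alpha>" for \<alpha>
    using Zsol[rule_format, OF that, THEN conjunct2] by (simp only: term_eq[OF that(2)])
  interpret S: rq_solution F "w_fun ct k" "renewal_idc U" k \<beta> \<mu> b \<gamma> c ca2 cs2 \<tau> K Z
  proof
    fix \<alpha> :: real assume \<alpha>: "0 < \<alpha>" "0 < A.\<rho> \<alpha>"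
    show "0 \<le> Z \<alpha>" using Zsol \<alpha> \<rho> by simp
    note sup = sup[OF \<alpha>(1) \<alpha>(2)[unfolded \<rho>]]
    fix s :: real assume "0 \<le> s"
    then have "ereal ((A.p \<alpha> - 1) * s + b * sqrt (A.G \<alpha> s)) \<le> ereal (Z \<alpha>)"
      unfolding sup by (intro SUP_upper) simp
    then show "(A.p \<alpha> - 1) * s + b * sqrt (A.G \<alpha> s) \<le> Z \<alpha>" by simp
  next
    fix \<alpha> B :: real assume \<alpha>: "0 < \<alpha>" "0 < A.\<rho> \<alpha>"
      and B: "\<And>s. 0 \<le> s \<Longrightarrow> (A.p \<alpha> - 1) * s + b * sqrt (A.G \<alpha> s) \<le> B"
    have "ereal (Z \<alpha>) \<le> ereal B"
      unfolding sup[OF \<alpha>(1) \<alpha>(2)[unfolded \<rho>]] by (intro SUP_least) (use B in simp)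
    then show "Z \<alpha> \<le> B" by simp
  qed
  have cbar: "S.cbar = cbar" by (simp add: S.cbar_def def8 h)
  have Zhat: "Zhat_eq y \<longleftrightarrow> S.critical_solution y" if y: "0 < y" for y
  proof -
    let ?g = "\<lambda>u. (cbar - \<beta> * y ^ k) * u + S.q u"
    have eq: "Zhat_eq y \<longleftrightarrow> ereal y = (SUP u\<in>{0..}. ereal (?g u))"
      unfolding def12 S.q_def cx2' ..
    have crit: "S.critical_solution y \<longleftrightarrow> (\<forall>u\<ge>0. ?g u \<le> y) \<and> (\<forall>S. (\<forall>u\<ge>0. ?g u \<le> S) \<longrightarrow> y \<le> S)"
      unfolding S.critical_solution_def cbar using y by simp
    show ?thesis
    proof
      assume "Zhat_eq y"
      then have sup: "ereal y = (SUP u\<in>{0..}. ereal (?g u))" by (simp add: eq)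
      have "?g u \<le> y" if "0 \<le> u" for u
      proof -
        have "ereal (?g u) \<le> ereal y" unfolding sup using that by (intro SUP_upper) simp
        then show ?thesis by simp
      qed
      moreover have "y \<le> S" if "\<forall>u\<ge>0. ?g u \<le> S" for S
      proof -
        have "ereal y \<le> ereal S" unfolding sup using that by (intro SUP_least) simp
        then show ?thesis by simp
      qed
      ultimately show "S.critical_solution y" by (simp add: crit)
    next
      assume c: "S.critical_solution y"
      let ?S = "SUP u\<in>{0..}. ereal (?g u)"
      have le: "?S \<le> ereal y" by (intro SUP_least) (use c crit in auto)
      have ge: "ereal (?g u) \<le> ?S" if "0 \<le> u" for u using that by (intro SUP_upper) simp
      \<comment> \<open>The value at u = 0 is 0. Together with the upper bound y this makes the
        supremum a real number r.\<close>
      have "ereal 0 \<le> ?S" using ge[of 0] by (simp add: S.q_def)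
      with le obtain r where r: "?S = ereal r" by (cases ?S) auto
      have "\<forall>u\<ge>0. ?g u \<le> r" using ge unfolding r by simp
      then have "y \<le> r" using c crit by blast
      then show "Zhat_eq y" unfolding eq using le r by simp
    qed
  qed
  show ?thesis
  proof (intro conjI impI)
    assume "\<gamma> < h \<and> c < 0"
    then have *: "\<gamma> < A.h" "c < 0" by (simp_all add: h)
    show "((\<lambda>\<alpha>. (- c) * \<mu> * \<alpha> powr \<gamma> * Z \<alpha>) \<longlongrightarrow> b\<^sup>2 / 2 * (cx2 / 2)) (at_right 0)"
      using S.underloaded(1)[OF *] unfolding cx2' .
    show "((\<lambda>\<alpha>. Z \<alpha> / (\<rho> \<alpha> / (\<mu> * (1 - \<rho> \<alpha>)))) \<longlongrightarrow> b\<^sup>2 / 2 * (cx2 / 2)) (at_right 0)"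
      using S.underloaded(2)[OF *] unfolding cx2' \<rho> .
  next
    assume "h \<le> \<gamma>"
    then have "A.h \<le> \<gamma>" by (simp add: h)
    then obtain l where l: "S.critical_solution l" "((\<lambda>\<alpha>. \<alpha> powr h * Z \<alpha>) \<longlongrightarrow> l) (at_right 0)"
      using S.critical unfolding h by blast
    have "0 < l" using l(1) by (simp add: S.critical_solution_def)
    moreover have "y = l" if "0 < y" "Zhat_eq y" for y
      using that l(1) Zhat[OF that(1)] S.critical_solution_unique_le by (auto intro: antisym)
    ultimately show "\<exists>Zh>0. ((\<lambda>\<alpha>. \<alpha> powr h * Z \<alpha>) \<longlongrightarrow> Zh) (at_right 0) \<and> Zhat_eq Zh \<and>
                    (\<forall>y>0. Zhat_eq y \<longrightarrow> y = Zh)"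
      using l Zhat by blast
  next
    assume "\<gamma> < h \<and> 0 < c"
    then have *: "\<gamma> < A.h" "0 < c" by (simp_all add: h)
    show "((\<lambda>\<alpha>. \<alpha> powr (1 - \<gamma> / real k) * Z \<alpha>) \<longlongrightarrow> (c / \<beta>) powr (1 / real k)) (at_right 0)"
      by (rule S.overloaded_wait[OF *])
    show "((\<lambda>\<alpha>. \<rho> \<alpha> / (\<rho> \<alpha> - 1) * F (\<alpha> * Z \<alpha>)) \<longlongrightarrow> 1) (at_right 0)"
      using S.overloaded_abandonment[OF *] unfolding \<rho> .
  qed
qed

end
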